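(* There holds $\mathscr L\lesssim\mathscr H$. Explicitly, there is an absolute constant $C$ such that, for every interval $I_0\in\mathcal D$, every collection $\mathcal S$ of disjoint intervals contained in $I_0$, every $f\in L^2_0(I_0,\sigma)$ that is uniform with respect to $\mathcal S$, and every $g\in L^2_0(I_0,w)$ that is weakly adapted to $\mathcal S$, $$|B^{\mathrm{above}}(f,g)|\le C\,\mathscr H\,\{\sigma(I_0)^{1/2}+\|f\|_\sigma\}\,\|g\|_w,$$ and the dual inequality, obtained by interchanging the roles of $\sigma$ and $w$ throughout, also holds.
   Context: $\sigma,w$ are locally finite positive Borel measures on $\mathbb{R}$ with no common point masses. $\mathcal D$ is a fixed dyadic grid such that neither $\sigma$ nor $w$ has a point mass at an endpoint of an interval of $\mathcal D$; all intervals below are in $\mathcal D$. Intervals are identified with their indicator functions, and $\sigma I_0$ is the restriction of $\sigma$ to $I_0$. $\|\cdot\|_\sigma$ and $\langle\cdot,\cdot\rangle_\sigma$ are the norm and inner product of $L^2(\sigma)$ (similarly for $w$), and $\mathbb E^\sigma_I\phi=\sigma(I)^{-1}\int_I\phi\,d\sigma$. $L^2_0(I_0,\sigma)$ is the space of functions in $L^2(\sigma)$ supported on $I_0$ with $\sigma$-mean zero (similarly for $w$). Hilbert transform and constants. For a signed locally finite measure $\nu$ and $0<\epsilon<\delta$ let $H_{\epsilon,\delta}\nu(x)=\int_{\epsilon<|x-y|<\delta}\frac{\nu(dy)}{y-x}$. One writes $H$ for $H_{\epsilon,\delta}$; all estimates are independent of $0<\epsilon<\delta$. $H_\sigma\phi:=H(\sigma\phi)$.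 $P(\mu,I)=\int\frac{|I|}{|I|^2+\mathrm{dist}(x,I)^2}\mu(dx)$. $\mathscr H:=\mathscr A_2^{1/2}+\mathscr T$, where $\mathscr A_2$ is the best constant in $P(\sigma,I)P(w,I)\le\mathscr A_2$ and $\mathscr T$ is the best constant in $\int_I|H(\mathbf 1_I\sigma)|^2dw\le\mathscr T^2\sigma(I)$, $\int_I|H(\mathbf 1_Iw)|^2d\sigma\le\mathscr T^2w(I)$, over all intervals $I\subset\mathbb R$ and all truncations. Haar functions. With $I_-,I_+$ the left and right children of $I$, $h^\sigma_I=\sqrt{\frac{\sigma(I_-)\sigma(I_+)}{\sigma(I)}}\Big(-\frac{\mathbf 1_{I_-}}{\sigma(I_-)}+\frac{\mathbf 1_{I_+}}{\sigma(I_+)}\Big)$ if $\sigma(I_\pm)>0$, and $h^\sigma_I=0$ otherwise; $\Delta^\sigma_If=\langle f,h^\sigma_I\rangle_\sigma h^\sigma_I$. The Haar support of $f$ is the set of $I$ with $\langle f,h^\sigma_I\rangle_\sigma\ne0$. Same for $w$. For $J\subsetneq I$, $I_J$ is the child of $I$ containing $J$, and $\mathbb E^\sigma_J\Delta^\sigma_If$ is the constant value of $\Delta^\sigma_If$ on $I_J$. Goodness. Fix a sufficiently small $\theta\in(0,1)$ and a sufficiently large integer $r$ (depending on $\theta$); absolute constants may depend on $\theta,r$. $J\Subset I$ means $J\subset I$ and $2^r|J|\le|I|$. An interval $I$ is good if whenever $I\subset\tilde I\in\mathcal D$ and $2^{r-1}|I|\le|\tilde I|$, the distance of either child of $I$ to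 the boundary of $\tilde I$ is at least $|I|^\theta|\tilde I|^{1-\theta}$. Functions $f,g$ are assumed good: their Haar supports contain only good intervals. Energy stopping intervals. $\mathsf E(w,I)^2:=\frac1{w(I)^2}\int_I\int_I\frac{(x-x')^2}{|I|^2}\,w(dx)\,w(dx')$ (zero if $w(I)=0$). $C_0$ is an absolute constant for which the energy inequality $\sum_jP(\sigma I_0,I_j)^2\mathsf E(w,I_j)^2w(I_j)\le C_0\mathscr H^2\sigma(I_0)$ holds for all $I_0$ and all partitions $\{I_j\}$ of $I_0$ into intervals, and also with $\sigma,w$ interchanged. $\mathcal F_{\mathrm{energy}}(I_0)$ is the set of maximal intervals $I\subsetneq I_0$ with $P(\sigma I_0,I)^2\mathsf E(w,I)^2w(I)>10C_0\mathscr H^2\sigma(I)$. Uniformity. Let $\mathcal S$ be a collection of disjoint intervals contained in $I_0$. $f\in L^2_0(I_0,\sigma)$ is uniform w.r.t. $\mathcal S$ if: (1) each $F\in\mathcal F_{\mathrm{energy}}(I_0)$ is contained in some $S\in\mathcal S$; (2) $f$ is constant on each $S\in\mathcal S$; (3) $\mathbb E^\sigma_I|f|\le1$ for every interval $I$ not contained in any $S\in\mathcal S$. $g$ is weakly adapted to $\mathcal S$ if $\langle g,h^w_J\rangle_w\ne0$ implies $J\not\Subset S$ for all $S\in\mathcal S$. The form is $$B^{\mathrm{above}}(f,g):=\sum_{I:\,I\subset I_0}\ \sum_{J:\,J\Subset I}\mathbb E^\sigma_J\Delta^\sigma_If\cdot\langle H_\sigma I_J,\Delta^w_Jg\rangle_w,$$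 with $I$ and $J$ restricted to good intervals. For $g$ with finite Haar support this is a finite sum; for general $g$ the inequality is understood by continuous extension. $\mathscr L$ is the best constant in $|B^{\mathrm{above}}(f,g)|\le\mathscr L\{\sigma(I_0)^{1/2}+\|f\|_\sigma\}\|g\|_w$ over all such $I_0,\mathcal S,f,g$, and in its dual form with $\sigma$ and $w$ interchanged. *)

theory Defs
  imports "HOL-Analysis.Analysis"
begin

section \<open>Intervals and dyadic grids\<close>

definition len :: "real set \<Rightarrow> real" where
  "len I = measure lborel I"

definition bounded_interval :: "real set \<Rightarrow> bool" where
  "bounded_interval I \<longleftrightarrow> is_interval I \<and> bounded I \<and> interior I \<noteq> {}"

text \<open>Dyadic intervals are half-open, \<open>[a,b)\<close>.  The choice of endpoint convention is
  immaterial, since the measures will not charge endpoints of dyadic intervals.\<close>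

definition left_child :: "real set \<Rightarrow> real set" where
  "left_child I = {Inf I ..< (Inf I + Sup I) / 2}"

definition right_child :: "real set \<Rightarrow> real set" where
  "right_child I = {(Inf I + Sup I) / 2 ..< Sup I}"

definition child_containing :: "real set \<Rightarrow> real set \<Rightarrow> real set" where
  "child_containing I J = (if J \<subseteq> left_child I then left_child I else right_child I)"

definition dyadic_grid :: "real set set \<Rightarrow> bool" where
  "dyadic_grid D \<longleftrightarrow>
     (\<forall>I\<in>D. \<exists>a. \<exists>k::int. I = {a ..< a + 2 powi k}) \<and>
     (\<forall>k::int. partition_on UNIV {I\<in>D. len I = 2 powi k}) \<and>
     (\<forall>I\<in>D. left_child I \<in> D \<and> right_child I \<in> D)"

definition deeply_inside :: "nat \<Rightarrow> real set \<Rightarrow> real set \<Rightarrow> bool" where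
  "deeply_inside r J I \<longleftrightarrow> J \<subseteq> I \<and> 2 ^ r * len J \<le> len I"

definition good_interval :: "real set set \<Rightarrow> real \<Rightarrow> nat \<Rightarrow> real set \<Rightarrow> bool" where
  "good_interval D \<theta> r I \<longleftrightarrow> I \<in> D \<and>
     (\<forall>I'\<in>D. I \<subseteq> I' \<and> 2 ^ (r - 1) * len I \<le> len I' \<longrightarrow>
        (\<forall>K\<in>{left_child I, right_child I}.
           setdist K (frontier I') \<ge> len I powr \<theta> * len I' powr (1 - \<theta>)))"

section \<open>Measures and functions\<close>

definition locally_finite_borel :: "real measure \<Rightarrow> bool" where
  "locally_finite_borel \<mu> \<longleftrightarrow> sets \<mu> = sets borel \<and> (\<forall>K. compact K \<longrightarrow> emeasure \<mu> K < \<infinity>)"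

definition weight_pair :: "real set set \<Rightarrow> real measure \<Rightarrow> real measure \<Rightarrow> bool" where
  "weight_pair D \<sigma> w \<longleftrightarrow>
     locally_finite_borel \<sigma> \<and> locally_finite_borel w \<and>
     (\<forall>x. emeasure \<sigma> {x} = 0 \<or> emeasure w {x} = 0) \<and>
     (\<forall>I\<in>D. \<forall>x\<in>frontier I. emeasure \<sigma> {x} = 0 \<and> emeasure w {x} = 0)"

definition restrict_meas :: "real measure \<Rightarrow> real set \<Rightarrow> real measure" where
  "restrict_meas \<mu> A = density \<mu> (indicator A)"

definition ip :: "real measure \<Rightarrow> (real \<Rightarrow> real) \<Rightarrow> (real \<Rightarrow> real) \<Rightarrow> real" where
  "ip \<mu> f g = (\<integral>x. f x * g x \<partial>\<mu>)"

definition nrm :: "real measure \<Rightarrow> (real \<Rightarrow> real) \<Rightarrow> real" where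
  "nrm \<mu> f = sqrt (ip \<mu> f f)"

definition avg :: "real measure \<Rightarrow> real set \<Rightarrow> (real \<Rightarrow> real) \<Rightarrow> real" where
  "avg \<mu> I f = (\<integral>x\<in>I. f x \<partial>\<mu>) / measure \<mu> I"

definition L2 :: "real measure \<Rightarrow> (real \<Rightarrow> real) \<Rightarrow> bool" where
  "L2 \<mu> f \<longleftrightarrow> f \<in> borel_measurable \<mu> \<and> integrable \<mu> (\<lambda>x. (f x)\<^sup>2)"

definition L2_zero :: "real set \<Rightarrow> real measure \<Rightarrow> (real \<Rightarrow> real) \<Rightarrow> bool" where
  "L2_zero I0 \<mu> f \<longleftrightarrow> L2 \<mu> f \<and> (AE x in \<mu>. x \<notin> I0 \<longrightarrow> f x = 0) \<and> (\<integral>x. f x \<partial>\<mu>) = 0"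

section \<open>Haar functions\<close>

definition haar :: "real measure \<Rightarrow> real set \<Rightarrow> real \<Rightarrow> real" where
  "haar \<mu> I x =
     (let I1 = left_child I; I2 = right_child I in
      if measure \<mu> I1 > 0 \<and> measure \<mu> I2 > 0
      then sqrt (measure \<mu> I1 * measure \<mu> I2 / measure \<mu> I) *
           (- indicator I1 x / measure \<mu> I1 + indicator I2 x / measure \<mu> I2)
      else 0)"

definition haar_diff :: "real measure \<Rightarrow> real set \<Rightarrow> (real \<Rightarrow> real) \<Rightarrow> real \<Rightarrow> real" where
  "haar_diff \<mu> I f x = ip \<mu> f (haar \<mu> I) * haar \<mu> I x"

definition haar_diff_value ::
  "real measure \<Rightarrow> real set \<Rightarrow> real set \<Rightarrow> (real \<Rightarrow> real) \<Rightarrow> real" where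
  "haar_diff_value \<mu> J I f = (THE c. \<forall>x\<in>child_containing I J. haar_diff \<mu> I f x = c)"

definition haar_support ::
  "real set set \<Rightarrow> real measure \<Rightarrow> (real \<Rightarrow> real) \<Rightarrow> real set set" where
  "haar_support D \<mu> f = {I\<in>D. ip \<mu> f (haar \<mu> I) \<noteq> 0}"

definition good_function ::
  "real set set \<Rightarrow> real \<Rightarrow> nat \<Rightarrow> real measure \<Rightarrow> (real \<Rightarrow> real) \<Rightarrow> bool" where
  "good_function D \<theta> r \<mu> f \<longleftrightarrow> (\<forall>I\<in>haar_support D \<mu> f. good_interval D \<theta> r I)"

section \<open>The Hilbert transform and the two weight constants\<close>

text \<open>\<open>hilbert \<epsilon> \<delta> \<mu> \<phi>\<close> is the truncated Hilbert transform of the signed measure \<open>\<phi> d\<mu>\<close>.\<close>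

definition hilbert ::
  "real \<Rightarrow> real \<Rightarrow> real measure \<Rightarrow> (real \<Rightarrow> real) \<Rightarrow> real \<Rightarrow> real" where
  "hilbert \<epsilon> \<delta> \<mu> \<phi> x = (\<integral>y\<in>{y. \<epsilon> < \<bar>x - y\<bar> \<and> \<bar>x - y\<bar> < \<delta>}. \<phi> y / (y - x) \<partial>\<mu>)"

definition poisson :: "real measure \<Rightarrow> real set \<Rightarrow> ennreal" where
  "poisson \<mu> I = (\<integral>\<^sup>+x. ennreal (len I / ((len I)\<^sup>2 + (infdist x I)\<^sup>2)) \<partial>\<mu>)"

text \<open>Best constants are infima in \<^typ>\<open>ennreal\<close>, hence \<open>\<infinity>\<close> if there is no finite constant.\<close>

definition A2_const :: "real measure \<Rightarrow> real measure \<Rightarrow> ennreal" where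
  "A2_const \<sigma> w = Inf {A. \<forall>I. bounded_interval I \<longrightarrow> poisson \<sigma> I * poisson w I \<le> A}"

definition testing_const :: "real measure \<Rightarrow> real measure \<Rightarrow> ennreal" where
  "testing_const \<sigma> w = Inf {T. \<forall>I \<epsilon> \<delta>. bounded_interval I \<and> 0 < \<epsilon> \<and> \<epsilon> < \<delta> \<longrightarrow>
     (\<integral>\<^sup>+x\<in>I. ennreal (\<bar>hilbert \<epsilon> \<delta> \<sigma> (indicator I) x\<bar>\<^sup>2) \<partial>w) \<le> T\<^sup>2 * emeasure \<sigma> I \<and>
     (\<integral>\<^sup>+x\<in>I. ennreal (\<bar>hilbert \<epsilon> \<delta> w (indicator I) x\<bar>\<^sup>2) \<partial>\<sigma>) \<le> T\<^sup>2 * emeasure w I}"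

definition ennreal_sqrt :: "ennreal \<Rightarrow> ennreal" where
  "ennreal_sqrt x = (if x = \<infinity> then \<infinity> else ennreal (sqrt (enn2real x)))"

definition H_const :: "real measure \<Rightarrow> real measure \<Rightarrow> ennreal" where
  "H_const \<sigma> w = ennreal_sqrt (A2_const \<sigma> w) + testing_const \<sigma> w"

section \<open>Energy\<close>

definition energy_sq :: "real measure \<Rightarrow> real set \<Rightarrow> ennreal" where
  "energy_sq w I =
     (if emeasure w I = 0 then 0
      else (\<integral>\<^sup>+x\<in>I. (\<integral>\<^sup>+x'\<in>I. ennreal ((x - x')\<^sup>2 / (len I)\<^sup>2) \<partial>w) \<partial>w) / (emeasure w I)\<^sup>2)"

text \<open>\<open>C0\<close> is absolute, so the energy inequality is required for all grids and all pairs of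
  weights; as \<^const>\<open>weight_pair\<close> is symmetric, this contains the inequality with the weights
  interchanged.\<close>

definition energy_constant :: "real \<Rightarrow> bool" where
  "energy_constant C0 \<longleftrightarrow> 0 < C0 \<and>
     (\<forall>D \<sigma> w. dyadic_grid D \<and> weight_pair D \<sigma> w \<longrightarrow>
       (\<forall>I0\<in>D. \<forall>Q. Q \<subseteq> D \<and> partition_on I0 Q \<longrightarrow>
         (\<Sum>\<^sub>\<infinity>I\<in>Q. (poisson (restrict_meas \<sigma> I0) I)\<^sup>2 * energy_sq w I * emeasure w I)
           \<le> ennreal C0 * (H_const \<sigma> w)\<^sup>2 * emeasure \<sigma> I0))"

definition energy_stopping ::
  "real set set \<Rightarrow> real \<Rightarrow> real measure \<Rightarrow> real measure \<Rightarrow> real set \<Rightarrow> real set set" where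
  "energy_stopping D C0 \<sigma> w I0 =
     (let \<I> = {I\<in>D. I \<subset> I0 \<and>
         (poisson (restrict_meas \<sigma> I0) I)\<^sup>2 * energy_sq w I * emeasure w I
           > 10 * ennreal C0 * (H_const \<sigma> w)\<^sup>2 * emeasure \<sigma> I}
      in {I\<in>\<I>. \<forall>I'\<in>\<I>. I \<subseteq> I' \<longrightarrow> I' = I})"

section \<open>Uniform and weakly adapted functions\<close>

definition uniform_wrt ::
  "real set set \<Rightarrow> real \<Rightarrow> real measure \<Rightarrow> real measure \<Rightarrow> real set \<Rightarrow> real set set
     \<Rightarrow> (real \<Rightarrow> real) \<Rightarrow> bool" where
  "uniform_wrt D C0 \<sigma> w I0 \<S> f \<longleftrightarrow>
     L2_zero I0 \<sigma> f \<and>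
     (\<forall>F\<in>energy_stopping D C0 \<sigma> w I0. \<exists>S\<in>\<S>. F \<subseteq> S) \<and>
     (\<forall>S\<in>\<S>. \<exists>c. AE x in \<sigma>. x \<in> S \<longrightarrow> f x = c) \<and>
     (\<forall>I\<in>D. (\<nexists>S. S \<in> \<S> \<and> I \<subseteq> S) \<longrightarrow> avg \<sigma> I (\<lambda>x. \<bar>f x\<bar>) \<le> 1)"

definition weakly_adapted ::
  "real set set \<Rightarrow> nat \<Rightarrow> real measure \<Rightarrow> real set set \<Rightarrow> (real \<Rightarrow> real) \<Rightarrow> bool" where
  "weakly_adapted D r w \<S> g \<longleftrightarrow>
     (\<forall>J\<in>haar_support D w g. \<forall>S\<in>\<S>. \<not> deeply_inside r J S)"

section \<open>The form\<close>

text \<open>For \<open>g\<close> with finite Haar support only finitely many terms are nonzero: for each \<open>J\<close> there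
  are finitely many \<open>I\<close> with \<open>J \<subseteq> I \<subseteq> I0\<close>.  So the infinite sum below is then a finite one.\<close>

definition B_above_fin ::
  "real set set \<Rightarrow> real \<Rightarrow> nat \<Rightarrow> real \<Rightarrow> real \<Rightarrow> real measure \<Rightarrow> real measure \<Rightarrow> real set
     \<Rightarrow> (real \<Rightarrow> real) \<Rightarrow> (real \<Rightarrow> real) \<Rightarrow> real" where
  "B_above_fin D \<theta> r \<epsilon> \<delta> \<sigma> w I0 f g =
     (\<Sum>\<^sub>\<infinity>(I, J) \<in> {(I, J). I \<subseteq> I0 \<and> deeply_inside r J I \<and>
                          good_interval D \<theta> r I \<and> good_interval D \<theta> r J}.
        haar_diff_value \<sigma> J I f *
        ip w (hilbert \<epsilon> \<delta> \<sigma> (indicator (child_containing I J))) (haar_diff w J g))"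

definition haar_trunc ::
  "real measure \<Rightarrow> real set set \<Rightarrow> (real \<Rightarrow> real) \<Rightarrow> real \<Rightarrow> real" where
  "haar_trunc \<mu> F g x = (\<Sum>J\<in>F. haar_diff \<mu> J g x)"

text \<open>Extension to general \<open>g\<close> by continuity: the finite Haar truncations of \<open>g \<in> L\<^sup>2\<^sub>0(I0, w)\<close>
  converge to \<open>g\<close> in \<open>L\<^sup>2(w)\<close>, and inherit goodness and weak adaptedness.\<close>

definition B_above ::
  "real set set \<Rightarrow> real \<Rightarrow> nat \<Rightarrow> real \<Rightarrow> real \<Rightarrow> real measure \<Rightarrow> real measure \<Rightarrow> real set
     \<Rightarrow> (real \<Rightarrow> real) \<Rightarrow> (real \<Rightarrow> real) \<Rightarrow> real" where
  "B_above D \<theta> r \<epsilon> \<delta> \<sigma> w I0 f g =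
     Lim (finite_subsets_at_top D)
       (\<lambda>F. B_above_fin D \<theta> r \<epsilon> \<delta> \<sigma> w I0 f (haar_trunc w F g))"

end

theory Submission
  imports Defs
begin

text \<open>
  Fix a good interval \<open>J\<close> and collect the terms of the form that contain \<open>h\<^sub>J\<close>. Writing \<open>K\<close> for \<open>I\<^sub>J\<close>,
  this row is split in three. The intervals \<open>K\<close> of length comparable to \<open>J\<close> are handled by testing,
  Bessel's inequality and Cauchy-Schwarz. For the larger ones the indicator of \<open>K\<close> is replaced by that of
  \<open>I\<^sub>0\<close> minus that of the complement. The first replacement gives a telescoping sum of martingale
  differences, bounded by 1 because \<open>f\<close> is uniform, and then testing on \<open>I\<^sub>0\<close> suffices. The second is
  the stopping form. There the kernel is smooth up to errors supported in two annuli, which the \<open>A\<^sub>2\<close>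
  condition controls. The smooth part is estimated by a recursion on the size of the collection of
  pairs \<open>(J, K)\<close>, as in Lacey's proof of the two weight inequality: stopping at intervals where the local
  size is a fixed fraction of the maximal one gives a part with geometric decay, summed by Doob's
  maximal inequality, and a remainder of smaller size, and the initial size is bounded because the
  Whitney intervals involved are not energy stopping intervals.
\<close>

text \<open>The obstacle is that the coefficients \<open>a K\<close> have no sign, so absolute
  values cannot be taken along the chain of \<open>K\<close> above a given \<open>J\<close>. What is
  under control is their partial sums, through a maximal function, and the increments of the
  pairings \<open>T K J\<close>, which are dominated by the increments of a Poisson tail. Summation
  by parts along stretches between chosen intervals combines exactly these two facts. The second one
  needs a kernel that is Lipschitz away from the origin; a sharp cutoff is not, and this is why the
  continuous cutoff \<open>psi\<close> and its error terms appear. The quantity estimated throughout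
  is the square sum of the rows over finitely many \<open>J\<close>, with a bound that does not
  depend on how many. Together with Bessel's inequality for \<open>g\<close> it bounds the finite
  form, and it also makes the series over all \<open>J\<close> absolutely summable, so that the
  continuous extension is an actual limit. Goodness enters as the separation sqrt(|J| |K|) of
  \<open>J\<close> from the complement of \<open>K\<close>; the gap 2 r + 4 turns this into a
  distance of at least 4 * 2 ^ r |J|.\<close>

section \<open>The abstract stopping form\<close>

text \<open>Serves the bottom-up choice of stopping pairs, whose rule at \<open>K\<close> consults
  its own outcome strictly below \<open>K\<close>. Strict inclusion need not be well-founded on
  arbitrary sets, so the recursion runs inside the finite \<open>U\<close>, where the number of
  members below decreases.\<close>

lemma recursion_on_subsets:
  fixes F :: "('a set \<Rightarrow> 'b) \<Rightarrow> 'a set \<Rightarrow> 'b"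
  assumes fin: "finite U"
    and loc: "\<And>K s s'. K \<in> U \<Longrightarrow> (\<And>K'. K' \<in> U \<Longrightarrow> K' \<subset> K \<Longrightarrow> s K' = s' K') \<Longrightarrow> F s K = F s' K"
  obtains s where "\<And>K. K \<in> U \<Longrightarrow> s K = F s K"
proof -
  define r where "r = {(K', K). K' \<in> U \<and> K \<in> U \<and> K' \<subset> K}"
  have "r \<subseteq> Wellfounded.measure (\<lambda>K. card {K' \<in> U. K' \<subset> K})"
  proof
    fix z assume "z \<in> r"
    then obtain x y where z: "z = (x, y)" "x \<in> U" "y \<in> U" "x \<subset> y" by (auto simp: r_def)
    have "{K' \<in> U. K' \<subset> x} \<subset> {K' \<in> U. K' \<subset> y}"
      using z by (intro psubsetI subsetI) auto
    then show "z \<in> Wellfounded.measure (\<lambda>K. card {K' \<in> U. K' \<subset> K})"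
      using fin z by (auto intro!: psubset_card_mono)
  qed
  then have "wf r" by (rule wf_subset[OF wf_measure])
  have "wfrec r F K = F (wfrec r F) K" if K: "K \<in> U" for K
  proof (subst wfrec[OF \<open>wf r\<close>], rule loc[OF K])
    fix K' assume "K' \<in> U" "K' \<subset> K"
    then have "(K', K) \<in> r" using K unfolding r_def by blast
    then show "cut (wfrec r F) r K K' = wfrec r F K'" by (rule cut_apply)
  qed
  then show thesis using that by blast
qed

text \<open>Abel summation along a chain. Increments of \<open>T\<close> are dominated by decrements
  of \<open>p\<close>, so the variation of \<open>T\<close>, including its last value by
  \<open>T0\<close>, is at most \<open>P\<close>, while the \<open>a K\<close> enter only through
  their partial sums from below.\<close>

lemma summation_by_parts_bound:
  fixes a T p :: "'a set \<Rightarrow> real"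
  assumes "finite X"
    and chain: "\<And>K K'. K \<in> X \<Longrightarrow> K' \<in> X \<Longrightarrow> K \<subseteq> K' \<or> K' \<subseteq> K"
    and T1: "\<And>K K'. K \<in> X \<Longrightarrow> K' \<in> X \<Longrightarrow> K \<subseteq> K' \<Longrightarrow> \<bar>T K - T K'\<bar> \<le> p K - p K'"
    and T0: "\<And>K. K \<in> X \<Longrightarrow> \<bar>T K\<bar> \<le> p K"
    and P: "\<And>K. K \<in> X \<Longrightarrow> p K \<le> P" "0 \<le> P"
    and part: "\<And>K'. K' \<in> X \<Longrightarrow> \<bar>\<Sum>K\<in>{K\<in>X. K \<subseteq> K'}. a K\<bar> \<le> \<alpha>"
    and "0 \<le> \<alpha>"
  shows "\<bar>\<Sum>K\<in>X. a K * T K\<bar> \<le> \<alpha> * P"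
proof -
  \<comment> \<open>\<open>Y\<close> runs over lower parts of the chain; \<open>t\<close> and
    \<open>q\<close> stand for the values of \<open>T\<close> and \<open>p\<close> at the next
    member above. At the top there is none, and \<open>t = q = 0\<close> turns the condition into
    \<open>T0\<close>.\<close>
  have main: "Y \<subseteq> X \<Longrightarrow> (\<And>K K'. K \<in> Y \<Longrightarrow> K' \<in> X \<Longrightarrow> K' \<subseteq> K \<Longrightarrow> K' \<in> Y) \<Longrightarrow>
      (\<And>K. K \<in> Y \<Longrightarrow> \<bar>T K - t\<bar> \<le> p K - q) \<Longrightarrow> q \<le> P \<Longrightarrow>
      \<bar>(\<Sum>K\<in>Y. a K * T K) - (\<Sum>K\<in>Y. a K) * t\<bar> \<le> \<alpha> * (P - q)" if "finite Y" for Y t q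
    using that
  proof (induction "card Y" arbitrary: Y t q)
    case 0
    then show ?case using \<open>0 \<le> \<alpha>\<close> by simp
  next
    case (Suc n)
    then have "Y \<noteq> {}" by auto
    obtain m where m: "m \<in> Y" "\<And>K. K \<in> Y \<Longrightarrow> \<not> m \<subset> K"
      using finite_has_maximal[OF \<open>finite Y\<close> \<open>Y \<noteq> {}\<close>] by (metis psubset_eq)
    have below: "K \<subseteq> m" if "K \<in> Y" for K
      using m chain[of K m] that Suc.prems(1) by (auto simp: psubset_eq)
    define Z where "Z = Y - {m}"
    have Z: "card Z = n" "finite Z" "Z \<subseteq> X" "m \<notin> Z" "Y = insert m Z"
      using Suc m(1) by (auto simp: Z_def)
    have mX: "m \<in> X" using m(1) Suc.prems by auto
    have Ym: "Y = {K \<in> X. K \<subseteq> m}"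
      using below Suc.prems m(1) by blast
    have IH: "\<bar>(\<Sum>K\<in>Z. a K * T K) - (\<Sum>K\<in>Z. a K) * T m\<bar> \<le> \<alpha> * (P - p m)"
    proof (rule Suc.hyps(1))
      show "n = card Z" using Z(1) by simp
      show "finite Z" "Z \<subseteq> X" "p m \<le> P" using Z(2,3) P mX by blast+
      show "K' \<in> Z" if "K \<in> Z" "K' \<in> X" "K' \<subseteq> K" for K K'
        using that Suc.prems(2)[of K K'] below[of K] by (auto simp: Z_def)
      show "\<bar>T K - T m\<bar> \<le> p K - p m" if "K \<in> Z" for K
        using that T1[of K m] mX Z(3) below[of K] by (auto simp: Z_def)
    qed
    have "(\<Sum>K\<in>Y. a K * T K) - (\<Sum>K\<in>Y. a K) * t
       = ((\<Sum>K\<in>Z. a K * T K) - (\<Sum>K\<in>Z. a K) * T m) + (\<Sum>K\<in>Y. a K) * (T m - t)"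
      using Z(2,4) by (subst (1 2 3) Z(5)) (simp add: algebra_simps)
    also have "\<bar>\<dots>\<bar> \<le> \<alpha> * (P - p m) + \<alpha> * (p m - q)"
    proof (rule order_trans[OF abs_triangle_ineq add_mono[OF IH]])
      have "\<bar>\<Sum>K\<in>Y. a K\<bar> \<le> \<alpha>" using part[OF mX] Ym by simp
      then show "\<bar>(\<Sum>K\<in>Y. a K) * (T m - t)\<bar> \<le> \<alpha> * (p m - q)"
        using Suc.prems(3)[OF m(1)] \<open>0 \<le> \<alpha>\<close> by (simp add: abs_mult mult_mono)
    qed
    also have "\<dots> = \<alpha> * (P - q)" by (simp add: algebra_simps)
    finally show ?case .
  qed
  show ?thesis using main[OF \<open>finite X\<close>, of 0 0] T0 P by auto
qed

text \<open>The exponents are distinct, so the weights \<open>l ^ t v\<close> sum to at most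
  \<open>1 / (1 - l)\<close>. With Cauchy-Schwarz this turns the sum over the chosen intervals of
  one \<open>J\<close> into a sum of squares with growing weights, which
  \<open>geometric_decay\<close> can afford.\<close>

lemma geometric_weights_square:
  fixes x :: "'a \<Rightarrow> real" and t :: "'a \<Rightarrow> nat"
  assumes "finite V" "inj_on t V" "0 < l" "l < 1"
  shows "(\<Sum>v\<in>V. x v)\<^sup>2 \<le> (1 / (1 - l)) * (\<Sum>v\<in>V. (1 / l) ^ t v * (x v)\<^sup>2)"
proof -
  have "(\<Sum>v\<in>V. x v)\<^sup>2 = (\<Sum>v\<in>V. sqrt (l ^ t v) * (sqrt ((1 / l) ^ t v) * x v))\<^sup>2"
    using assms by (simp add: real_sqrt_mult[symmetric] mult.assoc[symmetric] power_mult_distrib[symmetric])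
  also have "\<dots> \<le> (\<Sum>v\<in>V. (sqrt (l ^ t v))\<^sup>2) * (\<Sum>v\<in>V. (sqrt ((1 / l) ^ t v) * x v)\<^sup>2)"
    by (rule Cauchy_Schwarz_ineq_sum)
  also have "\<dots> = (\<Sum>v\<in>V. l ^ t v) * (\<Sum>v\<in>V. (1 / l) ^ t v * (x v)\<^sup>2)"
    using assms by (simp add: power_mult_distrib)
  also have "\<dots> \<le> (1 / (1 - l)) * (\<Sum>v\<in>V. (1 / l) ^ t v * (x v)\<^sup>2)"
  proof (rule mult_right_mono)
    have "(\<Sum>v\<in>V. l ^ t v) = (\<Sum>n\<in>t ` V. l ^ n)" using assms by (simp add: sum.reindex)
    also have "\<dots> \<le> (\<Sum>n. l ^ n)"
      using assms by (intro sum_le_suminf summable_geometric) auto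
    also have "\<dots> = 1 / (1 - l)" using assms by (subst suminf_geometric) auto
    finally show "(\<Sum>v\<in>V. l ^ t v) \<le> 1 / (1 - l)" .
  qed (use assms in \<open>auto intro!: sum_nonneg\<close>)
  finally show ?thesis .
qed

text \<open>
  \<open>Q K J\<close> says that \<open>K\<close> lies far above \<open>J\<close>; then \<open>W K J\<close> is the Whitney interval of \<open>K\<close> containing
  \<open>J\<close>, \<open>c J\<close> the moment of the Haar function of \<open>J\<close>, \<open>p K J\<close> a Poisson tail outside \<open>K\<close>, and \<open>T K J\<close> the
  pairing of the transform of the part of the measure outside \<open>K\<close> with the Haar function. The
  coefficients \<open>a K\<close> come from a martingale difference on \<open>par K\<close> of squared norm \<open>A (par K)\<close>.
\<close>
locale stopping_form =
  fixes KK :: "'a set set" and JJ :: "'j set"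
    and Q :: "'a set \<Rightarrow> 'j \<Rightarrow> bool" and W :: "'a set \<Rightarrow> 'j \<Rightarrow> 'a set" and Ws :: "'a set set"
    and c :: "'j \<Rightarrow> real" and p T :: "'a set \<Rightarrow> 'j \<Rightarrow> real"
    and sg a :: "'a set \<Rightarrow> real" and b :: "'j \<Rightarrow> real"
    and par :: "'a set \<Rightarrow> 'i" and A :: "'i \<Rightarrow> real"
  assumes fin: "finite KK" "finite JJ"
    and ne: "K \<in> KK \<Longrightarrow> K \<noteq> {}"
    and chain: "K \<in> KK \<Longrightarrow> K' \<in> KK \<Longrightarrow> J \<in> JJ \<Longrightarrow> Q K J \<Longrightarrow> Q K' J \<Longrightarrow> K \<subseteq> K' \<or> K' \<subseteq> K"
    and nested: "K \<in> KK \<Longrightarrow> K' \<in> KK \<Longrightarrow> K \<inter> K' \<noteq> {} \<Longrightarrow> K \<subseteq> K' \<or> K' \<subseteq> K"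
    and up: "K \<in> KK \<Longrightarrow> K' \<in> KK \<Longrightarrow> J \<in> JJ \<Longrightarrow> Q K J \<Longrightarrow> K \<subseteq> K' \<Longrightarrow> Q K' J"
    and W_disj: "K \<in> KK \<Longrightarrow> J \<in> JJ \<Longrightarrow> J' \<in> JJ \<Longrightarrow> Q K J \<Longrightarrow> Q K J' \<Longrightarrow>
        W K J \<inter> W K J' \<noteq> {} \<Longrightarrow> W K J = W K J'"
    and W_sub: "K \<in> KK \<Longrightarrow> J \<in> JJ \<Longrightarrow> Q K J \<Longrightarrow> W K J \<subseteq> K \<and> W K J \<noteq> {} \<and> W K J \<in> Ws"
    and W_sep: "K \<in> KK \<Longrightarrow> K' \<in> KK \<Longrightarrow> J \<in> JJ \<Longrightarrow> Q K' J \<Longrightarrow> K' \<subset> K \<Longrightarrow> K' \<subseteq> W K J"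
    and c_nonneg: "J \<in> JJ \<Longrightarrow> 0 \<le> c J"
    and p_nonneg: "K \<in> KK \<Longrightarrow> J \<in> JJ \<Longrightarrow> Q K J \<Longrightarrow> 0 \<le> p K J"
    and p_const: "K \<in> KK \<Longrightarrow> J \<in> JJ \<Longrightarrow> J' \<in> JJ \<Longrightarrow> Q K J \<Longrightarrow> Q K J' \<Longrightarrow>
        W K J = W K J' \<Longrightarrow> p K J \<le> 4 * p K J'"
    and T_bound: "K \<in> KK \<Longrightarrow> J \<in> JJ \<Longrightarrow> Q K J \<Longrightarrow> \<bar>T K J\<bar> \<le> c J * p K J"
    and T_diff: "K \<in> KK \<Longrightarrow> K' \<in> KK \<Longrightarrow> J \<in> JJ \<Longrightarrow> Q K J \<Longrightarrow> K \<subseteq> K' \<Longrightarrow>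
        \<bar>T K J - T K' J\<bar> \<le> c J * p K J - c J * p K' J"
    and sg_nonneg: "0 \<le> sg R"
    and A_nonneg: "0 \<le> A i"
    and par_card: "card {K \<in> KK. par K = i} \<le> 2"
    and maximal: "I' \<subseteq> par ` KK \<Longrightarrow> finite N \<Longrightarrow>
        (\<And>V R. (V, R) \<in> N \<Longrightarrow> V \<in> KK \<and> k V \<in> KK \<and> R \<in> Ws \<and> R \<subseteq> V) \<Longrightarrow>
        (\<And>V R V' R'. (V, R) \<in> N \<Longrightarrow> (V', R') \<in> N \<Longrightarrow> R \<inter> R' \<noteq> {} \<Longrightarrow> V = V' \<and> R = R') \<Longrightarrow>
        (\<Sum>(V, R)\<in>N. (\<Sum>K\<in>{K\<in>KK. V \<subseteq> K \<and> K \<subseteq> k V \<and> par K \<in> I'}. a K)\<^sup>2 * sg R) \<le> 32 * (\<Sum>i\<in>I'. A i)"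
begin

text \<open>Lacey's size: squared tail times energy, relative to the measure of a Whitney interval
  \<open>R\<close>. The product form, instead of a supremum of quotients, covers \<open>R\<close> of
  measure zero too.\<close>

definition size_le :: "'j set \<Rightarrow> 'a set set \<Rightarrow> real \<Rightarrow> bool" where
  "size_le J\<^sub>0 U s \<longleftrightarrow> (\<forall>K\<in>U. \<forall>R. (\<Sum>J\<in>{J\<in>J\<^sub>0. Q K J \<and> W K J = R}. (c J * p K J)\<^sup>2) \<le> s * sg R)"

definition form :: "'j set \<Rightarrow> 'a set set \<Rightarrow> real" where
  "form J\<^sub>0 U = (\<Sum>J\<in>J\<^sub>0. b J * (\<Sum>K\<in>{K\<in>U. Q K J}. a K * T K J))"

definition occ :: "'j set \<Rightarrow> 'a set set \<Rightarrow> 'a set set" where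
  "occ J\<^sub>0 U = {K\<in>U. \<exists>J\<in>J\<^sub>0. Q K J}"

text \<open>Only parents of intervals that occur with some \<open>J\<close> are counted. This makes
  the quantity additive up to the factor 2 of \<open>sum_parents_le\<close> when the form is
  split.\<close>

definition a_norm :: "'j set \<Rightarrow> 'a set set \<Rightarrow> real" where
  "a_norm J\<^sub>0 U = (\<Sum>i\<in>par ` occ J\<^sub>0 U. A i)"

definition b_norm :: "'j set \<Rightarrow> real" where
  "b_norm J\<^sub>0 = (\<Sum>J\<in>J\<^sub>0. (b J)\<^sup>2)"

text \<open>Ensures that everything in \<open>KK\<close> between a chosen \<open>V\<close> and the
  end of its segment lies in \<open>U\<close>, so that partial sums over \<open>U\<close> have the
  shape treated by the assumption \<open>maximal\<close>.\<close>

definition down_closed :: "'a set set \<Rightarrow> bool" where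
  "down_closed U \<longleftrightarrow> U \<subseteq> KK \<and> (\<forall>K\<in>KK. \<forall>K'\<in>U. K \<subseteq> K' \<longrightarrow> K \<in> U)"

text \<open>Disjoint families can meet the same parent only through different children, and a parent
  has at most two.\<close>

lemma sum_parents_le:
  assumes "finite Z" and disj: "\<And>K z z'. z \<in> Z \<Longrightarrow> z' \<in> Z \<Longrightarrow> K \<in> F z \<Longrightarrow> K \<in> F z' \<Longrightarrow> z = z'"
    and sub: "\<And>z. z \<in> Z \<Longrightarrow> F z \<subseteq> G" and G: "G \<subseteq> KK"
  shows "(\<Sum>z\<in>Z. \<Sum>i\<in>par ` F z. A i) \<le> 2 * (\<Sum>i\<in>par ` G. A i)"
proof -
  have finG: "finite G" using G fin finite_subset by blast
  then have finF: "finite (F z)" if "z \<in> Z" for z using sub[OF that] finite_subset by blast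
  have "(\<Sum>z\<in>Z. \<Sum>i\<in>par ` F z. A i) = (\<Sum>z\<in>Z. \<Sum>i\<in>par ` G. if i \<in> par ` F z then A i else 0)"
  proof (rule sum.cong[OF refl])
    fix z assume "z \<in> Z"
    then have "par ` G \<inter> par ` F z = par ` F z" using sub by blast
    then show "(\<Sum>i\<in>par ` F z. A i) = (\<Sum>i\<in>par ` G. if i \<in> par ` F z then A i else 0)"
      using finG by (simp add: sum.If_cases Int_def)
  qed
  also have "\<dots> = (\<Sum>i\<in>par ` G. \<Sum>z\<in>Z. if i \<in> par ` F z then A i else 0)"
    by (rule sum.swap)
  also have "\<dots> = (\<Sum>i\<in>par ` G. real (card {z\<in>Z. i \<in> par ` F z}) * A i)"
    using \<open>finite Z\<close> by (simp add: sum.If_cases Int_def)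
  also have "\<dots> \<le> (\<Sum>i\<in>par ` G. 2 * A i)"
  proof (rule sum_mono, rule mult_right_mono[OF _ A_nonneg])
    fix i
    have "\<forall>z\<in>{z\<in>Z. i \<in> par ` F z}. \<exists>K. K \<in> F z \<and> par K = i" by auto
    then obtain f where f: "\<And>z. z \<in> Z \<Longrightarrow> i \<in> par ` F z \<Longrightarrow> f z \<in> F z \<and> par (f z) = i"
      by (metis (mono_tags, lifting) mem_Collect_eq)
    have "card {z\<in>Z. i \<in> par ` F z} \<le> card {K \<in> KK. par K = i}"
    proof (rule card_inj_on_le)
      show "inj_on f {z\<in>Z. i \<in> par ` F z}"
        by (rule inj_onI) (metis (mono_tags, lifting) disj f mem_Collect_eq)
      show "f ` {z\<in>Z. i \<in> par ` F z} \<subseteq> {K \<in> KK. par K = i}"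
      proof
        fix K assume "K \<in> f ` {z\<in>Z. i \<in> par ` F z}"
        then obtain z where z: "z \<in> Z" "i \<in> par ` F z" "K = f z" by auto
        then have "K \<in> F z" "par K = i" using f[of z] by auto
        then show "K \<in> {K \<in> KK. par K = i}" using sub[OF z(1)] G by blast
      qed
    qed (use fin in auto)
    then show "real (card {z\<in>Z. i \<in> par ` F z}) \<le> 2" using par_card[of i] by linarith
  qed
  finally show ?thesis by (simp add: sum_distrib_left)
qed

end

section \<open>The choice of stopping pairs and the sum over the intervals above them\<close>

context stopping_form
begin

text \<open>
  The stopping pairs \<open>(K, R)\<close> are chosen from the bottom up: \<open>J\<close> is fresh for \<open>K\<close> if it belongs to no
  pair chosen below \<open>K\<close>, and \<open>(K, R)\<close> is chosen when its fresh \<open>J\<close> alone give an eighth of the size \<open>s\<close>.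
\<close>
definition fresh :: "'j set \<Rightarrow> 'a set set \<Rightarrow> ('a set \<Rightarrow> 'a set \<Rightarrow> bool) \<Rightarrow> 'a set \<Rightarrow> 'j set" where
  "fresh J\<^sub>0 U sel K = {J\<in>J\<^sub>0. Q K J \<and> (\<forall>K'\<in>U. K' \<subset> K \<and> Q K' J \<longrightarrow> \<not> sel K' (W K' J))}"

definition node :: "'j set \<Rightarrow> 'a set \<Rightarrow> 'a set \<Rightarrow> 'j set" where
  "node J\<^sub>0 V R = {J\<in>J\<^sub>0. Q V J \<and> W V J = R}"

definition selection :: "'j set \<Rightarrow> 'a set set \<Rightarrow> real \<Rightarrow> ('a set \<Rightarrow> 'a set \<Rightarrow> bool) \<Rightarrow> bool" where
  "selection J\<^sub>0 U s sel \<longleftrightarrow> (\<forall>K\<in>U. \<forall>R. sel K R \<longleftrightarrow>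
      s / 8 * sg R < (\<Sum>J\<in>fresh J\<^sub>0 U sel K \<inter> node J\<^sub>0 K R. (c J * p K J)\<^sup>2))"

lemma selection_exists:
  assumes "down_closed U"
  obtains sel where "selection J\<^sub>0 U s sel"
proof -
  have "finite U" using assms fin finite_subset unfolding down_closed_def by blast
  then obtain sel where "\<And>K. K \<in> U \<Longrightarrow> sel K =
      (\<lambda>R. s / 8 * sg R < (\<Sum>J\<in>fresh J\<^sub>0 U sel K \<inter> node J\<^sub>0 K R. (c J * p K J)\<^sup>2))"
  proof (rule recursion_on_subsets)
    fix K and s1 s2 :: "'a set \<Rightarrow> 'a set \<Rightarrow> bool"
    assume "K \<in> U" "\<And>K'. K' \<in> U \<Longrightarrow> K' \<subset> K \<Longrightarrow> s1 K' = s2 K'"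
    then have "fresh J\<^sub>0 U s1 K = fresh J\<^sub>0 U s2 K" by (auto simp: fresh_def)
    then show "(\<lambda>R. s / 8 * sg R < (\<Sum>J\<in>fresh J\<^sub>0 U s1 K \<inter> node J\<^sub>0 K R. (c J * p K J)\<^sup>2)) =
        (\<lambda>R. s / 8 * sg R < (\<Sum>J\<in>fresh J\<^sub>0 U s2 K \<inter> node J\<^sub>0 K R. (c J * p K J)\<^sup>2))" by simp
  qed blast
  then show thesis by (intro that[of sel]) (auto simp: selection_def)
qed

context
  fixes J\<^sub>0 U s sel
  assumes J0: "J\<^sub>0 \<subseteq> JJ" and U: "down_closed U" and s: "0 \<le> s"
    and size: "size_le J\<^sub>0 U s" and sel: "selection J\<^sub>0 U s sel"
begin

abbreviation "Fr \<equiv> fresh J\<^sub>0 U sel"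
abbreviation "Nd \<equiv> node J\<^sub>0"

definition VV :: "'j \<Rightarrow> 'a set set" where
  "VV J = {K\<in>U. Q K J \<and> sel K (W K J)}"

definition tt :: "'a set \<Rightarrow> 'j \<Rightarrow> nat" where
  "tt V J = card {V'\<in>VV J. V' \<subset> V}"

lemma UKK: "K \<in> U \<Longrightarrow> K \<in> KK"
  using U by (auto simp: down_closed_def)

lemma JJJ: "J \<in> J\<^sub>0 \<Longrightarrow> J \<in> JJ"
  using J0 by auto

lemma fins [simp]: "finite U" "finite J\<^sub>0" "finite (Nd V R)" "finite (Fr V)" "finite (VV J)"
  using U J0 fin finite_subset
  by (auto simp: down_closed_def node_def fresh_def VV_def intro: finite_subset)

lemma VV_D: "K \<in> VV J \<Longrightarrow> K \<in> U \<and> K \<in> KK \<and> Q K J \<and> sel K (W K J)"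
  using UKK by (auto simp: VV_def)

lemma VV_chain: "J \<in> J\<^sub>0 \<Longrightarrow> K \<in> VV J \<Longrightarrow> K' \<in> VV J \<Longrightarrow> K \<subseteq> K' \<or> K' \<subseteq> K"
  using chain[of K K' J] VV_D JJJ by blast

text \<open>By separation the whole of \<open>V\<close> lies in one Whitney interval of
  \<open>X\<close>, so all \<open>J\<close> below \<open>V\<close> are treated alike at every larger
  \<open>X\<close>.\<close>

lemma W_eq:
  assumes "V \<in> KK" "X \<in> KK" "J \<in> J\<^sub>0" "J' \<in> J\<^sub>0" "Q V J" "Q V J'" "V \<subset> X"
  shows "W X J = W X J'"
proof (rule W_disj)
  show "W X J \<inter> W X J' \<noteq> {}"
    using W_sep[of X V J] W_sep[of X V J'] ne[of V] assms JJJ by blast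
qed (use assms JJJ up[of V X] in auto)

lemma sel_iff: "V \<in> U \<Longrightarrow> sel V R \<longleftrightarrow> s / 8 * sg R < (\<Sum>J\<in>Fr V \<inter> Nd V R. (c J * p V J)\<^sup>2)"
  using sel by (auto simp: selection_def)

lemma sel_fresh: "V \<in> U \<Longrightarrow> sel V R \<Longrightarrow> \<exists>J. J \<in> Fr V \<inter> Nd V R"
  using sel_iff[of V R] s sg_nonneg[of R] mult_nonneg_nonneg[of "s/8" "sg R"]
  by (metis divide_nonneg_pos ex_in_conv not_le sum.empty zero_less_numeral)

lemma node_le:
  assumes "V \<in> U" shows "(\<Sum>J\<in>Nd V R. (c J * p V J)\<^sup>2) \<le> s * sg R"
  using size assms by (auto simp: size_le_def node_def)

lemma node_p_bounds:
  assumes "V \<in> U" "J \<in> Nd V R" "J' \<in> Nd V R"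
  shows "(c J)\<^sup>2 * (p V J')\<^sup>2 \<le> 16 * (c J * p V J)\<^sup>2" "(c J * p V J)\<^sup>2 \<le> 16 * ((c J)\<^sup>2 * (p V J')\<^sup>2)"
proof -
  have *: "p V J \<le> 4 * p V J'" "p V J' \<le> 4 * p V J" "0 \<le> p V J" "0 \<le> p V J'"
    using assms p_const[of V J J'] p_const[of V J' J] p_nonneg UKK JJJ by (auto simp: node_def)
  then have "(p V J)\<^sup>2 \<le> (4 * p V J')\<^sup>2" "(p V J')\<^sup>2 \<le> (4 * p V J)\<^sup>2" by (intro power_mono; simp)+
  then show "(c J)\<^sup>2 * (p V J')\<^sup>2 \<le> 16 * (c J * p V J)\<^sup>2" "(c J * p V J)\<^sup>2 \<le> 16 * ((c J)\<^sup>2 * (p V J')\<^sup>2)"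
    using mult_left_mono[of "(p V J)\<^sup>2" "(4 * p V J')\<^sup>2" "(c J)\<^sup>2"]
      mult_left_mono[of "(p V J')\<^sup>2" "(4 * p V J)\<^sup>2" "(c J)\<^sup>2"]
    by (simp_all add: power_mult_distrib mult.left_commute)
qed

text \<open>2048 = 16 * 8 * 16: replacing \<open>p\<close> by its value at one element costs 16 on
  either side, and the fresh part carries more than an eighth of the bound
  \<open>s * sg R\<close>.\<close>

lemma fresh_rich:
  assumes V: "V \<in> U" "sel V R"
  shows "(\<Sum>J\<in>Nd V R. (c J)\<^sup>2) \<le> 2048 * (\<Sum>J\<in>Fr V \<inter> Nd V R. (c J)\<^sup>2)"
proof -
  obtain J' where J': "J' \<in> Fr V" "J' \<in> Nd V R" using sel_fresh[OF V] by blast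
  define q where "q = (p V J')\<^sup>2"
  have "q * (\<Sum>J\<in>Nd V R. (c J)\<^sup>2) \<le> 16 * (\<Sum>J\<in>Nd V R. (c J * p V J)\<^sup>2)"
    unfolding sum_distrib_left using node_p_bounds(1)[OF V(1) _ J'(2)]
    by (intro sum_mono) (auto simp: q_def mult.commute)
  also have "\<dots> \<le> 16 * (s * sg R)" using node_le[OF V(1)] by simp
  also have "\<dots> \<le> 128 * (\<Sum>J\<in>Fr V \<inter> Nd V R. (c J * p V J)\<^sup>2)"
    using V sel_iff[of V R] by auto
  also have fr: "\<dots> \<le> 128 * (16 * (q * (\<Sum>J\<in>Fr V \<inter> Nd V R. (c J)\<^sup>2)))"
    unfolding sum_distrib_left using node_p_bounds(2)[OF V(1) _ J'(2)]
    by (intro sum_mono) (auto simp: q_def mult.commute)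
  finally have "q * (\<Sum>J\<in>Nd V R. (c J)\<^sup>2) \<le> q * (2048 * (\<Sum>J\<in>Fr V \<inter> Nd V R. (c J)\<^sup>2))" by simp
  \<comment> \<open>The choice rule is strict with a nonnegative threshold, so the tails on a chosen
    node cannot vanish and \<open>q\<close> may be cancelled.\<close>
  moreover have "0 < q"
  proof (rule ccontr)
    assume "\<not> 0 < q"
    then have "q = 0" by (simp add: q_def)
    then have "(\<Sum>J\<in>Fr V \<inter> Nd V R. (c J * p V J)\<^sup>2) \<le> 0" using fr by simp
    moreover have "0 < (\<Sum>J\<in>Fr V \<inter> Nd V R. (c J * p V J)\<^sup>2)"
      using V sel_iff[of V R] s sg_nonneg[of R] mult_nonneg_nonneg[of "s/8" "sg R"] by linarith
    ultimately show False by linarith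
  qed
  ultimately show ?thesis by simp
qed

lemma highest_below:
  assumes "J \<in> J\<^sub>0" "{V'\<in>VV J. P V'} \<noteq> {}"
  shows "\<exists>V. V \<in> VV J \<and> P V \<and> (\<forall>V'\<in>VV J. P V' \<longrightarrow> V' \<subseteq> V)"
proof -
  have "finite {V'\<in>VV J. P V'}" by simp
  then obtain V where V: "V \<in> {V'\<in>VV J. P V'}" "\<And>V'. V' \<in> {V'\<in>VV J. P V'} \<Longrightarrow> V \<subseteq> V' \<Longrightarrow> V = V'"
    using finite_has_maximal[OF _ assms(2)] by auto
  then have "V' \<subseteq> V" if "V' \<in> VV J" "P V'" for V'
    using VV_chain[OF assms(1), of V V'] that by auto
  then show ?thesis using V(1) by auto
qed

text \<open>
  The constant is 1 + 1/4095: fresh elements carry a fraction 1/8 of the size and \<open>p\<close> varies by a factor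
  at most 4 on a node, so they carry a definite fraction of \<open>c\<^sup>2\<close>. This absorbs the growth of the weight
  by one factor at each chosen level.
\<close>
lemma geometric_decay:
  assumes "V \<in> U" "sel V R"
  shows "(\<Sum>J\<in>Nd V R. (c J)\<^sup>2 * (4096/4095) ^ tt V J) \<le> 2 * (\<Sum>J\<in>Nd V R. (c J)\<^sup>2)"
  using assms
proof (induction "card {K\<in>U. K \<subset> V}" arbitrary: V R rule: less_induct)
  case less
  let ?l = "4096/4095 :: real"
  let ?N = "Nd V R" and ?F = "Fr V \<inter> Nd V R"
  define NF where "NF = ?N - ?F"
  have VK: "V \<in> KK" using less.prems UKK by auto
  have "\<exists>top. top \<in> VV J \<and> top \<subset> V \<and> (\<forall>V'\<in>VV J. V' \<subset> V \<longrightarrow> V' \<subseteq> top)" if "J \<in> NF" for J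
    using that by (intro highest_below) (auto simp: NF_def node_def fresh_def VV_def)
  then obtain top where top: "\<And>J. J \<in> NF \<Longrightarrow> top J \<in> VV J" "\<And>J. J \<in> NF \<Longrightarrow> top J \<subset> V"
      "\<And>J V'. J \<in> NF \<Longrightarrow> V' \<in> VV J \<Longrightarrow> V' \<subset> V \<Longrightarrow> V' \<subseteq> top J" by metis
  have NFJ: "J \<in> J\<^sub>0" "Q V J" "W V J = R" if "J \<in> NF" for J using that by (auto simp: NF_def node_def)
  have tt_Suc: "tt V J = Suc (tt (top J) J)" if J: "J \<in> NF" for J
  proof -
    have "{V'\<in>VV J. V' \<subset> V} = insert (top J) {V'\<in>VV J. V' \<subset> top J}"
    proof (intro equalityI subsetI)
      fix x assume "x \<in> {V'\<in>VV J. V' \<subset> V}"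
      then show "x \<in> insert (top J) {V'\<in>VV J. V' \<subset> top J}" using top(3)[OF J, of x] by auto
    next
      fix x assume "x \<in> insert (top J) {V'\<in>VV J. V' \<subset> top J}"
      then show "x \<in> {V'\<in>VV J. V' \<subset> V}" using top(1,2)[OF J] by auto
    qed
    then show ?thesis by (simp add: tt_def)
  qed
  define h where "h = (\<lambda>J. (top J, W (top J) J))"
  \<comment> \<open>Non-fresh elements are grouped by the highest chosen pair below \<open>V\<close>
    that contains them. Such a group is the full node of that pair: its members share their Whitney
    interval in every larger interval, hence their chosen intervals from there up to
    \<open>V\<close>. The induction hypothesis therefore applies to each group.\<close>
  have fiber: "{J\<in>NF. h J = (V', R')} = Nd V' R'" if hV: "(V', R') \<in> h ` NF" for V' R'
  proof -
    obtain J where J: "J \<in> NF" "V' = top J" "R' = W V' J" using hV by (auto simp: h_def)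
    have V': "V' \<in> U" "V' \<in> KK" "Q V' J" "sel V' R'" "V' \<subset> V"
      using top[OF J(1)] VV_D[of V' J] J by auto
    have "J' \<in> NF \<and> h J' = (V', R')" if "J' \<in> Nd V' R'" for J'
    proof -
      have J': "J' \<in> J\<^sub>0" "Q V' J'" "W V' J' = R'" using that by (auto simp: node_def)
      have "Q V J'" using up[of V' V J'] V' VK J' JJJ by auto
      moreover have "W V J' = R" using W_eq[of V' V J' J] V' VK J' J NFJ[OF J(1)] by auto
      moreover have VVJ': "V' \<in> VV J'" using V' J' by (auto simp: VV_def)
      ultimately have N: "J' \<in> NF" using J' V' by (auto simp: NF_def node_def fresh_def)
      have "top J' = V'"
      proof (rule ccontr)
        assume "top J' \<noteq> V'"
        then have less: "V' \<subset> top J'" using top(3)[OF N VVJ' V'(5)] by blast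
        define X where "X = top J'"
        have X: "X \<in> U" "X \<in> KK" "sel X (W X J')" using VV_D[OF top(1)[OF N]] by (auto simp: X_def)
        have "W X J' = W X J" using W_eq[of V' X J' J] V' X J' J NFJ[OF J(1)] less by (auto simp: X_def)
        then have "X \<in> VV J" using X up[of V' X J] V' less NFJ[OF J(1)] JJJ by (auto simp: VV_def X_def)
        then have "X \<subseteq> V'" using top(3)[OF J(1)] top(2)[OF N] J(2) by (auto simp: X_def)
        then show False using less by (auto simp: X_def)
      qed
      then show ?thesis using N J' by (auto simp: h_def)
    qed
    moreover have "J' \<in> Nd V' R'" if "J' \<in> NF" "h J' = (V', R')" for J'
      using that top(1)[OF that(1)] NFJ[OF that(1)] VV_D by (auto simp: h_def node_def)
    ultimately show ?thesis by blast
  qed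
  have finNF: "finite NF" by (simp add: NF_def)
  have group: "(\<Sum>J\<in>NF. g J) = (\<Sum>y\<in>h ` NF. \<Sum>J\<in>Nd (fst y) (snd y). g J)" for g :: "'j \<Rightarrow> real"
  proof -
    have "(\<Sum>J\<in>NF. g J) = (\<Sum>y\<in>h ` NF. \<Sum>J\<in>{J\<in>NF. h J = y}. g J)"
      using finNF by (intro sum.group[symmetric]) auto
    also have "\<dots> = (\<Sum>y\<in>h ` NF. \<Sum>J\<in>Nd (fst y) (snd y). g J)"
    proof (intro sum.cong)
      fix y assume "y \<in> h ` NF"
      then show "{J\<in>NF. h J = y} = Nd (fst y) (snd y)" using fiber[of "fst y" "snd y"] by simp
    qed auto
    finally show ?thesis .
  qed
  have "(\<Sum>J\<in>NF. (c J)\<^sup>2 * ?l ^ tt V J) = ?l * (\<Sum>J\<in>NF. (c J)\<^sup>2 * ?l ^ tt (top J) J)"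
    unfolding sum_distrib_left by (intro sum.cong refl) (simp add: tt_Suc)
  also have "\<dots> = ?l * (\<Sum>y\<in>h ` NF. \<Sum>J\<in>Nd (fst y) (snd y). (c J)\<^sup>2 * ?l ^ tt (fst y) J)"
  proof -
    have "(\<Sum>J\<in>Nd (fst y) (snd y). (c J)\<^sup>2 * ?l ^ tt (top J) J)
        = (\<Sum>J\<in>Nd (fst y) (snd y). (c J)\<^sup>2 * ?l ^ tt (fst y) J)" if "y \<in> h ` NF" for y
    proof (rule sum.cong[OF refl])
      fix J assume "J \<in> Nd (fst y) (snd y)"
      then have "h J = y" using fiber[of "fst y" "snd y"] that by auto
      then show "(c J)\<^sup>2 * ?l ^ tt (top J) J = (c J)\<^sup>2 * ?l ^ tt (fst y) J" by (auto simp: h_def)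
    qed
    then show ?thesis unfolding group by simp
  qed
  also have "\<dots> \<le> ?l * (\<Sum>y\<in>h ` NF. 2 * (\<Sum>J\<in>Nd (fst y) (snd y). (c J)\<^sup>2))"
  proof (intro mult_left_mono sum_mono)
    fix y assume "y \<in> h ` NF"
    then obtain J where "J \<in> NF" and h: "y = h J" by auto
    then have V': "fst y \<in> U" "sel (fst y) (snd y)" "fst y \<subset> V"
      using top(1,2)[of J] VV_D[of "fst y" J] by (simp_all add: h_def)
    then have "{K\<in>U. K \<subset> fst y} \<subset> {K\<in>U. K \<subset> V}" by blast
    then have "card {K\<in>U. K \<subset> fst y} < card {K\<in>U. K \<subset> V}" by (intro psubset_card_mono) auto
    then show "(\<Sum>J\<in>Nd (fst y) (snd y). (c J)\<^sup>2 * ?l ^ tt (fst y) J) \<le> 2 * (\<Sum>J\<in>Nd (fst y) (snd y). (c J)\<^sup>2)"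
      using less.hyps V' by blast
  qed simp
  also have "\<dots> = 2 * ?l * (\<Sum>J\<in>NF. (c J)\<^sup>2)"
    unfolding group by (simp add: sum_distrib_left)
  finally have NFle: "(\<Sum>J\<in>NF. (c J)\<^sup>2 * ?l ^ tt V J) \<le> 2 * ?l * (\<Sum>J\<in>NF. (c J)\<^sup>2)" .
  have Fr0: "tt V J = 0" if "J \<in> ?F" for J
    using that by (auto simp: tt_def fresh_def VV_def)
  have split: "(\<Sum>J\<in>?N. g J) = (\<Sum>J\<in>?F. g J) + (\<Sum>J\<in>NF. g J)" for g :: "'j \<Rightarrow> real"
    unfolding NF_def by (subst sum.subset_diff[of ?F ?N]) auto
  have "(\<Sum>J\<in>?N. (c J)\<^sup>2 * ?l ^ tt V J) \<le> (\<Sum>J\<in>?F. (c J)\<^sup>2) + 2 * ?l * (\<Sum>J\<in>NF. (c J)\<^sup>2)"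
  proof -
    have "(\<Sum>J\<in>?F. (c J)\<^sup>2 * ?l ^ tt V J) = (\<Sum>J\<in>?F. (c J)\<^sup>2)"
      using Fr0 by (intro sum.cong) auto
    then show ?thesis unfolding split using NFle by linarith
  qed
  \<comment> \<open>The non-fresh sum is at most 2047 times the fresh one, and 2 * 2047 / 4095 < 1
    absorbs the surplus; this is what fixes 4095.\<close>
  also have "\<dots> \<le> 2 * (\<Sum>J\<in>?N. (c J)\<^sup>2)"
    using fresh_rich[OF less.prems] sum_nonneg[of ?F "\<lambda>J. (c J)\<^sup>2"]
    unfolding split[of "\<lambda>J. (c J)\<^sup>2"] by (simp add: field_simps)
  finally show ?case .
qed

text \<open>On a node \<open>p\<close> is constant up to a factor 4, so the decay for the squares of
  \<open>c J\<close> passes to the squares of \<open>c J * p V J\<close>; 512 = 16 * 2 * 16.\<close>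

lemma node_weighted_le:
  assumes V: "V \<in> U" "sel V R"
  shows "(\<Sum>J\<in>Nd V R. (c J * p V J)\<^sup>2 * (4096/4095) ^ tt V J) \<le> 512 * (s * sg R)"
proof -
  obtain J' where J': "J' \<in> Nd V R" using sel_fresh[OF V] by blast
  define q where "q = (p V J')\<^sup>2"
  have "(\<Sum>J\<in>Nd V R. (c J * p V J)\<^sup>2 * (4096/4095) ^ tt V J)
      \<le> (\<Sum>J\<in>Nd V R. 16 * ((c J)\<^sup>2 * q) * (4096/4095) ^ tt V J)"
    using node_p_bounds(2)[OF V(1) _ J'] by (intro sum_mono mult_right_mono) (auto simp: q_def)
  also have "\<dots> = 16 * q * (\<Sum>J\<in>Nd V R. (c J)\<^sup>2 * (4096/4095) ^ tt V J)"
    by (simp add: sum_distrib_left mult_ac)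
  also have "\<dots> \<le> 16 * q * (2 * (\<Sum>J\<in>Nd V R. (c J)\<^sup>2))"
    using geometric_decay[OF V] by (intro mult_left_mono) (auto simp: q_def)
  also have "\<dots> = 32 * (\<Sum>J\<in>Nd V R. (c J)\<^sup>2 * q)" by (simp add: sum_distrib_left mult_ac)
  also have "\<dots> \<le> 32 * (\<Sum>J\<in>Nd V R. 16 * (c J * p V J)\<^sup>2)"
    using node_p_bounds(1)[OF V(1) _ J'] by (intro mult_left_mono sum_mono) (auto simp: q_def)
  also have "\<dots> \<le> 512 * (s * sg R)"
    using node_le[OF V(1), of R] by (simp add: sum_distrib_left[symmetric])
  finally show ?thesis .
qed

text \<open>
  \<open>Seg V\<close> consists of the \<open>K\<close> from \<open>V\<close> up to, but not including, the next chosen interval. The property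
  \<open>above X V\<close> is stated with some \<open>J\<close>, but by separation it holds for all \<open>J\<close> below \<open>V\<close> or for none, so
  that the segments do not depend on \<open>J\<close>.
\<close>
definition above :: "'a set \<Rightarrow> 'a set \<Rightarrow> bool" where
  "above X V \<longleftrightarrow> (\<exists>J\<in>J\<^sub>0. Q X J \<and> sel X (W X J) \<and> V \<subseteq> W X J)"

definition Seg :: "'a set \<Rightarrow> 'a set set" where
  "Seg V = {K\<in>U. V \<subseteq> K \<and> \<not> (\<exists>X\<in>U. V \<subset> X \<and> X \<subseteq> K \<and> above X V)}"

text \<open>A label for segments: it is constant along the segment of \<open>V\<close>
  (\<open>nx_Seg\<close>), and distinct chosen pairs with equal labels have disjoint Whitney
  intervals. Recording all chosen intervals above, rather than the lowest one, gives a label also to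
  segments without a successor.\<close>

definition nx :: "'a set \<Rightarrow> 'a set set" where
  "nx V = {X\<in>U. V \<subset> X \<and> above X V}"

lemma Seg_finite [simp]: "finite (Seg V)"
  by (simp add: Seg_def)

lemma Seg_down: "K' \<in> Seg V \<Longrightarrow> K \<in> U \<Longrightarrow> V \<subseteq> K \<Longrightarrow> K \<subseteq> K' \<Longrightarrow> K \<in> Seg V"
  unfolding Seg_def mem_Collect_eq by (meson order_trans)

lemma W_eq_of_subset:
  assumes "V \<in> U" "X \<in> U" "J \<in> J\<^sub>0" "Q V J" "V \<subset> X" "J' \<in> J\<^sub>0" "Q X J'" "W X J' \<inter> V \<noteq> {}"
  shows "W X J' = W X J"
proof (rule W_disj)
  show "W X J' \<inter> W X J \<noteq> {}" using W_sep[of X V J] assms UKK JJJ by blast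
qed (use assms up[of V X J] UKK JJJ in auto)

lemma above_iff:
  assumes "V \<in> U" "X \<in> U" "J \<in> J\<^sub>0" "Q V J" "V \<subset> X"
  shows "above X V \<longleftrightarrow> X \<in> VV J"
proof
  assume "above X V"
  then obtain J' where J': "J' \<in> J\<^sub>0" "Q X J'" "sel X (W X J')" "V \<subseteq> W X J'" by (auto simp: above_def)
  then have "W X J' = W X J" using W_eq_of_subset[OF assms] ne[of V] UKK assms(1) by blast
  then show "X \<in> VV J" using J' up[of V X J] assms UKK JJJ by (auto simp: VV_def)
next
  assume "X \<in> VV J"
  then show "above X V"
    using W_sep[of X V J] assms UKK JJJ by (auto simp: above_def VV_def)
qed

lemma nx_Seg:
  assumes "V \<in> U" "J \<in> J\<^sub>0" "Q V J" "K \<in> Seg V"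
  shows "nx K = nx V"
proof -
  have K: "K \<in> U" "V \<subseteq> K" "Q K J" using assms up[of V K J] UKK JJJ by (auto simp: Seg_def)
  have "X \<in> nx V \<longleftrightarrow> X \<in> nx K" for X
  proof
    assume X: "X \<in> nx V"
    then have X': "X \<in> U" "V \<subset> X" "X \<in> VV J" using above_iff assms by (auto simp: nx_def)
    then have "\<not> X \<subseteq> K" using assms(4) X by (auto simp: Seg_def nx_def)
    moreover have "X \<subseteq> K \<or> K \<subseteq> X"
      using chain[of X K J] X' K VV_D[of X J] UKK JJJ assms by auto
    ultimately have "K \<subset> X" by auto
    then show "X \<in> nx K" using above_iff[of K X J] X' K assms by (auto simp: nx_def)
  next
    assume X: "X \<in> nx K"
    then have "X \<in> U" "K \<subset> X" "above X K" by (auto simp only: nx_def)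
    moreover have "above X V" using \<open>above X K\<close> K(2) unfolding above_def by blast
    ultimately show "X \<in> nx V" using K(2) unfolding nx_def by blast
  qed
  then show ?thesis by blast
qed

definition partial :: "'a set \<Rightarrow> 'a set \<Rightarrow> real" where
  "partial V K' = (\<Sum>K\<in>{K\<in>Seg V. K \<subseteq> K'}. a K)"

lemma exists_max_partial: "V \<in> U \<Longrightarrow> \<exists>k. k \<in> Seg V \<and> (\<forall>K'\<in>Seg V. \<bar>partial V K'\<bar> \<le> \<bar>partial V k\<bar>)"
proof -
  assume "V \<in> U"
  then have ne: "(\<lambda>K. \<bar>partial V K\<bar>) ` Seg V \<noteq> {}" by (auto simp: Seg_def)
  have "Max ((\<lambda>K. \<bar>partial V K\<bar>) ` Seg V) \<in> (\<lambda>K. \<bar>partial V K\<bar>) ` Seg V"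
    by (rule Max_in[OF _ ne]) simp
  then obtain k where k: "k \<in> Seg V" "Max ((\<lambda>K. \<bar>partial V K\<bar>) ` Seg V) = \<bar>partial V k\<bar>" by blast
  have "\<bar>partial V K'\<bar> \<le> \<bar>partial V k\<bar>" if "K' \<in> Seg V" for K'
    using that unfolding k(2)[symmetric] by (intro Max_ge) auto
  then show ?thesis using k(1) by blast
qed

text \<open>The largest partial sum is attained, hence is a sum over the \<open>K\<close> between
  \<open>V\<close> and a member \<open>kk V\<close>, the shape required by
  \<open>maximal\<close>.\<close>

definition kk :: "'a set \<Rightarrow> 'a set" where
  "kk V = (SOME k. k \<in> Seg V \<and> (\<forall>K'\<in>Seg V. \<bar>partial V K'\<bar> \<le> \<bar>partial V k\<bar>))"

definition alpha :: "'a set \<Rightarrow> real" where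
  "alpha V = \<bar>partial V (kk V)\<bar>"

lemma kk: "V \<in> U \<Longrightarrow> kk V \<in> Seg V" "V \<in> U \<Longrightarrow> K' \<in> Seg V \<Longrightarrow> \<bar>partial V K'\<bar> \<le> alpha V"
  using someI_ex[OF exists_max_partial[of V]] by (auto simp: kk_def alpha_def)

lemma Seg_sum_le:
  assumes J: "J \<in> J\<^sub>0" and V: "V \<in> VV J"
  shows "\<bar>\<Sum>K\<in>Seg V. a K * T K J\<bar> \<le> alpha V * (c J * p V J)"
proof (rule summation_by_parts_bound)
  have VU: "V \<in> U" "V \<in> KK" "Q V J" using VV_D[OF V] by auto
  have Seg: "K \<in> U \<and> K \<in> KK \<and> V \<subseteq> K \<and> Q K J" if "K \<in> Seg V" for K
    using that up[of V K J] VU J JJJ UKK by (auto simp: Seg_def)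
  show "K \<subseteq> K' \<or> K' \<subseteq> K" if "K \<in> Seg V" "K' \<in> Seg V" for K K'
    using Seg[OF that(1)] Seg[OF that(2)] chain[of K K' J] J JJJ by auto
  show "\<bar>T K J - T K' J\<bar> \<le> c J * p K J - c J * p K' J" if "K \<in> Seg V" "K' \<in> Seg V" "K \<subseteq> K'" for K K'
    using T_diff[of K K' J] Seg[OF that(1)] Seg[OF that(2)] that J JJJ by auto
  show "\<bar>T K J\<bar> \<le> c J * p K J" if "K \<in> Seg V" for K
    using T_bound[of K J] Seg[OF that] J JJJ by auto
  \<comment> \<open>\<open>T_diff\<close> bounds an absolute value, so its right side is
    nonnegative: \<open>c J * p K J\<close> decreases as \<open>K\<close> grows and is largest at
    \<open>V\<close>.\<close>
  show "c J * p K J \<le> c J * p V J" if "K \<in> Seg V" for K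
    using T_diff[of V K J] Seg[OF that] VU J JJJ by auto
  show "0 \<le> c J * p V J" using c_nonneg p_nonneg VU J JJJ by auto
  show "\<bar>\<Sum>K\<in>{K \<in> Seg V. K \<subseteq> K'}. a K\<bar> \<le> alpha V" if "K' \<in> Seg V" for K'
    using kk(2)[OF VU(1) that] by (simp add: partial_def)
qed (auto simp: alpha_def)

definition large :: "'j \<Rightarrow> 'a set set" where
  "large J = {K\<in>U. Q K J \<and> (\<exists>V\<in>VV J. V \<subseteq> K)}"

text \<open>Each \<open>K\<close> that contains a chosen interval belongs to the segment of the
  highest one it contains, so the segments partition \<open>large J\<close>.\<close>

lemma large_sum_le:
  assumes J: "J \<in> J\<^sub>0"
  shows "\<bar>\<Sum>K\<in>large J. a K * T K J\<bar> \<le> (\<Sum>V\<in>VV J. alpha V * (c J * p V J))"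
proof -
  have Seg: "K \<in> Seg V \<longleftrightarrow> K \<in> U \<and> V \<subseteq> K \<and> (\<forall>X\<in>VV J. X \<subseteq> K \<longrightarrow> X \<subseteq> V)" if V: "V \<in> VV J" for K V
  proof -
    have VU: "V \<in> U" "Q V J" using VV_D[OF V] by auto
    have "(\<exists>X\<in>U. V \<subset> X \<and> X \<subseteq> K \<and> above X V) \<longleftrightarrow> (\<exists>X\<in>VV J. V \<subset> X \<and> X \<subseteq> K)"
      using above_iff[OF VU(1) _ J VU(2)] VV_D[of _ J] by meson
    also have "\<dots> \<longleftrightarrow> \<not> (\<forall>X\<in>VV J. X \<subseteq> K \<longrightarrow> X \<subseteq> V)"
      using VV_chain[OF J V] by blast
    finally show ?thesis unfolding Seg_def mem_Collect_eq by simp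
  qed
  have large_eq: "large J = (\<Union>V\<in>VV J. Seg V)"
  proof (intro equalityI subsetI)
    fix K assume K: "K \<in> large J"
    then have "\<exists>V. V \<in> VV J \<and> V \<subseteq> K \<and> (\<forall>V'\<in>VV J. V' \<subseteq> K \<longrightarrow> V' \<subseteq> V)"
      using highest_below[OF J, of "\<lambda>V. V \<subseteq> K"] by (auto simp: large_def)
    then show "K \<in> (\<Union>V\<in>VV J. Seg V)" using Seg K by (auto simp: large_def)
  next
    fix K assume "K \<in> (\<Union>V\<in>VV J. Seg V)"
    then obtain V where V: "V \<in> VV J" "K \<in> Seg V" by auto
    then show "K \<in> large J" using Seg[OF V(1)] up[of V K J] VV_D[OF V(1)] UKK JJJ J by (auto simp: large_def)
  qed
  have "(\<Sum>K\<in>large J. a K * T K J) = (\<Sum>V\<in>VV J. \<Sum>K\<in>Seg V. a K * T K J)"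
    unfolding large_eq
  proof (rule sum.UNION_disjoint[where A = Seg and g = "\<lambda>K. a K * T K J"])
    show "finite (VV J)" by (rule fins)
    show "\<forall>V\<in>VV J. finite (Seg V)" using Seg_finite by blast
    show "\<forall>V\<in>VV J. \<forall>V'\<in>VV J. V \<noteq> V' \<longrightarrow> Seg V \<inter> Seg V' = {}"
    proof (intro ballI impI equals0I)
      fix V V' K assume V: "V \<in> VV J" "V' \<in> VV J" "V \<noteq> V'" and "K \<in> Seg V \<inter> Seg V'"
      then have "V \<subseteq> V'" "V' \<subseteq> V" using Seg[OF V(1), of K] Seg[OF V(2), of K] by simp_all
      then show False using V(3) by (simp add: subset_antisym)
    qed
  qed
  moreover have "(\<Sum>V\<in>VV J. \<bar>\<Sum>K\<in>Seg V. a K * T K J\<bar>) \<le> (\<Sum>V\<in>VV J. alpha V * (c J * p V J))"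
    by (rule sum_mono) (rule Seg_sum_le[OF J])
  moreover have "\<bar>\<Sum>V\<in>VV J. \<Sum>K\<in>Seg V. a K * T K J\<bar> \<le> (\<Sum>V\<in>VV J. \<bar>\<Sum>K\<in>Seg V. a K * T K J\<bar>)"
    by (rule sum_abs)
  ultimately show ?thesis by linarith
qed

lemma tt_inj: "J \<in> J\<^sub>0 \<Longrightarrow> inj_on (\<lambda>V. tt V J) (VV J)"
proof (rule inj_onI, rule ccontr)
  fix V V' assume J: "J \<in> J\<^sub>0" and V: "V \<in> VV J" "V' \<in> VV J" and eq: "tt V J = tt V' J" and "V \<noteq> V'"
  have less: "tt X J < tt Y J" if "X \<in> VV J" "X \<subset> Y" for X Y
    unfolding tt_def using that by (intro psubset_card_mono psubsetI subsetI) auto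
  show False
    using VV_chain[OF J V] less[of V V'] less[of V' V] V eq \<open>V \<noteq> V'\<close> by auto
qed

definition NN :: "('a set \<times> 'a set) set" where
  "NN = Sigma U (\<lambda>V. {R \<in> W V ` {J\<in>J\<^sub>0. Q V J}. sel V R})"

lemma sum_nodes:
  fixes g :: "'j \<Rightarrow> 'a set \<Rightarrow> real"
  shows "(\<Sum>J\<in>J\<^sub>0. \<Sum>V\<in>VV J. g J V) = (\<Sum>(V, R)\<in>NN. \<Sum>J\<in>Nd V R. g J V)"
proof -
  have "(\<Sum>J\<in>J\<^sub>0. \<Sum>V\<in>VV J. g J V) = (\<Sum>V\<in>U. \<Sum>J\<in>{J\<in>J\<^sub>0. Q V J \<and> sel V (W V J)}. g J V)"
    unfolding VV_def by (rule sum.swap_restrict) auto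
  also have "\<dots> = (\<Sum>V\<in>U. \<Sum>R\<in>{R \<in> W V ` {J\<in>J\<^sub>0. Q V J}. sel V R}. \<Sum>J\<in>Nd V R. g J V)"
  proof (rule sum.cong[OF refl])
    fix V assume "V \<in> U"
    have "(\<Sum>J\<in>{J\<in>J\<^sub>0. Q V J \<and> sel V (W V J)}. g J V) =
      (\<Sum>R\<in>{R \<in> W V ` {J\<in>J\<^sub>0. Q V J}. sel V R}. \<Sum>J\<in>{J\<in>{J\<in>J\<^sub>0. Q V J \<and> sel V (W V J)}. W V J = R}. g J V)"
      by (rule sum.group[symmetric]) auto
    also have "\<dots> = (\<Sum>R\<in>{R \<in> W V ` {J\<in>J\<^sub>0. Q V J}. sel V R}. \<Sum>J\<in>Nd V R. g J V)"
      by (intro sum.cong refl) (auto simp: node_def)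
    finally show "(\<Sum>J\<in>{J\<in>J\<^sub>0. Q V J \<and> sel V (W V J)}. g J V) =
      (\<Sum>R\<in>{R \<in> W V ` {J\<in>J\<^sub>0. Q V J}. sel V R}. \<Sum>J\<in>Nd V R. g J V)" .
  qed
  also have "\<dots> = (\<Sum>(V, R)\<in>NN. \<Sum>J\<in>Nd V R. g J V)"
    unfolding NN_def by (rule sum.Sigma) auto
  finally show ?thesis .
qed

lemma finite_NN [simp]: "finite NN"
  by (auto simp: NN_def intro!: finite_SigmaI)

lemma NN_D:
  assumes "(V, R) \<in> NN"
  obtains J where "J \<in> J\<^sub>0" "Q V J" "R = W V J" "V \<in> U" "V \<in> KK" "V \<in> VV J" "sel V R"
  using assms UKK by (auto simp: NN_def VV_def)

text \<open>For a fixed label the Whitney intervals are disjoint: if those of \<open>V\<close> and a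
  larger \<open>V'\<close> met, \<open>V'\<close> would be above \<open>V\<close> and hence in
  \<open>nx V\<close>, but no interval is in its own label. So the maximal inequality applies to
  each label, and \<open>sum_parents_le\<close> adds up the labels, with 64 = 2 * 32.\<close>

lemma NN_maximal:
  "(\<Sum>(V, R)\<in>NN. (alpha V)\<^sup>2 * sg R) \<le> 64 * a_norm J\<^sub>0 U"
proof -
  define Z where "Z = (\<lambda>y. nx (fst y)) ` NN"
  define F where "F = (\<lambda>z. {K\<in>occ J\<^sub>0 U. nx K = z})"
  have occ: "occ J\<^sub>0 U \<subseteq> KK" using UKK by (auto simp: occ_def)
  have "(\<Sum>(V, R)\<in>NN. (alpha V)\<^sup>2 * sg R) =
      (\<Sum>z\<in>Z. \<Sum>(V, R)\<in>{y\<in>NN. nx (fst y) = z}. (alpha V)\<^sup>2 * sg R)"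
    unfolding Z_def by (rule sum.group[symmetric]) auto
  also have "\<dots> \<le> (\<Sum>z\<in>Z. 32 * (\<Sum>i\<in>par ` F z. A i))"
  proof (rule sum_mono)
    fix z assume "z \<in> Z"
    have alpha: "(alpha V)\<^sup>2 = (\<Sum>K\<in>{K\<in>KK. V \<subseteq> K \<and> K \<subseteq> kk V \<and> par K \<in> par ` F z}. a K)\<^sup>2"
      if VR: "(V, R) \<in> NN" "nx V = z" for V R
    proof -
      obtain J where J: "J \<in> J\<^sub>0" "Q V J" "V \<in> U" using VR(1) by (rule NN_D)
      have "K \<in> Seg V \<and> K \<subseteq> kk V \<longleftrightarrow> K \<in> KK \<and> V \<subseteq> K \<and> K \<subseteq> kk V \<and> par K \<in> par ` F z" for K
      proof
        assume K: "K \<in> Seg V \<and> K \<subseteq> kk V"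
        then have "nx K = z" using nx_Seg[OF J(3,1,2)] VR by auto
        moreover have "K \<in> U" "V \<subseteq> K" "K \<in> KK" using K UKK by (auto simp: Seg_def)
        moreover have "Q K J" using up[of V K J] calculation J JJJ UKK by auto
        ultimately show "K \<in> KK \<and> V \<subseteq> K \<and> K \<subseteq> kk V \<and> par K \<in> par ` F z"
          using K J by (auto simp: F_def occ_def)
      next
        assume K: "K \<in> KK \<and> V \<subseteq> K \<and> K \<subseteq> kk V \<and> par K \<in> par ` F z"
        have "kk V \<in> U" using kk(1)[OF J(3)] unfolding Seg_def by blast
        then have "K \<in> U" using K U unfolding down_closed_def by blast
        then show "K \<in> Seg V \<and> K \<subseteq> kk V"
          using K Seg_down[OF kk(1)[OF J(3)]] by blast
      qed
      then have "{K \<in> Seg V. K \<subseteq> kk V} = {K\<in>KK. V \<subseteq> K \<and> K \<subseteq> kk V \<and> par K \<in> par ` F z}" by blast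
      then show ?thesis by (simp add: alpha_def partial_def)
    qed
    have "(\<Sum>(V, R)\<in>{y\<in>NN. nx (fst y) = z}. (alpha V)\<^sup>2 * sg R) =
        (\<Sum>(V, R)\<in>{y\<in>NN. nx (fst y) = z}. (\<Sum>K\<in>{K\<in>KK. V \<subseteq> K \<and> K \<subseteq> kk V \<and> par K \<in> par ` F z}. a K)\<^sup>2 * sg R)"
      by (intro sum.cong refl) (use alpha in auto)
    also have "\<dots> \<le> 32 * (\<Sum>i\<in>par ` F z. A i)"
    proof (rule maximal)
      show "par ` F z \<subseteq> par ` KK" using occ by (auto simp: F_def)
      show "finite {y \<in> NN. nx (fst y) = z}" by simp
      show "V \<in> KK \<and> kk V \<in> KK \<and> R \<in> Ws \<and> R \<subseteq> V" if "(V, R) \<in> {y \<in> NN. nx (fst y) = z}" for V R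
      proof -
        obtain J where "J \<in> J\<^sub>0" "Q V J" "R = W V J" "V \<in> KK" "V \<in> U" using NN_D[of V R] \<open>(V, R) \<in> _\<close> by blast
        moreover have "kk V \<in> KK" using kk(1)[OF \<open>V \<in> U\<close>] UKK unfolding Seg_def by blast
        ultimately show ?thesis using W_sub[of V J] JJJ[of J] by simp
      qed
      fix V R V' R'
      assume 1: "(V, R) \<in> {y \<in> NN. nx (fst y) = z}" and 2: "(V', R') \<in> {y \<in> NN. nx (fst y) = z}"
        and ne: "R \<inter> R' \<noteq> {}"
      obtain J where J: "J \<in> J\<^sub>0" "Q V J" "R = W V J" "V \<in> U" "V \<in> KK" "sel V R"
        using 1 NN_D[of V R] by blast
      obtain J' where J': "J' \<in> J\<^sub>0" "Q V' J'" "R' = W V' J'" "V' \<in> U" "V' \<in> KK" "sel V' R'"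
        using 2 NN_D[of V' R'] by blast
      have not: "\<not> X \<subset> Y" if "X \<in> U" "Y \<in> U" "nx X = nx Y" "j \<in> J\<^sub>0" "Q X j" "j' \<in> J\<^sub>0" "Q Y j'"
        "sel Y (W Y j')" "W X j \<inter> W Y j' \<noteq> {}" for X Y j j'
      proof
        assume "X \<subset> Y"
        moreover have "W X j \<subseteq> X" using W_sub[of X j] that UKK JJJ by auto
        ultimately have "W Y j' = W Y j" using W_eq_of_subset[of X Y j j'] that by blast
        then have "above Y X"
          using that W_sep[of Y X j] UKK JJJ up[of X Y j] \<open>X \<subset> Y\<close> by (auto simp: above_def)
        then have "Y \<in> nx X" using that \<open>X \<subset> Y\<close> by (auto simp: nx_def)
        then show False using that by (auto simp: nx_def)
      qed
      have "V \<inter> V' \<noteq> {}" using ne W_sub[of V J] W_sub[of V' J'] J J' JJJ by blast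
      moreover have "nx V = nx V'" using 1 2 by auto
      ultimately have "V = V'"
        using nested[of V V'] not[of V V' J J'] not[of V' V J' J] J J' ne by (auto simp: Int_commute)
      moreover have "R = R'" using W_disj[of V J J'] J J' ne calculation JJJ by auto
      ultimately show "V = V' \<and> R = R'" by simp
    qed
    finally show "(\<Sum>(V, R)\<in>{y\<in>NN. nx (fst y) = z}. (alpha V)\<^sup>2 * sg R) \<le> 32 * (\<Sum>i\<in>par ` F z. A i)" .
  qed
  also have "\<dots> = 32 * (\<Sum>z\<in>Z. \<Sum>i\<in>par ` F z. A i)" by (simp add: sum_distrib_left)
  also have "\<dots> \<le> 32 * (2 * (\<Sum>i\<in>par ` occ J\<^sub>0 U. A i))"
    by (intro mult_left_mono sum_parents_le) (auto simp: Z_def F_def occ)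
  finally show ?thesis by (simp add: a_norm_def)
qed

lemma large_form_le:
  "\<bar>\<Sum>J\<in>J\<^sub>0. b J * (\<Sum>K\<in>large J. a K * T K J)\<bar> \<le> 2 ^ 14 * (sqrt s * sqrt (a_norm J\<^sub>0 U) * sqrt (b_norm J\<^sub>0))"
proof -
  let ?x = "\<lambda>J. \<Sum>V\<in>VV J. alpha V * (c J * p V J)"
  have x0: "0 \<le> ?x J" if "J \<in> J\<^sub>0" for J
    using that c_nonneg p_nonneg JJJ VV_D by (auto intro!: sum_nonneg mult_nonneg_nonneg simp: alpha_def)
  have "\<bar>\<Sum>J\<in>J\<^sub>0. b J * (\<Sum>K\<in>large J. a K * T K J)\<bar> \<le> (\<Sum>J\<in>J\<^sub>0. \<bar>b J\<bar> * ?x J)"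
    using large_sum_le by (intro order_trans[OF sum_abs] sum_mono) (auto simp: abs_mult intro!: mult_left_mono)
  also have "\<dots> \<le> sqrt (\<Sum>J\<in>J\<^sub>0. \<bar>b J\<bar>\<^sup>2) * sqrt (\<Sum>J\<in>J\<^sub>0. (?x J)\<^sup>2)"
    unfolding real_sqrt_mult[symmetric] by (intro real_le_rsqrt Cauchy_Schwarz_ineq_sum)
  also have "\<dots> \<le> sqrt (b_norm J\<^sub>0) * sqrt ((2 ^ 14)\<^sup>2 * (s * a_norm J\<^sub>0 U))"
  proof (intro mult_mono real_sqrt_le_mono)
    have "(\<Sum>J\<in>J\<^sub>0. (?x J)\<^sup>2) \<le> (\<Sum>J\<in>J\<^sub>0. 4096 * (\<Sum>V\<in>VV J. (4096/4095) ^ tt V J * (alpha V * (c J * p V J))\<^sup>2))"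
      using geometric_weights_square[OF _ tt_inj, of _ "4095/4096"] by (intro sum_mono) simp
    also have "\<dots> = 4096 * (\<Sum>(V, R)\<in>NN. \<Sum>J\<in>Nd V R. (4096/4095) ^ tt V J * (alpha V * (c J * p V J))\<^sup>2)"
      unfolding sum_distrib_left[symmetric] sum_nodes ..
    also have "\<dots> \<le> 4096 * (\<Sum>(V, R)\<in>NN. 512 * s * ((alpha V)\<^sup>2 * sg R))"
    proof (intro mult_left_mono sum_mono, clarify)
      fix V R assume "(V, R) \<in> NN"
      then have V: "V \<in> U" "sel V R" using NN_D[of V R] by blast+
      have "(\<Sum>J\<in>Nd V R. (4096/4095) ^ tt V J * (alpha V * (c J * p V J))\<^sup>2)
          = (alpha V)\<^sup>2 * (\<Sum>J\<in>Nd V R. (c J * p V J)\<^sup>2 * (4096/4095) ^ tt V J)"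
        by (simp add: sum_distrib_left power_mult_distrib mult_ac)
      also have "\<dots> \<le> (alpha V)\<^sup>2 * (512 * (s * sg R))"
        using node_weighted_le[OF V] by (intro mult_left_mono) auto
      finally show "(\<Sum>J\<in>Nd V R. (4096/4095) ^ tt V J * (alpha V * (c J * p V J))\<^sup>2)
          \<le> 512 * s * ((alpha V)\<^sup>2 * sg R)" by (simp add: mult_ac)
    qed simp
    also have "\<dots> = 4096 * (512 * s) * (\<Sum>(V, R)\<in>NN. (alpha V)\<^sup>2 * sg R)"
      by (simp add: sum_distrib_left case_prod_unfold mult.assoc)
    also have "\<dots> \<le> 4096 * (512 * s) * (64 * a_norm J\<^sub>0 U)"
      using NN_maximal s by (intro mult_left_mono) auto
    \<comment> \<open>4096 * 512 * 64 is half the square of 2 ^ 14; here 4096 is the sum of the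
      geometric weights of ratio 4095/4096.\<close>
    also have "\<dots> \<le> (2 ^ 14)\<^sup>2 * (s * a_norm J\<^sub>0 U)"
    proof -
      have "0 \<le> s * a_norm J\<^sub>0 U" using s A_nonneg by (auto simp: a_norm_def intro!: mult_nonneg_nonneg sum_nonneg)
      then show ?thesis by simp
    qed
    finally show "(\<Sum>J\<in>J\<^sub>0. (?x J)\<^sup>2) \<le> (2 ^ 14)\<^sup>2 * (s * a_norm J\<^sub>0 U)" .
  qed (auto simp: b_norm_def intro!: sum_nonneg)
  also have "\<dots> = 2 ^ 14 * (sqrt s * sqrt (a_norm J\<^sub>0 U) * sqrt (b_norm J\<^sub>0))"
    by (simp add: real_sqrt_mult)
  finally show ?thesis .
qed

end

end

lemma sum_sqrt_mult_le:
  assumes "\<And>x. x \<in> X \<Longrightarrow> 0 \<le> f x" "\<And>x. x \<in> X \<Longrightarrow> 0 \<le> g x"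
  shows "(\<Sum>x\<in>X. sqrt (f x) * sqrt (g x)) \<le> sqrt (\<Sum>x\<in>X. f x) * sqrt (\<Sum>x\<in>X. g x)"
proof -
  have "(\<Sum>x\<in>X. sqrt (f x) * sqrt (g x))\<^sup>2 \<le> (\<Sum>x\<in>X. (sqrt (f x))\<^sup>2) * (\<Sum>x\<in>X. (sqrt (g x))\<^sup>2)"
    by (rule Cauchy_Schwarz_ineq_sum)
  also have "\<dots> = (\<Sum>x\<in>X. f x) * (\<Sum>x\<in>X. g x)" using assms by simp
  finally show ?thesis by (simp add: real_le_rsqrt real_sqrt_mult[symmetric])
qed

section \<open>The recursion on the size\<close>

context stopping_form
begin

text \<open>The recursion wants a size bound that is sharp up to the factor 8. If \<open>s\<close>
  can be divided by 8 forever, every majorant \<open>c J * p K J\<close> vanishes, and with it the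
  form.\<close>

lemma form_eq_0:
  assumes "J\<^sub>0 \<subseteq> JJ" "down_closed U" and size: "\<And>n::nat. size_le J\<^sub>0 U (s / 8 ^ n)"
  shows "form J\<^sub>0 U = 0"
proof -
  have "a K * T K J = 0" if J: "J \<in> J\<^sub>0" and K: "K \<in> U" "Q K J" for J K
  proof -
    have "(c J * p K J)\<^sup>2 \<le> s / 8 ^ n * sg (W K J)" for n
    proof -
      have "(c J * p K J)\<^sup>2 \<le> (\<Sum>J'\<in>{J'\<in>J\<^sub>0. Q K J' \<and> W K J' = W K J}. (c J' * p K J')\<^sup>2)"
        using J K finite_subset[OF assms(1) fin(2)] by (intro member_le_sum) auto
      also have "\<dots> \<le> s / 8 ^ n * sg (W K J)" using size[of n] K by (auto simp: size_le_def)
      finally show ?thesis .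
    qed
    moreover have "(\<lambda>n. s / 8 ^ n * sg (W K J)) \<longlonglongrightarrow> s * 0 * sg (W K J)"
      unfolding divide_inverse power_inverse[symmetric]
      by (intro tendsto_mult tendsto_const LIMSEQ_realpow_zero) auto
    ultimately have "(c J * p K J)\<^sup>2 \<le> 0"
      by (intro LIMSEQ_le_const[of "\<lambda>n. s / 8 ^ n * sg (W K J)"]) auto
    moreover have "\<bar>T K J\<bar> \<le> c J * p K J"
    proof (rule T_bound)
      show "K \<in> KK" using K(1) assms(2) unfolding down_closed_def by (elim conjE) (rule subsetD)
      show "J \<in> JJ" using J assms(1) by (rule rev_subsetD)
    qed (rule K)
    ultimately show ?thesis by auto
  qed
  then show ?thesis by (auto simp: form_def intro!: sum.neutral)
qed

text \<open>
  Pairs with \<open>K\<close> above a chosen interval are summed directly. The others split according to the lowest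
  chosen interval into forms with disjoint \<open>J\<close> and disjoint \<open>K\<close>, all of size at most \<open>s / 8\<close>; the
  gain \<open>sqrt (1/8)\<close> beats the factor \<open>sqrt 2\<close> lost because two classes may share a parent.
\<close>
theorem form_bound:
  assumes "J\<^sub>0 \<subseteq> JJ" "down_closed U" "0 \<le> s" "size_le J\<^sub>0 U s"
  shows "\<bar>form J\<^sub>0 U\<bar> \<le> 2 ^ 15 * (sqrt s * sqrt (a_norm J\<^sub>0 U) * sqrt (b_norm J\<^sub>0))"
  using assms
proof (induction "card {(K, J). J \<in> J\<^sub>0 \<and> K \<in> U \<and> Q K J}" arbitrary: J\<^sub>0 U s rule: less_induct)
  case less
  have nn: "0 \<le> a_norm J\<^sub>0 U" "0 \<le> b_norm J\<^sub>0" for J\<^sub>0 U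
    using A_nonneg by (auto simp: a_norm_def b_norm_def intro!: sum_nonneg)
  have finU: "finite U" "finite J\<^sub>0"
    using less.prems fin finite_subset by (auto simp: down_closed_def)
  have UKK: "K \<in> KK" if "K \<in> U" for K using that less.prems by (auto simp: down_closed_def)
  have JJJ: "J \<in> JJ" if "J \<in> J\<^sub>0" for J using that less.prems by auto
  let ?P = "\<lambda>J\<^sub>0 U. {(K, J). J \<in> J\<^sub>0 \<and> K \<in> U \<and> Q K J}"
  \<comment> \<open>The failure of \<open>s / 8\<close> forces at least one chosen pair, so that the
    subforms contain strictly fewer pairs \<open>(K, J)\<close>.\<close>
  have main: "\<bar>form J\<^sub>0 U\<bar> \<le> 2 ^ 15 * (sqrt s * sqrt (a_norm J\<^sub>0 U) * sqrt (b_norm J\<^sub>0))"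
    if s: "0 \<le> s" "size_le J\<^sub>0 U s" "\<not> size_le J\<^sub>0 U (s / 8)" for s
  proof -
    obtain sel where sel: "selection J\<^sub>0 U s sel" using selection_exists[OF less.prems(2)] by blast
    note ctx = less.prems(1,2) s(1,2) sel
    define V where "V = VV U sel"
    have V_iff: "K \<in> V J \<longleftrightarrow> K \<in> U \<and> Q K J \<and> sel K (W K J)" for K J
      by (simp add: V_def VV_def[OF ctx])
    \<comment> \<open>\<open>dn J\<close> depends on \<open>J\<close> only through its chosen
      intervals, and is all of \<open>U\<close> when there are none. Its fibres index the
      subforms.\<close>
    define dn where "dn = (\<lambda>J. {K\<in>U. \<forall>X\<in>V J. K \<subset> X})"
    define JD where "JD = (\<lambda>D. {J\<in>J\<^sub>0. dn J = D})"
    have dn_iff: "K \<in> dn J \<longleftrightarrow> K \<in> U \<and> (\<forall>X\<in>V J. K \<subset> X)" for K J by (simp add: dn_def)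
    have notV: "K \<notin> V J" if "K \<in> dn J" for K J using that dn_iff by blast
    have eq: "W X J = W X J'" if "K \<in> U" "X \<in> U" "J \<in> J\<^sub>0" "J' \<in> J\<^sub>0" "Q K J" "Q K J'" "K \<subset> X" for K X J J'
      using W_eq[OF ctx, of K X J J'] that UKK by blast
    have small: "{K\<in>U. Q K J} = large U sel J \<union> {K\<in>dn J. Q K J}" "large U sel J \<inter> {K\<in>dn J. Q K J} = {}"
      if J: "J \<in> J\<^sub>0" for J
    proof -
      have lg: "K \<in> large U sel J \<longleftrightarrow> K \<in> U \<and> Q K J \<and> (\<exists>X\<in>V J. X \<subseteq> K)" for K
        by (simp add: large_def[OF ctx] V_def)
      have "K \<subset> X \<longleftrightarrow> \<not> X \<subseteq> K" if "X \<in> V J" "K \<in> U" "Q K J" for K X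
        using chain[of K X J] that V_iff[of X J] J UKK[of X] UKK[of K] JJJ[of J] by blast
      then have sm: "K \<in> dn J \<longleftrightarrow> \<not> (\<exists>X\<in>V J. X \<subseteq> K)" if "K \<in> U" "Q K J" for K
        using that unfolding dn_iff by simp
      have dnU: "K \<in> U" if "K \<in> dn J" for K using that unfolding dn_iff by simp
      show "{K\<in>U. Q K J} = large U sel J \<union> {K\<in>dn J. Q K J}"
        by (rule set_eqI, simp only: Un_iff mem_Collect_eq lg) (use sm dnU in meson)
      show "large U sel J \<inter> {K\<in>dn J. Q K J} = {}"
        by (rule equals0I, simp only: Int_iff mem_Collect_eq lg) (use sm in meson)
    qed
    have "form J\<^sub>0 U = (\<Sum>J\<in>J\<^sub>0. b J * (\<Sum>K\<in>large U sel J. a K * T K J)) +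
        (\<Sum>J\<in>J\<^sub>0. b J * (\<Sum>K\<in>{K\<in>dn J. Q K J}. a K * T K J))"
      unfolding form_def sum.distrib[symmetric] distrib_left[symmetric]
    proof (rule sum.cong[OF refl], rule arg_cong[where f = "\<lambda>x. b _ * x"])
      fix J assume J: "J \<in> J\<^sub>0"
      have "finite {K\<in>U. Q K J}" using finU(1) by simp
      then have "finite (large U sel J) \<and> finite {K\<in>dn J. Q K J}" unfolding small(1)[OF J] finite_Un .
      then have "finite (large U sel J)" "finite {K\<in>dn J. Q K J}" by - (erule conjunct1, erule conjunct2)
      then show "(\<Sum>K\<in>{K\<in>U. Q K J}. a K * T K J) =
          (\<Sum>K\<in>large U sel J. a K * T K J) + (\<Sum>K\<in>{K\<in>dn J. Q K J}. a K * T K J)"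
        unfolding small(1)[OF J] using small(2)[OF J] by (rule sum.union_disjoint)
    qed
    moreover have "(\<Sum>J\<in>J\<^sub>0. b J * (\<Sum>K\<in>{K\<in>dn J. Q K J}. a K * T K J)) = (\<Sum>D\<in>dn ` J\<^sub>0. form (JD D) D)"
    proof -
      have "(\<Sum>J\<in>J\<^sub>0. b J * (\<Sum>K\<in>{K\<in>dn J. Q K J}. a K * T K J)) =
          (\<Sum>D\<in>dn ` J\<^sub>0. \<Sum>J\<in>{J\<in>J\<^sub>0. dn J = D}. b J * (\<Sum>K\<in>{K\<in>dn J. Q K J}. a K * T K J))"
        using finU by (intro sum.group[symmetric]) auto
      also have "\<dots> = (\<Sum>D\<in>dn ` J\<^sub>0. form (JD D) D)"
        unfolding form_def JD_def by (intro sum.cong refl) simp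
      finally show ?thesis .
    qed
    moreover have "\<bar>\<Sum>J\<in>J\<^sub>0. b J * (\<Sum>K\<in>large U sel J. a K * T K J)\<bar>
        \<le> 2 ^ 14 * (sqrt s * sqrt (a_norm J\<^sub>0 U) * sqrt (b_norm J\<^sub>0))"
      by (rule large_form_le[OF ctx])
    moreover have "\<bar>\<Sum>D\<in>dn ` J\<^sub>0. form (JD D) D\<bar> \<le> 2 ^ 14 * (sqrt s * sqrt (a_norm J\<^sub>0 U) * sqrt (b_norm J\<^sub>0))"
    proof -
      obtain K R where KR: "K \<in> U" "s / 8 * sg R < (\<Sum>J\<in>{J\<in>J\<^sub>0. Q K J \<and> W K J = R}. (c J * p K J)\<^sup>2)"
        using s(3) by (auto simp: size_le_def not_le)
      \<comment> \<open>Without chosen pairs every \<open>J\<close> is fresh everywhere, and the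
        pair \<open>(K, R)\<close> that violates \<open>s / 8\<close> would itself be
        chosen.\<close>
      have "\<exists>J\<in>J\<^sub>0. V J \<noteq> {}"
      proof (rule ccontr)
        assume no: "\<not> (\<exists>J\<in>J\<^sub>0. V J \<noteq> {})"
        have "fresh J\<^sub>0 U sel K \<inter> node J\<^sub>0 K R = {J\<in>J\<^sub>0. Q K J \<and> W K J = R}"
          using no V_iff by (auto simp: fresh_def node_def)
        then have "sel K R" using sel KR by (simp add: selection_def)
        moreover have "{J\<in>J\<^sub>0. Q K J \<and> W K J = R} \<noteq> {}"
          using KR(2) s(1) sg_nonneg[of R] mult_nonneg_nonneg[of "s/8" "sg R"] by fastforce
        ultimately show False using no V_iff KR(1) by blast
      qed
      then obtain K J where KJ: "J \<in> J\<^sub>0" "K \<in> V J" by auto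
      have step: "\<bar>form (JD D) D\<bar> \<le> 2 ^ 15 * (sqrt (s / 8) * sqrt (a_norm (JD D) D) * sqrt (b_norm (JD D)))"
        if D: "D \<in> dn ` J\<^sub>0" for D
      proof (rule less.hyps)
        have DU: "D \<subseteq> U" using D dn_iff by auto
        have sub: "?P (JD D) D \<subset> ?P J\<^sub>0 U"
        proof (rule psubsetI)
          show "?P (JD D) D \<subseteq> ?P J\<^sub>0 U" using DU by (auto simp: JD_def)
          have "(K, J) \<in> ?P J\<^sub>0 U" using KJ V_iff by auto
          moreover have "(K, J) \<notin> ?P (JD D) D" using notV[of K J] KJ by (auto simp: JD_def)
          ultimately show "?P (JD D) D \<noteq> ?P J\<^sub>0 U" by blast
        qed
        have "finite (?P J\<^sub>0 U)"
          by (rule finite_subset[of _ "U \<times> J\<^sub>0"]) (use finU in auto)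
        then show "card (?P (JD D) D) < card (?P J\<^sub>0 U)" using sub by (rule psubset_card_mono)
        show "JD D \<subseteq> JJ" using less.prems by (auto simp: JD_def)
        show "down_closed D"
          unfolding down_closed_def
        proof (intro conjI ballI impI)
          show "D \<subseteq> KK" using DU UKK by blast
          fix K K' assume "K \<in> KK" "K' \<in> D" "K \<subseteq> K'"
          moreover have "K \<in> U"
            using calculation subsetD[OF DU, of K'] less.prems(2) unfolding down_closed_def by blast
          moreover obtain J where "D = dn J" using D by blast
          ultimately show "K \<in> D" unfolding dn_iff \<open>D = dn J\<close> by (meson subset_psubset_trans)
        qed
        show "0 \<le> s / 8" using s by simp
        show "size_le (JD D) D (s / 8)"
          unfolding size_le_def
        proof (intro ballI allI)
          fix K R assume K: "K \<in> D"
          let ?X = "{J \<in> JD D. Q K J \<and> W K J = R}"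
          show "(\<Sum>J\<in>?X. (c J * p K J)\<^sup>2) \<le> s / 8 * sg R"
          proof (cases "?X = {}")
            case True
            then show ?thesis using s sg_nonneg[of R] by (simp del: Collect_empty_eq)
          next
            case False
            have KU: "K \<in> U" using K DU by blast
            have X: "J \<in> J\<^sub>0 \<and> K \<in> dn J" if "J \<in> ?X" for J using that K by (auto simp: JD_def)
            have "?X \<subseteq> fresh J\<^sub>0 U sel K \<inter> node J\<^sub>0 K R"
            proof
              fix J assume J: "J \<in> ?X"
              have "\<not> sel K' (W K' J)" if "K' \<in> U" "K' \<subset> K" "Q K' J" for K'
                using that X[OF J] V_iff[of K' J] dn_iff[of K J] by blast
              then show "J \<in> fresh J\<^sub>0 U sel K \<inter> node J\<^sub>0 K R"
                using J X[OF J] by (auto simp: fresh_def node_def)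
            qed
            then have "(\<Sum>J\<in>?X. (c J * p K J)\<^sup>2) \<le> (\<Sum>J\<in>fresh J\<^sub>0 U sel K \<inter> node J\<^sub>0 K R. (c J * p K J)\<^sup>2)"
              using finU by (intro sum_mono2) (auto simp: node_def)
            moreover have "\<not> sel K R" using False X notV V_iff KU by blast
            ultimately show ?thesis using sel KU by (auto simp: selection_def not_less)
          qed
        qed
      qed
      have fine: "(\<Sum>D\<in>dn ` J\<^sub>0. a_norm (JD D) D) \<le> 2 * a_norm J\<^sub>0 U"
        unfolding a_norm_def
      proof (rule sum_parents_le)
        show "occ J\<^sub>0 U \<subseteq> KK" using UKK by (auto simp: occ_def)
        show "occ (JD D) D \<subseteq> occ J\<^sub>0 U" if "D \<in> dn ` J\<^sub>0" for D
          using that dn_iff by (auto simp: occ_def JD_def)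
        show "finite (dn ` J\<^sub>0)" using finU by simp
        fix K D D' assume D: "K \<in> occ (JD D) D" "K \<in> occ (JD D') D'"
        obtain J where J: "J \<in> J\<^sub>0" "D = dn J" "K \<in> dn J" "Q K J" using D by (auto simp: occ_def JD_def)
        obtain J' where J': "J' \<in> J\<^sub>0" "D' = dn J'" "K \<in> dn J'" "Q K J'" using D by (auto simp: occ_def JD_def)
        \<comment> \<open>A chosen interval of \<open>j\<close> strictly above \<open>K\<close> is
          chosen for every \<open>j'\<close> below \<open>K\<close>, since both lie in the same
          Whitney interval. Hence \<open>K\<close> determines its class, and different classes have
          disjoint \<open>K\<close>.\<close>
        have "X \<in> V j'" if "X \<in> V j" "j \<in> J\<^sub>0" "K \<in> dn j" "Q K j" "j' \<in> J\<^sub>0" "Q K j'" for X j j'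
        proof -
          have X: "K \<subset> X" "K \<in> U" "X \<in> U" "sel X (W X j)" using that dn_iff V_iff by auto
          moreover have "W X j = W X j'" using eq[of K X j j'] that X by blast
          moreover have "Q X j'" using up[of K X j'] X that UKK JJJ by blast
          ultimately show ?thesis using V_iff by simp
        qed
        then have "V J = V J'" using J J' by blast
        then show "D = D'" using J J' by (simp add: dn_def)
      qed
      have bn: "(\<Sum>D\<in>dn ` J\<^sub>0. b_norm (JD D)) = b_norm J\<^sub>0"
        unfolding b_norm_def JD_def using finU by (intro sum.group) auto
      have "\<bar>\<Sum>D\<in>dn ` J\<^sub>0. form (JD D) D\<bar> \<le>
          (\<Sum>D\<in>dn ` J\<^sub>0. 2 ^ 15 * (sqrt (s / 8) * sqrt (a_norm (JD D) D) * sqrt (b_norm (JD D))))"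
        using step by (intro order_trans[OF sum_abs sum_mono])
      also have "\<dots> = 2 ^ 15 * sqrt (s / 8) * (\<Sum>D\<in>dn ` J\<^sub>0. sqrt (a_norm (JD D) D) * sqrt (b_norm (JD D)))"
        by (simp add: sum_distrib_left mult.assoc)
      also have "\<dots> \<le> 2 ^ 15 * sqrt (s / 8) * (sqrt (\<Sum>D\<in>dn ` J\<^sub>0. a_norm (JD D) D) * sqrt (\<Sum>D\<in>dn ` J\<^sub>0. b_norm (JD D)))"
        using s nn by (intro mult_left_mono sum_sqrt_mult_le) auto
      also have "\<dots> \<le> 2 ^ 15 * sqrt (s / 8) * (sqrt (2 * a_norm J\<^sub>0 U) * sqrt (b_norm J\<^sub>0))"
        unfolding bn using s nn fine by (intro mult_left_mono mult_right_mono real_sqrt_le_mono) auto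
      also have "\<dots> = 2 ^ 14 * (sqrt s * sqrt (a_norm J\<^sub>0 U) * sqrt (b_norm J\<^sub>0))"
      proof -
        have "sqrt 8 = 2 * sqrt 2" using real_sqrt_mult[of 4 2] by simp
        then have "sqrt (s / 8) * sqrt (2 * a_norm J\<^sub>0 U) = sqrt s * sqrt (a_norm J\<^sub>0 U) / 2"
          by (simp add: real_sqrt_divide real_sqrt_mult)
        then show ?thesis by (simp add: mult.assoc[symmetric])
      qed
      finally show ?thesis .
    qed
    ultimately show ?thesis by simp
  qed
  show ?case
  proof (cases "\<forall>n::nat. size_le J\<^sub>0 U (s / 8 ^ n)")
    case True
    then have "form J\<^sub>0 U = 0" using form_eq_0[OF less.prems(1,2)] by blast
    then show ?thesis using nn less.prems by simp
  next
    case False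
    then obtain n :: nat where n: "\<not> size_le J\<^sub>0 U (s / 8 ^ n)" "\<And>m. m < n \<Longrightarrow> size_le J\<^sub>0 U (s / 8 ^ m)"
      using exists_least_iff[of "\<lambda>n. \<not> size_le J\<^sub>0 U (s / 8 ^ n)"] by blast
    then obtain m where m: "n = Suc m" using less.prems(4) by (cases n) auto
    have "size_le J\<^sub>0 U (s / 8 ^ m)" using n(2)[of m] m by simp
    then have "\<bar>form J\<^sub>0 U\<bar> \<le> 2 ^ 15 * (sqrt (s / 8 ^ m) * sqrt (a_norm J\<^sub>0 U) * sqrt (b_norm J\<^sub>0))"
      using n(1) less.prems(3) by (intro main) (simp_all add: m mult.commute)
    also have "\<dots> \<le> 2 ^ 15 * (sqrt s * sqrt (a_norm J\<^sub>0 U) * sqrt (b_norm J\<^sub>0))"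
      using less.prems(3) nn mult_left_mono[of 1 "8 ^ m" s]
      by (intro mult_left_mono mult_right_mono real_sqrt_le_mono) (auto simp: divide_le_eq)
    finally show ?thesis .
  qed
qed

end

section \<open>Dyadic grids and good intervals\<close>

definition level :: "real set \<Rightarrow> int" where
  "level I = \<lfloor>log 2 (len I)\<rfloor>"

text \<open>The Whitney condition on \<open>R\<close> as a subset of \<open>K\<close>, in pointwise
  form.\<close>

definition inner_set :: "real set \<Rightarrow> real set \<Rightarrow> bool" where
  "inner_set R K \<longleftrightarrow> (\<forall>x\<in>R. \<forall>y. y \<notin> K \<longrightarrow> len R \<le> \<bar>x - y\<bar>)"

lemma len_Ico: "len {a..<b} = max 0 (b - a)"
  by (cases "a \<le> b") (auto simp: len_def)

lemma level_powi: "len I = 2 powi k \<Longrightarrow> level I = k"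
proof -
  assume "len I = 2 powi k"
  then have "len I = 2 powr of_int k" by (simp add: powr_real_of_int')
  then show ?thesis by (simp add: level_def)
qed

lemma powi_less_iff: "(2::real) powi m < 2 powi n \<longleftrightarrow> m < n"
  using power_int_strict_increasing[of m n "2::real"] power_int_increasing[of n m "2::real"] by force

lemma powi_le_iff: "(2::real) powi m \<le> 2 powi n \<longleftrightarrow> m \<le> n"
  using powi_less_iff[of n m] by linarith

locale dyadic =
  fixes D :: "real set set"
  assumes grid: "dyadic_grid D"
begin

lemma D_len: "I \<in> D \<Longrightarrow> len I = 2 powi level I"
proof -
  assume "I \<in> D"
  then obtain a and k :: int where "I = {a ..< a + 2 powi k}" using grid unfolding dyadic_grid_def by blast
  then have "len I = 2 powi k" by (simp add: len_Ico)
  then show ?thesis using level_powi by simp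
qed

lemma len_pos: "I \<in> D \<Longrightarrow> 0 < len I"
  by (simp add: D_len)

lemma D_eq: "I \<in> D \<Longrightarrow> I = {Inf I ..< Inf I + len I}"
proof -
  assume "I \<in> D"
  then obtain a and k :: int where I: "I = {a ..< a + 2 powi k}" using grid unfolding dyadic_grid_def by blast
  moreover have "a < a + 2 powi k" by simp
  ultimately show ?thesis by (simp add: len_Ico)
qed

lemma D_Sup: "I \<in> D \<Longrightarrow> Sup I = Inf I + len I"
  using D_eq[of I] len_pos[of I] by (metis cSup_atLeastLessThan less_add_same_cancel1)

lemma Inf_in: "I \<in> D \<Longrightarrow> Inf I \<in> I"
  using D_eq[of I] len_pos[of I] by (metis atLeastLessThan_iff less_add_same_cancel1 order_refl)

lemma D_ne: "I \<in> D \<Longrightarrow> I \<noteq> {}"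
  using Inf_in by auto

lemma left_eq: "I \<in> D \<Longrightarrow> left_child I = {Inf I ..< Inf I + len I / 2}"
  by (simp add: left_child_def D_Sup field_simps)

lemma right_eq: "I \<in> D \<Longrightarrow> right_child I = {Inf I + len I / 2 ..< Inf I + len I}"
  by (simp add: right_child_def D_Sup field_simps)

lemma children_in: "I \<in> D \<Longrightarrow> left_child I \<in> D" "I \<in> D \<Longrightarrow> right_child I \<in> D"
  using grid by (auto simp: dyadic_grid_def)

lemma children_Un: "I \<in> D \<Longrightarrow> left_child I \<union> right_child I = I"
proof -
  assume I: "I \<in> D"
  have "{Inf I ..< Inf I + len I / 2} \<union> {Inf I + len I / 2 ..< Inf I + len I} = {Inf I ..< Inf I + len I}"
    using len_pos[OF I] by (intro ivl_disj_un_two) auto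
  then show ?thesis using I D_eq left_eq right_eq by metis
qed

lemma children_disj: "I \<in> D \<Longrightarrow> left_child I \<inter> right_child I = {}"
  by (auto simp: left_eq right_eq)

lemma children_len: "I \<in> D \<Longrightarrow> len (left_child I) = len I / 2" "I \<in> D \<Longrightarrow> len (right_child I) = len I / 2"
  using len_pos[of I] by (simp_all add: left_eq right_eq len_Ico)

lemma half_powi: "(2::real) powi k / 2 = 2 powi (k - 1)"
  by (simp add: power_int_diff)

lemma children_level: "I \<in> D \<Longrightarrow> level (left_child I) = level I - 1" "I \<in> D \<Longrightarrow> level (right_child I) = level I - 1"
  using children_len[of I] D_len[of I] by (auto intro!: level_powi simp: half_powi)

lemma level_le_iff: "I \<in> D \<Longrightarrow> J \<in> D \<Longrightarrow> len I \<le> len J \<longleftrightarrow> level I \<le> level J"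
  by (simp add: D_len powi_le_iff)

lemma len_level_add: "I \<in> D \<Longrightarrow> 2 ^ n * len I = 2 powi (level I + int n)"
  by (simp add: D_len power_int_add)

lemma len_level_iff: "I \<in> D \<Longrightarrow> J \<in> D \<Longrightarrow> 2 ^ n * len I \<le> len J \<longleftrightarrow> level I + int n \<le> level J"
  by (simp add: len_level_add D_len[of J] powi_le_iff)

lemma same_level: "I \<in> D \<Longrightarrow> J \<in> D \<Longrightarrow> level I = level J \<Longrightarrow> x \<in> I \<Longrightarrow> x \<in> J \<Longrightarrow> I = J"
proof -
  assume I: "I \<in> D" "J \<in> D" "level I = level J" "x \<in> I" "x \<in> J"
  have "partition_on UNIV {K\<in>D. len K = 2 powi level J}" using grid by (auto simp: dyadic_grid_def)
  then have "disjoint {K\<in>D. len K = 2 powi level J}" by (simp add: partition_on_def)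
  moreover have "I \<in> {K\<in>D. len K = 2 powi level J}" "J \<in> {K\<in>D. len K = 2 powi level J}"
    using I D_len by auto
  ultimately show ?thesis using I(4,5) unfolding disjoint_def by blast
qed

lemma exists_level: "\<exists>I\<in>D. level I = k \<and> x \<in> I"
proof -
  have "partition_on UNIV {K\<in>D. len K = 2 powi k}" using grid by (auto simp: dyadic_grid_def)
  then have "x \<in> \<Union>{K\<in>D. len K = 2 powi k}" by (simp add: partition_on_def)
  then show ?thesis using level_powi by auto
qed

lemma nested_level:
  assumes "I \<in> D" "J \<in> D" "level J \<le> level I" "x \<in> I" "x \<in> J"
  shows "J \<subseteq> I"
  using assms
proof (induction "nat (level I - level J)" arbitrary: I)
  case 0
  then show ?case using same_level[of I J x] by simp
next
  case (Suc n)
  obtain C where C: "C \<in> D" "x \<in> C" "C \<subseteq> I" "level C = level I - 1"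
    using children_Un[of I] children_in[of I] children_level[of I] Suc.prems by blast
  have "J \<subseteq> C" using Suc.hyps(2) Suc.prems C by (intro Suc.hyps(1)) auto
  then show ?case using C by blast
qed

lemma nested: "I \<in> D \<Longrightarrow> J \<in> D \<Longrightarrow> I \<inter> J \<noteq> {} \<Longrightarrow> I \<subseteq> J \<or> J \<subseteq> I"
proof -
  assume I: "I \<in> D" "J \<in> D" "I \<inter> J \<noteq> {}"
  then obtain x where "x \<in> I" "x \<in> J" by blast
  then show ?thesis using nested_level[of I J x] nested_level[of J I x] I by (cases "level I \<le> level J") auto
qed

lemma level_mono: "I \<in> D \<Longrightarrow> J \<in> D \<Longrightarrow> J \<subseteq> I \<Longrightarrow> level J \<le> level I"
proof -
  assume I: "I \<in> D" "J \<in> D" "J \<subseteq> I"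
  have "len J \<le> len I"
  proof -
    have "{Inf J ..< Inf J + len J} \<subseteq> {Inf I ..< Inf I + len I}" using I D_eq by metis
    then have "Inf I \<le> Inf J \<and> Inf J + len J \<le> Inf I + len I"
      using len_pos[OF I(2)] by (simp add: atLeastLessThan_subset_iff)
    then show ?thesis by linarith
  qed
  then show ?thesis using I level_le_iff by blast
qed

lemma level_strict_mono:
  assumes "I \<in> D" "J \<in> D" "J \<subset> I"
  shows "level J < level I"
proof (rule ccontr)
  assume "\<not> level J < level I"
  then have "level I = level J" using level_mono[of I J] assms by auto
  moreover have "Inf J \<in> J" "Inf J \<in> I" using Inf_in[OF assms(2)] assms(3) by auto
  ultimately have "I = J" using same_level assms by blast
  then show False using assms by simp
qed

lemma sub_level: "I \<in> D \<Longrightarrow> J \<in> D \<Longrightarrow> C \<in> D \<Longrightarrow> C \<subseteq> I \<Longrightarrow> C \<subseteq> J \<Longrightarrow> level I \<le> level J \<Longrightarrow> I \<subseteq> J"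
  using nested_level[of J I "Inf C"] Inf_in[of C] by blast

lemma sub_child: "I \<in> D \<Longrightarrow> J \<in> D \<Longrightarrow> J \<subset> I \<Longrightarrow> J \<subseteq> left_child I \<or> J \<subseteq> right_child I"
proof -
  assume I: "I \<in> D" "J \<in> D" "J \<subset> I"
  have "Inf J \<in> left_child I \<or> Inf J \<in> right_child I"
    using Inf_in[OF I(2)] I(3) children_Un[OF I(1)] by blast
  then show ?thesis
    using nested_level[of "left_child I" J "Inf J"] nested_level[of "right_child I" J "Inf J"]
      children_in[OF I(1)] children_level[OF I(1)] level_strict_mono[OF I] Inf_in[OF I(2)] I(2) by force
qed

definition parent :: "real set \<Rightarrow> real set" where
  "parent I = (THE P. P \<in> D \<and> I \<subseteq> P \<and> level P = level I + 1)"

lemma ancestor: "I \<in> D \<Longrightarrow> level I \<le> k \<Longrightarrow> \<exists>!P. P \<in> D \<and> I \<subseteq> P \<and> level P = k"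
proof -
  assume I: "I \<in> D" "level I \<le> k"
  obtain P where P: "P \<in> D" "level P = k" "Inf I \<in> P" using exists_level by blast
  have "I \<subseteq> P" using nested_level[of P I "Inf I"] P I Inf_in by auto
  moreover have "P' = P" if "P' \<in> D" "I \<subseteq> P'" "level P' = k" for P'
    using same_level[of P' P "Inf I"] that P Inf_in[OF I(1)] by auto
  ultimately show ?thesis using P by blast
qed

lemma parent: "I \<in> D \<Longrightarrow> parent I \<in> D" "I \<in> D \<Longrightarrow> I \<subseteq> parent I" "I \<in> D \<Longrightarrow> level (parent I) = level I + 1"
  using theI'[OF ancestor[of I "level I + 1"]] by (auto simp: parent_def)

lemma parent_eq: "I \<in> D \<Longrightarrow> P \<in> D \<Longrightarrow> I \<subseteq> P \<Longrightarrow> level P = level I + 1 \<Longrightarrow> parent I = P"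
  using ancestor[of I "level I + 1"] parent[of I] by auto

lemma parent_children:
  assumes I: "I \<in> D"
  shows "parent (left_child I) = I" "parent (right_child I) = I"
proof -
  have "left_child I \<subseteq> I" "right_child I \<subseteq> I" using children_Un[OF I] by blast+
  then show "parent (left_child I) = I" "parent (right_child I) = I"
    using I by (simp_all add: parent_eq children_in children_level)
qed

lemma child_parent: "I \<in> D \<Longrightarrow> I = left_child (parent I) \<or> I = right_child (parent I)"
proof -
  assume I: "I \<in> D"
  then have "I \<subset> parent I" using parent[OF I] by force
  then show ?thesis
    using sub_child[of "parent I" I] parent[OF I] I same_level[of _ I "Inf I"] children_in[of "parent I"]
      children_level[of "parent I"] Inf_in[OF I] by (metis add_diff_cancel_right' subsetD)
qed

lemma parent_psubset: "I \<in> D \<Longrightarrow> I \<subset> parent I"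
  using parent[of I] by force

lemma parent_least: "I \<in> D \<Longrightarrow> K \<in> D \<Longrightarrow> I \<subset> K \<Longrightarrow> parent I \<subseteq> K"
  using sub_level[of "parent I" K I] parent[of I] level_strict_mono[of K I] by auto

lemma len_parent: "I \<in> D \<Longrightarrow> len (parent I) = 2 * len I"
  using D_len[of I] D_len[of "parent I"] parent[of I] by (simp add: power_int_add)

lemma child_containing:
  assumes "I \<in> D" "J \<in> D" "J \<subset> I"
  shows "child_containing I J \<in> D" "J \<subseteq> child_containing I J" "parent (child_containing I J) = I"
  using sub_child[OF assms] children_in[OF assms(1)] parent_children[OF assms(1)]
  by (auto simp: child_containing_def)

lemma child_containing_eq: "K \<in> D \<Longrightarrow> J \<in> D \<Longrightarrow> J \<subseteq> K \<Longrightarrow> child_containing (parent K) J = K"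
  using child_containing[of "parent K" J] parent[of K] parent_psubset[of K]
    same_level[of "child_containing (parent K) J" K "Inf J"] parent(3)[of "child_containing (parent K) J"] Inf_in[of J]
  by (metis add_right_cancel subset_psubset_trans subsetD)

lemma card_children_le: "finite F \<Longrightarrow> F \<subseteq> D \<Longrightarrow> card {K\<in>F. parent K = I} \<le> 2"
proof -
  assume F: "finite F" "F \<subseteq> D"
  have "{K\<in>F. parent K = I} \<subseteq> {left_child I, right_child I}" using F child_parent by blast
  then have "card {K\<in>F. parent K = I} \<le> card {left_child I, right_child I}" by (intro card_mono) auto
  also have "\<dots> \<le> 2" by (simp add: card_insert_if)
  finally show ?thesis .
qed

lemma finite_between: "J \<in> D \<Longrightarrow> I \<in> D \<Longrightarrow> finite {K\<in>D. J \<subseteq> K \<and> K \<subseteq> I}"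
proof -
  assume J: "J \<in> D" "I \<in> D"
  have "inj_on level {K\<in>D. J \<subseteq> K \<and> K \<subseteq> I}"
    using same_level Inf_in[OF J(1)] by (intro inj_onI) blast
  moreover have "level ` {K\<in>D. J \<subseteq> K \<and> K \<subseteq> I} \<subseteq> {level J..level I}"
    using level_mono J by auto
  ultimately show ?thesis using finite_subset finite_imageD by blast
qed

lemma frontier_D: "K \<in> D \<Longrightarrow> frontier K = {Inf K, Inf K + len K}"
proof -
  assume K: "K \<in> D"
  have "frontier {Inf K ..< Inf K + len K} = {Inf K, Inf K + len K}"
    using len_pos[OF K] by (auto simp: frontier_def)
  then show ?thesis using D_eq[OF K] by simp
qed

lemma dist_frontier:
  assumes K: "K \<in> D" and "x \<in> C" "x \<in> K" "y \<notin> K"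
  shows "setdist C (frontier K) \<le> \<bar>x - y\<bar>"
proof -
  have x: "Inf K \<le> x" "x < Inf K + len K" and y: "\<not> (Inf K \<le> y \<and> y < Inf K + len K)"
    using assms D_eq[OF K] by (metis atLeastLessThan_iff)+
  have "setdist C (frontier K) \<le> dist x (Inf K)" "setdist C (frontier K) \<le> dist x (Inf K + len K)"
    using frontier_D[OF K] assms by (auto intro!: setdist_le_dist)
  then show ?thesis using x y by (auto simp: dist_real_def)
qed

end

section \<open>Distances forced by goodness, and Whitney intervals\<close>

locale good_dyadic = dyadic +
  fixes \<theta> :: real and r :: nat
  assumes \<theta>: "0 < \<theta>" "\<theta> < 1/2" and r: "1 \<le> r"
begin

abbreviation "good \<equiv> good_interval D \<theta> r"

lemma good_D: "good I \<Longrightarrow> I \<in> D"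
  by (simp add: good_interval_def)

text \<open>Goodness separates by |J|^\<theta> |K|^(1 - \<theta>), which is (|K| / |J|)^(1 -
  \<theta>) times |J|. As \<theta> < 1/2 and |K| / |J| is at least 2 ^ m, the exponent may be
  lowered to 1/2. The smallest \<open>m\<close> allowed is r - 1, where goodness begins.\<close>

lemma good_dist:
  assumes J: "good J" and K: "K \<in> D" "J \<subseteq> K" "level J + int m \<le> level K" "r \<le> Suc m"
    and x: "x \<in> J" and y: "y \<notin> K"
  shows "sqrt (2 ^ m) * len J \<le> \<bar>x - y\<bar>"
proof -
  have JD: "J \<in> D" using good_D[OF J] .
  have pos: "0 < len J" "0 < len K" using len_pos JD K by auto
  have "level J + int (r - 1) \<le> level K" using K by linarith
  then have "2 ^ (r - 1) * len J \<le> len K" using len_level_iff[OF JD K(1)] by blast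
  then have d: "setdist C (frontier K) \<ge> len J powr \<theta> * len K powr (1 - \<theta>)"
    if "C \<in> {left_child J, right_child J}" for C
    using J K that unfolding good_interval_def by blast
  obtain C where C: "C \<in> {left_child J, right_child J}" "x \<in> C" using x children_Un[OF JD] by blast
  have "2 ^ m * len J \<le> len K" using len_level_iff[OF JD K(1)] K by blast
  then have "sqrt (2 ^ m) * len J \<le> len J powr \<theta> * len K powr (1 - \<theta>)"
  proof -
    have "2 ^ m \<le> len K / len J" using \<open>2 ^ m * len J \<le> len K\<close> pos by (simp add: field_simps)
    moreover have "(1::real) \<le> 2 ^ m" by simp
    ultimately have ge: "2 ^ m \<le> len K / len J" "1 \<le> len K / len J" by linarith+
    have "sqrt (2 ^ m) \<le> (len K / len J) powr (1/2)"
      using ge by (simp add: powr_half_sqrt)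
    also have "\<dots> \<le> (len K / len J) powr (1 - \<theta>)" using \<theta> ge by (intro powr_mono) auto
    finally have "sqrt (2 ^ m) * len J \<le> (len K / len J) powr (1 - \<theta>) * len J" using pos by simp
    also have "\<dots> = len J powr \<theta> * len K powr (1 - \<theta>)"
      using pos by (simp add: powr_divide powr_diff)
    finally show ?thesis .
  qed
  also have "\<dots> \<le> setdist C (frontier K)" using d C by blast
  also have "\<dots> \<le> \<bar>x - y\<bar>" using C x y K by (intro dist_frontier) auto
  finally show ?thesis .
qed

text \<open>The coefficients of \<open>f\<close> give goodness of the parent, not of its child
  \<open>K\<close>. Passing to the parent costs one level, so the gap \<open>r\<close> leaves the r
  - 1 that goodness asks for.\<close>

lemma separated:
  assumes K: "K \<in> D" "good (parent K)" "K' \<in> D" "K \<subset> K'" "level K + int r \<le> level K'"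
  shows "inner_set K K'"
  unfolding inner_set_def
proof (intro ballI allI impI)
  fix x y assume x: "x \<in> K" and y: "y \<notin> K'"
  have "sqrt (2 ^ (r - 1)) * len (parent K) \<le> \<bar>x - y\<bar>"
    using assms x y parent[OF K(1)] parent_least[OF K(1,3,4)] r by (intro good_dist[of _ K']) auto
  moreover have "1 * len (parent K) \<le> sqrt (2 ^ (r - 1)) * len (parent K)"
    using len_pos[of "parent K"] parent[OF K(1)] by (intro mult_right_mono) auto
  ultimately show "len K \<le> \<bar>x - y\<bar>" using len_parent[OF K(1)] len_pos[OF K(1)] by linarith
qed

definition whit :: "real set \<Rightarrow> real set \<Rightarrow> real set" where
  "whit K J = \<Union>{R\<in>D. J \<subseteq> R \<and> R \<subseteq> K \<and> inner_set R K}"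

text \<open>The competitors form a finite chain, so their union is the largest of them. The gap 2 r
  + 4 makes the square root in \<open>good_dist\<close> equal to 4 * 2 ^ r; hence the ancestor
  \<open>A\<close> of length 2 ^ r |J| competes, and the Whitney interval is long enough for weak
  adaptedness to bear on it.\<close>

lemma whit:
  assumes J: "good J" and K: "K \<in> D" "J \<subseteq> K" "level J + int (2 * r + 4) \<le> level K"
  shows "whit K J \<in> D" "J \<subseteq> whit K J" "whit K J \<subseteq> K" "inner_set (whit K J) K"
    "\<And>R. R \<in> D \<Longrightarrow> J \<subseteq> R \<Longrightarrow> R \<subseteq> K \<Longrightarrow> inner_set R K \<Longrightarrow> R \<subseteq> whit K J"
    "level J + int r \<le> level (whit K J)"
proof -
  let ?F = "{R\<in>D. J \<subseteq> R \<and> R \<subseteq> K \<and> inner_set R K}"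
  have JD: "J \<in> D" using good_D[OF J] .
  have fin: "finite ?F" using finite_between[OF JD K(1)] by (rule rev_finite_subset) auto
  obtain A where A: "A \<in> D" "J \<subseteq> A" "level A = level J + int r" using ancestor[OF JD, of "level J + int r"] by auto
  have AK: "A \<subseteq> K" using sub_level[of A K J] A JD K by auto
  have lenA: "len A = 2 ^ r * len J" using A len_level_add[OF JD, of r] D_len[OF A(1)] by simp
  have "inner_set A K"
    unfolding inner_set_def
  proof (intro ballI allI impI)
    fix x y assume x: "x \<in> A" and y: "y \<notin> K"
    have "sqrt (2 ^ (2 * r + 4)) * len J \<le> \<bar>Inf J - y\<bar>"
      using J K y Inf_in[OF JD] by (intro good_dist[of _ K]) auto
    moreover have "sqrt (2 ^ (2 * r + 4)) = 4 * 2 ^ r"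
      unfolding power_add power_even_eq by (simp add: real_sqrt_mult)
    moreover have "\<bar>x - Inf J\<bar> \<le> len A"
      using x A(2) Inf_in[OF JD] D_eq[OF A(1)] by (smt (verit, best) atLeastLessThan_iff subsetD)
    ultimately have "4 * len A \<le> \<bar>Inf J - y\<bar>" "\<bar>x - Inf J\<bar> \<le> len A" using lenA by simp_all
    then show "len A \<le> \<bar>x - y\<bar>" using lenA len_pos[OF A(1)] by linarith
  qed
  then have AF: "A \<in> ?F" using A AK by auto
  then obtain W where W: "W \<in> ?F" "\<And>R. R \<in> ?F \<Longrightarrow> W \<subseteq> R \<Longrightarrow> R = W"
    using finite_has_maximal[OF fin] AF by (metis (no_types, lifting) empty_iff)
  have max: "R \<subseteq> W" if "R \<in> ?F" for R
    using nested[of R W] that W Inf_in[OF JD] by blast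
  have eq: "whit K J = W" unfolding whit_def using W(1) max by blast
  show "whit K J \<in> D" "J \<subseteq> whit K J" "whit K J \<subseteq> K" "inner_set (whit K J) K" using W(1) eq by auto
  show "R \<subseteq> whit K J" if "R \<in> D" "J \<subseteq> R" "R \<subseteq> K" "inner_set R K" for R
    using max that eq by auto
  have "A \<subseteq> W" using max AF by blast
  then show "level J + int r \<le> level (whit K J)" using level_mono[of W A] A W(1) eq by auto
qed

lemma whit_disj:
  assumes "good J" "K \<in> D" "J \<subseteq> K" "level J + int (2 * r + 4) \<le> level K"
    and "good J'" "J' \<subseteq> K" "level J' + int (2 * r + 4) \<le> level K"
    and "whit K J \<inter> whit K J' \<noteq> {}"
  shows "whit K J = whit K J'"
proof -
  note w = whit[OF assms(1-4)] and w' = whit[OF assms(5,2,6,7)]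
  have "whit K J \<subseteq> whit K J' \<or> whit K J' \<subseteq> whit K J" using nested w w' assms by blast
  then show ?thesis
    using w(5)[of "whit K J'"] w'(5)[of "whit K J"] w w' by blast
qed

end

section \<open>Weights, Haar functions and a maximal inequality\<close>

locale weight =
  fixes \<mu> :: "real measure"
  assumes lf: "locally_finite_borel \<mu>"
begin

lemma sets_eq [simp, measurable_cong]: "sets \<mu> = sets borel"
  using lf by (simp add: locally_finite_borel_def)

lemma space_eq [simp]: "space \<mu> = UNIV"
  using sets_eq_imp_space_eq[OF sets_eq] by simp

lemma emeasure_bounded: "bounded B \<Longrightarrow> emeasure \<mu> B < \<infinity>"
proof -
  assume "bounded B"
  then obtain e where "B \<subseteq> ball 0 e" using bounded_subset_ballD by blast
  then have "emeasure \<mu> B \<le> emeasure \<mu> (cball 0 e)"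
    using ball_subset_cball[of 0 e] by (intro emeasure_mono) auto
  also have "\<dots> < \<infinity>" using lf by (simp add: locally_finite_borel_def)
  finally show ?thesis .
qed

lemma fmeasurable_bounded: "bounded B \<Longrightarrow> B \<in> sets borel \<Longrightarrow> B \<in> fmeasurable \<mu>"
  using emeasure_bounded[of B] by (auto simp: fmeasurable_def)

lemma emeasure_eq: "bounded B \<Longrightarrow> emeasure \<mu> B = ennreal (measure \<mu> B)"
  using emeasure_bounded[of B] by (simp add: emeasure_eq_ennreal_measure less_top)

lemma sigma_finite: "sigma_finite_measure \<mu>"
proof
  let ?A = "range (\<lambda>n. cball (0::real) (real n))"
  have "\<Union> ?A = UNIV" using real_arch_simple by (auto simp: dist_real_def)
  moreover have "emeasure \<mu> a \<noteq> \<infinity>" if "a \<in> ?A" for a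
    using that emeasure_bounded[of a] by auto
  ultimately show "\<exists>A. countable A \<and> A \<subseteq> sets \<mu> \<and> \<Union> A = space \<mu> \<and> (\<forall>a\<in>A. emeasure \<mu> a \<noteq> \<infinity>)"
    by (intro exI[of _ ?A]) auto
qed

lemma integrable_bdd:
  fixes f :: "real \<Rightarrow> real"
  assumes f: "f \<in> borel_measurable borel" and B: "bounded B"
    and bd: "\<And>x. \<bar>f x\<bar> \<le> C" and z: "\<And>x. x \<notin> B \<Longrightarrow> f x = 0"
  shows "integrable \<mu> f"
proof -
  obtain e where e: "B \<subseteq> ball 0 e" using B bounded_subset_ballD by blast
  have "integrable \<mu> (\<lambda>x. C * indicator (cball 0 e) x :: real)"
    using emeasure_bounded[of "cball 0 e"] by (intro integrable_mult_right integrable_real_indicator) auto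
  then show ?thesis
  proof (rule Bochner_Integration.integrable_bound)
    show "f \<in> borel_measurable \<mu>" using f by (simp add: measurable_cong_sets[OF sets_eq])
    show "AE x in \<mu>. norm (f x) \<le> norm (C * indicator (cball 0 e) x :: real)"
    proof (rule AE_I2)
      fix x show "norm (f x) \<le> norm (C * indicator (cball 0 e) x :: real)"
        using bd[of x] z[of x] e ball_subset_cball[of 0 e] by (cases "x \<in> cball 0 e"; cases "x \<in> B") auto
    qed
  qed
qed

lemma L2_bdd:
  fixes f :: "real \<Rightarrow> real"
  assumes f: "f \<in> borel_measurable borel" and B: "bounded B"
    and bd: "\<And>x. \<bar>f x\<bar> \<le> C" and z: "\<And>x. x \<notin> B \<Longrightarrow> f x = 0"
  shows "L2 \<mu> f"
proof -
  have "integrable \<mu> (\<lambda>x. (f x)\<^sup>2)"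
  proof (rule integrable_bdd[OF _ B])
    show "(\<lambda>x. (f x)\<^sup>2) \<in> borel_measurable borel" using f by measurable
    show "\<bar>(f x)\<^sup>2\<bar> \<le> C\<^sup>2" for x using power_mono[OF bd[of x], of 2] by simp
    show "(f x)\<^sup>2 = 0" if "x \<notin> B" for x using z that by simp
  qed
  then show ?thesis using f by (simp add: L2_def measurable_cong_sets[OF sets_eq])
qed

lemma L2_mult_integrable: "L2 \<mu> f \<Longrightarrow> L2 \<mu> g \<Longrightarrow> integrable \<mu> (\<lambda>x. f x * g x)"
proof -
  assume f: "L2 \<mu> f" and g: "L2 \<mu> g"
  then have "integrable \<mu> (\<lambda>x. (f x)\<^sup>2 + (g x)\<^sup>2)" by (simp add: L2_def)
  then show ?thesis
  proof (rule Bochner_Integration.integrable_bound)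
    show "(\<lambda>x. f x * g x) \<in> borel_measurable \<mu>"
      using f g unfolding L2_def by (intro borel_measurable_times) auto
    have "\<bar>a * b\<bar> \<le> a\<^sup>2 + b\<^sup>2" for a b :: real
    proof -
      have "2 * \<bar>a\<bar> * \<bar>b\<bar> \<le> a\<^sup>2 + b\<^sup>2" using sum_squares_bound[of "\<bar>a\<bar>" "\<bar>b\<bar>"] by simp
      moreover have "0 \<le> \<bar>a\<bar> * \<bar>b\<bar>" by simp
      ultimately show ?thesis unfolding abs_mult by linarith
    qed
    then show "AE x in \<mu>. norm (f x * g x) \<le> norm ((f x)\<^sup>2 + (g x)\<^sup>2)" by simp
  qed
qed

end

section \<open>Haar expansions, Bessel's inequality and the maximal function\<close>

locale dyadic_weight = dyadic + weight
begin

lemma D_bounded: "I \<in> D \<Longrightarrow> bounded I"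
  using D_eq[of I] bounded_subset[OF bounded_closed_interval[of "Inf I" "Inf I + len I"], of I]
  by (metis atLeastLessThan_subseteq_atLeastAtMost_iff cbox_interval order_refl)

lemma D_borel: "I \<in> D \<Longrightarrow> I \<in> sets borel"
  using D_eq[of I] by (metis atLeastLessThan_borel)

lemma D_fmeas: "I \<in> D \<Longrightarrow> I \<in> fmeasurable \<mu>"
  by (intro fmeasurable_bounded D_bounded D_borel)

lemma measure_children: "I \<in> D \<Longrightarrow> measure \<mu> I = measure \<mu> (left_child I) + measure \<mu> (right_child I)"
  using measure_Un3[of "left_child I" \<mu> "right_child I"] D_fmeas[of "left_child I"] D_fmeas[of "right_child I"]
  by (simp add: children_Un children_disj children_in)

abbreviation "h \<equiv> haar \<mu>"

lemma haar_eq: "h I x = (if measure \<mu> (left_child I) > 0 \<and> measure \<mu> (right_child I) > 0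
      then sqrt (measure \<mu> (left_child I) * measure \<mu> (right_child I) / measure \<mu> I) *
           (- indicator (left_child I) x / measure \<mu> (left_child I) + indicator (right_child I) x / measure \<mu> (right_child I))
      else 0)"
  by (simp add: haar_def Let_def)

lemma haar_borel [measurable]: "I \<in> D \<Longrightarrow> h I \<in> borel_measurable borel"
proof -
  assume I: "I \<in> D"
  have [measurable]: "left_child I \<in> sets borel" "right_child I \<in> sets borel"
    using D_borel children_in[OF I] by auto
  show ?thesis unfolding haar_eq[abs_def] by measurable
qed

lemma haar_outside: "I \<in> D \<Longrightarrow> x \<notin> I \<Longrightarrow> h I x = 0"
proof -
  assume "I \<in> D" "x \<notin> I"
  then have "x \<notin> left_child I" "x \<notin> right_child I" using children_Un[of I] by blast+
  then show ?thesis by (simp add: haar_eq)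
qed

lemma haar_const:
  assumes "L \<inter> I = {} \<or> L \<subseteq> left_child I \<or> L \<subseteq> right_child I" "I \<in> D" "x \<in> L" "y \<in> L"
  shows "h I x = h I y"
proof -
  have "indicator (left_child I) x = (indicator (left_child I) y :: real)"
    "indicator (right_child I) x = (indicator (right_child I) y :: real)"
    using assms children_disj[of I] children_Un[of I] by (auto simp: indicator_def)
  then show ?thesis by (simp add: haar_eq)
qed

lemma haar_bounded: "I \<in> D \<Longrightarrow> \<exists>C. \<forall>x. \<bar>h I x\<bar> \<le> C"
proof -
  assume I: "I \<in> D"
  let ?C = "\<bar>h I (Inf (left_child I))\<bar> + \<bar>h I (Inf (right_child I))\<bar>"
  have "\<bar>h I x\<bar> \<le> ?C" for x
  proof -
    consider "x \<notin> I" | "x \<in> left_child I" | "x \<in> right_child I" using children_Un[OF I] by blast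
    then show ?thesis
    proof cases
      case 2
      then show ?thesis
        using haar_const[of "left_child I" I x "Inf (left_child I)"] I Inf_in children_in by force
    next
      case 3
      then show ?thesis
        using haar_const[of "right_child I" I x "Inf (right_child I)"] I Inf_in children_in by force
    qed (use haar_outside[OF I] in simp)
  qed
  then show ?thesis by blast
qed

lemma haar_L2: "I \<in> D \<Longrightarrow> L2 \<mu> (h I)"
  using haar_bounded[of I] by (auto intro!: L2_bdd[OF _ D_bounded] simp: haar_outside)

lemma haar_integrable: "I \<in> D \<Longrightarrow> integrable \<mu> (h I)"
  using haar_bounded[of I] by (auto intro!: integrable_bdd[OF _ D_bounded] simp: haar_outside)

lemma indicator_integrable: "I \<in> D \<Longrightarrow> integrable \<mu> (indicator I :: real \<Rightarrow> real)"
  using D_fmeas[of I] by (intro integrable_real_indicator) (auto simp: fmeasurable_def)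

lemma haar_integral: "I \<in> D \<Longrightarrow> (\<integral>x. h I x \<partial>\<mu>) = 0"
proof -
  assume I: "I \<in> D"
  note i = indicator_integrable[OF children_in(1)[OF I]] indicator_integrable[OF children_in(2)[OF I]]
  show ?thesis
  proof (cases "measure \<mu> (left_child I) > 0 \<and> measure \<mu> (right_child I) > 0")
    case True
    let ?s = "sqrt (measure \<mu> (left_child I) * measure \<mu> (right_child I) / measure \<mu> I)"
    have "(\<integral>x. h I x \<partial>\<mu>) = (\<integral>x. ?s * ((- 1 / measure \<mu> (left_child I)) * indicator (left_child I) x
        + (1 / measure \<mu> (right_child I)) * indicator (right_child I) x) \<partial>\<mu>)"
      using True by (intro Bochner_Integration.integral_cong) (auto simp: haar_eq)
    also have "\<dots> = ?s * ((- 1 / measure \<mu> (left_child I)) * measure \<mu> (left_child I)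
        + (1 / measure \<mu> (right_child I)) * measure \<mu> (right_child I))"
      using i by simp
    finally show ?thesis using True by simp
  next
    case False
    then have "h I x = 0" for x unfolding haar_eq by auto
    then show ?thesis by simp
  qed
qed

lemma haar_norm: "I \<in> D \<Longrightarrow> ip \<mu> (h I) (h I) \<le> 1"
proof -
  assume I: "I \<in> D"
  note i = indicator_integrable[OF children_in(1)[OF I]] indicator_integrable[OF children_in(2)[OF I]]
  let ?l = "measure \<mu> (left_child I)" and ?r = "measure \<mu> (right_child I)"
  show ?thesis
  proof (cases "?l > 0 \<and> ?r > 0")
    case True
    let ?s = "?l * ?r / measure \<mu> I"
    have s: "?s \<ge> 0" using True by (auto intro!: divide_nonneg_nonneg mult_nonneg_nonneg)
    have "ip \<mu> (h I) (h I) = (\<integral>x. ?s * ((1 / ?l\<^sup>2) * indicator (left_child I) x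
        + (1 / ?r\<^sup>2) * indicator (right_child I) x) \<partial>\<mu>)"
      unfolding ip_def
    proof (intro Bochner_Integration.integral_cong refl)
      fix x
      have "x \<notin> left_child I \<or> x \<notin> right_child I" using children_disj[OF I] by blast
      moreover have "sqrt ?s * sqrt ?s = ?s" using s by simp
      ultimately show "h I x * h I x = ?s * ((1 / ?l\<^sup>2) * indicator (left_child I) x
        + (1 / ?r\<^sup>2) * indicator (right_child I) x)"
        using True by (auto simp: haar_eq power2_eq_square indicator_def)
    qed
    also have "\<dots> = ?s * ((1 / ?l\<^sup>2) * ?l + (1 / ?r\<^sup>2) * ?r)"
      using i by simp
    also have "\<dots> = 1"
    proof -
      have "l * r / (l + r) * ((1 / l\<^sup>2) * l + (1 / r\<^sup>2) * r) = 1" if "0 < l" "0 < r" for l r :: real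
      proof -
        have "(1 / l\<^sup>2) * l + (1 / r\<^sup>2) * r = (l + r) / (l * r)"
          using that by (simp add: power2_eq_square add_frac_eq)
        then show ?thesis using that by simp
      qed
      then show ?thesis using True by (simp only: measure_children[OF I])
    qed
    finally show ?thesis by simp
  next
    case False
    then have "h I x = 0" for x unfolding haar_eq by auto
    then show ?thesis by (simp add: ip_def)
  qed
qed

lemma haar_orthogonal:
  assumes "I \<in> D" "J \<in> D" "I \<noteq> J" shows "ip \<mu> (h I) (h J) = 0"
proof -
  have *: "ip \<mu> (h I) (h J) = 0" if D: "I \<in> D" "J \<in> D" and "J \<subset> I \<or> I \<inter> J = {}" for I J
  proof -
    have "J \<inter> I = {} \<or> J \<subseteq> left_child I \<or> J \<subseteq> right_child I" using sub_child[OF D] that by blast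
    then have eq: "h I x * h J x = h I (Inf J) * h J x" for x
      using haar_const[of J I x "Inf J"] D Inf_in[OF D(2)] haar_outside[OF D(2), of x] by (cases "x \<in> J") auto
    have "ip \<mu> (h I) (h J) = (\<integral>x. h I (Inf J) * h J x \<partial>\<mu>)" unfolding ip_def eq ..
    then show ?thesis using haar_integral[OF D(2)] by simp
  qed
  have "J \<subset> I \<or> I \<subset> J \<or> I \<inter> J = {}" using nested[OF assms(1,2)] assms(3) by blast
  moreover have "ip \<mu> (h I) (h J) = ip \<mu> (h J) (h I)" by (simp add: ip_def mult.commute)
  ultimately show ?thesis using *[of I J] *[of J I] assms by auto
qed

lemma ip_haar_sum:
  assumes "finite F" "F \<subseteq> D" "L2 \<mu> u"
  shows "ip \<mu> u (\<lambda>x. \<Sum>J\<in>F. c J * h J x) = (\<Sum>J\<in>F. c J * ip \<mu> u (h J))"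
proof -
  have i: "integrable \<mu> (\<lambda>x. u x * h J x)" if "J \<in> F" for J
    using that assms haar_L2 by (intro L2_mult_integrable) auto
  have "ip \<mu> u (\<lambda>x. \<Sum>J\<in>F. c J * h J x) = (\<integral>x. (\<Sum>J\<in>F. c J * (u x * h J x)) \<partial>\<mu>)"
    unfolding ip_def by (intro Bochner_Integration.integral_cong) (auto simp: sum_distrib_left mult_ac)
  also have "\<dots> = (\<Sum>J\<in>F. \<integral>x. c J * (u x * h J x) \<partial>\<mu>)"
    using i by (intro Bochner_Integration.integral_sum) auto
  finally show ?thesis by (simp add: ip_def)
qed

lemma haar_sum_bdd:
  assumes "finite F" "F \<subseteq> D"
  shows "(\<lambda>x. \<Sum>J\<in>F. c J * h J x) \<in> borel_measurable borel"
    "\<exists>C. \<forall>x. \<bar>\<Sum>J\<in>F. c J * h J x\<bar> \<le> C" "bounded (\<Union>F)"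
    "\<And>x. x \<notin> \<Union>F \<Longrightarrow> (\<Sum>J\<in>F. c J * h J x) = 0"
proof -
  show "(\<lambda>x. \<Sum>J\<in>F. c J * h J x) \<in> borel_measurable borel"
    using assms haar_borel by (intro borel_measurable_sum borel_measurable_times) auto
  have "\<forall>J\<in>F. \<exists>C. \<forall>x. \<bar>h J x\<bar> \<le> C" using haar_bounded assms by blast
  then obtain C where C: "\<And>J x. J \<in> F \<Longrightarrow> \<bar>h J x\<bar> \<le> C J" by metis
  have "\<bar>\<Sum>J\<in>F. c J * h J x\<bar> \<le> (\<Sum>J\<in>F. \<bar>c J\<bar> * C J)" for x
    using C by (intro order_trans[OF sum_abs sum_mono]) (auto simp: abs_mult intro: mult_left_mono)
  then show "\<exists>C. \<forall>x. \<bar>\<Sum>J\<in>F. c J * h J x\<bar> \<le> C" by blast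
  show "bounded (\<Union>F)" using assms D_bounded by (intro bounded_Union) auto
  show "(\<Sum>J\<in>F. c J * h J x) = 0" if "x \<notin> \<Union>F" for x
    using that assms haar_outside by (intro sum.neutral) auto
qed

lemma haar_sum_L2: "finite F \<Longrightarrow> F \<subseteq> D \<Longrightarrow> L2 \<mu> (\<lambda>x. \<Sum>J\<in>F. c J * h J x)"
  using haar_sum_bdd(1,2)[of F c] haar_sum_bdd(4)[of F _ c] haar_sum_bdd(3)[of F] by (metis (no_types, lifting) L2_bdd)

lemma haar_coeff_sum:
  assumes "finite F" "F \<subseteq> D" "K \<in> D"
  shows "ip \<mu> (\<lambda>x. \<Sum>J\<in>F. c J * h J x) (h K) = (if K \<in> F then c K * ip \<mu> (h K) (h K) else 0)"
proof -
  have "ip \<mu> (\<lambda>x. \<Sum>J\<in>F. c J * h J x) (h K) = ip \<mu> (h K) (\<lambda>x. \<Sum>J\<in>F. c J * h J x)"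
    by (simp add: ip_def mult.commute)
  also have "\<dots> = (\<Sum>J\<in>F. c J * ip \<mu> (h K) (h J))"
    using assms haar_L2 by (intro ip_haar_sum) auto
  also have "\<dots> = (\<Sum>J\<in>F. if J = K then c K * ip \<mu> (h K) (h K) else 0)"
    using assms haar_orthogonal by (intro sum.cong refl) auto
  finally show ?thesis using assms(1) by simp
qed

lemma haar_sum_norm:
  assumes "finite F" "F \<subseteq> D"
  shows "ip \<mu> (\<lambda>x. \<Sum>J\<in>F. c J * h J x) (\<lambda>x. \<Sum>J\<in>F. c J * h J x) \<le> (\<Sum>J\<in>F. (c J)\<^sup>2)"
proof -
  have "ip \<mu> (\<lambda>x. \<Sum>J\<in>F. c J * h J x) (\<lambda>x. \<Sum>J\<in>F. c J * h J x) = (\<Sum>J\<in>F. c J * (c J * ip \<mu> (h J) (h J)))"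
    unfolding ip_haar_sum[OF assms haar_sum_L2[OF assms]]
    using assms by (intro sum.cong refl) (simp add: haar_coeff_sum[OF assms] subsetD)
  also have "\<dots> \<le> (\<Sum>J\<in>F. (c J)\<^sup>2)"
  proof (rule sum_mono)
    fix J assume "J \<in> F"
    then have "(c J)\<^sup>2 * ip \<mu> (h J) (h J) \<le> (c J)\<^sup>2 * 1" using haar_norm assms by (intro mult_left_mono) auto
    then show "c J * (c J * ip \<mu> (h J) (h J)) \<le> (c J)\<^sup>2" by (simp add: power2_eq_square mult.assoc)
  qed
  finally show ?thesis .
qed

lemma bessel:
  assumes F: "finite F" "F \<subseteq> D" and u: "L2 \<mu> u"
  shows "(\<Sum>J\<in>F. (ip \<mu> u (h J))\<^sup>2) \<le> ip \<mu> u u"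
proof -
  define v where "v = (\<lambda>x. \<Sum>J\<in>F. ip \<mu> u (h J) * h J x)"
  have v: "L2 \<mu> v" unfolding v_def by (rule haar_sum_L2[OF F])
  have uv: "ip \<mu> u v = (\<Sum>J\<in>F. (ip \<mu> u (h J))\<^sup>2)"
    unfolding v_def ip_haar_sum[OF F u] by (simp add: power2_eq_square)
  have vv: "ip \<mu> v v \<le> (\<Sum>J\<in>F. (ip \<mu> u (h J))\<^sup>2)" unfolding v_def by (rule haar_sum_norm[OF F])
  have i: "integrable \<mu> (\<lambda>x. u x * u x)" "integrable \<mu> (\<lambda>x. u x * v x)" "integrable \<mu> (\<lambda>x. v x * v x)"
    using L2_mult_integrable u v by auto
  have "0 \<le> (\<integral>x. (u x - v x)\<^sup>2 \<partial>\<mu>)" by simp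
  also have "\<dots> = (\<integral>x. u x * u x - 2 * (u x * v x) + v x * v x \<partial>\<mu>)"
    by (intro Bochner_Integration.integral_cong) (auto simp: power2_eq_square algebra_simps)
  also have "\<dots> = ip \<mu> u u - 2 * ip \<mu> u v + ip \<mu> v v"
    using i by (simp add: ip_def)
  finally show ?thesis using uv vv by simp
qed

text \<open>
  The maximal function \<open>m\<close> of the partial sums \<open>S\<close> is built one Haar function at a time, keeping
  the integral of \<open>m\<^sup>2 / 2 - m S\<close> nonpositive: replacing \<open>m\<close> by the maximum of \<open>m\<close> and \<open>S + d\<close> does not increase
  it, as \<open>m d\<close> has integral zero. Completing the square then gives Doob's constant 4.
\<close>
lemma haar_maximal:
  assumes "finite F" "F \<subseteq> D"
  shows "\<exists>m. m \<in> borel_measurable borel \<and> (\<exists>C. \<forall>y. \<bar>m y\<bar> \<le> C) \<and> (\<forall>y. y \<notin> \<Union>F \<longrightarrow> m y = 0) \<and>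
    (\<forall>y l. (\<Sum>I\<in>{I\<in>F. l \<le> level I}. c I * h I y) \<le> m y) \<and> (\<forall>y. 0 \<le> m y) \<and>
    (\<integral>y. (m y)\<^sup>2 \<partial>\<mu>) \<le> 4 * (\<Sum>I\<in>F. (c I)\<^sup>2)"
proof -
  let ?S = "\<lambda>F y. \<Sum>I\<in>F. c I * h I y"
  define P where "P = (\<lambda>F m. m \<in> borel_measurable borel \<and> (\<exists>C. \<forall>y. \<bar>m y\<bar> \<le> C) \<and> (\<forall>y. y \<notin> \<Union>F \<longrightarrow> m y = 0) \<and>
    (\<forall>y l. ?S {I\<in>F. l \<le> level I} y \<le> m y) \<and> (\<forall>y. 0 \<le> m y) \<and>
    (\<forall>L\<in>D. (\<forall>I\<in>F. L \<inter> I = {} \<or> L \<subseteq> left_child I \<or> L \<subseteq> right_child I) \<longrightarrow> (\<forall>y\<in>L. \<forall>z\<in>L. m y = m z)) \<and>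
    (\<integral>y. (m y)\<^sup>2 / 2 - m y * ?S F y \<partial>\<mu>) \<le> 0)"
  have "F \<subseteq> D \<longrightarrow> (\<exists>m. P F m)"
    using \<open>finite F\<close>
  \<comment> \<open>Intervals are inserted from large to small, so the new \<open>I\<close> lies in
    one half of, or off, every earlier one. This keeps \<open>m\<close> constant on
    \<open>I\<close>, and \<open>m\<close> times the new Haar term then has integral zero.\<close>
  proof (induction F rule: finite_ranking_induct[where f = "\<lambda>I. - level I"])
    case empty
    have "P {} (\<lambda>_. 0)" unfolding P_def by auto
    then show ?case by blast
  next
    case (insert I F)
    show ?case
    proof (cases "I \<in> F")
      case True
      then show ?thesis using insert.IH by (simp add: insert_absorb)
    next
      case False
      show ?thesis
      proof
        assume ins: "insert I F \<subseteq> D"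
        then have I: "I \<in> D" and FD: "F \<subseteq> D" by auto
        obtain m where "P F m" using insert.IH FD by blast
        note mm = this[unfolded P_def]
        have m: "m \<in> borel_measurable borel" "\<exists>C. \<forall>y. \<bar>m y\<bar> \<le> C" "\<forall>y. y \<notin> \<Union>F \<longrightarrow> m y = 0"
            "\<forall>y l. ?S {I\<in>F. l \<le> level I} y \<le> m y" "\<forall>y. 0 \<le> m y"
          and mc: "\<forall>L\<in>D. (\<forall>I\<in>F. L \<inter> I = {} \<or> L \<subseteq> left_child I \<or> L \<subseteq> right_child I) \<longrightarrow> (\<forall>y\<in>L. \<forall>z\<in>L. m y = m z)"
          and mi: "(\<integral>y. (m y)\<^sup>2 / 2 - m y * ?S F y \<partial>\<mu>) \<le> 0"
          using mm by - (elim conjE, assumption)+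
        obtain C where mC: "\<And>y. \<bar>m y\<bar> \<le> C" using m(2) by blast
        have m0: "m y = 0" if "y \<notin> \<Union>F" for y using m(3) that by blast
        have mt: "?S {I\<in>F. l \<le> level I} y \<le> m y" for y l using m(4) by blast
        have mc': "m y = m z" if "L \<in> D" "\<forall>I\<in>F. L \<inter> I = {} \<or> L \<subseteq> left_child I \<or> L \<subseteq> right_child I"
            "y \<in> L" "z \<in> L" for L y z
          using bspec[OF mc that(1), rule_format, OF bspec[OF that(2)] that(3,4)] .
        define d where "d = (\<lambda>y. c I * h I y)"
        define S' where "S' = (\<lambda>y. ?S F y + d y)"
        define m' where "m' = (\<lambda>y. max (m y) (S' y))"
        have S': "?S (insert I F) y = S' y" for y
          using insert.hyps False by (simp add: S'_def d_def)
        have lev: "level I \<le> level I'" if "I' \<in> F" for I' using insert.hyps that by auto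
        have SF: "?S F y \<le> m y" for y
        proof -
          have "{I'\<in>F. level I \<le> level I'} = F" using lev by auto
          then show ?thesis using mt[of y "level I"] by simp
        qed
        have IF: "I \<inter> I' = {} \<or> I \<subseteq> left_child I' \<or> I \<subseteq> right_child I'" if "I' \<in> F" for I'
        proof (cases "I \<inter> I' = {}")
          case False
          then obtain x where "x \<in> I" "x \<in> I'" by blast
          then have "I \<subseteq> I'" using nested_level[of I' I x] lev[OF that] I FD that by auto
          then have "I \<subset> I'" using that \<open>I \<notin> F\<close> by auto
          then show ?thesis using sub_child[of I' I] I FD that by auto
        qed simp
        have SD: "?S F \<in> borel_measurable borel" "\<exists>C. \<forall>x. \<bar>?S F x\<bar> \<le> C" "bounded (\<Union>F)"
          "\<And>y. y \<notin> \<Union>F \<Longrightarrow> ?S F y = 0"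
          using haar_sum_bdd(1,2)[of F c] haar_sum_bdd(3)[of F] haar_sum_bdd(4)[of F _ c] insert.hyps FD by auto
        have SD': "S' \<in> borel_measurable borel" "\<exists>C. \<forall>x. \<bar>S' x\<bar> \<le> C" "bounded (\<Union>(insert I F))"
          "\<And>y. y \<notin> \<Union>(insert I F) \<Longrightarrow> S' y = 0"
          using haar_sum_bdd(1,2)[of "insert I F" c] haar_sum_bdd(3)[of "insert I F"]
            haar_sum_bdd(4)[of "insert I F" _ c] insert.hyps ins unfolding S' by auto
        obtain B where B: "\<And>x. \<bar>S' x\<bar> \<le> B" using SD' by blast
        obtain B2 where B2: "\<And>x. \<bar>?S F x\<bar> \<le> B2" using SD by blast
        have m'b: "\<bar>m' y\<bar> \<le> C + B" for y using mC[of y] B[of y] by (auto simp: m'_def max_def)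
        have m'm: "m' \<in> borel_measurable borel" unfolding m'_def using m(1) SD'(1) by (intro borel_measurable_max)
        have m'0: "m' y = 0" if "y \<notin> \<Union>(insert I F)" for y
          using that m0[of y] SD'(4)[of y] by (auto simp: m'_def)
        have thr: "?S {I'\<in>insert I F. l \<le> level I'} y \<le> m' y" for y l
        proof (cases "l \<le> level I")
          case True
          then have "{I'\<in>insert I F. l \<le> level I'} = insert I F" using lev by force
          then show ?thesis using S' by (simp add: m'_def)
        next
          case False
          then have "{I'\<in>insert I F. l \<le> level I'} = {I'\<in>F. l \<le> level I'}" by auto
          then show ?thesis using mt[of y l] by (simp add: m'_def)
        qed
        have const: "m' y = m' z" if L: "L \<in> D" "\<And>I'. I' \<in> insert I F \<Longrightarrow> L \<inter> I' = {} \<or> L \<subseteq> left_child I' \<or> L \<subseteq> right_child I'"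
          "y \<in> L" "z \<in> L" for L y z
        proof -
          have "m y = m z" using L by (intro mc'[of L]) auto
          moreover have "h I' y = h I' z" if "I' \<in> insert I F" for I'
            using L(2)[OF that] L(3,4) ins that by (intro haar_const[of L]) auto
          then have "S' y = S' z" unfolding S'[symmetric] by (intro sum.cong) auto
          ultimately show ?thesis by (simp add: m'_def)
        qed
        have md: "m y * d y = m (Inf I) * c I * h I y" for y
        proof (cases "y \<in> I")
          case True
          then show ?thesis using mc'[of I y "Inf I"] IF I Inf_in by (simp add: d_def)
        qed (simp add: d_def haar_outside[OF I])
        have mdi: "integrable \<mu> (\<lambda>y. m y * d y)" "(\<integral>y. m y * d y \<partial>\<mu>) = 0"
          unfolding md using haar_integrable[OF I] haar_integral[OF I] by auto
        have i1: "integrable \<mu> (\<lambda>y. (m y)\<^sup>2 / 2 - m y * ?S F y)"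
        proof (rule integrable_bdd[OF _ SD(3)])
          show "(\<lambda>y. (m y)\<^sup>2 / 2 - m y * ?S F y) \<in> borel_measurable borel" using m(1) SD(1) by measurable
          show "\<bar>(m y)\<^sup>2 / 2 - m y * ?S F y\<bar> \<le> C\<^sup>2 / 2 + C * B2" for y
          proof -
            have "\<bar>m y * ?S F y\<bar> \<le> C * B2" unfolding abs_mult using mC[of y] B2[of y] by (intro mult_mono) auto
            moreover have "(m y)\<^sup>2 \<le> C\<^sup>2" using power_mono[OF mC[of y], of 2] by simp
            ultimately show ?thesis using zero_le_power2[of "m y"] by linarith
          qed
        qed (use m0 in simp)
        have i2: "integrable \<mu> (\<lambda>y. (m' y)\<^sup>2 / 2 - m' y * S' y)"
        proof (rule integrable_bdd[OF _ SD'(3)])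
          show "(\<lambda>y. (m' y)\<^sup>2 / 2 - m' y * S' y) \<in> borel_measurable borel" using m'm SD'(1) by measurable
          show "\<bar>(m' y)\<^sup>2 / 2 - m' y * S' y\<bar> \<le> (C + B)\<^sup>2 / 2 + (C + B) * B" for y
          proof -
            have "\<bar>m' y * S' y\<bar> \<le> (C + B) * B" unfolding abs_mult using m'b[of y] B[of y] by (intro mult_mono) auto
            moreover have "(m' y)\<^sup>2 \<le> (C + B)\<^sup>2" using power_mono[OF m'b[of y], of 2] by simp
            ultimately show ?thesis using zero_le_power2[of "m' y"] by linarith
          qed
        qed (use m'0 in simp)
        have "(\<integral>y. (m' y)\<^sup>2 / 2 - m' y * S' y \<partial>\<mu>) \<le> (\<integral>y. ((m y)\<^sup>2 / 2 - m y * ?S F y) - m y * d y \<partial>\<mu>)"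
        proof (rule integral_mono[OF i2])
          show "integrable \<mu> (\<lambda>y. ((m y)\<^sup>2 / 2 - m y * ?S F y) - m y * d y)" using i1 mdi by simp
          fix y
          show "(m' y)\<^sup>2 / 2 - m' y * S' y \<le> ((m y)\<^sup>2 / 2 - m y * ?S F y) - m y * d y"
          proof (cases "S' y \<le> m y")
            case True
            then have "m' y = m y" by (simp add: m'_def)
            then show ?thesis by (simp add: S'_def algebra_simps)
          next
            case False
            then have "m' y = S' y" by (simp add: m'_def)
            moreover have "(p\<^sup>2 / 2 - p * u) - p * v - ((u + v)\<^sup>2 / 2 - (u + v) * (u + v)) = (p - (u + v))\<^sup>2 / 2" for p u v :: real
              by (simp add: power2_eq_square field_simps)
            from this[of "m y" "?S F y" "d y"]
            have "(S' y)\<^sup>2 / 2 - S' y * S' y \<le> ((m y)\<^sup>2 / 2 - m y * ?S F y) - m y * d y"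
              unfolding S'_def using zero_le_power2[of "m y - (?S F y + d y)"] by linarith
            ultimately show ?thesis by simp
          qed
        qed
        also have "\<dots> = (\<integral>y. (m y)\<^sup>2 / 2 - m y * ?S F y \<partial>\<mu>)" using i1 mdi by simp
        also have "\<dots> \<le> 0" by (rule mi)
        finally have fin: "(\<integral>y. (m' y)\<^sup>2 / 2 - m' y * S' y \<partial>\<mu>) \<le> 0" .
        have "0 \<le> m' y" for y using m(5)[rule_format, of y] by (simp add: m'_def le_max_iff_disj)
        moreover have "\<exists>C. \<forall>y. \<bar>m' y\<bar> \<le> C" using m'b by blast
        moreover have "\<forall>y l. ?S {I'\<in>insert I F. l \<le> level I'} y \<le> m' y" using thr by blast
        moreover have "\<forall>y. y \<notin> \<Union>(insert I F) \<longrightarrow> m' y = 0" using m'0 by blast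
        moreover have "\<forall>L\<in>D. (\<forall>I'\<in>insert I F. L \<inter> I' = {} \<or> L \<subseteq> left_child I' \<or> L \<subseteq> right_child I') \<longrightarrow> (\<forall>y\<in>L. \<forall>z\<in>L. m' y = m' z)"
          using const by (intro ballI impI) (rule const; assumption?; blast)
        moreover have "(\<integral>y. (m' y)\<^sup>2 / 2 - m' y * ?S (insert I F) y \<partial>\<mu>) \<le> 0"
          unfolding S' by (rule fin)
        ultimately have "P (insert I F) m'"
          using m'm unfolding P_def by (intro conjI; (assumption | blast))
        then show "\<exists>m. P (insert I F) m" by blast
      qed
    qed
  qed
  then obtain m where "P F m" using assms(2) by blast
  note mm = this[unfolded P_def]
  have m: "m \<in> borel_measurable borel" "\<exists>C. \<forall>y. \<bar>m y\<bar> \<le> C" "\<forall>y. y \<notin> \<Union>F \<longrightarrow> m y = 0"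
      "\<forall>y l. ?S {I\<in>F. l \<le> level I} y \<le> m y" "\<forall>y. 0 \<le> m y"
    and mi: "(\<integral>y. (m y)\<^sup>2 / 2 - m y * ?S F y \<partial>\<mu>) \<le> 0"
    using mm by - (elim conjE, assumption)+
  obtain C where mC: "\<And>y. \<bar>m y\<bar> \<le> C" using m(2) by blast
  have bF: "bounded (\<Union>F)" by (rule haar_sum_bdd(3)[OF assms])
  have mL2: "L2 \<mu> m" using m(3) by (intro L2_bdd[OF m(1) bF mC]) blast
  have SL2: "L2 \<mu> (?S F)" by (rule haar_sum_L2[OF assms])
  have i: "integrable \<mu> (\<lambda>y. (m y)\<^sup>2)" "integrable \<mu> (\<lambda>y. m y * ?S F y)" "integrable \<mu> (\<lambda>y. (?S F y)\<^sup>2)"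
    using mL2 SL2 L2_mult_integrable[OF mL2 SL2] by (auto simp: L2_def)
  have "(\<integral>y. (m y)\<^sup>2 \<partial>\<mu>) / 2 \<le> (\<integral>y. m y * ?S F y \<partial>\<mu>)" using mi i by simp
  also have "\<dots> \<le> (\<integral>y. (m y)\<^sup>2 / 4 + (?S F y)\<^sup>2 \<partial>\<mu>)"
  proof (rule integral_mono)
    fix y
    have "0 \<le> (m y / 2 - ?S F y)\<^sup>2" by simp
    then show "m y * ?S F y \<le> (m y)\<^sup>2 / 4 + (?S F y)\<^sup>2"
      by (simp add: power2_eq_square field_simps)
  qed (use i in auto)
  also have "\<dots> = (\<integral>y. (m y)\<^sup>2 \<partial>\<mu>) / 4 + ip \<mu> (?S F) (?S F)"
    using i by (simp add: ip_def power2_eq_square)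
  also have "\<dots> \<le> (\<integral>y. (m y)\<^sup>2 \<partial>\<mu>) / 4 + (\<Sum>I\<in>F. (c I)\<^sup>2)" using haar_sum_norm[OF assms, of c] by simp
  finally have "(\<integral>y. (m y)\<^sup>2 \<partial>\<mu>) \<le> 4 * (\<Sum>I\<in>F. (c I)\<^sup>2)" by simp
  then show ?thesis using m by (intro exI[of _ m] conjI)
qed

text \<open>A sum between two levels is a difference of two truncated sums, each of which lies
  between minus the maximal function for \<open>-c\<close> and the one for \<open>c\<close>. The
  constant is 4 * (4 + 4).\<close>

lemma haar_maximal_square:
  assumes "finite F" "F \<subseteq> D"
  shows "\<exists>M. integrable \<mu> M \<and> (\<forall>y. 0 \<le> M y) \<and> (\<integral>y. M y \<partial>\<mu>) \<le> 32 * (\<Sum>I\<in>F. (c I)\<^sup>2) \<and>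
    (\<forall>y l l'. ((\<Sum>I\<in>{I\<in>F. l \<le> level I}. c I * h I y) - (\<Sum>I\<in>{I\<in>F. l' \<le> level I}. c I * h I y))\<^sup>2 \<le> M y)"
proof -
  have bF: "bounded (\<Union>F)" by (rule haar_sum_bdd(3)[OF assms])
  obtain m C where m: "m \<in> borel_measurable borel" "\<And>y. \<bar>m y\<bar> \<le> C" "\<And>y. y \<notin> \<Union>F \<Longrightarrow> m y = 0"
      "\<And>y l. (\<Sum>I\<in>{I\<in>F. l \<le> level I}. c I * h I y) \<le> m y" "\<And>y. 0 \<le> m y"
      "(\<integral>y. (m y)\<^sup>2 \<partial>\<mu>) \<le> 4 * (\<Sum>I\<in>F. (c I)\<^sup>2)"
    using haar_maximal[OF assms, of c] by blast
  obtain n C' where n: "n \<in> borel_measurable borel" "\<And>y. \<bar>n y\<bar> \<le> C'" "\<And>y. y \<notin> \<Union>F \<Longrightarrow> n y = 0"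
      "\<And>y l. (\<Sum>I\<in>{I\<in>F. l \<le> level I}. - c I * h I y) \<le> n y" "\<And>y. 0 \<le> n y"
      "(\<integral>y. (n y)\<^sup>2 \<partial>\<mu>) \<le> 4 * (\<Sum>I\<in>F. (- c I)\<^sup>2)"
    using haar_maximal[OF assms, of "\<lambda>I. - c I"] by blast
  define M where "M = (\<lambda>y. 4 * ((m y)\<^sup>2 + (n y)\<^sup>2))"
  have i: "integrable \<mu> (\<lambda>y. (m y)\<^sup>2)" "integrable \<mu> (\<lambda>y. (n y)\<^sup>2)"
    using L2_bdd[OF m(1) bF m(2,3)] L2_bdd[OF n(1) bF n(2,3)] by (auto simp: L2_def)
  have "((\<Sum>I\<in>{I\<in>F. l \<le> level I}. c I * h I y) - (\<Sum>I\<in>{I\<in>F. l' \<le> level I}. c I * h I y))\<^sup>2 \<le> M y" for y l l'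
  proof -
    let ?a = "\<Sum>I\<in>{I\<in>F. l \<le> level I}. c I * h I y" and ?b = "\<Sum>I\<in>{I\<in>F. l' \<le> level I}. c I * h I y"
    have "?a \<le> m y" "?b \<le> m y" "- ?a \<le> n y" "- ?b \<le> n y"
      using m(4)[of y l] m(4)[of y l'] n(4)[of y l] n(4)[of y l'] by (simp_all add: sum_negf)
    then have "\<bar>?a - ?b\<bar> \<le> m y + n y" by linarith
    then have "(?a - ?b)\<^sup>2 \<le> (m y + n y)\<^sup>2" using power_mono[of "\<bar>?a - ?b\<bar>" "m y + n y" 2] by simp
    also have "\<dots> \<le> M y"
    proof -
      have "(p + q)\<^sup>2 \<le> 4 * (p\<^sup>2 + q\<^sup>2)" for p q :: real
      proof -
        have "4 * (p\<^sup>2 + q\<^sup>2) - (p + q)\<^sup>2 = 2 * (p\<^sup>2 + q\<^sup>2) + (p - q)\<^sup>2"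
          by (simp add: power2_eq_square algebra_simps)
        also have "0 \<le> \<dots>" by simp
        finally show ?thesis by simp
      qed
      then show ?thesis by (simp add: M_def)
    qed
    finally show ?thesis .
  qed
  moreover have "(\<integral>y. M y \<partial>\<mu>) \<le> 32 * (\<Sum>I\<in>F. (c I)\<^sup>2)"
    unfolding M_def using i m(6) n(6) by simp
  moreover have "integrable \<mu> M" unfolding M_def using i by simp
  ultimately show ?thesis by (intro exI[of _ M]) (auto simp: M_def)
qed

end

section \<open>Truncated kernels\<close>

text \<open>
  \<open>psi s\<close> agrees with \<open>1 / t\<close> for \<open>\<bar>t\<bar> \<ge> s\<close>, vanishes for \<open>\<bar>t\<bar> \<le> s / 2\<close>, and is Lipschitz with constant
  \<open>2 / d\<^sup>2\<close> on each half line \<open>\<bar>t\<bar> \<ge> d\<close>, uniformly in \<open>s\<close>. At \<open>t = 0\<close> the factor \<open>sgn t\<close> annihilates the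
  junk value of \<open>1 / \<bar>t\<bar>\<close>.
\<close>
definition psi :: "real \<Rightarrow> real \<Rightarrow> real" where
  "psi s t = sgn t * min (1 / \<bar>t\<bar>) (max 0 ((2 * \<bar>t\<bar> - s) / s\<^sup>2))"

definition hard :: "real \<Rightarrow> real \<Rightarrow> real \<Rightarrow> real" where
  "hard \<epsilon> \<delta> t = (if \<epsilon> < \<bar>t\<bar> \<and> \<bar>t\<bar> < \<delta> then 1 / t else 0)"

definition annular :: "real \<Rightarrow> (real \<Rightarrow> real) \<Rightarrow> bool" where
  "annular s e \<longleftrightarrow> 0 < s \<and> e \<in> borel_measurable borel \<and> (\<forall>t. \<bar>e t\<bar> \<le> 1 / s) \<and>
     (\<forall>t. e t \<noteq> 0 \<longrightarrow> s / 2 \<le> \<bar>t\<bar> \<and> \<bar>t\<bar> \<le> s)"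

lemma psi_borel [measurable]: "psi s \<in> borel_measurable borel"
  unfolding psi_def[abs_def] by measurable

lemma hard_borel [measurable]: "hard \<epsilon> \<delta> \<in> borel_measurable borel"
  unfolding hard_def[abs_def] by measurable

lemma psi_pos: "0 < t \<Longrightarrow> psi s t = min (1 / t) (max 0 ((2 * t - s) / s\<^sup>2))"
  by (simp add: psi_def)

lemma psi_odd: "psi s (- t) = - psi s t"
  by (simp add: psi_def sgn_minus)

lemma psi_large: "0 < s \<Longrightarrow> s \<le> \<bar>t\<bar> \<Longrightarrow> psi s t = 1 / t"
proof -
  assume s: "0 < s" "s \<le> \<bar>t\<bar>"
  have "1 / \<bar>t\<bar> \<le> (2 * \<bar>t\<bar> - s) / s\<^sup>2"
  proof -
    have "s * s \<le> \<bar>t\<bar> * (2 * \<bar>t\<bar> - s)" using s by (intro mult_mono) auto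
    then show ?thesis using s by (simp add: field_simps power2_eq_square)
  qed
  then have "psi s t = sgn t * (1 / \<bar>t\<bar>)" using s by (simp add: psi_def min_def max_def)
  then show ?thesis by (cases "t > 0") (use s in \<open>auto simp: sgn_if\<close>)
qed

lemma psi_small: "0 < s \<Longrightarrow> \<bar>t\<bar> < s / 2 \<Longrightarrow> psi s t = 0"
proof -
  assume s: "0 < s" "\<bar>t\<bar> < s / 2"
  then have "(2 * \<bar>t\<bar> - s) / s\<^sup>2 \<le> 0" by (intro divide_nonpos_nonneg) auto
  then have "max 0 ((2 * \<bar>t\<bar> - s) / s\<^sup>2) = 0" by simp
  then show ?thesis unfolding psi_def by simp
qed

lemma psi_bound: "0 < s \<Longrightarrow> \<bar>psi s t\<bar> \<le> 1 / s"
proof (cases "s \<le> \<bar>t\<bar>")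
  case True
  assume "0 < s"
  then show ?thesis using True psi_large[of s t] by (simp add: frac_le)
next
  case False
  assume s: "0 < s"
  have "(2 * \<bar>t\<bar> - s) / s\<^sup>2 \<le> s / s\<^sup>2" using False by (intro divide_right_mono) auto
  then have "(2 * \<bar>t\<bar> - s) / s\<^sup>2 \<le> 1 / s" using s by (simp add: power2_eq_square)
  then have "min (1 / \<bar>t\<bar>) (max 0 ((2 * \<bar>t\<bar> - s) / s\<^sup>2)) \<le> 1 / s" using s by (intro min.coboundedI2) auto
  moreover have "0 \<le> min (1 / \<bar>t\<bar>) (max 0 ((2 * \<bar>t\<bar> - s) / s\<^sup>2))" by simp
  ultimately show ?thesis unfolding psi_def abs_mult by (auto simp: sgn_if)
qed

text \<open>For positive arguments \<open>psi\<close> is built by minimum and maximum from 1 / t, of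
  slope at most 1 / d^2 beyond \<open>d\<close>, and a line of slope 2 / s^2, which comes into play
  only if d < s. Minima and maxima keep Lipschitz constants.\<close>

lemma psi_lipschitz_pos:
  assumes "0 < s" "0 < d" "d \<le> t" "d \<le> t'"
  shows "\<bar>psi s t - psi s t'\<bar> \<le> 2 / d\<^sup>2 * \<bar>t - t'\<bar>"
proof -
  have inv: "\<bar>1 / t - 1 / t'\<bar> \<le> 2 / d\<^sup>2 * \<bar>t - t'\<bar>"
  proof -
    have "\<bar>1 / t - 1 / t'\<bar> = \<bar>t - t'\<bar> / (t * t')"
      using assms by (simp add: diff_frac_eq abs_mult abs_minus_commute)
    also have "\<dots> \<le> \<bar>t - t'\<bar> / (d * d)" using assms mult_mono[of d t d t'] mult_pos_pos[of t t'] by (intro divide_left_mono) auto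
    also have "\<dots> \<le> 2 / d\<^sup>2 * \<bar>t - t'\<bar>" using assms by (simp add: power2_eq_square field_simps)
    finally show ?thesis .
  qed
  show ?thesis
  proof (cases "s \<le> d")
    case True
    then show ?thesis using assms inv by (simp add: psi_large)
  next
    case False
    have "\<bar>(2 * t - s) / s\<^sup>2 - (2 * t' - s) / s\<^sup>2\<bar> = 2 / s\<^sup>2 * \<bar>t - t'\<bar>"
    proof -
      have "(2 * t - s) / s\<^sup>2 - (2 * t' - s) / s\<^sup>2 = 2 / s\<^sup>2 * (t - t')"
        by (simp add: diff_divide_distrib algebra_simps)
      then have "\<bar>(2 * t - s) / s\<^sup>2 - (2 * t' - s) / s\<^sup>2\<bar> = \<bar>2 / s\<^sup>2\<bar> * \<bar>t - t'\<bar>"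
        by (simp only: abs_mult)
      then show ?thesis by simp
    qed
    also have "\<dots> \<le> 2 / d\<^sup>2 * \<bar>t - t'\<bar>"
      using assms False by (intro mult_right_mono divide_left_mono power_mono) auto
    finally have lin: "\<bar>(2 * t - s) / s\<^sup>2 - (2 * t' - s) / s\<^sup>2\<bar> \<le> 2 / d\<^sup>2 * \<bar>t - t'\<bar>" .
    have "\<bar>min a (max 0 b) - min a' (max 0 b')\<bar> \<le> L" if "\<bar>a - a'\<bar> \<le> L" "\<bar>b - b'\<bar> \<le> L" for a b a' b' L :: real
      using that by (auto simp: min_def max_def abs_if split: if_splits)
    from this[OF inv lin] show ?thesis using assms by (simp add: psi_pos)
  qed
qed

lemma psi_lipschitz:
  assumes "0 < s" "0 < d" "(d \<le> t \<and> d \<le> t') \<or> (t \<le> - d \<and> t' \<le> - d)"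
  shows "\<bar>psi s t - psi s t'\<bar> \<le> 2 / d\<^sup>2 * \<bar>t - t'\<bar>"
  using psi_lipschitz_pos[of s d t t'] psi_lipschitz_pos[of s d "- t" "- t'"] assms
  by (auto simp: psi_odd abs_minus_commute)

text \<open>\<open>hard\<close> vanishes at both cutoff radii, so it is 1 / t on |t| > \<epsilon>
  minus 1 / t on |t| >= \<delta>; hence one strict and one weak version.\<close>

lemma annular_psi:
  assumes "0 < s"
  shows "annular s (\<lambda>t. (if s < \<bar>t\<bar> then 1 / t else 0) - psi s t)"
    "annular s (\<lambda>t. (if s \<le> \<bar>t\<bar> then 1 / t else 0) - psi s t)"
proof -
  have "\<bar>(if P then 1 / t else 0) - psi s t\<bar> \<le> 1 / s \<and> ((if P then 1 / t else 0) - psi s t \<noteq> 0 \<longrightarrow> s / 2 \<le> \<bar>t\<bar> \<and> \<bar>t\<bar> \<le> s)"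
    if "P \<Longrightarrow> s \<le> \<bar>t\<bar>" "s < \<bar>t\<bar> \<Longrightarrow> P" for P t
  proof (cases P)
    case True
    then show ?thesis using psi_large[of s t] that assms by simp
  next
    case False
    then show ?thesis using psi_bound[of s t] psi_small[of s t] that assms by force
  qed
  note q = this
  have A: "annular s (\<lambda>t. (if P t then 1 / t else 0) - psi s t)"
    if P: "\<And>t. P t \<Longrightarrow> s \<le> \<bar>t\<bar>" "\<And>t. s < \<bar>t\<bar> \<Longrightarrow> P t" and [measurable]: "Measurable.pred borel P" for P
    unfolding annular_def
  proof (intro conjI allI)
    show "(\<lambda>t. (if P t then 1 / t else 0) - psi s t) \<in> borel_measurable borel" by measurable
    show "\<bar>(if P t then 1 / t else 0) - psi s t\<bar> \<le> 1 / s"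
      "(if P t then 1 / t else 0) - psi s t \<noteq> 0 \<longrightarrow> s / 2 \<le> \<bar>t\<bar> \<and> \<bar>t\<bar> \<le> s" for t
      using q[of "P t" t] P by blast+
  qed (rule assms)
  show "annular s (\<lambda>t. (if s < \<bar>t\<bar> then 1 / t else 0) - psi s t)"
    "annular s (\<lambda>t. (if s \<le> \<bar>t\<bar> then 1 / t else 0) - psi s t)"
    by (rule A; simp)+
qed

lemma hard_split:
  assumes "0 < \<epsilon>" "\<epsilon> < \<delta>"
  obtains e1 e2 where "annular \<epsilon> e1" "annular \<delta> e2" "\<And>t. hard \<epsilon> \<delta> t = (psi \<epsilon> t - psi \<delta> t) + e1 t - e2 t"
proof -
  let ?e1 = "\<lambda>t. (if \<epsilon> < \<bar>t\<bar> then 1 / t else 0) - psi \<epsilon> t"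
  let ?e2 = "\<lambda>t. (if \<delta> \<le> \<bar>t\<bar> then 1 / t else 0) - psi \<delta> t"
  have "hard \<epsilon> \<delta> t = (psi \<epsilon> t - psi \<delta> t) + ?e1 t - ?e2 t" for t
    using assms by (auto simp: hard_def)
  then show thesis using annular_psi[of \<epsilon>] annular_psi[of \<delta>] assms by (intro that[of ?e1 ?e2]) auto
qed

section \<open>Integral operators with bounded kernels\<close>

context weight
begin

definition conv :: "(real \<Rightarrow> real) \<Rightarrow> (real \<Rightarrow> real) \<Rightarrow> real \<Rightarrow> real" where
  "conv k \<phi> x = (\<integral>y. \<phi> y * k (y - x) \<partial>\<mu>)"

lemma hilbert_conv: "hilbert \<epsilon> \<delta> \<mu> \<phi> = conv (hard \<epsilon> \<delta>) \<phi>"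
proof
  fix x
  show "hilbert \<epsilon> \<delta> \<mu> \<phi> x = conv (hard \<epsilon> \<delta>) \<phi> x"
    unfolding hilbert_def conv_def set_lebesgue_integral_def
    by (intro Bochner_Integration.integral_cong) (auto simp: hard_def indicator_def abs_minus_commute)
qed

text \<open>Such functions are integrable against every locally finite measure. The class contains
  bounded Borel indicators and Haar functions and is stable under multiplication by functions in
  \<open>bker\<close>, so it supplies integrability below.\<close>

definition bsupp :: "(real \<Rightarrow> real) \<Rightarrow> bool" where
  "bsupp \<phi> \<longleftrightarrow> \<phi> \<in> borel_measurable borel \<and> (\<exists>C. \<forall>x. \<bar>\<phi> x\<bar> \<le> C) \<and> (\<exists>B. bounded B \<and> (\<forall>x. x \<notin> B \<longrightarrow> \<phi> x = 0))"

definition bker :: "(real \<Rightarrow> real) \<Rightarrow> bool" where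
  "bker k \<longleftrightarrow> k \<in> borel_measurable borel \<and> (\<exists>C. \<forall>x. \<bar>k x\<bar> \<le> C)"

lemma bsupp_integrable: "bsupp \<phi> \<Longrightarrow> integrable \<mu> \<phi>"
  unfolding bsupp_def using integrable_bdd by blast

lemma bsupp_L2: "bsupp \<phi> \<Longrightarrow> L2 \<mu> \<phi>"
  unfolding bsupp_def using L2_bdd by blast

lemma bsupp_mult_bker: "bsupp \<phi> \<Longrightarrow> bker k \<Longrightarrow> bsupp (\<lambda>y. \<phi> y * k y)"
proof -
  assume "bsupp \<phi>" "bker k"
  then obtain C B C' where *: "\<phi> \<in> borel_measurable borel" "\<And>x. \<bar>\<phi> x\<bar> \<le> C" "bounded B" "\<And>x. x \<notin> B \<Longrightarrow> \<phi> x = 0"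
    "k \<in> borel_measurable borel" "\<And>x. \<bar>k x\<bar> \<le> C'" unfolding bsupp_def bker_def by metis
  have "\<bar>\<phi> x * k x\<bar> \<le> C * C'" for x
    unfolding abs_mult using *(2)[of x] *(6)[of x] by (intro mult_mono) auto
  then show ?thesis using * unfolding bsupp_def
    by (intro conjI borel_measurable_times exI[of _ "C * C'"] exI[of _ B]) auto
qed

lemma bker_shift: "bker k \<Longrightarrow> bker (\<lambda>y. k (y - x))"
  unfolding bker_def by (auto intro: measurable_compose[of "\<lambda>y. y - x" borel borel k])

lemma bsupp_indicator: "bounded B \<Longrightarrow> B \<in> sets borel \<Longrightarrow> bsupp (indicator B)"
  unfolding bsupp_def by (intro conjI exI[of _ 1] exI[of _ B]) (auto simp: indicator_def)

lemma bsupp_mult: "bsupp \<phi> \<Longrightarrow> bsupp g \<Longrightarrow> bsupp (\<lambda>y. \<phi> y * g y)"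
  using bsupp_mult_bker[of \<phi> g] by (auto simp: bker_def bsupp_def)

lemma bsupp_sum: "(\<And>i. i \<in> F \<Longrightarrow> bsupp (\<phi> i)) \<Longrightarrow> finite F \<Longrightarrow> bsupp (\<lambda>y. \<Sum>i\<in>F. c i * \<phi> i y)"
proof (induction F rule: infinite_finite_induct)
  case empty
  then show ?case by (auto simp: bsupp_def intro: exI[of _ "{}"])
next
  case (insert i F)
  have "bsupp (\<lambda>y. c i * f y + g y)" if fg: "bsupp f" "bsupp g" for f g
  proof -
    obtain C B where f: "f \<in> borel_measurable borel" "\<And>x. \<bar>f x\<bar> \<le> C" "bounded B" "\<And>x. x \<notin> B \<Longrightarrow> f x = 0"
      using fg(1) unfolding bsupp_def by metis
    obtain C' B' where g: "g \<in> borel_measurable borel" "\<And>x. \<bar>g x\<bar> \<le> C'" "bounded B'" "\<And>x. x \<notin> B' \<Longrightarrow> g x = 0"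
      using fg(2) unfolding bsupp_def by metis
    have "\<bar>c i * f y + g y\<bar> \<le> \<bar>c i\<bar> * C + C'" for y
      using f(2)[of y] g(2)[of y] mult_left_mono[OF f(2)[of y], of "\<bar>c i\<bar>"] by (auto simp: abs_mult intro!: order_trans[OF abs_triangle_ineq])
    moreover have "(\<lambda>y. c i * f y + g y) \<in> borel_measurable borel" using f g by measurable
    moreover have "c i * f y + g y = 0" if "y \<notin> B \<union> B'" for y using f(4)[of y] g(4)[of y] that by auto
    moreover have "bounded (B \<union> B')" using f g by simp
    ultimately show ?thesis unfolding bsupp_def by blast
  qed
  then show ?case using insert by simp
qed auto

lemma conv_integrable: "bsupp \<phi> \<Longrightarrow> bker k \<Longrightarrow> integrable \<mu> (\<lambda>y. \<phi> y * k (y - x))"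
  by (intro bsupp_integrable bsupp_mult_bker bker_shift)

lemma conv_bker: "bsupp \<phi> \<Longrightarrow> bker k \<Longrightarrow> bker (conv k \<phi>)"
proof -
  assume \<phi>: "bsupp \<phi>" and k: "bker k"
  obtain C where C: "\<And>x. \<bar>k x\<bar> \<le> C" using k by (auto simp: bker_def)
  have [measurable]: "\<phi> \<in> borel_measurable borel" "k \<in> borel_measurable borel" using \<phi> k by (auto simp: bsupp_def bker_def)
  have "(\<lambda>x. conv k \<phi> x) \<in> borel_measurable borel"
    unfolding conv_def
  proof (rule sigma_finite_measure.borel_measurable_lebesgue_integral[OF sigma_finite])
    have "(\<lambda>(x, y). \<phi> y * k (y - x)) \<in> borel_measurable (borel \<Otimes>\<^sub>M borel)" by measurable
    moreover have "sets (borel \<Otimes>\<^sub>M \<mu>) = sets (borel \<Otimes>\<^sub>M borel)" by (intro sets_pair_measure_cong) auto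
    ultimately show "(\<lambda>(x, y). \<phi> y * k (y - x)) \<in> borel_measurable (borel \<Otimes>\<^sub>M \<mu>)"
      using measurable_cong_sets by blast
  qed
  moreover have "\<bar>conv k \<phi> x\<bar> \<le> (\<integral>y. \<bar>\<phi> y\<bar> * C \<partial>\<mu>)" for x
    unfolding conv_def
  proof (rule order_trans[OF integral_abs_bound integral_mono])
    show "integrable \<mu> (\<lambda>y. \<bar>\<phi> y * k (y - x)\<bar>)" using conv_integrable[OF \<phi> k] by simp
    show "integrable \<mu> (\<lambda>y. \<bar>\<phi> y\<bar> * C)" using bsupp_integrable[OF \<phi>] by simp
  qed (auto simp: abs_mult intro!: mult_left_mono C)
  ultimately show ?thesis by (auto simp: bker_def)
qed

lemma conv_sum:
  assumes "finite F" "\<And>i. i \<in> F \<Longrightarrow> bsupp (\<phi> i)" "bker k"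
  shows "conv k (\<lambda>y. \<Sum>i\<in>F. c i * \<phi> i y) x = (\<Sum>i\<in>F. c i * conv k (\<phi> i) x)"
proof -
  have "conv k (\<lambda>y. \<Sum>i\<in>F. c i * \<phi> i y) x = (\<integral>y. (\<Sum>i\<in>F. c i * (\<phi> i y * k (y - x))) \<partial>\<mu>)"
    unfolding conv_def by (simp add: sum_distrib_right mult.assoc)
  also have "\<dots> = (\<Sum>i\<in>F. \<integral>y. c i * (\<phi> i y * k (y - x)) \<partial>\<mu>)"
    using assms conv_integrable by (intro Bochner_Integration.integral_sum) auto
  finally show ?thesis by (simp add: conv_def)
qed

lemma conv_kernel_combination:
  assumes "bsupp \<phi>" "bker k1" "bker k2" "bker k3"
  shows "conv (\<lambda>t. k1 t + k2 t - k3 t) \<phi> x = conv k1 \<phi> x + conv k2 \<phi> x - conv k3 \<phi> x"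
proof -
  have "conv (\<lambda>t. k1 t + k2 t - k3 t) \<phi> x = (\<integral>y. \<phi> y * k1 (y - x) + \<phi> y * k2 (y - x) - \<phi> y * k3 (y - x) \<partial>\<mu>)"
    unfolding conv_def by (simp add: algebra_simps)
  then show ?thesis using assms conv_integrable by (simp add: conv_def)
qed

end

section \<open>Moments and Whitney intervals\<close>

lemma infdist_ge: "A \<noteq> {} \<Longrightarrow> (\<And>x. x \<in> A \<Longrightarrow> d \<le> \<bar>y - x\<bar>) \<Longrightarrow> d \<le> infdist (y::real) A"
  unfolding infdist_def by (auto intro!: cINF_greatest simp: dist_real_def)

lemma infdist_le_abs: "x \<in> A \<Longrightarrow> infdist (y::real) A \<le> \<bar>y - x\<bar>"
  using infdist_le[of x A y] by (simp add: dist_real_def)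

section \<open>Haar pairings with Lipschitz functions, and energy\<close>

context dyadic_weight
begin

lemma haar_bsupp: "I \<in> D \<Longrightarrow> bsupp (h I)"
  unfolding bsupp_def using haar_bounded[of I] haar_outside[of I] D_bounded[of I] by (auto intro: haar_borel)

lemma bker_haar_integrable: "bker g \<Longrightarrow> I \<in> D \<Longrightarrow> integrable \<mu> (\<lambda>x. g x * h I x)"
  using bsupp_integrable[OF bsupp_mult_bker[OF haar_bsupp, of I g]] by (simp add: mult.commute)

lemma D_bsupp: "I \<in> D \<Longrightarrow> bsupp (indicator I)"
  by (intro bsupp_indicator D_bounded D_borel)

lemma haar_sign:
  assumes "J \<in> D" shows "0 \<le> (x - (Inf J + len J / 2)) * h J x"
proof -
  have "h J x = 0 \<or> (x < Inf J + len J / 2 \<and> h J x \<le> 0) \<or> (Inf J + len J / 2 \<le> x \<and> 0 \<le> h J x)"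
  proof -
    consider "x \<notin> J" | "x \<in> left_child J" "x \<notin> right_child J" | "x \<in> right_child J" "x \<notin> left_child J"
      using children_Un[OF assms] children_disj[OF assms] by blast
    then show ?thesis
    proof cases
      case 2
      then have "x < Inf J + len J / 2" using left_eq[OF assms] by auto
      moreover have "h J x \<le> 0" using 2 by (simp add: haar_eq mult_nonneg_nonpos)
      ultimately show ?thesis by simp
    next
      case 3
      then have "Inf J + len J / 2 \<le> x" using right_eq[OF assms] by auto
      moreover have "0 \<le> h J x" using 3 by (simp add: haar_eq)
      ultimately show ?thesis by simp
    qed (use haar_outside[OF assms] in simp)
  qed
  then show ?thesis by (auto intro: mult_nonneg_nonneg mult_nonpos_nonpos)
qed

text \<open>By \<open>haar_sign\<close> the integrand is nonnegative, so this is the first absolute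
  moment of the Haar function about the centre, which bounds pairings with Lipschitz functions. It
  is also a Haar coefficient of the identity function, so Bessel's inequality links its squares to
  the energy.\<close>

definition moment :: "real set \<Rightarrow> real" where
  "moment J = (\<integral>x. (x - (Inf J + len J / 2)) * h J x \<partial>\<mu>)"

lemma moment_integrable: "J \<in> D \<Longrightarrow> integrable \<mu> (\<lambda>x. (x - z) * h J x)"
proof -
  assume J: "J \<in> D"
  have b: "bsupp (\<lambda>x. (x - z) * indicator J x)"
    unfolding bsupp_def
  proof (intro conjI exI allI)
    have [measurable]: "J \<in> sets borel" by (rule D_borel[OF J])
    show "(\<lambda>x. (x - z) * indicator J x) \<in> borel_measurable borel" by measurable
    show "bounded J" by (rule D_bounded[OF J])
    show "\<bar>(x - z) * indicator J x\<bar> \<le> \<bar>Inf J\<bar> + len J + \<bar>z\<bar>" for x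
    proof (cases "x \<in> J")
      case True
      then have "Inf J \<le> x" "x < Inf J + len J" using D_eq[OF J] by (metis atLeastLessThan_iff)+
      then show ?thesis using True by simp
    qed (use len_pos[OF J] in simp)
  qed auto
  have "(\<lambda>x. (x - z) * h J x) = (\<lambda>x. (x - z) * indicator J x * h J x)"
  proof
    fix x show "(x - z) * h J x = (x - z) * indicator J x * h J x"
      using haar_outside[OF J, of x] by (cases "x \<in> J") simp_all
  qed
  then show ?thesis using bsupp_integrable[OF bsupp_mult[OF b haar_bsupp[OF J]]] by simp
qed

lemma moment_eq: "J \<in> D \<Longrightarrow> (\<integral>x. (x - z) * h J x \<partial>\<mu>) = moment J"
proof -
  assume J: "J \<in> D"
  have "moment J = (\<integral>x. (x - z) * h J x + (z - (Inf J + len J / 2)) * h J x \<partial>\<mu>)"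
    unfolding moment_def by (simp add: algebra_simps)
  also have "\<dots> = (\<integral>x. (x - z) * h J x \<partial>\<mu>)"
    using moment_integrable[OF J] haar_integrable[OF J] haar_integral[OF J] by simp
  finally show ?thesis by simp
qed

lemma moment_nonneg: "J \<in> D \<Longrightarrow> 0 \<le> moment J"
  unfolding moment_def using haar_sign by (intro integral_nonneg_AE) auto

lemma lipschitz_pairing:
  assumes J: "J \<in> D" and g: "bker g" and L: "\<And>x. x \<in> J \<Longrightarrow> \<bar>g x - g (Inf J + len J / 2)\<bar> \<le> L * \<bar>x - (Inf J + len J / 2)\<bar>"
  shows "\<bar>ip \<mu> g (h J)\<bar> \<le> L * moment J"
proof -
  let ?c = "Inf J + len J / 2"
  note i = bker_haar_integrable[OF g J] haar_integrable[OF J]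
  have "ip \<mu> g (h J) = (\<integral>x. g x * h J x - g ?c * h J x \<partial>\<mu>)"
    unfolding ip_def using i haar_integral[OF J] by simp
  then have "\<bar>ip \<mu> g (h J)\<bar> \<le> (\<integral>x. \<bar>g x * h J x - g ?c * h J x\<bar> \<partial>\<mu>)"
    by (simp add: integral_abs_bound)
  also have "\<dots> \<le> (\<integral>x. L * ((x - ?c) * h J x) \<partial>\<mu>)"
  proof (rule integral_mono)
    show "integrable \<mu> (\<lambda>x. \<bar>g x * h J x - g ?c * h J x\<bar>)" using i by simp
    show "integrable \<mu> (\<lambda>x. L * ((x - ?c) * h J x))" using moment_integrable[OF J] by simp
    fix x
    show "\<bar>g x * h J x - g ?c * h J x\<bar> \<le> L * ((x - ?c) * h J x)"
    proof (cases "x \<in> J")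
      case True
      have "\<bar>g x * h J x - g ?c * h J x\<bar> = \<bar>g x - g ?c\<bar> * \<bar>h J x\<bar>"
        by (simp add: left_diff_distrib[symmetric] abs_mult)
      also have "\<dots> \<le> (L * \<bar>x - ?c\<bar>) * \<bar>h J x\<bar>" using L[OF True] by (intro mult_right_mono) auto
      also have "\<dots> = L * \<bar>(x - ?c) * h J x\<bar>" by (simp add: abs_mult)
      also have "\<dots> = L * ((x - ?c) * h J x)" using haar_sign[OF J, of x] by simp
      finally show ?thesis .
    qed (simp add: haar_outside[OF J])
  qed
  also have "\<dots> = L * moment J" by (simp add: moment_def)
  finally show ?thesis .
qed

lemma moment_sum_le:
  assumes F: "finite F" "F \<subseteq> D" "\<And>J. J \<in> F \<Longrightarrow> J \<subseteq> R" and R: "R \<in> D" and z: "z \<in> R"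
  shows "(\<Sum>J\<in>F. (moment J)\<^sup>2) \<le> (\<integral>x. (x - z)\<^sup>2 * indicator R x \<partial>\<mu>)"
proof -
  let ?u = "\<lambda>x. (x - z) * indicator R x"
  have b: "bsupp ?u"
    unfolding bsupp_def
  proof (intro conjI exI allI)
    have [measurable]: "R \<in> sets borel" by (rule D_borel[OF R])
    show "?u \<in> borel_measurable borel" by measurable
    show "bounded R" by (rule D_bounded[OF R])
    show "\<bar>?u x\<bar> \<le> \<bar>Inf R\<bar> + len R + \<bar>z\<bar>" for x
    proof (cases "x \<in> R")
      case True
      then have "Inf R \<le> x" "x < Inf R + len R" using D_eq[OF R] by (metis atLeastLessThan_iff)+
      then show ?thesis using True by simp
    qed (use len_pos[OF R] in simp)
  qed auto
  have "ip \<mu> ?u (h J) = moment J" if "J \<in> F" for J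
  proof -
    have "ip \<mu> ?u (h J) = (\<integral>x. (x - z) * h J x \<partial>\<mu>)"
      unfolding ip_def
    proof (intro Bochner_Integration.integral_cong refl)
      fix x show "(x - z) * indicator R x * h J x = (x - z) * h J x"
        using haar_outside[of J x] F(2) subsetD[OF F(3)[OF that], of x] that by (cases "x \<in> J") auto
    qed
    then show ?thesis using moment_eq F that by auto
  qed
  then have "(\<Sum>J\<in>F. (moment J)\<^sup>2) = (\<Sum>J\<in>F. (ip \<mu> ?u (h J))\<^sup>2)" by simp
  also have "\<dots> \<le> ip \<mu> ?u ?u" by (rule bessel[OF F(1,2) bsupp_L2[OF b]])
  also have "\<dots> = (\<integral>x. (x - z)\<^sup>2 * indicator R x \<partial>\<mu>)"
    unfolding ip_def by (intro Bochner_Integration.integral_cong) (auto simp: power2_eq_square indicator_def)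
  finally show ?thesis .
qed

text \<open>Bessel's inequality for x - z on \<open>R\<close> bounds the sum for each
  \<open>z\<close> in \<open>R\<close>. Averaging over \<open>z\<close> with respect to
  \<open>\<mu>\<close> produces the double integral of the energy.\<close>

lemma moment_sum_energy:
  assumes F: "finite F" "F \<subseteq> D" "\<And>J. J \<in> F \<Longrightarrow> J \<subseteq> R" and R: "R \<in> D"
  shows "ennreal ((\<Sum>J\<in>F. (moment J)\<^sup>2) / (len R)\<^sup>2) \<le> energy_sq \<mu> R * emeasure \<mu> R"
proof -
  have [measurable]: "R \<in> sets borel" by (rule D_borel[OF R])
  let ?S = "(\<Sum>J\<in>F. (moment J)\<^sup>2) / (len R)\<^sup>2"
  let ?G = "\<lambda>z. \<integral>\<^sup>+x\<in>R. ennreal ((z - x)\<^sup>2 / (len R)\<^sup>2) \<partial>\<mu>"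
  have G: "ennreal ?S \<le> ?G z" if z: "z \<in> R" for z
  proof -
    have i: "integrable \<mu> (\<lambda>x. (x - z)\<^sup>2 * indicator R x)"
    proof (rule integrable_bdd[OF _ D_bounded[OF R]])
      show "\<bar>(x - z)\<^sup>2 * indicator R x\<bar> \<le> (len R)\<^sup>2" for x
      proof (cases "x \<in> R")
        case True
        then have "\<bar>x - z\<bar> \<le> len R" using z D_eq[OF R] by (smt (verit) atLeastLessThan_iff)
        then show ?thesis using True power_mono[of "\<bar>x - z\<bar>" "len R" 2] by simp
      qed simp
    qed auto
    have "?S \<le> (\<integral>x. (x - z)\<^sup>2 * indicator R x \<partial>\<mu>) / (len R)\<^sup>2"
      using moment_sum_le[OF F R z] by (intro divide_right_mono) auto
    also have "\<dots> = (\<integral>x. (z - x)\<^sup>2 / (len R)\<^sup>2 * indicator R x \<partial>\<mu>)"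
      by (simp add: power2_commute[of z])
    finally have "ennreal ?S \<le> ennreal (\<integral>x. (z - x)\<^sup>2 / (len R)\<^sup>2 * indicator R x \<partial>\<mu>)" by (rule ennreal_leI)
    also have "\<dots> = (\<integral>\<^sup>+x. ennreal ((z - x)\<^sup>2 / (len R)\<^sup>2 * indicator R x) \<partial>\<mu>)"
    proof (intro nn_integral_eq_integral[symmetric])
      have "integrable \<mu> (\<lambda>x. (x - z)\<^sup>2 * indicator R x / (len R)\<^sup>2)" using i by simp
      then show "integrable \<mu> (\<lambda>x. (z - x)\<^sup>2 / (len R)\<^sup>2 * indicator R x)"
        by (simp add: power2_commute[of z])
    qed auto
    also have "\<dots> = ?G z" by (intro nn_integral_cong) (auto simp: indicator_def)
    finally show ?thesis .
  qed
  show ?thesis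
  proof (cases "emeasure \<mu> R = 0")
    case True
    have "moment J = 0" if "J \<in> F" for J
    proof -
      have "h J x = 0" for x
      proof -
        have "J \<in> D" using that F by auto
        moreover have "left_child J \<subseteq> R" using F(3)[OF that] children_Un[of J] calculation by blast
        ultimately have "emeasure \<mu> (left_child J) \<le> emeasure \<mu> R" by (intro emeasure_mono) auto
        then have "measure \<mu> (left_child J) = 0" using True by (simp add: measure_def)
        then show ?thesis by (simp add: haar_eq)
      qed
      then show ?thesis by (simp add: moment_def)
    qed
    then show ?thesis by simp
  next
    case False
    have m: "emeasure \<mu> R \<noteq> \<infinity>" using emeasure_bounded[OF D_bounded[OF R]] by simp
    have "ennreal ?S * emeasure \<mu> R = (\<integral>\<^sup>+z\<in>R. ennreal ?S \<partial>\<mu>)"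
      by (simp add: nn_integral_cmult_indicator)
    also have "\<dots> \<le> (\<integral>\<^sup>+z\<in>R. ?G z \<partial>\<mu>)"
      using G by (intro nn_integral_mono) (auto simp: indicator_def)
    finally have le: "ennreal ?S * emeasure \<mu> R \<le> (\<integral>\<^sup>+z\<in>R. ?G z \<partial>\<mu>)" .
    have "ennreal ?S = (ennreal ?S * emeasure \<mu> R) / emeasure \<mu> R"
      using ennreal_mult_divide_eq[of "emeasure \<mu> R" "ennreal ?S"] False m by simp
    also have "\<dots> \<le> (\<integral>\<^sup>+z\<in>R. ?G z \<partial>\<mu>) / emeasure \<mu> R" by (intro divide_right_mono_ennreal le)
    also have "\<dots> = energy_sq \<mu> R * emeasure \<mu> R"
    proof -
      define m where "m = measure \<mu> R"
      have e: "emeasure \<mu> R = ennreal m" using emeasure_eq[OF D_bounded[OF R]] by (simp add: m_def)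
      then have "m \<noteq> 0" using False by auto
      then have m0: "0 < m" using measure_nonneg[of \<mu> R] unfolding m_def by linarith
      have X: "X / ennreal m = X / (ennreal m)\<^sup>2 * ennreal m" for X
      proof -
        have "inverse ((ennreal m)\<^sup>2) * ennreal m = inverse (ennreal m)"
          using m0 by (simp add: inverse_ennreal ennreal_power ennreal_mult'[symmetric] power2_eq_square)
        then show ?thesis by (simp add: divide_ennreal_def mult.assoc)
      qed
      show ?thesis using False X by (simp add: energy_sq_def e)
    qed
    finally show ?thesis .
  qed
qed

text \<open>At a point \<open>y\<close> of \<open>V\<close> each \<open>a K\<close> is the value at
  \<open>y\<close> of the Haar term of the parent of \<open>K\<close>, so the chain sum is a
  difference of two truncated Haar sums at \<open>y\<close>. This holds throughout \<open>R\<close>,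
  and since the \<open>R\<close> are disjoint, integrating the majorant \<open>M\<close> over them
  costs at most its total integral.\<close>

lemma maximal_nodes:
  assumes II: "finite II" "II \<subseteq> D" and I': "I' \<subseteq> II" and N: "finite N"
    and VR: "\<And>V R. (V, R) \<in> N \<Longrightarrow> V \<in> D \<and> k V \<in> D \<and> R \<in> D \<and> R \<subseteq> V"
    and disj: "\<And>V R V' R'. (V, R) \<in> N \<Longrightarrow> (V', R') \<in> N \<Longrightarrow> R \<inter> R' \<noteq> {} \<Longrightarrow> V = V' \<and> R = R'"
    and a: "\<And>K. K \<in> D \<Longrightarrow> parent K \<in> II \<Longrightarrow> a K = c (parent K) * h (parent K) (Inf K)"
  shows "(\<Sum>(V, R)\<in>N. (\<Sum>K\<in>{K\<in>{K\<in>D. parent K \<in> II}. V \<subseteq> K \<and> K \<subseteq> k V \<and> parent K \<in> I'}. a K)\<^sup>2 * measure \<mu> R)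
    \<le> 32 * (\<Sum>i\<in>I'. (c i)\<^sup>2)"
proof -
  have I'D: "finite I'" "I' \<subseteq> D" using I' II finite_subset by auto
  obtain M where M: "integrable \<mu> M" "\<And>y. 0 \<le> M y" "(\<integral>y. M y \<partial>\<mu>) \<le> 32 * (\<Sum>I\<in>I'. (c I)\<^sup>2)"
    "\<And>y l l'. ((\<Sum>I\<in>{I\<in>I'. l \<le> level I}. c I * h I y) - (\<Sum>I\<in>{I\<in>I'. l' \<le> level I}. c I * h I y))\<^sup>2 \<le> M y"
    using haar_maximal_square[OF I'D, of c] by blast
  let ?X = "\<lambda>V. {K\<in>{K\<in>D. parent K \<in> II}. V \<subseteq> K \<and> K \<subseteq> k V \<and> parent K \<in> I'}"
  have pt: "(\<Sum>K\<in>?X V. a K)\<^sup>2 \<le> M y" if V: "(V, R) \<in> N" and y: "y \<in> V" for V R y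
  proof (cases "V \<subseteq> k V")
    case True
    have VD: "V \<in> D" "k V \<in> D" using VR[OF V] by auto
    \<comment> \<open>Parents sit one level up: \<open>V \<subseteq> K\<close> gives parents of
      level at least \<open>level V + 1\<close>, and \<open>K \<subseteq> k V\<close> excludes those
      of level \<open>level (k V) + 2\<close> or more.\<close>
    let ?F1 = "{I\<in>I'. level V + 1 \<le> level I}" and ?F2 = "{I\<in>I'. level (k V) + 2 \<le> level I}"
    have "inj_on parent (?X V)"
    proof (rule inj_onI)
      fix K K' assume *: "K \<in> ?X V" "K' \<in> ?X V" "parent K = parent K'"
      then have "level K = level K'" using parent(3)[of K] parent(3)[of K'] by auto
      then show "K = K'" using same_level[of K K' y] * y by auto
    qed
    moreover have "a K = c (parent K) * h (parent K) y" if K: "K \<in> ?X V" for K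
    proof -
      have "h (parent K) (Inf K) = h (parent K) y"
        using haar_const[of K "parent K" "Inf K" y] child_parent[of K] parent(1)[of K] Inf_in[of K] K y by blast
      then show ?thesis using a[of K] K by simp
    qed
    ultimately have "(\<Sum>K\<in>?X V. a K) = (\<Sum>I\<in>parent ` ?X V. c I * h I y)"
      by (simp add: sum.reindex)
    also have "\<dots> = (\<Sum>I\<in>?F1 - ?F2. c I * h I y)"
    proof (rule sum.mono_neutral_left)
      show "finite (?F1 - ?F2)" using I'D by simp
      show "parent ` ?X V \<subseteq> ?F1 - ?F2"
      proof
        fix I assume "I \<in> parent ` ?X V"
        then obtain K where K: "K \<in> D" "V \<subseteq> K" "K \<subseteq> k V" "parent K \<in> I'" "I = parent K" by auto
        then show "I \<in> ?F1 - ?F2" using level_mono[of K V] level_mono[of "k V" K] VD parent(3)[of K] by auto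
      qed
      show "\<forall>I\<in>?F1 - ?F2 - parent ` ?X V. c I * h I y = 0"
      proof (intro ballI, rule ccontr)
        fix I assume I: "I \<in> ?F1 - ?F2 - parent ` ?X V" and "c I * h I y \<noteq> 0"
        then have ID: "I \<in> D" "I \<in> I'" "I \<in> II" "y \<in> I" using haar_outside[of I y] I' I'D by auto
        have "V \<subseteq> I" using nested_level[of I V y] ID VD y I by auto
        moreover have "V \<noteq> I" using I by auto
        ultimately have "V \<subset> I" by blast
        note K = child_containing[OF ID(1) VD(1) this]
        let ?K = "child_containing I V"
        have "?K \<subseteq> k V"
          using nested_level[of "k V" ?K y] parent(3)[OF K(1)] K VD I subsetD[OF True y] subsetD[OF K(2) y] by auto
        then have "?K \<in> ?X V" using K ID by simp
        then show False using I K(3) by (metis (no_types, lifting) DiffD2 imageI)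
      qed
    qed
    also have "\<dots> = (\<Sum>I\<in>?F1. c I * h I y) - (\<Sum>I\<in>?F2. c I * h I y)"
      using I'D level_mono[OF VD(2,1) True] by (intro sum_diff) auto
    finally show ?thesis using M(4)[where y = y and l = "level V + 1" and l' = "level (k V) + 2"] by simp
  next
    case False
    then have e: "?X V = {}" by blast
    show ?thesis unfolding e using M(2)[of y] by simp
  qed
  have RD: "snd n \<in> D" if "n \<in> N" for n using VR[of "fst n" "snd n"] that by simp
  have iR: "integrable \<mu> (\<lambda>y. M y * indicator R y)" if "R \<in> D" for R
    using integrable_real_mult_indicator[of R \<mu> M] M(1) D_borel[OF that] by (simp add: mult.commute)
  have "(\<Sum>(V, R)\<in>N. (\<Sum>K\<in>?X V. a K)\<^sup>2 * measure \<mu> R) \<le> (\<Sum>n\<in>N. \<integral>y. M y * indicator (snd n) y \<partial>\<mu>)"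
  proof (rule sum_mono, clarify)
    fix V R assume n: "(V, R) \<in> N"
    have R: "R \<in> D" "R \<subseteq> V" using VR[OF n] by auto
    have "(\<Sum>K\<in>?X V. a K)\<^sup>2 * measure \<mu> R = (\<integral>y. (\<Sum>K\<in>?X V. a K)\<^sup>2 * indicator R y \<partial>\<mu>)"
      using indicator_integrable[OF R(1)] by simp
    also have "\<dots> \<le> (\<integral>y. M y * indicator R y \<partial>\<mu>)"
    proof (rule integral_mono)
      show "integrable \<mu> (\<lambda>y. (\<Sum>K\<in>?X V. a K)\<^sup>2 * indicator R y)" using indicator_integrable[OF R(1)] by simp
      show "(\<Sum>K\<in>?X V. a K)\<^sup>2 * indicator R y \<le> M y * indicator R y" for y
        using pt[OF n, of y] R(2) by (cases "y \<in> R") auto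
    qed (rule iR[OF R(1)])
    finally show "(\<Sum>K\<in>?X V. a K)\<^sup>2 * measure \<mu> R \<le> (\<integral>y. M y * indicator (snd (V, R)) y \<partial>\<mu>)" by simp
  qed
  also have "\<dots> = (\<integral>y. (\<Sum>n\<in>N. M y * indicator (snd n) y) \<partial>\<mu>)"
    using iR RD by (intro Bochner_Integration.integral_sum[symmetric]) auto
  also have "\<dots> \<le> (\<integral>y. M y \<partial>\<mu>)"
  proof (rule integral_mono)
    show "integrable \<mu> (\<lambda>y. \<Sum>n\<in>N. M y * indicator (snd n) y)" using iR RD by auto
    fix y
    have "(\<Sum>n\<in>N. indicator (snd n) y) \<le> (1::real)"
    proof (cases "\<exists>n\<in>N. y \<in> snd n")
      case True
      then obtain n where n: "n \<in> N" "y \<in> snd n" by blast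
      have "n' = n" if n': "n' \<in> N" "y \<in> snd n'" for n'
      proof (rule prod_eqI)
        have "fst n' = fst n \<and> snd n' = snd n"
        proof (rule disj)
          show "snd n' \<inter> snd n \<noteq> {}" using n(2) n'(2) by blast
        qed (use n(1) n'(1) in simp_all)
        then show "fst n' = fst n" "snd n' = snd n" by simp_all
      qed
      note uniq = this
      have "(\<Sum>n'\<in>N. indicator (snd n') y) = (\<Sum>n'\<in>N. if n' = n then 1 else 0 :: real)"
      proof (rule sum.cong[OF refl])
        fix n' assume "n' \<in> N"
        then show "indicator (snd n') y = (if n' = n then 1 else 0 :: real)"
          using uniq[of n'] n(2) by (cases "y \<in> snd n'") auto
      qed
      then show ?thesis using N n by simp
    next
      case False
      then have "(\<Sum>n\<in>N. indicator (snd n) y) = (0::real)" by (intro sum.neutral) simp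
      then show ?thesis by simp
    qed
    then have "M y * (\<Sum>n\<in>N. indicator (snd n) y) \<le> M y * 1" using M(2) by (intro mult_left_mono) auto
    then show "(\<Sum>n\<in>N. M y * indicator (snd n) y) \<le> M y" by (simp add: sum_distrib_left)
  qed (rule M(1))
  finally show ?thesis using M(3) by linarith
qed

end

section \<open>The stopping part of the form\<close>

lemma (in dyadic) mem_D: "J \<in> D \<Longrightarrow> x \<in> J \<longleftrightarrow> Inf J \<le> x \<and> x < Inf J + len J"
  using D_eq[of J] by (metis atLeastLessThan_iff)

text \<open>The setting with a real \<open>H\<close> in place of the extended constant;
  \<open>corona_exists\<close> supplies it for every \<open>H\<close> above that constant. The
  \<open>energy\<close> assumption negates the stopping inequality at every \<open>R\<close>
  strictly inside \<open>I0\<close> that lies in no member of \<open>SS\<close>.\<close>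

locale corona = good_dyadic D \<theta> r + sig: dyadic_weight D \<sigma> + wt: dyadic_weight D w
  for D \<theta> r \<sigma> w +
  fixes H C0 \<epsilon> \<delta> :: real and I0 :: "real set" and SS :: "real set set" and f :: "real \<Rightarrow> real"
  assumes H: "0 < H" and C0: "0 < C0" and eps: "0 < \<epsilon>" "\<epsilon> < \<delta>" and I0: "I0 \<in> D" and SS: "SS \<subseteq> D"
    and testing: "\<And>B. B \<in> D \<Longrightarrow>
      (\<integral>x. indicator B x * (sig.conv (hard \<epsilon> \<delta>) (indicator B) x)\<^sup>2 \<partial>w) \<le> H\<^sup>2 * measure \<sigma> B"
    and A2: "\<And>u v. u < v \<Longrightarrow> measure \<sigma> {u..v} * measure w {u..v} \<le> H\<^sup>2 * (v - u)\<^sup>2"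
    and energy: "\<And>R. R \<in> D \<Longrightarrow> R \<subset> I0 \<Longrightarrow> \<not> (\<exists>S\<in>SS. R \<subseteq> S) \<Longrightarrow>
      (poisson (restrict_meas \<sigma> I0) R)\<^sup>2 * energy_sq w R * emeasure w R \<le> ennreal (10 * C0 * H\<^sup>2 * measure \<sigma> R)"
    and f_zero: "L2_zero I0 \<sigma> f" and f_good: "good_function D \<theta> r \<sigma> f"
    and f_avg: "\<And>K. K \<in> D \<Longrightarrow> \<not> (\<exists>S\<in>SS. K \<subseteq> S) \<Longrightarrow> avg \<sigma> K (\<lambda>x. \<bar>f x\<bar>) \<le> 1"
begin

text \<open>The constant value on \<open>K\<close> of the martingale difference of \<open>f\<close>
  at the parent; \<open>Inf K\<close> is merely a point of \<open>K\<close>.\<close>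

definition a :: "real set \<Rightarrow> real" where
  "a K = ip \<sigma> f (haar \<sigma> (parent K)) * haar \<sigma> (parent K) (Inf K)"

definition far :: "real set \<Rightarrow> real set \<Rightarrow> bool" where
  "far K J \<longleftrightarrow> J \<subseteq> K \<and> level J + int (2 * r + 4) \<le> level K"

definition smooth :: "real \<Rightarrow> real" where
  "smooth t = psi \<epsilon> t - psi \<delta> t"

text \<open>A Poisson integral with the length factor removed: seen from distance \<open>d\<close>,
  the kernel has on \<open>J\<close> a Lipschitz constant of order 1 / d^2. Being additive in
  \<open>B\<close>, it yields the increment bound that summation by parts requires.\<close>

definition tail :: "real set \<Rightarrow> real set \<Rightarrow> real" where
  "tail B J = (\<integral>y. indicator B y / (infdist y J)\<^sup>2 \<partial>\<sigma>)"

definition pairing :: "real set \<Rightarrow> real set \<Rightarrow> real" where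
  "pairing B J = ip w (sig.conv smooth (indicator B)) (haar w J)"

definition admissible :: "real set set \<Rightarrow> bool" where
  "admissible JJ \<longleftrightarrow> finite JJ \<and> (\<forall>J\<in>JJ. good J \<and> (\<forall>S\<in>SS. \<not> deeply_inside r J S))"

lemma bker_smooth: "sig.bker smooth"
proof -
  have "\<bar>smooth t\<bar> \<le> 1 / \<epsilon> + 1 / \<delta>" for t
    using psi_bound[of \<epsilon> t] psi_bound[of \<delta> t] eps unfolding smooth_def by linarith
  moreover have "smooth \<in> borel_measurable borel" unfolding smooth_def[abs_def] by measurable
  ultimately show ?thesis unfolding sig.bker_def by blast
qed

lemma tail_bsupp:
  assumes B: "B \<in> sets borel" "B \<subseteq> I0" and d: "0 < d" "\<And>y. y \<in> B \<Longrightarrow> d \<le> infdist y J"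
  shows "sig.bsupp (\<lambda>y. indicator B y / (infdist y J)\<^sup>2)"
  unfolding sig.bsupp_def
proof (intro conjI exI allI impI)
  have [measurable]: "(\<lambda>y. infdist y J) \<in> borel_measurable borel"
    by (intro borel_measurable_continuous_onI continuous_on_infdist continuous_on_id)
  show "(\<lambda>y. indicator B y / (infdist y J)\<^sup>2) \<in> borel_measurable borel" using B by measurable
  show "bounded I0" by (rule sig.D_bounded[OF I0])
  show "indicator B y / (infdist y J)\<^sup>2 = 0" if "y \<notin> I0" for y using that B by (auto simp: indicator_def)
  show "\<bar>indicator B y / (infdist y J)\<^sup>2\<bar> \<le> 1 / d\<^sup>2" for y
  proof (cases "y \<in> B")
    case True
    have "1 / (infdist y J)\<^sup>2 \<le> 1 / d\<^sup>2"
      using d(2)[OF True] d(1) by (intro divide_left_mono power_mono mult_pos_pos) auto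
    then show ?thesis using True by simp
  qed simp
qed

text \<open>For \<open>y\<close> in \<open>B\<close> the smooth kernel is Lipschitz in the variable
  from \<open>J\<close>, with constant 2 / d^2 for either of its two cutoffs; hence the 4.\<close>

lemma pairing_bound:
  assumes J: "J \<in> D" and B: "B \<in> sets borel" "B \<subseteq> I0" and d: "0 < d" "\<And>y. y \<in> B \<Longrightarrow> d \<le> infdist y J"
  shows "\<bar>pairing B J\<bar> \<le> 4 * wt.moment J * tail B J"
proof -
  let ?c = "Inf J + len J / 2"
  have bB: "sig.bsupp (indicator B)" using B bounded_subset[OF sig.D_bounded[OF I0]] by (intro sig.bsupp_indicator) auto
  have cJ: "?c \<in> J" using len_pos[OF J] by (simp add: mem_D[OF J])
  have "\<bar>sig.conv smooth (indicator B) x - sig.conv smooth (indicator B) ?c\<bar> \<le> (4 * tail B J) * \<bar>x - ?c\<bar>" if x: "x \<in> J" for x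
  proof -
    have eq: "sig.conv smooth (indicator B) x - sig.conv smooth (indicator B) ?c
        = (\<integral>y. indicator B y * smooth (y - x) - indicator B y * smooth (y - ?c) \<partial>\<sigma>)"
      unfolding sig.conv_def
      by (rule Bochner_Integration.integral_diff[symmetric]) (rule sig.conv_integrable[OF bB bker_smooth])+
    have "\<bar>sig.conv smooth (indicator B) x - sig.conv smooth (indicator B) ?c\<bar>
        \<le> (\<integral>y. \<bar>indicator B y * smooth (y - x) - indicator B y * smooth (y - ?c)\<bar> \<partial>\<sigma>)"
      unfolding eq by (rule integral_abs_bound)
    also have "\<dots> \<le> (\<integral>y. 4 * \<bar>x - ?c\<bar> * (indicator B y / (infdist y J)\<^sup>2) \<partial>\<sigma>)"
    proof (rule integral_mono)
      show "integrable \<sigma> (\<lambda>y. \<bar>indicator B y * smooth (y - x) - indicator B y * smooth (y - ?c)\<bar>)"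
        by (intro integrable_abs Bochner_Integration.integrable_diff sig.conv_integrable[OF bB bker_smooth])
      show "integrable \<sigma> (\<lambda>y. 4 * \<bar>x - ?c\<bar> * (indicator B y / (infdist y J)\<^sup>2))"
        by (intro integrable_mult_right sig.bsupp_integrable tail_bsupp[OF B d])
      fix y
      show "\<bar>indicator B y * smooth (y - x) - indicator B y * smooth (y - ?c)\<bar>
          \<le> 4 * \<bar>x - ?c\<bar> * (indicator B y / (infdist y J)\<^sup>2)"
      proof (cases "y \<in> B")
        case True
        let ?d = "infdist y J"
        have dpos: "0 < ?d" using d(2)[OF True] d(1) by linarith
        have dx: "?d \<le> \<bar>y - x\<bar>" "?d \<le> \<bar>y - ?c\<bar>" using infdist_le_abs x cJ by auto
        have "y \<notin> J" using dpos infdist_zero[of y J] by auto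
        then have "y < Inf J \<or> Inf J + len J \<le> y" unfolding mem_D[OF J] by linarith
        moreover have "Inf J \<le> x" "x < Inf J + len J" "Inf J \<le> ?c" "?c < Inf J + len J"
          using x cJ unfolding mem_D[OF J] by simp_all
        \<comment> \<open>\<open>J\<close> is an interval and \<open>y\<close> lies outside it, so
          both differences have the same sign and the singularity is not crossed.\<close>
        ultimately have side: "(?d \<le> y - x \<and> ?d \<le> y - ?c) \<or> (y - x \<le> - ?d \<and> y - ?c \<le> - ?d)"
          using dx by linarith
        have "\<bar>smooth (y - x) - smooth (y - ?c)\<bar> \<le> \<bar>psi \<epsilon> (y - x) - psi \<epsilon> (y - ?c)\<bar> + \<bar>psi \<delta> (y - x) - psi \<delta> (y - ?c)\<bar>"
          unfolding smooth_def by linarith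
        also have "\<dots> \<le> 2 / ?d\<^sup>2 * \<bar>(y - x) - (y - ?c)\<bar> + 2 / ?d\<^sup>2 * \<bar>(y - x) - (y - ?c)\<bar>"
          using eps dpos side by (intro add_mono psi_lipschitz) auto
        also have "\<dots> = 4 * \<bar>x - ?c\<bar> * (1 / ?d\<^sup>2)" by (simp add: abs_minus_commute)
        finally show ?thesis using True by simp
      qed simp
    qed
    also have "\<dots> = (4 * tail B J) * \<bar>x - ?c\<bar>"
      unfolding tail_def by (subst Bochner_Integration.integral_mult_right_zero) (simp only: mult_ac)
    finally show ?thesis .
  qed
  then have "\<bar>ip w (sig.conv smooth (indicator B)) (haar w J)\<bar> \<le> (4 * tail B J) * wt.moment J"
    using sig.conv_bker[OF bB bker_smooth] by (intro wt.lipschitz_pairing[OF J]) auto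
  then show ?thesis by (simp add: pairing_def mult_ac)
qed

lemma far_gap:
  assumes "good J" "K \<in> D" "far K J" "y \<notin> K"
  shows "len J \<le> infdist y J"
proof (rule infdist_ge)
  have JD: "J \<in> D" using good_D[OF assms(1)] .
  show "J \<noteq> {}" using D_ne[OF JD] .
  fix x assume x: "x \<in> J"
  have "sqrt (2 ^ (2 * r + 4)) * len J \<le> \<bar>x - y\<bar>"
    using assms x by (intro good_dist[of _ K]) (auto simp: far_def)
  moreover have "1 * len J \<le> sqrt (2 ^ (2 * r + 4)) * len J"
    using len_pos[OF JD] by (intro mult_right_mono) auto
  ultimately show "len J \<le> \<bar>y - x\<bar>" by linarith
qed

text \<open>Both quantities are additive in the set, so the claim is \<open>pairing_bound\<close>
  for \<open>K' - K\<close>.\<close>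

lemma tail_diff:
  assumes "good J" "K \<in> D" "K' \<in> D" "K \<subseteq> K'" "K' \<subseteq> I0" "far K J"
  shows "\<bar>pairing (I0 - K) J - pairing (I0 - K') J\<bar> \<le> 4 * wt.moment J * tail (I0 - K) J - 4 * wt.moment J * tail (I0 - K') J"
proof -
  have JD: "J \<in> D" using good_D[OF assms(1)] .
  have [simp]: "I0 - K \<in> sets borel" "I0 - K' \<in> sets borel" "K' - K \<in> sets borel"
    using sig.D_borel I0 assms by auto
  have gap: "len J \<le> infdist y J" if "y \<notin> K" for y using far_gap[OF assms(1,2,6) that] .
  have bs: "sig.bsupp (indicator (I0 - K))" "sig.bsupp (indicator (I0 - K'))" "sig.bsupp (indicator (K' - K))"
    using bounded_subset[OF sig.D_bounded[OF I0]] assms by (auto intro!: sig.bsupp_indicator)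
  have ind: "indicator (I0 - K) y = (indicator (I0 - K') y + indicator (K' - K) y :: real)" for y
    using assms by (auto simp: indicator_def)
  have conv: "sig.conv smooth (indicator (I0 - K)) x = sig.conv smooth (indicator (I0 - K')) x + sig.conv smooth (indicator (K' - K)) x" for x
    unfolding sig.conv_def ind distrib_right
    by (intro Bochner_Integration.integral_add sig.conv_integrable[OF bs(2) bker_smooth] sig.conv_integrable[OF bs(3) bker_smooth])
  have bk: "wt.bker (sig.conv smooth (indicator B))" if "sig.bsupp (indicator B)" for B
    by (rule sig.conv_bker[OF that bker_smooth])
  have "pairing (I0 - K) J = pairing (I0 - K') J + pairing (K' - K) J"
    unfolding pairing_def ip_def conv distrib_right
    by (intro Bochner_Integration.integral_add wt.bker_haar_integrable[OF bk[OF bs(2)] JD] wt.bker_haar_integrable[OF bk[OF bs(3)] JD])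
  moreover have "tail (I0 - K) J = tail (I0 - K') J + tail (K' - K) J"
  proof -
    have t: "sig.bsupp (\<lambda>y. indicator B y / (infdist y J)\<^sup>2)" if "B \<in> sets borel" "B \<subseteq> I0" "B \<inter> K = {}" for B
      using gap that len_pos[OF JD] by (intro tail_bsupp[of _ "len J"]) auto
    have "integrable \<sigma> (\<lambda>y. indicator (I0 - K') y / (infdist y J)\<^sup>2)" "integrable \<sigma> (\<lambda>y. indicator (K' - K) y / (infdist y J)\<^sup>2)"
      by (rule sig.bsupp_integrable[OF t]; use assms in auto)+
    then show ?thesis unfolding tail_def ind add_divide_distrib by simp
  qed
  moreover have "\<bar>pairing (K' - K) J\<bar> \<le> 4 * wt.moment J * tail (K' - K) J"
    using gap assms len_pos[OF JD] by (intro pairing_bound[OF JD, of _ "len J"]) auto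
  ultimately show ?thesis by (simp add: algebra_simps)
qed

lemma tail_nonneg: "0 \<le> tail B J"
  unfolding tail_def by (intro integral_nonneg_AE) auto

text \<open>Off \<open>K\<close> the Whitney condition gives dist(y, R) >= |R|, and dist(y, R) <=
  dist(y, J) because \<open>J\<close> lies in \<open>R\<close>. Hence |R| / (|R|^2 + dist(y, R)^2)
  is at least half of |R| / dist(y, J)^2.\<close>

lemma poisson_ge_tail:
  assumes J: "good J" and K: "K \<in> D" "K \<subseteq> I0" "far K J"
  shows "ennreal (tail (I0 - K) J * len (whit K J) / 2) \<le> poisson (restrict_meas \<sigma> I0) (whit K J)"
proof -
  let ?R = "whit K J"
  have R: "?R \<in> D" "J \<subseteq> ?R" "inner_set ?R K" using whit[OF J K(1)] K(3) by (auto simp: far_def)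
  have JD: "J \<in> D" using good_D[OF J] .
  have [measurable]: "I0 \<in> sets borel" using sig.D_borel I0 by auto
  have [measurable]: "(\<lambda>y. infdist y ?R) \<in> borel_measurable borel"
    by (intro borel_measurable_continuous_onI continuous_on_infdist continuous_on_id)
  have i: "integrable \<sigma> (\<lambda>y. indicator (I0 - K) y / (infdist y J)\<^sup>2)"
    using far_gap[OF J K(1,3)] len_pos[OF JD] sig.D_borel K(1) I0
    by (intro sig.bsupp_integrable tail_bsupp[of _ "len J"]) auto
  have "poisson (restrict_meas \<sigma> I0) ?R = (\<integral>\<^sup>+x. indicator I0 x * ennreal (len ?R / ((len ?R)\<^sup>2 + (infdist x ?R)\<^sup>2)) \<partial>\<sigma>)"
    unfolding poisson_def restrict_meas_def by (subst nn_integral_density) auto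
  moreover have "ennreal (tail (I0 - K) J * len ?R / 2) = (\<integral>\<^sup>+x. ennreal (indicator (I0 - K) x / (infdist x J)\<^sup>2 * (len ?R / 2)) \<partial>\<sigma>)"
  proof (subst nn_integral_eq_integral)
    show "integrable \<sigma> (\<lambda>x. indicator (I0 - K) x / (infdist x J)\<^sup>2 * (len ?R / 2))"
      by (rule integrable_mult_left[OF i])
    have e: "(\<integral>x. indicator (I0 - K) x / (infdist x J)\<^sup>2 * (len ?R / 2) \<partial>\<sigma>) = tail (I0 - K) J * (len ?R / 2)"
      unfolding tail_def by (rule Bochner_Integration.integral_mult_left_zero)
    show "ennreal (tail (I0 - K) J * len ?R / 2) = ennreal (\<integral>x. indicator (I0 - K) x / (infdist x J)\<^sup>2 * (len ?R / 2) \<partial>\<sigma>)"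
      unfolding e by simp
  qed (use len_pos[OF R(1)] in auto)
  moreover have "(\<integral>\<^sup>+x. ennreal (indicator (I0 - K) x / (infdist x J)\<^sup>2 * (len ?R / 2)) \<partial>\<sigma>)
      \<le> (\<integral>\<^sup>+x. indicator I0 x * ennreal (len ?R / ((len ?R)\<^sup>2 + (infdist x ?R)\<^sup>2)) \<partial>\<sigma>)"
  proof (rule nn_integral_mono)
    fix y
    show "ennreal (indicator (I0 - K) y / (infdist y J)\<^sup>2 * (len ?R / 2)) \<le> indicator I0 y * ennreal (len ?R / ((len ?R)\<^sup>2 + (infdist y ?R)\<^sup>2))"
    proof (cases "y \<in> I0 - K")
      case True
      have p: "0 < len ?R" by (rule len_pos[OF R(1)])
      have d: "len ?R \<le> infdist y ?R"
        using R(3) True D_ne[OF R(1)] by (intro infdist_ge) (auto simp: inner_set_def abs_minus_commute)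
      have d': "infdist y ?R \<le> infdist y J" by (rule infdist_mono[OF R(2) D_ne[OF JD]])
      have "(len ?R)\<^sup>2 + (infdist y ?R)\<^sup>2 \<le> (infdist y J)\<^sup>2 + (infdist y J)\<^sup>2"
        using p d d' by (intro add_mono power_mono) auto
      then have "len ?R / (2 * (infdist y J)\<^sup>2) \<le> len ?R / ((len ?R)\<^sup>2 + (infdist y ?R)\<^sup>2)"
        using p d d' by (intro divide_left_mono mult_pos_pos add_pos_nonneg) auto
      then show ?thesis using True by (auto intro!: ennreal_leI simp: mult.commute)
    qed simp
  qed
  ultimately show ?thesis by simp
qed

text \<open>Every point off \<open>K\<close> is at least |R| away from the common Whitney interval
  \<open>R\<close>, whereas moving within \<open>R\<close> costs at most |R|. So the distances to
  \<open>J\<close> and \<open>J'\<close> differ by a factor at most 2, whose square is 4.\<close>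

lemma tail_compare:
  assumes J: "good J" and J': "good J'" and K: "K \<in> D" "K \<subseteq> I0" "far K J" "far K J'"
    and eq: "whit K J = whit K J'"
  shows "tail (I0 - K) J \<le> 4 * tail (I0 - K) J'"
proof -
  let ?R = "whit K J"
  have R: "?R \<in> D" "J \<subseteq> ?R" "inner_set ?R K" using whit[OF J K(1)] K(3) by (auto simp: far_def)
  have R': "J' \<subseteq> ?R" using whit(2)[OF J' K(1)] K(4) eq by (auto simp: far_def)
  have JD: "J \<in> D" "J' \<in> D" using good_D J J' by auto
  have i: "integrable \<sigma> (\<lambda>y. indicator (I0 - K) y / (infdist y J)\<^sup>2)" "integrable \<sigma> (\<lambda>y. indicator (I0 - K) y / (infdist y J')\<^sup>2)"
    using far_gap[OF J K(1,3)] far_gap[OF J' K(1,4)] len_pos JD sig.D_borel K(1) I0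
    by (auto intro!: sig.bsupp_integrable intro: tail_bsupp[of _ "len J"] tail_bsupp[of _ "len J'"])
  have "tail (I0 - K) J \<le> (\<integral>y. 4 * (indicator (I0 - K) y / (infdist y J')\<^sup>2) \<partial>\<sigma>)"
    unfolding tail_def
  proof (rule integral_mono[OF i(1)])
    show "integrable \<sigma> (\<lambda>y. 4 * (indicator (I0 - K) y / (infdist y J')\<^sup>2))" by (rule integrable_mult_right[OF i(2)])
    fix y
    show "indicator (I0 - K) y / (infdist y J)\<^sup>2 \<le> 4 * (indicator (I0 - K) y / (infdist y J')\<^sup>2)"
    proof (cases "y \<in> I0 - K")
      case True
      obtain z where z: "z \<in> J" using D_ne[OF JD(1)] by blast
      have "infdist y J' \<le> 2 * infdist y J"
      proof -
        have "infdist y J' / 2 \<le> infdist y J"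
        proof (rule infdist_ge[OF D_ne[OF JD(1)]])
          fix x assume x: "x \<in> J"
          have "len ?R \<le> \<bar>x - y\<bar>" using R x True by (auto simp: inner_set_def)
          moreover obtain z' where z': "z' \<in> J'" using D_ne[OF JD(2)] by blast
          moreover have "\<bar>x - z'\<bar> \<le> len ?R"
            using subsetD[OF R(2) x] subsetD[OF R' z'] unfolding mem_D[OF R(1)] by linarith
          moreover have "infdist y J' \<le> \<bar>y - z'\<bar>" by (rule infdist_le_abs[OF z'])
          ultimately show "infdist y J' / 2 \<le> \<bar>y - x\<bar>" by linarith
        qed
        then show ?thesis by simp
      qed
      then have "(infdist y J')\<^sup>2 \<le> (2 * infdist y J)\<^sup>2" by (intro power_mono infdist_nonneg)
      moreover have "0 < infdist y J" "0 < infdist y J'"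
        using far_gap[OF J K(1,3), of y] far_gap[OF J' K(1,4), of y] True len_pos[OF JD(1)] len_pos[OF JD(2)] by auto
      ultimately have "1 / (infdist y J)\<^sup>2 \<le> 4 / (infdist y J')\<^sup>2"
        by (simp add: divide_le_eq le_divide_eq power_mult_distrib mult.commute)
      then show ?thesis using True by simp
    qed simp
  qed
  also have "\<dots> = 4 * tail (I0 - K) J'"
    unfolding tail_def by (rule Bochner_Integration.integral_mult_right_zero)
  finally show ?thesis .
qed

text \<open>If such an \<open>R\<close> were inside some \<open>S\<close>, then \<open>J\<close>
  would be deeply inside \<open>S\<close>, against weak adaptedness. This is how uniformity, stated
  for intervals outside the \<open>S\<close>, becomes available at ancestors of
  \<open>J\<close>.\<close>

lemma not_in_SS:
  assumes "admissible JJ" "J \<in> JJ" "J \<subseteq> R" "R \<in> D" "level J + int r \<le> level R"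
  shows "\<not> (\<exists>S\<in>SS. R \<subseteq> S)"
proof
  assume "\<exists>S\<in>SS. R \<subseteq> S"
  then obtain S where S: "S \<in> SS" "R \<subseteq> S" by blast
  have JD: "J \<in> D" using assms good_D by (auto simp: admissible_def)
  have "level R \<le> level S" using S SS assms by (intro level_mono) auto
  then have "2 ^ r * len J \<le> len S" using len_level_iff[OF JD, of S r] S SS assms by auto
  then have "deeply_inside r J S" using S assms by (auto simp: deeply_inside_def)
  then show False using assms S by (auto simp: admissible_def)
qed

text \<open>The tails are compared with the Poisson integral at \<open>R\<close>, the moments with
  its energy, and the stopping inequality fails at \<open>R\<close>. The factor is 640 = 16 * 4 *
  10, from the 4 in the majorant, the 1/2 in \<open>poisson_ge_tail\<close> and the stopping
  threshold.\<close>

lemma size_bound: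
  assumes adm: "admissible JJ" and K: "K \<in> D" "K \<subset> I0"
  shows "(\<Sum>J\<in>{J\<in>JJ. far K J \<and> whit K J = R}. (4 * wt.moment J * tail (I0 - K) J)\<^sup>2) \<le> 640 * C0 * H\<^sup>2 * measure \<sigma> R"
proof (cases "{J\<in>JJ. far K J \<and> whit K J = R} = {}")
  case True
  show ?thesis unfolding True using C0 by (simp add: measure_nonneg)
next
  case False
  let ?F = "{J\<in>JJ. far K J \<and> whit K J = R}"
  obtain J0 where J0: "J0 \<in> JJ" "far K J0" "whit K J0 = R" using False by blast
  have g: "good J" if "J \<in> JJ" for J using that adm by (auto simp: admissible_def)
  note W = whit[OF g[OF J0(1)] K(1)]
  have R: "R \<in> D" "R \<subseteq> K" "J0 \<subseteq> R" "level J0 + int r \<le> level R" using W J0 by (auto simp: far_def)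
  have fin: "finite ?F" using adm by (auto simp: admissible_def)
  have FD: "?F \<subseteq> D" using g good_D by auto
  have FR: "J \<subseteq> R" if "J \<in> ?F" for J using that whit(2)[OF g[of J] K(1)] by (auto simp: far_def)
  let ?P = "poisson (restrict_meas \<sigma> I0) R"
  define m where "m = Max ((\<lambda>J. tail (I0 - K) J) ` ?F)"
  have "m \<in> (\<lambda>J. tail (I0 - K) J) ` ?F" unfolding m_def using fin False by (intro Max_in) auto
  then obtain J1 where J1: "J1 \<in> ?F" "m = tail (I0 - K) J1" by blast
  have mx: "tail (I0 - K) J \<le> m" if "J \<in> ?F" for J unfolding m_def using fin that by (intro Max_ge) auto
  have m0: "0 \<le> m" using J1 tail_nonneg by simp
  have lp: "0 < len R" by (rule len_pos[OF R(1)])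
  have P: "ennreal (m * len R / 2) \<le> ?P"
    using poisson_ge_tail[of J1 K] J1 g K by auto
  have E: "ennreal ((\<Sum>J\<in>?F. (wt.moment J)\<^sup>2) / (len R)\<^sup>2) \<le> energy_sq w R * emeasure w R"
    by (rule wt.moment_sum_energy[OF fin FD FR R(1)])
  have "ennreal ((m * len R / 2)\<^sup>2 * ((\<Sum>J\<in>?F. (wt.moment J)\<^sup>2) / (len R)\<^sup>2))
      = (ennreal (m * len R / 2))\<^sup>2 * ennreal ((\<Sum>J\<in>?F. (wt.moment J)\<^sup>2) / (len R)\<^sup>2)"
    using m0 lp by (subst ennreal_mult) (auto simp: ennreal_power sum_nonneg)
  also have "\<dots> \<le> ?P\<^sup>2 * (energy_sq w R * emeasure w R)"
    using P E by (intro mult_mono power_mono) auto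
  also have "\<dots> \<le> ennreal (10 * C0 * H\<^sup>2 * measure \<sigma> R)"
    using energy[of R] R K not_in_SS[OF adm J0(1) R(3,1,4)] by (auto simp: mult.assoc)
  finally have "(m * len R / 2)\<^sup>2 * ((\<Sum>J\<in>?F. (wt.moment J)\<^sup>2) / (len R)\<^sup>2) \<le> 10 * C0 * H\<^sup>2 * measure \<sigma> R"
    using C0 by (subst (asm) ennreal_le_iff) auto
  moreover have "(m * len R / 2)\<^sup>2 * ((\<Sum>J\<in>?F. (wt.moment J)\<^sup>2) / (len R)\<^sup>2) = m\<^sup>2 / 4 * (\<Sum>J\<in>?F. (wt.moment J)\<^sup>2)"
    using lp by (simp add: power2_eq_square field_simps)
  ultimately have main: "m\<^sup>2 / 4 * (\<Sum>J\<in>?F. (wt.moment J)\<^sup>2) \<le> 10 * C0 * H\<^sup>2 * measure \<sigma> R" by linarith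
  have "(\<Sum>J\<in>?F. (4 * wt.moment J * tail (I0 - K) J)\<^sup>2) \<le> (\<Sum>J\<in>?F. 64 * (m\<^sup>2 / 4 * (wt.moment J)\<^sup>2))"
  proof (rule sum_mono)
    fix J assume J: "J \<in> ?F"
    have "(tail (I0 - K) J)\<^sup>2 \<le> m\<^sup>2" using mx[OF J] tail_nonneg by (intro power_mono)
    then have "16 * (wt.moment J)\<^sup>2 * (tail (I0 - K) J)\<^sup>2 \<le> 16 * (wt.moment J)\<^sup>2 * m\<^sup>2"
      by (intro mult_left_mono) auto
    then show "(4 * wt.moment J * tail (I0 - K) J)\<^sup>2 \<le> 64 * (m\<^sup>2 / 4 * (wt.moment J)\<^sup>2)"
      by (simp add: power_mult_distrib mult_ac)
  qed
  also have "\<dots> = 64 * (m\<^sup>2 / 4 * (\<Sum>J\<in>?F. (wt.moment J)\<^sup>2))" by (simp add: sum_distrib_left)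
  finally show ?thesis using main by linarith
qed

end

text \<open>Testing with \<open>b = Y\<close> converts a bound for the bilinear form into one for
  the square sum of the rows.\<close>

lemma l2_duality:
  fixes Y :: "'a \<Rightarrow> real"
  assumes "finite JJ" "0 \<le> B" "\<And>b. \<bar>\<Sum>J\<in>JJ. b J * Y J\<bar> \<le> B * sqrt (\<Sum>J\<in>JJ. (b J)\<^sup>2)"
  shows "(\<Sum>J\<in>JJ. (Y J)\<^sup>2) \<le> B\<^sup>2"
proof -
  let ?s = "\<Sum>J\<in>JJ. (Y J)\<^sup>2"
  have s0: "0 \<le> ?s" by (intro sum_nonneg) auto
  have "?s \<le> B * sqrt ?s" using assms(3)[of Y] s0 by (simp add: power2_eq_square)
  then have "sqrt ?s * sqrt ?s \<le> B * sqrt ?s" using s0 by simp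
  then have "sqrt ?s \<le> B \<or> sqrt ?s = 0" using s0 by (meson mult_right_le_imp_le not_le order_antisym real_sqrt_ge_zero)
  then have "sqrt ?s \<le> B" using assms(2) by auto
  then have "(sqrt ?s)\<^sup>2 \<le> B\<^sup>2" using s0 by (intro power_mono) auto
  then show ?thesis using s0 by simp
qed

section \<open>The coefficients of \<open>f\<close> and the application of the abstract form\<close>

context corona
begin

definition up :: "real set \<Rightarrow> real set set" where
  "up J = {K\<in>D. J \<subseteq> K \<and> K \<subset> I0}"

lemma finite_up: "J \<in> D \<Longrightarrow> finite (up J)"
  using finite_between[OF _ I0, of J] by (rule rev_finite_subset) (auto simp: up_def)

lemma f_L2: "L2 \<sigma> f"
  using f_zero by (simp add: L2_zero_def)

lemma f_norm_nonneg: "0 \<le> nrm \<sigma> f" "(nrm \<sigma> f)\<^sup>2 = ip \<sigma> f f"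
proof -
  have "0 \<le> ip \<sigma> f f" unfolding ip_def by (intro integral_nonneg_AE) auto
  then show "0 \<le> nrm \<sigma> f" "(nrm \<sigma> f)\<^sup>2 = ip \<sigma> f f" by (auto simp: nrm_def)
qed

lemma a_eq_on:
  assumes K: "K \<in> D" "x \<in> K"
  shows "ip \<sigma> f (haar \<sigma> (parent K)) * haar \<sigma> (parent K) x = a K"
proof -
  have "haar \<sigma> (parent K) x = haar \<sigma> (parent K) (Inf K)"
  proof (rule sig.haar_const)
    show "K \<inter> parent K = {} \<or> K \<subseteq> left_child (parent K) \<or> K \<subseteq> right_child (parent K)"
      using child_parent[OF K(1)] equalityD1 by blast
  qed (use K parent Inf_in in auto)
  then show ?thesis by (simp add: a_def)
qed

lemma a_not_good: "K \<in> D \<Longrightarrow> \<not> good (parent K) \<Longrightarrow> a K = 0"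
  using f_good parent(1)[of K] unfolding good_function_def haar_support_def a_def by auto

lemma a_square_le: "K \<in> D \<Longrightarrow> (a K)\<^sup>2 * measure \<sigma> K \<le> (ip \<sigma> f (haar \<sigma> (parent K)))\<^sup>2"
proof -
  assume K: "K \<in> D"
  let ?h = "haar \<sigma> (parent K)" and ?c = "ip \<sigma> f (haar \<sigma> (parent K))"
  have hh: "integrable \<sigma> (\<lambda>x. ?h x * ?h x)" using sig.haar_L2[OF parent(1)[OF K]] sig.L2_mult_integrable by blast
  have "(a K)\<^sup>2 * measure \<sigma> K = (\<integral>x. (a K)\<^sup>2 * indicator K x \<partial>\<sigma>)"
    using sig.indicator_integrable[OF K] by simp
  also have "\<dots> \<le> (\<integral>x. ?c\<^sup>2 * (?h x * ?h x) \<partial>\<sigma>)"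
  proof (rule integral_mono)
    show "integrable \<sigma> (\<lambda>x. (a K)\<^sup>2 * indicator K x)" using sig.indicator_integrable[OF K] by (rule integrable_mult_right)
    show "integrable \<sigma> (\<lambda>x. ?c\<^sup>2 * (?h x * ?h x))" using hh by (rule integrable_mult_right)
    show "(a K)\<^sup>2 * indicator K x \<le> ?c\<^sup>2 * (?h x * ?h x)" for x
    proof (cases "x \<in> K")
      case True
      then show ?thesis unfolding a_eq_on[OF K True, symmetric] by (simp add: power2_eq_square mult_ac)
    qed simp
  qed
  also have "\<dots> = ?c\<^sup>2 * ip \<sigma> ?h ?h" unfolding ip_def by (rule Bochner_Integration.integral_mult_right_zero)
  also have "\<dots> \<le> ?c\<^sup>2 * 1" using sig.haar_norm[OF parent(1)[OF K]] by (intro mult_left_mono) auto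
  finally show ?thesis by simp
qed

lemma a_square_sum_le:
  assumes "finite F" "F \<subseteq> D"
  shows "(\<Sum>K\<in>F. (a K)\<^sup>2 * measure \<sigma> K) \<le> 2 * (nrm \<sigma> f)\<^sup>2"
proof -
  let ?c = "\<lambda>I. (ip \<sigma> f (haar \<sigma> I))\<^sup>2"
  have "(\<Sum>K\<in>F. (a K)\<^sup>2 * measure \<sigma> K) \<le> (\<Sum>K\<in>F. ?c (parent K))"
    using a_square_le assms by (intro sum_mono) auto
  also have "\<dots> = (\<Sum>I\<in>parent ` F. \<Sum>K\<in>{K\<in>F. parent K = I}. ?c (parent K))"
    using assms by (intro sum.group[symmetric]) auto
  also have "\<dots> = (\<Sum>I\<in>parent ` F. real (card {K\<in>F. parent K = I}) * ?c I)"
    by (intro sum.cong refl) simp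
  also have "\<dots> \<le> (\<Sum>I\<in>parent ` F. 2 * ?c I)"
    using card_children_le[OF assms] by (intro sum_mono mult_right_mono) (auto simp: numeral_2_eq_2)
  also have "\<dots> = 2 * (\<Sum>I\<in>parent ` F. ?c I)" by (simp add: sum_distrib_left)
  also have "\<dots> \<le> 2 * ip \<sigma> f f"
    using assms parent f_L2 by (intro mult_left_mono sig.bessel) auto
  finally show ?thesis by (simp add: f_norm_nonneg)
qed

text \<open>
  Restricting the levels of \<open>I\<close> to one residue class mod \<open>r\<close> makes goodness separate consecutive
  intervals, so that the smaller one lies in a single Whitney interval of the larger one.
\<close>
lemma stopping_class:
  assumes adm: "admissible JJ"
  defines "II n \<equiv> {I\<in>D. good I \<and> I \<subseteq> I0 \<and> (\<exists>J\<in>JJ. J \<subseteq> I) \<and> level I mod int r = n}"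
  shows "\<bar>\<Sum>J\<in>JJ. b J * (\<Sum>K\<in>{K\<in>{K\<in>D. parent K \<in> II n}. far K J}. a K * pairing (I0 - K) J)\<bar>
    \<le> 2 ^ 15 * (sqrt (640 * C0 * H\<^sup>2) * nrm \<sigma> f * sqrt (\<Sum>J\<in>JJ. (b J)\<^sup>2))"
proof -
  let ?II = "II n"
  let ?KK = "{K\<in>D. parent K \<in> ?II}"
  have finJ: "finite JJ" and g: "\<And>J. J \<in> JJ \<Longrightarrow> good J" using adm by (auto simp: admissible_def)
  have finII: "finite ?II"
  proof (rule finite_subset)
    show "?II \<subseteq> (\<Union>J\<in>JJ. {K\<in>D. J \<subseteq> K \<and> K \<subseteq> I0})" by (auto simp: II_def)
    show "finite (\<Union>J\<in>JJ. {K\<in>D. J \<subseteq> K \<and> K \<subseteq> I0})" using finJ finite_between[OF _ I0] g good_D by auto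
  qed
  have IID: "?II \<subseteq> D" by (auto simp: II_def)
  have finKK: "finite ?KK"
  proof (rule finite_subset)
    show "?KK \<subseteq> left_child ` ?II \<union> right_child ` ?II"
    proof
      fix K assume "K \<in> ?KK"
      then have K: "K \<in> D" "parent K \<in> ?II" by auto
      from child_parent[OF K(1)] show "K \<in> left_child ` ?II \<union> right_child ` ?II"
      proof
        assume e: "K = left_child (parent K)"
        show ?thesis by (rule UnI1, rule image_eqI, rule e, rule K(2))
      next
        assume e: "K = right_child (parent K)"
        show ?thesis by (rule UnI2, rule image_eqI, rule e, rule K(2))
      qed
    qed
  qed (use finII in auto)
  have KK: "K \<in> D" "K \<subset> I0" "good (parent K)" "level (parent K) mod int r = n" if "K \<in> ?KK" for K
  proof -
    have "K \<in> D" "parent K \<in> ?II" using that by simp_all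
    then show "K \<in> D" "K \<subset> I0" "good (parent K)" "level (parent K) mod int r = n"
      using parent_psubset[of K] unfolding II_def by blast+
  qed
  have sep: "inner_set K' K" if K: "K \<in> ?KK" "K' \<in> ?KK" "K' \<subset> K" for K K'
  proof (rule separated)
    have lev: "level K' < level K" by (rule level_strict_mono[OF KK(1)[OF K(1)] KK(1)[OF K(2)] K(3)])
    have "(level K + 1) mod int r = (level K' + 1) mod int r"
      using KK(4)[OF K(1)] KK(4)[OF K(2)] by (simp add: parent(3)[OF KK(1)[OF K(1)]] parent(3)[OF KK(1)[OF K(2)]])
    then have "int r dvd (level K + 1) - (level K' + 1)" by (simp add: mod_eq_dvd_iff)
    then have "int r dvd level K - level K'" by simp
    then show "level K' + int r \<le> level K" using zdvd_imp_le[of "int r" "level K - level K'"] lev by auto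
  qed (use K KK(1)[OF K(1)] KK(1,3)[OF K(2)] in simp_all)
  have farD: "J \<in> D" "J \<subseteq> K" "level J + int (2 * r + 4) \<le> level K" if "J \<in> JJ" "far K J" for J K
    using that g good_D by (auto simp: far_def)
  interpret stopping_form ?KK JJ far whit D "\<lambda>J. 4 * wt.moment J" "\<lambda>K J. tail (I0 - K) J"
    "\<lambda>K J. pairing (I0 - K) J" "measure \<sigma>" a b parent "\<lambda>I. (ip \<sigma> f (haar \<sigma> I))\<^sup>2"
  proof
    show "finite ?KK" "finite JJ" by (rule finKK finJ)+
    show "K \<noteq> {}" if "K \<in> ?KK" for K using that D_ne by auto
    show "K \<subseteq> K' \<or> K' \<subseteq> K" if "K \<in> ?KK" "K' \<in> ?KK" "K \<inter> K' \<noteq> {}" for K K'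
      using nested[of K K'] that by auto
    show "K \<subseteq> K' \<or> K' \<subseteq> K" if "K \<in> ?KK" "K' \<in> ?KK" "J \<in> JJ" "far K J" "far K' J" for K K' J
    proof -
      have "Inf J \<in> K \<inter> K'" using farD(1,2)[OF that(3,4)] farD(2)[OF that(3,5)] Inf_in[of J] by blast
      then show ?thesis using nested[of K K'] that by auto
    qed
    show "far K' J" if "K \<in> ?KK" "K' \<in> ?KK" "J \<in> JJ" "far K J" "K \<subseteq> K'" for K K' J
      using that level_mono[of K' K] by (auto simp: far_def)
    show "whit K J = whit K J'" if "K \<in> ?KK" "J \<in> JJ" "J' \<in> JJ" "far K J" "far K J'" "whit K J \<inter> whit K J' \<noteq> {}" for K J J'
      using that g by (intro whit_disj) (auto simp: far_def)
    show "whit K J \<subseteq> K \<and> whit K J \<noteq> {} \<and> whit K J \<in> D" if "K \<in> ?KK" "J \<in> JJ" "far K J" for K J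
      using whit(1,3)[OF g[OF that(2)] KK(1)[OF that(1)] farD(2,3)[OF that(2,3)]] D_ne by auto
    show "K' \<subseteq> whit K J" if "K \<in> ?KK" "K' \<in> ?KK" "J \<in> JJ" "far K' J" "K' \<subset> K" for K K' J
    proof -
      have J: "J \<subseteq> K'" "J \<subseteq> K" "level J + int (2 * r + 4) \<le> level K"
        using farD[OF that(3,4)] that(5) level_mono[of K K'] KK(1)[OF that(1)] KK(1)[OF that(2)] by auto
      show ?thesis
        by (rule whit(5)[OF g[OF that(3)] KK(1)[OF that(1)] J(2,3) KK(1)[OF that(2)] J(1) _ sep[OF that(1,2,5)]])
          (use that in auto)
    qed
    show "0 \<le> 4 * wt.moment J" if "J \<in> JJ" for J using wt.moment_nonneg g[OF that] good_D by auto
    show "0 \<le> tail (I0 - K) J" for K J by (rule tail_nonneg)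
    show "tail (I0 - K) J \<le> 4 * tail (I0 - K) J'" if "K \<in> ?KK" "J \<in> JJ" "J' \<in> JJ" "far K J" "far K J'" "whit K J = whit K J'" for K J J'
      using that g KK(1,2)[OF that(1)] by (intro tail_compare) auto
    show "\<bar>pairing (I0 - K) J\<bar> \<le> 4 * wt.moment J * tail (I0 - K) J" if "K \<in> ?KK" "J \<in> JJ" "far K J" for K J
      using far_gap[OF g[OF that(2)] KK(1)[OF that(1)] that(3)] farD(1)[OF that(2,3)] len_pos sig.D_borel I0 KK(1)[OF that(1)]
      by (intro pairing_bound[of _ _ "len J"]) auto
    show "\<bar>pairing (I0 - K) J - pairing (I0 - K') J\<bar> \<le> 4 * wt.moment J * tail (I0 - K) J - 4 * wt.moment J * tail (I0 - K') J"
      if "K \<in> ?KK" "K' \<in> ?KK" "J \<in> JJ" "far K J" "K \<subseteq> K'" for K K' J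
      using that g KK(1,2)[OF that(2)] by (intro tail_diff) auto
    show "card {K\<in>?KK. parent K = i} \<le> 2" for i by (rule card_children_le[OF finKK]) auto
    show "(\<Sum>(V, R)\<in>N. (\<Sum>K\<in>{K\<in>?KK. V \<subseteq> K \<and> K \<subseteq> k V \<and> parent K \<in> I'}. a K)\<^sup>2 * measure \<sigma> R) \<le> 32 * (\<Sum>i\<in>I'. (ip \<sigma> f (haar \<sigma> i))\<^sup>2)"
      if "I' \<subseteq> parent ` ?KK" "finite N" "\<And>V R. (V, R) \<in> N \<Longrightarrow> V \<in> ?KK \<and> k V \<in> ?KK \<and> R \<in> D \<and> R \<subseteq> V"
        "\<And>V R V' R'. (V, R) \<in> N \<Longrightarrow> (V', R') \<in> N \<Longrightarrow> R \<inter> R' \<noteq> {} \<Longrightarrow> V = V' \<and> R = R'" for I' N k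
    proof (rule sig.maximal_nodes[OF finII IID _ that(2) _ that(4)])
      show "I' \<subseteq> ?II" using that(1) by auto
      show "V \<in> D \<and> k V \<in> D \<and> R \<in> D \<and> R \<subseteq> V" if "(V, R) \<in> N" for V R
        using \<open>\<And>V R. (V, R) \<in> N \<Longrightarrow> V \<in> ?KK \<and> k V \<in> ?KK \<and> R \<in> D \<and> R \<subseteq> V\<close>[OF that] by simp
      show "a K = ip \<sigma> f (haar \<sigma> (parent K)) * haar \<sigma> (parent K) (Inf K)" for K by (rule a_def)
    qed
  qed (auto simp: measure_nonneg)
  have "\<bar>form JJ ?KK\<bar> \<le> 2 ^ 15 * (sqrt (640 * C0 * H\<^sup>2) * sqrt (a_norm JJ ?KK) * sqrt (b_norm JJ))"
  proof (rule form_bound)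
    show "down_closed ?KK" by (auto simp: down_closed_def)
    show "0 \<le> 640 * C0 * H\<^sup>2" using C0 by simp
    show "size_le JJ ?KK (640 * C0 * H\<^sup>2)"
      unfolding size_le_def using size_bound[OF adm] KK(1,2) by blast
  qed simp
  moreover have "sqrt (a_norm JJ ?KK) \<le> nrm \<sigma> f"
  proof -
    have "a_norm JJ ?KK \<le> ip \<sigma> f f"
      unfolding a_norm_def
    proof (rule sig.bessel[OF _ _ f_L2])
      have sub: "parent ` occ JJ ?KK \<subseteq> ?II" by (auto simp: occ_def)
      then show "finite (parent ` occ JJ ?KK)" "parent ` occ JJ ?KK \<subseteq> D" using finII IID finite_subset by auto
    qed
    then show ?thesis unfolding nrm_def by (rule real_sqrt_le_mono)
  qed
  ultimately have "\<bar>form JJ ?KK\<bar> \<le> 2 ^ 15 * (sqrt (640 * C0 * H\<^sup>2) * nrm \<sigma> f * sqrt (b_norm JJ))"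
  proof -
    assume 1: "\<bar>form JJ ?KK\<bar> \<le> 2 ^ 15 * (sqrt (640 * C0 * H\<^sup>2) * sqrt (a_norm JJ ?KK) * sqrt (b_norm JJ))"
      and 2: "sqrt (a_norm JJ ?KK) \<le> nrm \<sigma> f"
    have "0 \<le> sqrt (640 * C0 * H\<^sup>2)" "0 \<le> sqrt (b_norm JJ)" using C0 by (auto simp: b_norm_def intro!: sum_nonneg)
    then show ?thesis using 1 2 by (meson mult_left_mono mult_right_mono order_trans zero_le_power zero_le_numeral)
  qed
  then show ?thesis by (simp add: form_def b_norm_def)
qed

definition far_sum :: "(real set \<Rightarrow> real) \<Rightarrow> real set \<Rightarrow> real" where
  "far_sum g J = (\<Sum>K\<in>{K\<in>up J. far K J}. a K * g K)"

text \<open>The residue classes are added by the triangle inequality, which gives the factor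
  \<open>real r\<close>.\<close>

lemma stopping_bound:
  assumes adm: "admissible JJ"
  shows "(\<Sum>J\<in>JJ. (far_sum (\<lambda>K. pairing (I0 - K) J) J)\<^sup>2) \<le> (real r * (2 ^ 15 * (sqrt (640 * C0 * H\<^sup>2) * nrm \<sigma> f)))\<^sup>2"
proof (rule l2_duality)
  have finJ: "finite JJ" and g: "\<And>J. J \<in> JJ \<Longrightarrow> good J" using adm by (auto simp: admissible_def)
  show "finite JJ" by (rule finJ)
  show "0 \<le> real r * (2 ^ 15 * (sqrt (640 * C0 * H\<^sup>2) * nrm \<sigma> f))"
    using C0 f_norm_nonneg by (intro mult_nonneg_nonneg) auto
  fix b :: "real set \<Rightarrow> real"
  define II where "II = (\<lambda>n. {I\<in>D. good I \<and> I \<subseteq> I0 \<and> (\<exists>J\<in>JJ. J \<subseteq> I) \<and> level I mod int r = n})"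
  let ?T = "\<lambda>K J. a K * pairing (I0 - K) J"
  have fs: "far_sum (\<lambda>K. pairing (I0 - K) J) J = (\<Sum>n\<in>{0..<int r}. \<Sum>K\<in>{K\<in>{K\<in>D. parent K \<in> II n}. far K J}. ?T K J)"
    if J: "J \<in> JJ" for J
  proof -
    have JD: "J \<in> D" using g[OF J] good_D by auto
    let ?X = "{K\<in>up J. far K J \<and> good (parent K)}"
    have "far_sum (\<lambda>K. pairing (I0 - K) J) J = (\<Sum>K\<in>?X. ?T K J)"
    proof -
      have "finite {K\<in>up J. far K J}" using finite_up[OF JD] by simp
      then show ?thesis
        unfolding far_sum_def using a_not_good by (intro sum.mono_neutral_right) (auto simp: up_def)
    qed
    also have "\<dots> = (\<Sum>n\<in>{0..<int r}. \<Sum>K\<in>{K\<in>?X. level (parent K) mod int r = n}. ?T K J)"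
      using finite_up[OF JD] r by (intro sum.group[symmetric]) auto
    also have "\<dots> = (\<Sum>n\<in>{0..<int r}. \<Sum>K\<in>{K\<in>{K\<in>D. parent K \<in> II n}. far K J}. ?T K J)"
    proof (intro sum.cong refl)
      fix n
      have "K \<in> ?X \<and> level (parent K) mod int r = n \<longleftrightarrow> K \<in> D \<and> parent K \<in> II n \<and> far K J" for K
      proof
        assume K: "K \<in> ?X \<and> level (parent K) mod int r = n"
        then have "K \<in> D" "J \<subseteq> K" "parent K \<subseteq> I0" using parent_least[OF _ I0] by (auto simp: up_def)
        then show "K \<in> D \<and> parent K \<in> II n \<and> far K J" using K J parent(1,2)[of K] unfolding II_def by blast
      next
        assume K: "K \<in> D \<and> parent K \<in> II n \<and> far K J"
        then have "K \<subset> I0" using parent_psubset[of K] unfolding II_def by blast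
        then show "K \<in> ?X \<and> level (parent K) mod int r = n" using K by (auto simp: up_def far_def II_def)
      qed
      then show "{K\<in>?X. level (parent K) mod int r = n} = {K\<in>{K\<in>D. parent K \<in> II n}. far K J}" by blast
    qed
    finally show ?thesis .
  qed
  have "(\<Sum>J\<in>JJ. b J * far_sum (\<lambda>K. pairing (I0 - K) J) J)
      = (\<Sum>J\<in>JJ. \<Sum>n\<in>{0..<int r}. b J * (\<Sum>K\<in>{K\<in>{K\<in>D. parent K \<in> II n}. far K J}. ?T K J))"
    by (intro sum.cong refl) (simp add: fs sum_distrib_left)
  also have "\<dots> = (\<Sum>n\<in>{0..<int r}. \<Sum>J\<in>JJ. b J * (\<Sum>K\<in>{K\<in>{K\<in>D. parent K \<in> II n}. far K J}. ?T K J))"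
    by (rule sum.swap)
  finally have eq: "(\<Sum>J\<in>JJ. b J * far_sum (\<lambda>K. pairing (I0 - K) J) J) = \<dots>" .
  have "\<bar>\<Sum>J\<in>JJ. b J * far_sum (\<lambda>K. pairing (I0 - K) J) J\<bar>
      \<le> (\<Sum>n\<in>{0..<int r}. 2 ^ 15 * (sqrt (640 * C0 * H\<^sup>2) * nrm \<sigma> f * sqrt (\<Sum>J\<in>JJ. (b J)\<^sup>2)))"
    unfolding eq
  proof (rule order_trans[OF sum_abs sum_mono])
    fix n
    show "\<bar>\<Sum>J\<in>JJ. b J * (\<Sum>K\<in>{K\<in>{K\<in>D. parent K \<in> II n}. far K J}. ?T K J)\<bar>
      \<le> 2 ^ 15 * (sqrt (640 * C0 * H\<^sup>2) * nrm \<sigma> f * sqrt (\<Sum>J\<in>JJ. (b J)\<^sup>2))"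
      unfolding II_def by (rule stopping_class[OF adm])
  qed
  then show "\<bar>\<Sum>J\<in>JJ. b J * far_sum (\<lambda>K. pairing (I0 - K) J) J\<bar>
      \<le> real r * (2 ^ 15 * (sqrt (640 * C0 * H\<^sup>2) * nrm \<sigma> f)) * sqrt (\<Sum>J\<in>JJ. (b J)\<^sup>2)"
    by (simp add: mult_ac)
qed

end

section \<open>The near-diagonal part and the paraproduct\<close>

context dyadic_weight
begin

lemma bessel_local:
  assumes F: "finite F" "F \<subseteq> D" "\<And>J. J \<in> F \<Longrightarrow> J \<subseteq> K" and K: "K \<in> D" and g: "bker g"
  shows "(\<Sum>J\<in>F. (ip \<mu> g (h J))\<^sup>2) \<le> (\<integral>x. indicator K x * (g x)\<^sup>2 \<partial>\<mu>)"
proof -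
  let ?u = "\<lambda>x. indicator K x * g x"
  have b: "bsupp ?u" by (rule bsupp_mult_bker[OF D_bsupp[OF K] g])
  have "ip \<mu> ?u (h J) = ip \<mu> g (h J)" if "J \<in> F" for J
    unfolding ip_def
  proof (intro Bochner_Integration.integral_cong refl)
    fix x show "indicator K x * g x * h J x = g x * h J x"
      using haar_outside[of J x] F(2) subsetD[OF F(3)[OF that], of x] that by (cases "x \<in> J") auto
  qed
  then have "(\<Sum>J\<in>F. (ip \<mu> g (h J))\<^sup>2) = (\<Sum>J\<in>F. (ip \<mu> ?u (h J))\<^sup>2)" by simp
  also have "\<dots> \<le> ip \<mu> ?u ?u" by (rule bessel[OF F(1,2) bsupp_L2[OF b]])
  also have "\<dots> = (\<integral>x. indicator K x * (g x)\<^sup>2 \<partial>\<mu>)"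
    unfolding ip_def by (intro Bochner_Integration.integral_cong) (auto simp: power2_eq_square indicator_def)
  finally show ?thesis .
qed

lemma L2_integrable_on: "L2 \<mu> u \<Longrightarrow> K \<in> D \<Longrightarrow> integrable \<mu> (\<lambda>x. indicator K x * u x)"
  by (rule L2_mult_integrable[OF bsupp_L2[OF D_bsupp]])

lemma avg_eq: "avg \<mu> K u = (\<integral>x. indicator K x * u x \<partial>\<mu>) / measure \<mu> K"
  by (simp add: avg_def set_lebesgue_integral_def)

text \<open>One step of the martingale telescoping. Positivity matters: over a null \<open>K\<close>
  the average is 0 by division, whatever the average over the parent.\<close>

lemma avg_child:
  assumes u: "L2 \<mu> u" and K: "K \<in> D" and pos: "0 < measure \<mu> K"
  shows "avg \<mu> K u = avg \<mu> (parent K) u + ip \<mu> u (h (parent K)) * h (parent K) (Inf K)"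
proof -
  let ?P = "parent K"
  let ?l = "left_child ?P" and ?r = "right_child ?P"
  have P: "?P \<in> D" using parent(1)[OF K] .
  have lr: "?l \<in> D" "?r \<in> D" using children_in[OF P] by auto
  define F where "F = (\<lambda>B. \<integral>x. indicator B x * u x \<partial>\<mu>)"
  define m where "m = (\<lambda>B. measure \<mu> B)"
  note iu = L2_integrable_on[OF u lr(1)] L2_integrable_on[OF u lr(2)]
  have mP: "m ?P = m ?l + m ?r" unfolding m_def by (rule measure_children[OF P])
  have ind: "indicator ?P x = (indicator ?l x + indicator ?r x :: real)" for x
  proof -
    have "x \<in> ?P \<longleftrightarrow> x \<in> ?l \<or> x \<in> ?r" "\<not> (x \<in> ?l \<and> x \<in> ?r)"
      using children_Un[OF P] children_disj[OF P] by blast+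
    then show ?thesis by (auto simp: indicator_def)
  qed
  have FP: "F ?P = F ?l + F ?r"
    unfolding F_def ind distrib_right by (rule Bochner_Integration.integral_add[OF iu])
  have F0: "F B = 0" if "B \<in> D" "m B = 0" for B
  proof -
    have "emeasure \<mu> B = 0" using that emeasure_eq[OF D_bounded[OF that(1)]] by (simp add: m_def)
    then have "B \<in> null_sets \<mu>" using D_borel[OF that(1)] by auto
    then have "AE x in \<mu>. x \<notin> B" by (rule AE_not_in)
    then have "AE x in \<mu>. indicator B x * u x = 0" by eventually_elim simp
    then show ?thesis unfolding F_def by (rule integral_eq_zero_AE)
  qed
  have nn: "0 \<le> m B" for B by (simp add: m_def measure_nonneg)
  show ?thesis
  proof (cases "0 < m ?l \<and> 0 < m ?r")
    case True
    let ?s = "sqrt (m ?l * m ?r / m ?P)"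
    have heq: "h ?P x = ?s * (- indicator ?l x / m ?l + indicator ?r x / m ?r)" for x
      using True unfolding haar_eq m_def by simp
    have "ip \<mu> u (h ?P) = (\<integral>x. ?s * ((- 1 / m ?l) * (indicator ?l x * u x) + (1 / m ?r) * (indicator ?r x * u x)) \<partial>\<mu>)"
      unfolding ip_def heq by (intro Bochner_Integration.integral_cong) (simp_all add: algebra_simps)
    also have "\<dots> = ?s * ((- 1 / m ?l) * F ?l + (1 / m ?r) * F ?r)"
      unfolding F_def using iu by simp
    finally have c: "ip \<mu> u (h ?P) = ?s * (- F ?l / m ?l + F ?r / m ?r)" by simp
    have ss: "?s * X * (?s * Y) = m ?l * m ?r / m ?P * (X * Y)" for X Y
    proof -
      have "?s * ?s = m ?l * m ?r / m ?P" using True mP by simp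
      then show ?thesis by (metis mult.assoc mult.left_commute)
    qed
    have alg1: "p / q = (p + p') / (q + q') + q * q' / (q + q') * ((- p / q + p' / q') * (- 1 / q))"
      and alg2: "p' / q' = (p + p') / (q + q') + q * q' / (q + q') * ((- p / q + p' / q') * (1 / q'))"
      if "0 < q" "0 < q'" for p q p' q' :: real
    proof -
      have n: "q + q' \<noteq> 0" "q \<noteq> 0" "q' \<noteq> 0" using that by auto
      define u where "u = p / q"
      define v where "v = p' / q'"
      have uv: "p = u * q" "p' = v * q'" "- p / q = - u" using n by (simp_all add: u_def v_def)
      have c1: "q * q' / (q + q') * (X * (- 1 / q)) = (- X * q') / (q + q')"
        and c2: "q * q' / (q + q') * (X * (1 / q')) = (X * q) / (q + q')" for X
        using n by simp_all
      show "p / q = (p + p') / (q + q') + q * q' / (q + q') * ((- p / q + p' / q') * (- 1 / q))"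
      proof -
        have "(p + p') / (q + q') + (- (- u + v) * q') / (q + q') = (u * (q + q')) / (q + q')"
          unfolding uv(1,2) add_divide_distrib[symmetric] by (simp add: algebra_simps)
        then show ?thesis unfolding c1 uv(3) v_def[symmetric] using n by (simp add: u_def)
      qed
      show "p' / q' = (p + p') / (q + q') + q * q' / (q + q') * ((- p / q + p' / q') * (1 / q'))"
      proof -
        have "(p + p') / (q + q') + ((- u + v) * q) / (q + q') = (v * (q + q')) / (q + q')"
          unfolding uv(1,2) add_divide_distrib[symmetric] by (simp add: algebra_simps)
        then show ?thesis unfolding c2 uv(3) v_def[symmetric] using n by simp
      qed
    qed
    from child_parent[OF K] show ?thesis
    proof
      assume e: "K = ?l"
      then have "Inf K \<in> ?l" "Inf K \<notin> ?r" using Inf_in[OF K] children_disj[OF P] by blast+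
      then have hI: "h ?P (Inf K) = ?s * (- 1 / m ?l)" unfolding heq by simp
      have "ip \<mu> u (h ?P) * h ?P (Inf K) = m ?l * m ?r / (m ?l + m ?r) * ((- F ?l / m ?l + F ?r / m ?r) * (- 1 / m ?l))"
        unfolding c hI ss unfolding mP ..
      moreover have "avg \<mu> K u = F ?l / m ?l" unfolding avg_eq F_def m_def using e by simp
      moreover have "avg \<mu> ?P u = (F ?l + F ?r) / (m ?l + m ?r)" unfolding avg_eq FP[symmetric] mP[symmetric] by (simp add: F_def m_def)
      ultimately show ?thesis using alg1[of "m ?l" "m ?r" "F ?l" "F ?r"] True by linarith
    next
      assume e: "K = ?r"
      then have "Inf K \<in> ?r" "Inf K \<notin> ?l" using Inf_in[OF K] children_disj[OF P] by blast+
      then have hI: "h ?P (Inf K) = ?s * (1 / m ?r)" unfolding heq by simp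
      have "ip \<mu> u (h ?P) * h ?P (Inf K) = m ?l * m ?r / (m ?l + m ?r) * ((- F ?l / m ?l + F ?r / m ?r) * (1 / m ?r))"
        unfolding c hI ss unfolding mP ..
      moreover have "avg \<mu> K u = F ?r / m ?r" unfolding avg_eq F_def m_def using e by simp
      moreover have "avg \<mu> ?P u = (F ?l + F ?r) / (m ?l + m ?r)" unfolding avg_eq FP[symmetric] mP[symmetric] by (simp add: F_def m_def)
      ultimately show ?thesis using alg2[of "m ?l" "m ?r" "F ?r" "F ?l"] True by linarith
    qed
  next
    case False
    then have h0: "h ?P x = 0" for x unfolding haar_eq m_def by auto
    \<comment> \<open>One child is null, so \<open>K\<close> carries all the mass of its parent and
      the average does not change; \<open>B\<close> is the null sibling.\<close>
    obtain B where B: "B \<in> D" "m K + m B = m ?P" "F K + F B = F ?P" "m B = 0"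
    proof -
      assume a1: "\<And>B. B \<in> D \<Longrightarrow> m K + m B = m ?P \<Longrightarrow> F K + F B = F ?P \<Longrightarrow> m B = 0 \<Longrightarrow> thesis"
      from child_parent[OF K] show thesis
      proof
        assume e: "K = ?l"
        have "\<not> 0 < m ?r" using False pos e by (auto simp: m_def)
        then have "m ?r = 0" using nn[of ?r] by linarith
        then show thesis using a1[of ?r] lr mP FP e by simp
      next
        assume e: "K = ?r"
        have "\<not> 0 < m ?l" using False pos e by (auto simp: m_def)
        then have "m ?l = 0" using nn[of ?l] by linarith
        then show thesis using a1[of ?l] lr mP FP e by simp
      qed
    qed
    then have "m K = m ?P" "F K = F ?P" using F0[OF B(1)] by auto
    then show ?thesis unfolding avg_eq h0 by (simp add: F_def m_def)
  qed
qed

end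

section \<open>Testing on near intervals, and the telescoped sum over far ones\<close>

context corona
begin

definition hp :: "(real \<Rightarrow> real) \<Rightarrow> real set \<Rightarrow> real set \<Rightarrow> real" where
  "hp k B J = ip w (sig.conv k (indicator B)) (haar w J)"

lemma bker_hard: "sig.bker (hard \<epsilon> \<delta>)"
proof -
  have "\<bar>hard \<epsilon> \<delta> t\<bar> \<le> 1 / \<epsilon>" for t using eps by (auto simp: hard_def intro!: divide_left_mono)
  then show ?thesis by (auto simp: sig.bker_def)
qed

lemma hp_square_sum:
  assumes F: "finite F" "F \<subseteq> D" "\<And>J. J \<in> F \<Longrightarrow> J \<subseteq> K" and K: "K \<in> D"
  shows "(\<Sum>J\<in>F. (hp (hard \<epsilon> \<delta>) K J)\<^sup>2) \<le> H\<^sup>2 * measure \<sigma> K"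
proof -
  have "(\<Sum>J\<in>F. (hp (hard \<epsilon> \<delta>) K J)\<^sup>2) \<le> (\<integral>x. indicator K x * (sig.conv (hard \<epsilon> \<delta>) (indicator K) x)\<^sup>2 \<partial>w)"
    unfolding hp_def by (rule wt.bessel_local[OF F K sig.conv_bker[OF sig.D_bsupp[OF K] bker_hard]])
  also have "\<dots> \<le> H\<^sup>2 * measure \<sigma> K" by (rule testing[OF K])
  finally show ?thesis .
qed

text \<open>There are at most 2 r + 4 intervals \<open>K\<close> per \<open>J\<close>, one per
  level, so Cauchy-Schwarz in \<open>K\<close> is affordable; after interchanging the sums, the sum
  over \<open>J\<close> is bounded for each \<open>K\<close> separately. \<open>P\<close> leaves
  room for the lower threshold on \<open>K\<close> in the form.\<close>

lemma near_bound:
  assumes JJ: "finite JJ" "JJ \<subseteq> D"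
  shows "(\<Sum>J\<in>JJ. (\<Sum>K\<in>{K\<in>up J. \<not> far K J \<and> P K J}. a K * hp (hard \<epsilon> \<delta>) K J)\<^sup>2)
      \<le> real (2 * r + 4) * (2 * H\<^sup>2 * (nrm \<sigma> f)\<^sup>2)"
proof -
  let ?hp = "hp (hard \<epsilon> \<delta>)"
  let ?N = "\<lambda>J. {K\<in>up J. \<not> far K J \<and> P K J}"
  let ?U = "\<Union>J\<in>JJ. up J"
  have finU: "finite ?U" using JJ finite_up by auto
  have UD: "?U \<subseteq> D" by (auto simp: up_def)
  have card: "card (?N J) \<le> 2 * r + 4" if J: "J \<in> JJ" for J
  proof -
    have JD: "J \<in> D" using J JJ by auto
    have "card (?N J) \<le> card {level J..<level J + int (2 * r + 4)}"
    proof (rule card_inj_on_le)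
      show "inj_on level (?N J)"
      proof (rule inj_onI)
        fix x y assume "x \<in> ?N J" "y \<in> ?N J" "level x = level y"
        moreover have "Inf J \<in> J" by (rule Inf_in[OF JD])
        ultimately show "x = y" by (intro same_level[of x y "Inf J"]) (unfold up_def, blast+)
      qed
      show "level ` ?N J \<subseteq> {level J..<level J + int (2 * r + 4)}"
        using level_mono[OF _ JD] by (auto simp: up_def far_def)
    qed simp
    then show ?thesis by simp
  qed
  have "(\<Sum>J\<in>JJ. (\<Sum>K\<in>?N J. a K * ?hp K J)\<^sup>2) \<le> (\<Sum>J\<in>JJ. real (2 * r + 4) * (\<Sum>K\<in>?N J. (a K * ?hp K J)\<^sup>2))"
  proof (rule sum_mono)
    fix J assume J: "J \<in> JJ"
    have "(\<Sum>K\<in>?N J. 1 * (a K * ?hp K J))\<^sup>2 \<le> (\<Sum>K\<in>?N J. 1\<^sup>2) * (\<Sum>K\<in>?N J. (a K * ?hp K J)\<^sup>2)"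
      by (rule Cauchy_Schwarz_ineq_sum)
    also have "\<dots> \<le> real (2 * r + 4) * (\<Sum>K\<in>?N J. (a K * ?hp K J)\<^sup>2)"
      using card[OF J] by (intro mult_right_mono sum_nonneg) auto
    finally show "(\<Sum>K\<in>?N J. a K * ?hp K J)\<^sup>2 \<le> real (2 * r + 4) * (\<Sum>K\<in>?N J. (a K * ?hp K J)\<^sup>2)" by simp
  qed
  also have "\<dots> = real (2 * r + 4) * (\<Sum>J\<in>JJ. \<Sum>K\<in>?N J. (a K * ?hp K J)\<^sup>2)"
    by (simp only: sum_distrib_left)
  also have "\<dots> \<le> real (2 * r + 4) * (2 * H\<^sup>2 * (nrm \<sigma> f)\<^sup>2)"
  proof (rule mult_left_mono)
    have "(\<Sum>J\<in>JJ. \<Sum>K\<in>?N J. (a K * ?hp K J)\<^sup>2) = (\<Sum>J\<in>JJ. \<Sum>K\<in>{K\<in>?U. K \<in> ?N J}. (a K * ?hp K J)\<^sup>2)"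
      by (intro sum.cong refl) auto
    also have "\<dots> = (\<Sum>K\<in>?U. \<Sum>J\<in>{J\<in>JJ. K \<in> ?N J}. (a K * ?hp K J)\<^sup>2)"
      by (rule sum.swap_restrict[OF JJ(1) finU])
    also have "\<dots> \<le> (\<Sum>K\<in>?U. H\<^sup>2 * ((a K)\<^sup>2 * measure \<sigma> K))"
    proof (rule sum_mono)
      fix K assume K: "K \<in> ?U"
      then have KD: "K \<in> D" using UD by auto
      have "(\<Sum>J\<in>{J\<in>JJ. K \<in> ?N J}. (a K * ?hp K J)\<^sup>2) = (a K)\<^sup>2 * (\<Sum>J\<in>{J\<in>JJ. K \<in> ?N J}. (?hp K J)\<^sup>2)"
        by (simp add: sum_distrib_left power_mult_distrib)
      also have "\<dots> \<le> (a K)\<^sup>2 * (H\<^sup>2 * measure \<sigma> K)"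
        using JJ by (intro mult_left_mono hp_square_sum[OF _ _ _ KD]) (auto simp: up_def)
      finally show "(\<Sum>J\<in>{J\<in>JJ. K \<in> ?N J}. (a K * ?hp K J)\<^sup>2) \<le> H\<^sup>2 * ((a K)\<^sup>2 * measure \<sigma> K)" by (simp add: mult_ac)
    qed
    also have "\<dots> = H\<^sup>2 * (\<Sum>K\<in>?U. (a K)\<^sup>2 * measure \<sigma> K)" by (simp add: sum_distrib_left)
    also have "\<dots> \<le> H\<^sup>2 * (2 * (nrm \<sigma> f)\<^sup>2)"
      using a_square_sum_le[OF finU UD] by (intro mult_left_mono) auto
    finally show "(\<Sum>J\<in>JJ. \<Sum>K\<in>?N J. (a K * ?hp K J)\<^sup>2) \<le> 2 * H\<^sup>2 * (nrm \<sigma> f)\<^sup>2" by (simp add: mult_ac)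
  qed simp
  finally show ?thesis .
qed

lemma avg_abs_le: "L \<in> D \<Longrightarrow> \<bar>avg \<sigma> L f\<bar> \<le> avg \<sigma> L (\<lambda>x. \<bar>f x\<bar>)"
proof -
  assume L: "L \<in> D"
  have "\<bar>\<integral>x. indicator L x * f x \<partial>\<sigma>\<bar> \<le> (\<integral>x. \<bar>indicator L x * f x\<bar> \<partial>\<sigma>)" by (rule integral_abs_bound)
  also have "\<dots> = (\<integral>x. indicator L x * \<bar>f x\<bar> \<partial>\<sigma>)" by (simp add: abs_mult)
  finally show ?thesis unfolding sig.avg_eq abs_divide by (simp add: divide_right_mono measure_nonneg)
qed

text \<open>The differences telescope from \<open>I0\<close>, where the average of \<open>f\<close>
  is zero, down to the average over \<open>L\<close>, which uniformity bounds. Over a null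
  \<open>L\<close> that average is a default value, so the bound is carried as a separate conjunct
  and inherited from the parent.\<close>

lemma chain_sum:
  assumes "L \<in> D" "L \<subseteq> I0" "\<not> (\<exists>S\<in>SS. L \<subseteq> S)"
  shows "(0 < measure \<sigma> L \<longrightarrow> (\<Sum>K\<in>up L. a K) = avg \<sigma> L f) \<and> \<bar>\<Sum>K\<in>up L. a K\<bar> \<le> 1"
  using assms
proof (induction "nat (level I0 - level L)" arbitrary: L)
  case 0
  then have "level L = level I0" using level_mono[OF I0 0(2,3)] by simp
  then have L: "L = I0" using same_level[of L I0 "Inf L"] Inf_in[of L] 0 I0 by auto
  have "up L = {}" using L by (auto simp: up_def)
  moreover have "avg \<sigma> I0 f = 0"
  proof -
    have "(\<integral>x. indicator I0 x * f x \<partial>\<sigma>) = (\<integral>x. f x \<partial>\<sigma>)"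
    proof (rule integral_cong_AE)
      have m: "f \<in> borel_measurable \<sigma>" using f_L2 by (simp add: L2_def)
      then show "f \<in> borel_measurable \<sigma>" .
      have "I0 \<in> sets \<sigma>" using sig.D_borel[OF I0] by simp
      then show "(\<lambda>x. indicator I0 x * f x) \<in> borel_measurable \<sigma>" using m by measurable
      have "AE x in \<sigma>. x \<notin> I0 \<longrightarrow> f x = 0" using f_zero by (simp add: L2_zero_def)
      then show "AE x in \<sigma>. indicator I0 x * f x = f x" by eventually_elim (auto simp: indicator_def)
    qed
    then show ?thesis using f_zero by (simp add: sig.avg_eq L2_zero_def)
  qed
  ultimately show ?case using L by simp
next
  case (Suc n)
  let ?P = "parent L"
  have LI: "L \<subset> I0" using Suc.hyps(2) Suc.prems by auto
  have P: "?P \<in> D" "L \<subset> ?P" "?P \<subseteq> I0" using parent(1) parent_psubset parent_least[OF _ I0 LI] Suc.prems by auto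
  have IH: "(0 < measure \<sigma> ?P \<longrightarrow> (\<Sum>K\<in>up ?P. a K) = avg \<sigma> ?P f) \<and> \<bar>\<Sum>K\<in>up ?P. a K\<bar> \<le> 1"
  proof (rule Suc.hyps(1))
    show "n = nat (level I0 - level ?P)" using Suc.hyps(2) parent(3)[OF Suc.prems(1)] by simp
    show "\<not> (\<exists>S\<in>SS. ?P \<subseteq> S)" using Suc.prems(3) P(2) by blast
  qed (rule P)+
  have "up L = insert L (up ?P)"
    using parent_least[OF Suc.prems(1)] P LI Suc.prems(1) unfolding up_def by blast
  moreover have "L \<notin> up ?P" using P by (auto simp: up_def)
  ultimately have sum: "(\<Sum>K\<in>up L. a K) = a L + (\<Sum>K\<in>up ?P. a K)" using finite_up[OF P(1)] by simp
  show ?case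
  proof (cases "0 < measure \<sigma> L")
    case True
    have "measure \<sigma> L \<le> measure \<sigma> ?P"
      using P sig.D_fmeas Suc.prems by (intro measure_mono_fmeasurable) (auto simp: sig.D_borel)
    then have "(\<Sum>K\<in>up ?P. a K) = avg \<sigma> ?P f" using IH True by linarith
    then have eq: "(\<Sum>K\<in>up L. a K) = avg \<sigma> L f"
      using sig.avg_child[OF f_L2 Suc.prems(1) True] sum by (simp add: a_def)
    have "\<bar>avg \<sigma> L f\<bar> \<le> 1" using avg_abs_le[OF Suc.prems(1)] f_avg[OF Suc.prems(1,3)] by linarith
    then show ?thesis using eq by simp
  next
    case False
    then have "measure \<sigma> L = 0" using measure_nonneg[of \<sigma> L] by linarith
    then have "haar \<sigma> ?P x = 0" for x using child_parent[OF Suc.prems(1)] unfolding sig.haar_eq by auto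
    then have "a L = 0" by (simp add: a_def)
    then show ?thesis using False sum IH by simp
  qed
qed

text \<open>The intervals far above \<open>J\<close> are exactly those from its ancestor
  \<open>L\<close> at level gap 2 r + 4 upwards, and \<open>L\<close> is too long to lie in an
  \<open>S\<close>; so \<open>chain_sum\<close> applies at \<open>L\<close>.\<close>

lemma far_sum_one:
  assumes adm: "admissible JJ" and J: "J \<in> JJ"
  shows "\<bar>far_sum (\<lambda>_. 1) J\<bar> \<le> 1" "\<not> J \<subseteq> I0 \<Longrightarrow> far_sum (\<lambda>_. 1) J = 0"
proof -
  have JD: "J \<in> D" using adm J good_D by (auto simp: admissible_def)
  obtain L where L: "L \<in> D" "J \<subseteq> L" "level L = level J + int (2 * r + 4)"
    using ancestor[OF JD, of "level J + int (2 * r + 4)"] by auto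
  have eq: "{K\<in>up J. far K J} = up L"
  proof -
    have "K \<in> up J \<and> far K J \<longleftrightarrow> K \<in> up L" for K
      using sub_level[OF L(1) _ JD L(2), of K] level_mono[of K L] L by (auto simp: up_def far_def)
    then show ?thesis by blast
  qed
  show "\<bar>far_sum (\<lambda>_. 1) J\<bar> \<le> 1"
  proof (cases "L \<subseteq> I0")
    case True
    then show ?thesis
      using chain_sum[OF L(1) True] not_in_SS[OF adm J L(2,1)] L(3) by (simp add: far_sum_def eq)
  next
    case False
    then have e: "up L = {}" by (auto simp: up_def)
    show ?thesis unfolding far_sum_def eq e by simp
  qed
  show "far_sum (\<lambda>_. 1) J = 0" if "\<not> J \<subseteq> I0"
  proof -
    have e: "{K\<in>up J. far K J} = {}" using that by (auto simp: up_def)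
    show ?thesis unfolding far_sum_def e by simp
  qed
qed

lemma para_bound:
  assumes adm: "admissible JJ"
  shows "(\<Sum>J\<in>JJ. (far_sum (\<lambda>_. 1) J * hp (hard \<epsilon> \<delta>) I0 J)\<^sup>2) \<le> H\<^sup>2 * measure \<sigma> I0"
proof -
  have finJ: "finite JJ" and JD: "JJ \<subseteq> D" using adm good_D by (auto simp: admissible_def)
  have "(\<Sum>J\<in>JJ. (far_sum (\<lambda>_. 1) J * hp (hard \<epsilon> \<delta>) I0 J)\<^sup>2) = (\<Sum>J\<in>{J\<in>JJ. J \<subseteq> I0}. (far_sum (\<lambda>_. 1) J * hp (hard \<epsilon> \<delta>) I0 J)\<^sup>2)"
    using finJ far_sum_one(2)[OF adm] by (intro sum.mono_neutral_right) auto
  also have "\<dots> \<le> (\<Sum>J\<in>{J\<in>JJ. J \<subseteq> I0}. (hp (hard \<epsilon> \<delta>) I0 J)\<^sup>2)"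
  proof (rule sum_mono)
    fix J assume "J \<in> {J\<in>JJ. J \<subseteq> I0}"
    then have "\<bar>far_sum (\<lambda>_. 1) J\<bar>\<^sup>2 \<le> 1\<^sup>2" using far_sum_one(1)[OF adm] by (intro power_mono) auto
    then have "(far_sum (\<lambda>_. 1) J)\<^sup>2 * (hp (hard \<epsilon> \<delta>) I0 J)\<^sup>2 \<le> 1 * (hp (hard \<epsilon> \<delta>) I0 J)\<^sup>2"
      by (intro mult_right_mono) auto
    then show "(far_sum (\<lambda>_. 1) J * hp (hard \<epsilon> \<delta>) I0 J)\<^sup>2 \<le> (hp (hard \<epsilon> \<delta>) I0 J)\<^sup>2" by (simp add: power_mult_distrib)
  qed
  also have "\<dots> \<le> H\<^sup>2 * measure \<sigma> I0" using finJ JD by (intro hp_square_sum[OF _ _ _ I0]) auto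
  finally show ?thesis .
qed

end

section \<open>The truncation errors\<close>

context dyadic
begin

lemma card_level_le:
  assumes "finite F" "F \<subseteq> D" "\<And>L. L \<in> F \<Longrightarrow> level L = j" "\<And>L. L \<in> F \<Longrightarrow> L \<subseteq> {u..v}" "u \<le> v"
  shows "real (card F) * 2 powi j \<le> v - u"
proof -
  have fm: "L \<in> fmeasurable lborel" if "L \<in> F" for L
  proof -
    have LD: "L \<in> D" using that assms(2) by auto
    have "{Inf L ..< Inf L + len L} \<in> fmeasurable lborel"
      using len_pos[OF LD] by (intro fmeasurableI) (auto simp: emeasure_lborel_Ico)
    then show ?thesis using D_eq[OF LD] by simp
  qed
  have "real (card F) * 2 powi j = (\<Sum>L\<in>F. measure lborel L)"
    using assms D_len by (simp add: len_def[symmetric] subset_iff)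
  also have "\<dots> = measure lborel (\<Union>F)"
  proof (rule measure_Union'[symmetric])
    show "pairwise disjnt F"
    proof (rule pairwiseI)
      fix L L' assume L: "L \<in> F" "L' \<in> F" "L \<noteq> L'"
      have "L = L'" if "x \<in> L" "x \<in> L'" for x
        using same_level[of L L' x] L(1,2) assms(2) assms(3)[OF L(1)] assms(3)[OF L(2)] that by auto
      then show "disjnt L L'" using L(3) unfolding disjnt_def by blast
    qed
  qed (use assms fm in auto)
  also have "\<dots> \<le> measure lborel {u..v}"
  proof (rule measure_mono_fmeasurable)
    show "\<Union>F \<in> sets lborel" using assms(1) fm fmeasurableD by (intro sets.finite_Union) blast+
    show "{u..v} \<in> fmeasurable lborel" using assms(5) by (intro fmeasurableI) auto
  qed (use assms(4) in blast)
  also have "\<dots> = v - u" using assms by simp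
  finally show ?thesis .
qed

text \<open>All \<open>L\<close> lie within 3 s of \<open>y\<close>. On level \<open>j\<close> they
  are disjoint, so there are at most 6 s / 2^j of them, and there are m + 1 levels.\<close>

lemma card_near_le:
  assumes F: "finite F" "F \<subseteq> D" "\<And>L. L \<in> F \<Longrightarrow> 2 powi k \<le> len L \<and> len L \<le> s"
    and near: "\<And>L. L \<in> F \<Longrightarrow> \<exists>x\<in>L. \<bar>x - y\<bar> \<le> 2 * s" and s: "s \<le> 2 powi (k + int m)"
  shows "real (card F) \<le> 6 * 2 ^ m * real (Suc m)"
proof -
  have s0: "0 \<le> s" if Fne: "F \<noteq> {}"
  proof -
    obtain L where "L \<in> F" using Fne by blast
    then show ?thesis using F(2) F(3)[of L] len_pos[of L] by force
  qed
  have lev: "k \<le> level L \<and> level L \<le> k + int m" if "L \<in> F" for L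
  proof -
    have "2 powi k \<le> (2::real) powi level L" "(2::real) powi level L \<le> 2 powi (k + int m)"
      using F(3)[OF that] F(2) that D_len[of L] s by auto
    then show ?thesis by (simp add: powi_le_iff)
  qed
  have each: "real (card {L\<in>F. level L = j}) \<le> 6 * 2 ^ m" if j: "j \<in> {k..k + int m}" for j
  proof (cases "F = {}")
    case False
    have "real (card {L\<in>F. level L = j}) * 2 powi j \<le> (y + 3 * s) - (y - 3 * s)"
    proof (rule card_level_le)
      show "L \<subseteq> {y - 3 * s..y + 3 * s}" if L: "L \<in> {L\<in>F. level L = j}" for L
      proof
        fix z assume z: "z \<in> L"
        obtain x where x: "x \<in> L" "\<bar>x - y\<bar> \<le> 2 * s" using near L by blast
        have LD: "L \<in> D" using L F by auto
        have "\<bar>z - x\<bar> \<le> len L" using z x(1) unfolding mem_D[OF LD] by linarith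
        then show "z \<in> {y - 3 * s..y + 3 * s}" using x(2) F(3)[of L] L by auto
      qed
    qed (use F s0[OF False] in auto)
    also have "\<dots> \<le> 6 * 2 powi (k + int m)" using s by simp
    also have "\<dots> = 6 * 2 ^ m * 2 powi k" by (simp add: power_int_add)
    also have "\<dots> \<le> 6 * 2 ^ m * 2 powi j" using j powi_le_iff[of k j] by simp
    finally show ?thesis by simp
  qed simp
  have "card F = (\<Sum>j\<in>{k..k + int m}. card {L\<in>F. level L = j})"
  proof -
    have "(\<Sum>L\<in>F. 1) = (\<Sum>j\<in>{k..k + int m}. \<Sum>L\<in>{L\<in>F. level L = j}. 1::nat)"
      using F(1) lev by (intro sum.group[symmetric]) auto
    then show ?thesis by simp
  qed
  then have "real (card F) = (\<Sum>j\<in>{k..k + int m}. real (card {L\<in>F. level L = j}))" by simp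
  also have "\<dots> \<le> (\<Sum>j\<in>{k..k + int m}. 6 * 2 ^ m)" using each by (rule sum_mono)
  also have "\<dots> = 6 * 2 ^ m * real (Suc m)" by simp
  finally show ?thesis .
qed

end

section \<open>Annular kernels under the A2 condition\<close>

context corona
begin

lemma bker_annular: "annular s e \<Longrightarrow> sig.bker e"
  unfolding annular_def sig.bker_def by blast

text \<open>An annular kernel has size at most 1 / s and range at most \<open>s\<close>, so on
  \<open>L\<close> the operator is bounded by the mass of the \<open>s\<close>-neighbourhood divided
  by \<open>s\<close>. Squaring and integrating leaves a product of both masses, and the A2
  condition on an interval of length at most 3 s gives the 9.\<close>

lemma annular_local:
  assumes e: "annular s e" and L: "L \<in> D" "len L \<le> s"
    and F: "finite F" "F \<subseteq> D" "\<And>J. J \<in> F \<Longrightarrow> J \<subseteq> L"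
    and \<phi>: "sig.bsupp \<phi>" "\<And>y. \<bar>\<phi> y\<bar> \<le> 1" "\<And>y. y \<notin> I0 \<Longrightarrow> \<phi> y = 0"
  shows "(\<Sum>J\<in>F. (ip w (sig.conv e \<phi>) (haar w J))\<^sup>2) \<le> 9 * H\<^sup>2 * measure \<sigma> (I0 \<inter> {Inf L - s..Inf L + len L + s})"
proof -
  let ?B = "I0 \<inter> {Inf L - s..Inf L + len L + s}" and ?I = "{Inf L - s..Inf L + len L + s}"
  have s: "0 < s" using e by (simp add: annular_def)
  have lL: "0 < len L" by (rule len_pos[OF L(1)])
  have Bb: "?B \<in> sets borel" using sig.D_borel[OF I0] by auto
  have bB: "sig.bsupp (indicator ?B)"
    using Bb bounded_subset[OF sig.D_bounded[OF I0]] by (intro sig.bsupp_indicator) auto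
  have pt: "\<bar>sig.conv e \<phi> x\<bar> \<le> measure \<sigma> ?B / s" if x: "x \<in> L" for x
  proof -
    have "\<bar>sig.conv e \<phi> x\<bar> \<le> (\<integral>y. \<bar>\<phi> y * e (y - x)\<bar> \<partial>\<sigma>)" unfolding sig.conv_def by (rule integral_abs_bound)
    also have "\<dots> \<le> (\<integral>y. 1 / s * indicator ?B y \<partial>\<sigma>)"
    proof (rule integral_mono)
      show "integrable \<sigma> (\<lambda>y. \<bar>\<phi> y * e (y - x)\<bar>)" using sig.conv_integrable[OF \<phi>(1) bker_annular[OF e]] by (rule integrable_abs)
      show "integrable \<sigma> (\<lambda>y. 1 / s * indicator ?B y)" using sig.bsupp_integrable[OF bB] by (rule integrable_mult_right)
      fix y
      show "\<bar>\<phi> y * e (y - x)\<bar> \<le> 1 / s * indicator ?B y"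
      proof (cases "\<phi> y * e (y - x) = 0")
        case False
        then have "y \<in> I0" "e (y - x) \<noteq> 0" using \<phi>(3)[of y] by auto
        then have "\<bar>y - x\<bar> \<le> s" using e by (auto simp: annular_def)
        then have "y \<in> ?B" using \<open>y \<in> I0\<close> x unfolding mem_D[OF L(1)] by auto
        moreover have "\<bar>\<phi> y * e (y - x)\<bar> \<le> 1 * (1 / s)"
          unfolding abs_mult using \<phi>(2)[of y] e by (intro mult_mono) (auto simp: annular_def)
        ultimately show ?thesis by simp
      next
        case True
        have "0 \<le> 1 / s * indicator ?B y" using s by simp
        then show ?thesis unfolding True abs_zero .
      qed
    qed
    also have "\<dots> = measure \<sigma> ?B / s"
      using Bochner_Integration.integral_mult_right_zero[of \<sigma> "1/s" "indicator ?B :: real \<Rightarrow> real"] by simp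
    finally show ?thesis .
  qed
  have "(\<Sum>J\<in>F. (ip w (sig.conv e \<phi>) (haar w J))\<^sup>2) \<le> (\<integral>x. indicator L x * (sig.conv e \<phi> x)\<^sup>2 \<partial>w)"
    by (rule wt.bessel_local[OF F L(1) sig.conv_bker[OF \<phi>(1) bker_annular[OF e]]])
  also have "\<dots> \<le> (\<integral>x. (measure \<sigma> ?B / s)\<^sup>2 * indicator L x \<partial>w)"
  proof (rule integral_mono)
    have bk: "wt.bker (\<lambda>x. (sig.conv e \<phi> x)\<^sup>2)"
    proof -
      obtain C where C: "sig.conv e \<phi> \<in> borel_measurable borel" "\<And>x. \<bar>sig.conv e \<phi> x\<bar> \<le> C"
        using sig.conv_bker[OF \<phi>(1) bker_annular[OF e]] unfolding sig.bker_def by blast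
      have "\<bar>(sig.conv e \<phi> x)\<^sup>2\<bar> \<le> C\<^sup>2" for x using power_mono[OF C(2)[of x], of 2] by simp
      moreover have "(\<lambda>x. (sig.conv e \<phi> x)\<^sup>2) \<in> borel_measurable borel" using C(1) by measurable
      ultimately show ?thesis unfolding wt.bker_def by blast
    qed
    show "integrable w (\<lambda>x. indicator L x * (sig.conv e \<phi> x)\<^sup>2)"
      by (rule wt.bsupp_integrable[OF wt.bsupp_mult_bker[OF wt.D_bsupp[OF L(1)] bk]])
    show "integrable w (\<lambda>x. (measure \<sigma> ?B / s)\<^sup>2 * indicator L x)" using wt.indicator_integrable[OF L(1)] by (rule integrable_mult_right)
    fix x
    show "indicator L x * (sig.conv e \<phi> x)\<^sup>2 \<le> (measure \<sigma> ?B / s)\<^sup>2 * indicator L x"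
      using power_mono[OF pt[of x], of 2] by (cases "x \<in> L") auto
  qed
  also have "\<dots> = (measure \<sigma> ?B / s)\<^sup>2 * measure w L"
    using Bochner_Integration.integral_mult_right_zero[of w "(measure \<sigma> ?B / s)\<^sup>2" "indicator L :: real \<Rightarrow> real"] by simp
  also have "\<dots> \<le> 9 * H\<^sup>2 * measure \<sigma> ?B"
  proof -
    have le1: "measure \<sigma> ?B \<le> measure \<sigma> ?I"
      using Bb by (intro measure_mono_fmeasurable sig.fmeasurable_bounded) (auto simp: Bb)
    have le2: "measure w L \<le> measure w ?I"
    proof (rule measure_mono_fmeasurable)
      show "L \<subseteq> ?I" using s by (auto simp: mem_D[OF L(1)])
      show "L \<in> sets w" using wt.D_borel[OF L(1)] by simp
      show "?I \<in> fmeasurable w" by (intro wt.fmeasurable_bounded) auto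
    qed
    have "(len L + 2 * s)\<^sup>2 \<le> (3 * s)\<^sup>2" using L(2) lL s by (intro power_mono) auto
    moreover have "measure \<sigma> ?I * measure w ?I \<le> H\<^sup>2 * (len L + 2 * s)\<^sup>2"
    proof -
      have "Inf L - s < Inf L + len L + s" using lL s by linarith
      from A2[OF this] show ?thesis by (simp add: algebra_simps)
    qed
    ultimately have "measure \<sigma> ?I * measure w ?I \<le> H\<^sup>2 * (3 * s)\<^sup>2"
      using mult_left_mono[of "(len L + 2 * s)\<^sup>2" "(3 * s)\<^sup>2" "H\<^sup>2"] by (meson order_trans zero_le_power2)
    moreover have "measure \<sigma> ?B * measure w L \<le> measure \<sigma> ?I * measure w ?I"
      using le1 le2 by (intro mult_mono) (auto simp: measure_nonneg)
    ultimately have "measure \<sigma> ?B * measure w L \<le> 9 * H\<^sup>2 * s\<^sup>2" by (simp add: power_mult_distrib)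
    then have "measure \<sigma> ?B * (measure \<sigma> ?B * measure w L) \<le> measure \<sigma> ?B * (9 * H\<^sup>2 * s\<^sup>2)"
      by (intro mult_left_mono) (auto simp: measure_nonneg)
    then show ?thesis using s by (simp add: power_divide divide_le_eq power2_eq_square mult_ac)
  qed
  finally show ?thesis .
qed

text \<open>The \<open>s\<close>-neighbourhoods of intervals of length comparable to
  \<open>s\<close> have bounded overlap.\<close>

lemma annular_families:
  assumes e: "annular s e" and LL: "finite LL" "LL \<subseteq> D" "\<And>L. L \<in> LL \<Longrightarrow> 2 powi k \<le> len L \<and> len L \<le> s"
    and s: "s \<le> 2 powi (k + int m)"
  shows "(\<Sum>L\<in>LL. measure \<sigma> (I0 \<inter> {Inf L - s..Inf L + len L + s})) \<le> 6 * 2 ^ m * real (Suc m) * measure \<sigma> I0"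
proof -
  let ?B = "\<lambda>L. I0 \<inter> {Inf L - s..Inf L + len L + s}"
  have s0: "0 < s" using e by (simp add: annular_def)
  have Bb: "sig.bsupp (indicator (?B L))" for L
    using sig.D_borel[OF I0] bounded_subset[OF sig.D_bounded[OF I0]] by (intro sig.bsupp_indicator) auto
  have "(\<Sum>L\<in>LL. measure \<sigma> (?B L)) = (\<Sum>L\<in>LL. \<integral>y. indicator (?B L) y \<partial>\<sigma>)" by simp
  also have "\<dots> = (\<integral>y. (\<Sum>L\<in>LL. indicator (?B L) y) \<partial>\<sigma>)"
    using sig.bsupp_integrable[OF Bb] by (intro Bochner_Integration.integral_sum[symmetric]) auto
  also have "\<dots> \<le> (\<integral>y. 6 * 2 ^ m * real (Suc m) * indicator I0 y \<partial>\<sigma>)"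
  proof (rule integral_mono)
    show "integrable \<sigma> (\<lambda>y. \<Sum>L\<in>LL. indicator (?B L) y :: real)" using sig.bsupp_integrable[OF Bb] by (intro Bochner_Integration.integrable_sum) auto
    show "integrable \<sigma> (\<lambda>y. 6 * 2 ^ m * real (Suc m) * indicator I0 y)" using sig.indicator_integrable[OF I0] by (rule integrable_mult_right)
    fix y
    show "(\<Sum>L\<in>LL. indicator (?B L) y) \<le> 6 * 2 ^ m * real (Suc m) * indicator I0 y"
    proof (cases "y \<in> I0")
      case True
      have "(\<Sum>L\<in>LL. indicator (?B L) y) = real (card {L\<in>LL. y \<in> ?B L})"
        using LL(1) by (simp add: indicator_def sum.If_cases Int_def)
      also have "\<dots> \<le> 6 * 2 ^ m * real (Suc m)"
      proof (rule card_near_le)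
        show "\<exists>x\<in>L. \<bar>x - y\<bar> \<le> 2 * s" if L: "L \<in> {L\<in>LL. y \<in> ?B L}" for L
          using Inf_in[of L] L LL(2) LL(3)[of L] s0 by (intro bexI[of _ "Inf L"]) auto
      qed (use LL s in auto)
      finally show ?thesis using True by simp
    qed simp
  qed
  also have "\<dots> = 6 * 2 ^ m * real (Suc m) * measure \<sigma> I0"
    using Bochner_Integration.integral_mult_right_zero[of \<sigma> "6 * 2 ^ m * real (Suc m)" "indicator I0 :: real \<Rightarrow> real"]
    by (simp add: sig.D_borel I0)
  finally show ?thesis .
qed

end

section \<open>The cutoff errors, summed over all \<open>J\<close>\<close>

context corona
begin

lemma hp_zero:
  assumes "J \<in> D" "\<And>x y. x \<in> J \<Longrightarrow> y \<in> B \<Longrightarrow> k (y - x) = 0"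
  shows "hp k B J = 0"
proof -
  have "sig.conv k (indicator B) x * haar w J x = 0" for x
  proof (cases "x \<in> J")
    case True
    have "indicator B y * k (y - x) = 0" for y using assms(2)[OF True, of y] by (cases "y \<in> B") auto
    then have "sig.conv k (indicator B) x = (\<integral>y. 0 \<partial>\<sigma>)"
      unfolding sig.conv_def by (intro Bochner_Integration.integral_cong refl)
    then show ?thesis by simp
  qed (simp add: wt.haar_outside[OF assms(1)])
  then have "hp k B J = (\<integral>x. 0 \<partial>w)"
    unfolding hp_def ip_def by (intro Bochner_Integration.integral_cong refl)
  then show ?thesis by simp
qed

lemma hp_combination:
  assumes "finite F" "F \<subseteq> D" "sig.bker k" "J \<in> D"
  shows "ip w (sig.conv k (\<lambda>y. \<Sum>K\<in>F. c K * indicator K y)) (haar w J) = (\<Sum>K\<in>F. c K * hp k K J)"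
proof -
  have b: "sig.bsupp (indicator K)" if "K \<in> F" for K using assms(2) that by (intro sig.D_bsupp) auto
  have i: "integrable w (\<lambda>x. sig.conv k (indicator K) x * haar w J x)" if "K \<in> F" for K
    by (rule wt.bker_haar_integrable[OF sig.conv_bker[OF b[OF that] assms(3)] assms(4)])
  have "ip w (sig.conv k (\<lambda>y. \<Sum>K\<in>F. c K * indicator K y)) (haar w J)
      = (\<integral>x. (\<Sum>K\<in>F. c K * (sig.conv k (indicator K) x * haar w J x)) \<partial>w)"
    unfolding ip_def using b by (simp add: sig.conv_sum[OF assms(1) _ assms(3)] sum_distrib_right mult.assoc)
  also have "\<dots> = (\<Sum>K\<in>F. \<integral>x. c K * (sig.conv k (indicator K) x * haar w J x) \<partial>w)"
    using i by (intro Bochner_Integration.integral_sum integrable_mult_right)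
  also have "\<dots> = (\<Sum>K\<in>F. c K * hp k K J)"
    unfolding hp_def ip_def by (simp only: Bochner_Integration.integral_mult_right_zero)
  finally show ?thesis .
qed

lemma hp_diff:
  assumes "K \<in> D" "K \<subseteq> I0" "sig.bker k" "J \<in> D"
  shows "hp k (I0 - K) J = hp k I0 J - hp k K J"
proof -
  have b: "sig.bsupp (indicator I0)" "sig.bsupp (indicator K)" using assms I0 by (auto intro: sig.D_bsupp)
  have ind: "indicator (I0 - K) y = (indicator I0 y - indicator K y :: real)" for y
    using assms(2) by (auto simp: indicator_def)
  have conv: "sig.conv k (indicator (I0 - K)) x = sig.conv k (indicator I0) x - sig.conv k (indicator K) x" for x
    unfolding sig.conv_def ind left_diff_distrib
    by (intro Bochner_Integration.integral_diff sig.conv_integrable b assms)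
  show ?thesis
    unfolding hp_def ip_def conv left_diff_distrib
    by (intro Bochner_Integration.integral_diff wt.bker_haar_integrable sig.conv_bker b assms)
qed

lemma far_sum_diff:
  assumes "J \<in> D" "sig.bker k"
  shows "far_sum (\<lambda>K. hp k (I0 - K) J) J = far_sum (\<lambda>_. 1) J * hp k I0 J - far_sum (\<lambda>K. hp k K J) J"
proof -
  have "far_sum (\<lambda>K. hp k (I0 - K) J) J = (\<Sum>K\<in>{K\<in>up J. far K J}. a K * 1 * hp k I0 J - a K * hp k K J)"
    unfolding far_sum_def using assms by (intro sum.cong refl) (simp add: up_def hp_diff right_diff_distrib psubset_imp_subset)
  then show ?thesis by (simp add: far_sum_def sum_subtractf sum_distrib_right)
qed

text \<open>
  Since the kernel lives at distance comparable to \<open>s\<close>, the sum over \<open>K\<close> telescopes to a function that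
  depends only on the ancestor of \<open>J\<close> of length comparable to \<open>s\<close>.
\<close>
lemma error_bound:
  assumes adm: "admissible JJ" and e: "annular s e"
  shows "(\<Sum>J\<in>JJ. (far_sum (\<lambda>K. hp e (I0 - K) J) J)\<^sup>2)
      \<le> 36 * H\<^sup>2 * (6 * 2 ^ (2 * r + 8) * real (Suc (2 * r + 8)) * measure \<sigma> I0)"
proof -
  define M where "M = 2 * r + 4"
  have finJ: "finite JJ" and g: "\<And>J. J \<in> JJ \<Longrightarrow> good J" using adm by (auto simp: admissible_def)
  have JD: "J \<in> D" if "J \<in> JJ" for J using g[OF that] good_D by auto
  have s0: "0 < s" using e by (simp add: annular_def)
  have bk: "sig.bker e" by (rule bker_annular[OF e])
  \<comment> \<open>\<open>k\<close> lies M + 3 levels below the cutoff scale. Enlarging a shorter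
    \<open>J\<close> to level \<open>k\<close> therefore keeps it \<open>M\<close> levels below
    every interval of length at least s / 2, and leaves boundedly many levels up to
    \<open>s\<close>.\<close>
  define k where "k = \<lfloor>log 2 s\<rfloor> - int (M + 3)"
  have ks: "2 powi (k + int (M + 3)) \<le> s" "s \<le> 2 powi (k + int (2 * r + 8))"
  proof -
    have *: "(2::real) powi n = 2 powr (of_int n)" for n :: int by (simp add: powr_real_of_int')
    have "2 powr (of_int \<lfloor>log 2 s\<rfloor>) \<le> 2 powr (log 2 s)" by simp
    also have "\<dots> = s" using s0 by simp
    finally show "2 powi (k + int (M + 3)) \<le> s" unfolding * by (simp add: k_def)
    have "s = 2 powr (log 2 s)" using s0 by simp
    also have "\<dots> \<le> 2 powr (of_int (\<lfloor>log 2 s\<rfloor> + 1))" by (intro powr_mono) linarith+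
    finally show "s \<le> 2 powi (k + int (2 * r + 8))" unfolding * by (simp add: k_def M_def)
  qed
  define J' where "J' = {J\<in>JJ. len J \<le> s \<and> J \<subseteq> I0}"
  define Lf where "Lf = (\<lambda>J. THE L. L \<in> D \<and> J \<subseteq> L \<and> level L = max (level J) k)"
  have Lf: "Lf J \<in> D" "J \<subseteq> Lf J" "level (Lf J) = max (level J) k" if "J \<in> JJ" for J
    using theI'[OF ancestor[OF JD[OF that], of "max (level J) k"]] by (auto simp: Lf_def)
  define Gs where "Gs = (\<lambda>L. {K\<in>up L. level L + int M \<le> level K \<and> s / 2 \<le> len K})"
  define \<phi> where "\<phi> = (\<lambda>L y. \<Sum>K\<in>Gs L. a K * indicator K y)"
  have finGs: "finite (Gs L)" "Gs L \<subseteq> D" if "L \<in> D" for L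
  proof -
    show "finite (Gs L)" unfolding Gs_def using finite_up[OF that] by simp
    show "Gs L \<subseteq> D" unfolding Gs_def up_def by blast
  qed
  have big: "k + int M \<le> level K" if "K \<in> D" "s / 2 \<le> len K" for K
  proof -
    have eq: "k + int (M + 2) = (k + int (M + 3)) - 1" by simp
    have "2 powi (k + int (M + 2)) = (2::real) powi (k + int (M + 3)) / 2" unfolding eq half_powi ..
    then have "(2::real) powi (k + int (M + 2)) \<le> 2 powi level K" using ks(1) that D_len[OF that(1)] by linarith
    then show ?thesis by (simp add: powi_le_iff)
  qed
  have Gs_eq: "Gs (Lf J) = {K\<in>up J. far K J \<and> s / 2 \<le> len K}" if J: "J \<in> JJ" for J
  proof -
    have "K \<in> Gs (Lf J) \<longleftrightarrow> K \<in> up J \<and> far K J \<and> s / 2 \<le> len K" for K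
    proof
      assume "K \<in> Gs (Lf J)"
      then have K: "K \<in> D" "Lf J \<subseteq> K" "K \<subset> I0" "level (Lf J) + int M \<le> level K" "s / 2 \<le> len K"
        by (auto simp only: Gs_def up_def mem_Collect_eq)
      have "J \<subseteq> K" using Lf(2)[OF J] K(2) by (rule subset_trans)
      moreover have "level J + int M \<le> level K" using K(4) Lf(3)[OF J] by simp
      ultimately show "K \<in> up J \<and> far K J \<and> s / 2 \<le> len K"
        using K unfolding up_def far_def M_def by blast
    next
      assume K: "K \<in> up J \<and> far K J \<and> s / 2 \<le> len K"
      then have K': "K \<in> D" "J \<subseteq> K" "K \<subset> I0" "level J + int M \<le> level K" by (auto simp only: up_def far_def M_def mem_Collect_eq)
      have lev: "level (Lf J) + int M \<le> level K" using K'(4) big[OF K'(1)] K Lf(3)[OF J] by simp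
      moreover have "Lf J \<subseteq> K" using sub_level[OF Lf(1)[OF J] K'(1) JD[OF J] Lf(2)[OF J] K'(2)] lev by simp
      ultimately show "K \<in> Gs (Lf J)" using K K' unfolding Gs_def up_def by blast
    qed
    then show ?thesis by blast
  qed
  have \<phi>b: "sig.bsupp (\<phi> L)" if "L \<in> D" for L
    unfolding \<phi>_def using finGs[OF that] by (intro sig.bsupp_sum sig.D_bsupp) auto
  have \<phi>0: "\<phi> L y = 0" if "y \<notin> I0" for L y
    unfolding \<phi>_def using that by (intro sum.neutral) (auto simp: Gs_def up_def indicator_def)
  \<comment> \<open>The intervals of \<open>Gs (Lf J)\<close> that contain \<open>y\<close> are
    exactly those of \<open>up K0\<close> for the smallest one \<open>K0\<close>, so
    \<open>chain_sum\<close> at \<open>K0\<close> gives the bound.\<close>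
  have \<phi>1: "\<bar>\<phi> (Lf J) y\<bar> \<le> 1" if J: "J \<in> JJ" for J y
  proof -
    let ?L = "Lf J"
    let ?X = "{K\<in>Gs ?L. y \<in> K}"
    have fX: "finite ?X" using finGs[OF Lf(1)[OF J]] by simp
    have eq: "\<phi> ?L y = (\<Sum>K\<in>?X. a K)"
    proof -
      have "\<phi> ?L y = (\<Sum>K\<in>Gs ?L. if y \<in> K then a K else 0)" unfolding \<phi>_def by (intro sum.cong) auto
      then show ?thesis using finGs[OF Lf(1)[OF J]] by (simp add: sum.If_cases Int_def)
    qed
    show ?thesis
    proof (cases "?X = {}")
      case True
      show ?thesis unfolding eq True by simp
    next
      case False
      then obtain K0 where K0: "K0 \<in> ?X" "\<And>K. K \<in> ?X \<Longrightarrow> level K0 \<le> level K"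
        using ex_is_arg_min_if_finite[OF fX False, of level] by (auto simp: is_arg_min_def not_less)
      have K0': "K0 \<in> D" "?L \<subseteq> K0" "K0 \<subset> I0" "level ?L + int M \<le> level K0" "s / 2 \<le> len K0" "y \<in> K0"
        using K0(1) by (auto simp only: Gs_def up_def mem_Collect_eq)
      have "K \<in> ?X \<longleftrightarrow> K \<in> up K0" for K
      proof
        assume K: "K \<in> ?X"
        then have "K \<in> D" "K \<subset> I0" "y \<in> K" by (auto simp only: Gs_def up_def mem_Collect_eq)
        then show "K \<in> up K0" using nested_level[of K K0 y] K0(2)[OF K] K0' unfolding up_def by blast
      next
        assume "K \<in> up K0"
        then have K: "K \<in> D" "K0 \<subseteq> K" "K \<subset> I0" by (auto simp only: up_def mem_Collect_eq)
        have lv: "level K0 \<le> level K" by (rule level_mono[OF K(1) K0'(1) K(2)])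
        have "len K0 \<le> len K" using lv level_le_iff[OF K0'(1) K(1)] by simp
        then have "s / 2 \<le> len K" "level ?L + int M \<le> level K" using K0' lv by linarith+
        then show "K \<in> ?X" using K K0' unfolding Gs_def up_def by blast
      qed
      then have X: "?X = up K0" by blast
      have "J \<subseteq> K0" using Lf(2)[OF J] K0'(2) by (rule subset_trans)
      moreover have "level J + int r \<le> level K0" using K0'(4) Lf(3)[OF J] by (simp add: M_def)
      ultimately have "\<not> (\<exists>S\<in>SS. K0 \<subseteq> S)" using not_in_SS[OF adm J _ K0'(1)] by blast
      then show ?thesis unfolding eq X using chain_sum[OF K0'(1)] K0'(3) by blast
    qed
  qed
  have Z: "(far_sum (\<lambda>K. hp e (I0 - K) J) J)\<^sup>2 \<le> 2 * (hp e I0 J)\<^sup>2 + 2 * (ip w (sig.conv e (\<phi> (Lf J))) (haar w J))\<^sup>2"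
    if J: "J \<in> JJ" for J
  proof -
    have "far_sum (\<lambda>K. hp e K J) J = (\<Sum>K\<in>Gs (Lf J). a K * hp e K J)"
      unfolding far_sum_def
    proof (rule sum.mono_neutral_right)
      show "finite {K\<in>up J. far K J}" using finite_up[OF JD[OF J]] by simp
      show "Gs (Lf J) \<subseteq> {K\<in>up J. far K J}" unfolding Gs_eq[OF J] by blast
      \<comment> \<open>Two points of an interval shorter than s / 2 are too close for
        \<open>e\<close>, so these terms vanish.\<close>
      show "\<forall>K\<in>{K\<in>up J. far K J} - Gs (Lf J). a K * hp e K J = 0"
      proof
        fix K assume "K \<in> {K\<in>up J. far K J} - Gs (Lf J)"
        then have K: "K \<in> D" "J \<subseteq> K" "len K < s / 2" unfolding Gs_eq[OF J] up_def by auto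
        have "hp e K J = 0"
        proof (rule hp_zero[OF JD[OF J]])
          fix x y assume "x \<in> J" "y \<in> K"
          then have "Inf K \<le> x \<and> x < Inf K + len K" "Inf K \<le> y \<and> y < Inf K + len K"
            using subsetD[OF K(2), of x] unfolding mem_D[OF K(1)] by blast+
          then have "\<bar>y - x\<bar> < s / 2" using K(3) by linarith
          then show "e (y - x) = 0" using e unfolding annular_def by (meson not_le)
        qed
        then show "a K * hp e K J = 0" by simp
      qed
    qed
    also have "\<dots> = ip w (sig.conv e (\<phi> (Lf J))) (haar w J)"
      unfolding \<phi>_def by (rule hp_combination[symmetric, OF finGs[OF Lf(1)[OF J]] bk JD[OF J]])
    finally have fs: "far_sum (\<lambda>K. hp e (I0 - K) J) J = far_sum (\<lambda>_. 1) J * hp e I0 J - ip w (sig.conv e (\<phi> (Lf J))) (haar w J)"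
      using far_sum_diff[OF JD[OF J] bk] by simp
    have "(u - v)\<^sup>2 \<le> 2 * u\<^sup>2 + 2 * v\<^sup>2" for u v :: real
      using zero_le_power2[of "u + v"] by (simp add: power2_eq_square algebra_simps)
    then have "(far_sum (\<lambda>K. hp e (I0 - K) J) J)\<^sup>2 \<le> 2 * (far_sum (\<lambda>_. 1) J * hp e I0 J)\<^sup>2 + 2 * (ip w (sig.conv e (\<phi> (Lf J))) (haar w J))\<^sup>2"
      unfolding fs by blast
    moreover have "(far_sum (\<lambda>_. 1) J * hp e I0 J)\<^sup>2 \<le> 1 * (hp e I0 J)\<^sup>2"
      unfolding power_mult_distrib
      using power_mono[OF far_sum_one(1)[OF adm J], of 2] by (intro mult_right_mono) auto
    ultimately show ?thesis by linarith
  qed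
  have zero: "far_sum (\<lambda>K. hp e (I0 - K) J) J = 0" if J: "J \<in> JJ" "J \<notin> J'" for J
  proof (cases "J \<subseteq> I0")
    case False
    then have e: "{K\<in>up J. far K J} = {}" by (auto simp: up_def)
    show ?thesis unfolding far_sum_def e by simp
  next
    case True
    then have sJ: "s < len J" using J by (auto simp: J'_def)
    \<comment> \<open>The complement of \<open>K\<close> is at distance at least |J| > s from
      \<open>J\<close>, beyond the range of \<open>e\<close>.\<close>
    have "hp e (I0 - K) J = 0" if K: "K \<in> up J" "far K J" for K
    proof (rule hp_zero[OF JD[OF J(1)]])
      fix x y assume x: "x \<in> J" and y: "y \<in> I0 - K"
      have KD: "K \<in> D" using K(1) by (simp add: up_def)
      have "len J \<le> infdist y J" using far_gap[OF g[OF J(1)] KD K(2)] y by blast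
      also have "\<dots> \<le> \<bar>y - x\<bar>" by (rule infdist_le_abs[OF x])
      finally show "e (y - x) = 0" using e sJ unfolding annular_def by (meson less_le_trans not_le)
    qed
    then show ?thesis unfolding far_sum_def by (intro sum.neutral) auto
  qed
  let ?B = "\<lambda>L. measure \<sigma> (I0 \<inter> {Inf L - s..Inf L + len L + s})"
  have sub: "J' \<subseteq> JJ" "finite J'" using finJ by (auto simp: J'_def)
  have LL: "L \<in> D" "2 powi k \<le> len L \<and> len L \<le> s" if LJ: "L \<in> Lf ` J'" for L
  proof -
    obtain J where J: "J \<in> JJ" "len J \<le> s" "L = Lf J" using LJ by (auto simp: J'_def)
    show LD: "L \<in> D" using Lf(1)[OF J(1)] J by simp
    have lv: "level L = max (level J) k" using Lf(3)[OF J(1)] J by simp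
    have "(2::real) powi k \<le> s" using ks(1) powi_le_iff[of k "k + int (M + 3)"] by linarith
    then show "2 powi k \<le> len L \<and> len L \<le> s"
      using J(2) D_len[OF LD] D_len[OF JD[OF J(1)]] lv powi_le_iff[of k "level L"] by (auto simp: max_def)
  qed
  \<comment> \<open>Applied twice, to the indicator of \<open>I0\<close> and to the telescoped
    \<open>\<phi>\<close>, the two parts into which the complements of the \<open>K\<close>
    split.\<close>
  have fam: "(\<Sum>J\<in>J'. (ip w (sig.conv e (\<psi> (Lf J))) (haar w J))\<^sup>2)
      \<le> 9 * H\<^sup>2 * (6 * 2 ^ (2 * r + 8) * real (Suc (2 * r + 8)) * measure \<sigma> I0)"
    if \<psi>: "\<And>L. L \<in> Lf ` J' \<Longrightarrow> sig.bsupp (\<psi> L)" "\<And>L y. L \<in> Lf ` J' \<Longrightarrow> \<bar>\<psi> L y\<bar> \<le> 1" "\<And>L y. y \<notin> I0 \<Longrightarrow> \<psi> L y = 0" for \<psi>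
  proof -
    have "(\<Sum>J\<in>J'. (ip w (sig.conv e (\<psi> (Lf J))) (haar w J))\<^sup>2)
        = (\<Sum>L\<in>Lf ` J'. \<Sum>J\<in>{J\<in>J'. Lf J = L}. (ip w (sig.conv e (\<psi> (Lf J))) (haar w J))\<^sup>2)"
      using sub by (intro sum.group[symmetric]) auto
    also have "\<dots> = (\<Sum>L\<in>Lf ` J'. \<Sum>J\<in>{J\<in>J'. Lf J = L}. (ip w (sig.conv e (\<psi> L)) (haar w J))\<^sup>2)"
      by (intro sum.cong refl) simp
    also have "\<dots> \<le> (\<Sum>L\<in>Lf ` J'. 9 * H\<^sup>2 * ?B L)"
    proof (rule sum_mono)
      fix L assume L: "L \<in> Lf ` J'"
      show "(\<Sum>J\<in>{J\<in>J'. Lf J = L}. (ip w (sig.conv e (\<psi> L)) (haar w J))\<^sup>2) \<le> 9 * H\<^sup>2 * ?B L"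
      proof (rule annular_local[OF e LL(1)[OF L]])
        show "len L \<le> s" using LL(2)[OF L] by simp
        show "{J\<in>J'. Lf J = L} \<subseteq> D" using sub JD by auto
        show "J \<subseteq> L" if "J \<in> {J\<in>J'. Lf J = L}" for J using that Lf(2)[of J] sub by auto
      qed (use sub \<psi> L in auto)
    qed
    also have "\<dots> = 9 * H\<^sup>2 * (\<Sum>L\<in>Lf ` J'. ?B L)" by (simp add: sum_distrib_left)
    also have "\<dots> \<le> 9 * H\<^sup>2 * (6 * 2 ^ (2 * r + 8) * real (Suc (2 * r + 8)) * measure \<sigma> I0)"
      using sub LL ks(2) by (intro mult_left_mono annular_families[OF e]) auto
    finally show ?thesis .
  qed
  have "(\<Sum>J\<in>JJ. (far_sum (\<lambda>K. hp e (I0 - K) J) J)\<^sup>2) = (\<Sum>J\<in>J'. (far_sum (\<lambda>K. hp e (I0 - K) J) J)\<^sup>2)"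
    using finJ sub zero by (intro sum.mono_neutral_right) auto
  also have "\<dots> \<le> (\<Sum>J\<in>J'. 2 * (hp e I0 J)\<^sup>2 + 2 * (ip w (sig.conv e (\<phi> (Lf J))) (haar w J))\<^sup>2)"
    using Z sub by (intro sum_mono) auto
  also have "\<dots> = 2 * (\<Sum>J\<in>J'. (hp e I0 J)\<^sup>2) + 2 * (\<Sum>J\<in>J'. (ip w (sig.conv e (\<phi> (Lf J))) (haar w J))\<^sup>2)"
    by (simp add: sum.distrib sum_distrib_left)
  also have "\<dots> \<le> 2 * (9 * H\<^sup>2 * (6 * 2 ^ (2 * r + 8) * real (Suc (2 * r + 8)) * measure \<sigma> I0))
      + 2 * (9 * H\<^sup>2 * (6 * 2 ^ (2 * r + 8) * real (Suc (2 * r + 8)) * measure \<sigma> I0))"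
  proof (intro add_mono mult_left_mono)
    show "(\<Sum>J\<in>J'. (hp e I0 J)\<^sup>2) \<le> 9 * H\<^sup>2 * (6 * 2 ^ (2 * r + 8) * real (Suc (2 * r + 8)) * measure \<sigma> I0)"
      unfolding hp_def
    proof (rule fam[where \<psi> = "\<lambda>_. indicator I0"])
      show "sig.bsupp (indicator I0)" by (rule sig.D_bsupp[OF I0])
    qed (auto simp: indicator_def)
    show "(\<Sum>J\<in>J'. (ip w (sig.conv e (\<phi> (Lf J))) (haar w J))\<^sup>2) \<le> 9 * H\<^sup>2 * (6 * 2 ^ (2 * r + 8) * real (Suc (2 * r + 8)) * measure \<sigma> I0)"
    proof (rule fam)
      show "sig.bsupp (\<phi> L)" if "L \<in> Lf ` J'" for L by (rule \<phi>b[OF LL(1)[OF that]])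
      show "\<bar>\<phi> L y\<bar> \<le> 1" if "L \<in> Lf ` J'" for L y using that \<phi>1 sub by auto
      show "\<phi> L y = 0" if "y \<notin> I0" for L y by (rule \<phi>0[OF that])
    qed
  qed auto
  also have "\<dots> = 36 * H\<^sup>2 * (6 * 2 ^ (2 * r + 8) * real (Suc (2 * r + 8)) * measure \<sigma> I0)"
  proof -
    have "2 * (9 * p * q) + 2 * (9 * p * q) = 36 * p * q" for p q :: real by simp
    then show ?thesis by this
  qed
  finally show ?thesis .
qed

end

section \<open>The theorem\<close>

context good_dyadic
begin

text \<open>The form is indexed here by the child \<open>K\<close> of \<open>I\<close> that contains
  \<open>J\<close>; the + 1 in the level condition is the step from \<open>K\<close> to its parent
  \<open>I\<close>.\<close>

definition scales :: "real set \<Rightarrow> real set \<Rightarrow> real set set" where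
  "scales I0 J = {K\<in>D. J \<subseteq> K \<and> K \<subset> I0 \<and> good (parent K) \<and> level J + int r \<le> level K + 1}"

definition row :: "real \<Rightarrow> real \<Rightarrow> real measure \<Rightarrow> real measure \<Rightarrow> real set \<Rightarrow> (real \<Rightarrow> real) \<Rightarrow> real set \<Rightarrow> real" where
  "row \<epsilon> \<delta> \<sigma> w I0 f J = (\<Sum>K\<in>scales I0 J. ip \<sigma> f (haar \<sigma> (parent K)) * haar \<sigma> (parent K) (Inf K) *
      ip w (hilbert \<epsilon> \<delta> \<sigma> (indicator K)) (haar w J))"

lemma finite_scales: "J \<in> D \<Longrightarrow> I0 \<in> D \<Longrightarrow> finite (scales I0 J)"
  using finite_between[of J I0] by (rule rev_finite_subset) (auto simp: scales_def)

lemma deeply_inside_level: "J \<in> D \<Longrightarrow> I \<in> D \<Longrightarrow> deeply_inside r J I \<longleftrightarrow> J \<subseteq> I \<and> level J + int r \<le> level I"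
  using len_level_iff[of J I r] by (auto simp: deeply_inside_def)

lemma haar_diff_value_eq:
  assumes "weight \<sigma>" "K \<in> D" "J \<in> D" "J \<subseteq> K"
  shows "haar_diff_value \<sigma> J (parent K) f = ip \<sigma> f (haar \<sigma> (parent K)) * haar \<sigma> (parent K) (Inf K)"
proof -
  interpret sig: dyadic_weight D \<sigma> using grid assms(1) by (simp add: dyadic_weight_def dyadic_def)
  have c: "haar \<sigma> (parent K) x = haar \<sigma> (parent K) (Inf K)" if "x \<in> K" for x
  proof (rule sig.haar_const)
    show "K \<inter> parent K = {} \<or> K \<subseteq> left_child (parent K) \<or> K \<subseteq> right_child (parent K)"
      using child_parent[OF assms(2)] equalityD1 by blast
  qed (use assms parent Inf_in that in auto)
  show ?thesis
    unfolding haar_diff_value_def child_containing_eq[OF assms(2,3,4)]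
  proof (rule the_equality)
    show "\<forall>x\<in>K. haar_diff \<sigma> (parent K) f x = ip \<sigma> f (haar \<sigma> (parent K)) * haar \<sigma> (parent K) (Inf K)"
    proof
      fix x assume "x \<in> K"
      show "haar_diff \<sigma> (parent K) f x = ip \<sigma> f (haar \<sigma> (parent K)) * haar \<sigma> (parent K) (Inf K)"
        by (simp only: haar_diff_def c[OF \<open>x \<in> K\<close>])
    qed
    fix d assume "\<forall>x\<in>K. haar_diff \<sigma> (parent K) f x = d"
    then show "d = ip \<sigma> f (haar \<sigma> (parent K)) * haar \<sigma> (parent K) (Inf K)"
      using Inf_in[OF assms(2)] by (auto simp: haar_diff_def)
  qed
qed

text \<open>The pairs are reindexed by \<open>J\<close> and the child \<open>K\<close>.
  \<open>S\<close> has to contain only the good part of the Haar support of \<open>g\<close>, so the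
  formula serves both \<open>g\<close> itself and its truncations.\<close>

lemma B_above_fin_eq:
  assumes \<sigma>: "weight \<sigma>" and I0: "I0 \<in> D" and S: "finite S" "\<And>J. J \<in> S \<Longrightarrow> good J"
    and supp: "\<And>J. good J \<Longrightarrow> J \<notin> S \<Longrightarrow> ip w g (haar w J) = 0"
  shows "B_above_fin D \<theta> r \<epsilon> \<delta> \<sigma> w I0 f g = (\<Sum>J\<in>S. ip w g (haar w J) * row \<epsilon> \<delta> \<sigma> w I0 f J)"
proof -
  let ?t = "\<lambda>(I, J). haar_diff_value \<sigma> J I f * ip w (hilbert \<epsilon> \<delta> \<sigma> (indicator (child_containing I J))) (haar_diff w J g)"
  let ?P = "{(I, J). I \<subseteq> I0 \<and> deeply_inside r J I \<and> good I \<and> good J}"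
  let ?F = "(\<lambda>(J, K). (parent K, J)) ` Sigma S (scales I0)"
  have b: "ip w G (haar_diff w J g) = ip w g (haar w J) * ip w G (haar w J)" for G J
  proof -
    have "ip w G (haar_diff w J g) = (\<integral>x. ip w g (haar w J) * (G x * haar w J x) \<partial>w)"
      unfolding ip_def[of w G] haar_diff_def by (simp add: mult_ac)
    also have "\<dots> = ip w g (haar w J) * ip w G (haar w J)"
      unfolding ip_def[of w G] by (rule Bochner_Integration.integral_mult_right_zero)
    finally show ?thesis .
  qed
  have fin: "finite (Sigma S (scales I0))" using S finite_scales[OF _ I0] good_D by auto
  have inj: "inj_on (\<lambda>(J, K). (parent K, J)) (Sigma S (scales I0))"
  proof (rule inj_onI)
    fix x y assume xy: "x \<in> Sigma S (scales I0)" "y \<in> Sigma S (scales I0)"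
      "(case x of (J, K) \<Rightarrow> (parent K, J)) = (case y of (J, K) \<Rightarrow> (parent K, J))"
    obtain J K K' where x: "x = (J, K)" and y: "y = (J, K')" using xy(3) by (cases x; cases y) auto
    have K: "J \<in> S" "K \<in> scales I0 J" "K' \<in> scales I0 J" "parent K = parent K'" using xy by (auto simp: x y)
    have KD: "K \<in> D" "K' \<in> D" "J \<subseteq> K" "J \<subseteq> K'" using K by (auto simp: scales_def)
    have "level K = level K'" using parent(3)[OF KD(1)] parent(3)[OF KD(2)] K(4) by simp
    then have "K = K'" using same_level[OF KD(1,2), of "Inf J"] Inf_in[of J] good_D[OF S(2)[OF K(1)]] KD(3,4) by blast
    then show "x = y" by (simp add: x y)
  qed
  have "B_above_fin D \<theta> r \<epsilon> \<delta> \<sigma> w I0 f g = infsum ?t ?P" by (simp add: B_above_fin_def)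
  also have "\<dots> = infsum ?t ?F"
  proof (rule infsum_cong_neutral)
    show "?t x = 0" if x: "x \<in> ?F - ?P" for x
    proof -
      obtain J K where JK: "J \<in> S" "K \<in> scales I0 J" "x = (parent K, J)" using x by auto
      have g: "good J" "J \<in> D" using S(2)[OF JK(1)] good_D by auto
      have K: "K \<in> D" "J \<subseteq> K" "K \<subset> I0" "good (parent K)" "level J + int r \<le> level K + 1" using JK(2) by (auto simp: scales_def)
      have "J \<subseteq> parent K" using K(2) parent(2)[OF K(1)] by (rule subset_trans)
      then have "deeply_inside r J (parent K)" using deeply_inside_level[OF g(2) parent(1)[OF K(1)]] parent(3)[OF K(1)] K(5) by simp
      then have "x \<in> ?P" using JK(3) K(4) g parent_least[OF K(1) I0 K(3)] by simp
      then show ?thesis using x by blast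
    qed
    show "?t x = 0" if x: "x \<in> ?P - ?F" for x
    proof -
      obtain I J where IJ: "x = (I, J)" "I \<subseteq> I0" "deeply_inside r J I" "good I" "good J" using x by auto
      have D: "I \<in> D" "J \<in> D" using IJ good_D by auto
      have JI: "J \<subseteq> I" "level J + int r \<le> level I" using IJ(3) deeply_inside_level[OF D(2,1)] by auto
      show ?thesis
      proof (cases "J \<in> S")
        case False
        then show ?thesis using supp[OF IJ(5)] IJ(1) b by simp
      next
        case True
        have "J \<subset> I" using JI r by auto
        note K = child_containing[OF D this]
        let ?K = "child_containing I J"
        have "?K \<subset> I0" using parent_psubset[OF K(1)] K(3) IJ(2) by auto
        moreover have "level J + int r \<le> level ?K + 1" using parent(3)[OF K(1)] K(3) JI(2) by simp
        ultimately have "?K \<in> scales I0 J" using K IJ(4) unfolding scales_def by simp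
        then have "(parent ?K, J) \<in> ?F" using True by force
        then show ?thesis using x IJ(1) K(3) by auto
      qed
    qed
  qed simp
  also have "\<dots> = (\<Sum>x\<in>?F. ?t x)" using fin by (intro infsum_finite) auto
  also have "\<dots> = (\<Sum>(J, K)\<in>Sigma S (scales I0). ?t (parent K, J))"
    using inj by (simp add: sum.reindex case_prod_unfold)
  also have "\<dots> = (\<Sum>J\<in>S. \<Sum>K\<in>scales I0 J. ?t (parent K, J))"
    using S finite_scales[OF _ I0] good_D by (intro sum.Sigma[symmetric]) auto
  also have "\<dots> = (\<Sum>J\<in>S. ip w g (haar w J) * row \<epsilon> \<delta> \<sigma> w I0 f J)"
  proof (rule sum.cong[OF refl])
    fix J assume J: "J \<in> S"
    have JD: "J \<in> D" using S(2)[OF J] good_D by auto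
    have "?t (parent K, J) = ip w g (haar w J) * (ip \<sigma> f (haar \<sigma> (parent K)) * haar \<sigma> (parent K) (Inf K) *
      ip w (hilbert \<epsilon> \<delta> \<sigma> (indicator K)) (haar w J))" if K: "K \<in> scales I0 J" for K
    proof -
      have K: "K \<in> D" "J \<subseteq> K" using K by (auto simp: scales_def)
      show ?thesis by (simp add: haar_diff_value_eq[OF \<sigma> K(1) JD K(2)] child_containing_eq[OF K(1) JD K(2)] b)
    qed
    then show "(\<Sum>K\<in>scales I0 J. ?t (parent K, J)) = ip w g (haar w J) * row \<epsilon> \<delta> \<sigma> w I0 f J"
      unfolding row_def sum_distrib_left by (rule sum.cong[OF refl])
  qed
  finally show ?thesis .
qed

end

text \<open>One summand per part of \<open>row_split\<close>: near intervals, paraproduct, stopping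
  form, and the two cutoff errors together; the 5 comes from squaring a sum of five terms.\<close>

definition core_const :: "nat \<Rightarrow> real \<Rightarrow> real" where
  "core_const r C0 = 5 * (real (2 * r + 4) * 2 + 1 + (real r * 2 ^ 15)\<^sup>2 * (640 * C0) + 2 * (36 * (6 * 2 ^ (2 * r + 8) * real (Suc (2 * r + 8)))))"

section \<open>The square sum of the rows\<close>

context corona
begin

text \<open>Only the complement term is rewritten with the smooth kernel; the near intervals and
  \<open>I0\<close> keep the hard kernel, to which the testing condition refers.\<close>

lemma row_split:
  assumes adm: "admissible JJ" and J: "J \<in> JJ"
    and split: "\<And>t. hard \<epsilon> \<delta> t = smooth t + e1 t - e2 t" and e: "annular \<epsilon> e1" "annular \<delta> e2"
  shows "row \<epsilon> \<delta> \<sigma> w I0 f J =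
      (\<Sum>K\<in>{K\<in>up J. \<not> far K J \<and> level J + int r \<le> level K + 1}. a K * hp (hard \<epsilon> \<delta>) K J)
      + far_sum (\<lambda>_. 1) J * hp (hard \<epsilon> \<delta>) I0 J - far_sum (\<lambda>K. pairing (I0 - K) J) J
      - far_sum (\<lambda>K. hp e1 (I0 - K) J) J + far_sum (\<lambda>K. hp e2 (I0 - K) J) J"
proof -
  have JD: "J \<in> D" using adm J good_D by (auto simp: admissible_def)
  let ?Y = "{K\<in>up J. level J + int r \<le> level K + 1}"
  let ?g = "\<lambda>K. a K * hp (hard \<epsilon> \<delta>) K J"
  have finY: "finite ?Y" using finite_up[OF JD] by simp
  have "row \<epsilon> \<delta> \<sigma> w I0 f J = (\<Sum>K\<in>scales I0 J. ?g K)"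
    unfolding row_def a_def hp_def sig.hilbert_conv ..
  also have "\<dots> = (\<Sum>K\<in>?Y. ?g K)"
  proof (rule sum.mono_neutral_left[OF finY])
    show "scales I0 J \<subseteq> ?Y" unfolding scales_def up_def by blast
    show "\<forall>K\<in>?Y - scales I0 J. ?g K = 0"
      using a_not_good unfolding scales_def up_def by auto
  qed
  also have "\<dots> = (\<Sum>K\<in>{K\<in>up J. \<not> far K J \<and> level J + int r \<le> level K + 1} \<union> {K\<in>up J. far K J}. ?g K)"
  proof (rule sum.cong[OF _ refl])
    have "level J + int r \<le> level K + 1" if "far K J" for K using that by (simp add: far_def)
    then show "?Y = {K\<in>up J. \<not> far K J \<and> level J + int r \<le> level K + 1} \<union> {K\<in>up J. far K J}" by blast
  qed
  also have "\<dots> = (\<Sum>K\<in>{K\<in>up J. \<not> far K J \<and> level J + int r \<le> level K + 1}. ?g K) + far_sum (\<lambda>K. hp (hard \<epsilon> \<delta>) K J) J"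
    unfolding far_sum_def using finite_up[OF JD] by (intro sum.union_disjoint) auto
  finally have 1: "row \<epsilon> \<delta> \<sigma> w I0 f J = \<dots>" .
  have 2: "far_sum (\<lambda>K. hp (hard \<epsilon> \<delta>) (I0 - K) J) J = far_sum (\<lambda>_. 1) J * hp (hard \<epsilon> \<delta>) I0 J - far_sum (\<lambda>K. hp (hard \<epsilon> \<delta>) K J) J"
    by (rule far_sum_diff[OF JD bker_hard])
  have hq: "hp (hard \<epsilon> \<delta>) (I0 - K) J = pairing (I0 - K) J + hp e1 (I0 - K) J - hp e2 (I0 - K) J" if K: "K \<in> D" for K
  proof -
    have b: "sig.bsupp (indicator (I0 - K))"
      using sig.D_borel[OF I0] sig.D_borel[OF K] bounded_subset[OF sig.D_bounded[OF I0]] by (intro sig.bsupp_indicator) auto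
    note bk = bker_smooth bker_annular[OF e(1)] bker_annular[OF e(2)]
    have "hard \<epsilon> \<delta> = (\<lambda>t. smooth t + e1 t - e2 t)" using split by blast
    then have conv: "sig.conv (hard \<epsilon> \<delta>) (indicator (I0 - K)) x = sig.conv smooth (indicator (I0 - K)) x
        + sig.conv e1 (indicator (I0 - K)) x - sig.conv e2 (indicator (I0 - K)) x" for x
      using sig.conv_kernel_combination[OF b bk] by simp
    note i = wt.bker_haar_integrable[OF sig.conv_bker[OF b bk(1)] JD] wt.bker_haar_integrable[OF sig.conv_bker[OF b bk(2)] JD]
      wt.bker_haar_integrable[OF sig.conv_bker[OF b bk(3)] JD]
    show ?thesis
      unfolding hp_def pairing_def ip_def conv left_diff_distrib distrib_right
      using i by simp
  qed
  have 3: "far_sum (\<lambda>K. hp (hard \<epsilon> \<delta>) (I0 - K) J) J = far_sum (\<lambda>K. pairing (I0 - K) J) J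
      + far_sum (\<lambda>K. hp e1 (I0 - K) J) J - far_sum (\<lambda>K. hp e2 (I0 - K) J) J"
    unfolding far_sum_def sum.distrib[symmetric] sum_subtractf[symmetric]
  proof (rule sum.cong[OF refl])
    fix K assume "K \<in> {K\<in>up J. far K J}"
    then have KD: "K \<in> D" by (simp add: up_def)
    show "a K * hp (hard \<epsilon> \<delta>) (I0 - K) J = a K * pairing (I0 - K) J + a K * hp e1 (I0 - K) J - a K * hp e2 (I0 - K) J"
      unfolding hq[OF KD] by (simp add: algebra_simps)
  qed
  show ?thesis using 1 2 3 by linarith
qed

lemma core_bound:
  assumes adm: "admissible JJ"
  shows "(\<Sum>J\<in>JJ. (row \<epsilon> \<delta> \<sigma> w I0 f J)\<^sup>2) \<le> core_const r C0 * H\<^sup>2 * (sqrt (measure \<sigma> I0) + nrm \<sigma> f)\<^sup>2"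
proof -
  obtain e1 e2 where e: "annular \<epsilon> e1" "annular \<delta> e2" "\<And>t. hard \<epsilon> \<delta> t = (psi \<epsilon> t - psi \<delta> t) + e1 t - e2 t"
    using hard_split[OF eps] by blast
  have finJ: "finite JJ" and JD: "JJ \<subseteq> D" using adm good_D by (auto simp: admissible_def)
  let ?x1 = "\<lambda>J. \<Sum>K\<in>{K\<in>up J. \<not> far K J \<and> level J + int r \<le> level K + 1}. a K * hp (hard \<epsilon> \<delta>) K J"
  let ?x2 = "\<lambda>J. far_sum (\<lambda>_. 1) J * hp (hard \<epsilon> \<delta>) I0 J"
  let ?x3 = "\<lambda>J. far_sum (\<lambda>K. pairing (I0 - K) J) J"
  let ?x4 = "\<lambda>J. far_sum (\<lambda>K. hp e1 (I0 - K) J) J"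
  let ?x5 = "\<lambda>J. far_sum (\<lambda>K. hp e2 (I0 - K) J) J"
  let ?m = "measure \<sigma> I0" and ?n = "(nrm \<sigma> f)\<^sup>2" and ?N = "36 * (6 * 2 ^ (2 * r + 8) * real (Suc (2 * r + 8)))"
  have "(p + q - u - v + z)\<^sup>2 \<le> 5 * (p\<^sup>2 + q\<^sup>2 + u\<^sup>2 + v\<^sup>2 + z\<^sup>2)" for p q u v z :: real
  proof -
    have "(p + q - u - v + z)\<^sup>2 + ((p - q)\<^sup>2 + (p + u)\<^sup>2 + (p + v)\<^sup>2 + (p - z)\<^sup>2 + (q + u)\<^sup>2 + (q + v)\<^sup>2
      + (q - z)\<^sup>2 + (u - v)\<^sup>2 + (u + z)\<^sup>2 + (v + z)\<^sup>2) = 5 * (p\<^sup>2 + q\<^sup>2 + u\<^sup>2 + v\<^sup>2 + z\<^sup>2)"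
      by (simp add: power2_eq_square algebra_simps)
    moreover have "0 \<le> (p - q)\<^sup>2 + (p + u)\<^sup>2 + (p + v)\<^sup>2 + (p - z)\<^sup>2 + (q + u)\<^sup>2 + (q + v)\<^sup>2
      + (q - z)\<^sup>2 + (u - v)\<^sup>2 + (u + z)\<^sup>2 + (v + z)\<^sup>2" by (intro add_nonneg_nonneg) auto
    ultimately show ?thesis by linarith
  qed
  then have "(row \<epsilon> \<delta> \<sigma> w I0 f J)\<^sup>2 \<le> 5 * ((?x1 J)\<^sup>2 + (?x2 J)\<^sup>2 + (?x3 J)\<^sup>2 + (?x4 J)\<^sup>2 + (?x5 J)\<^sup>2)" if "J \<in> JJ" for J
    unfolding row_split[OF adm that e(3)[folded smooth_def] e(1,2)] .
  then have "(\<Sum>J\<in>JJ. (row \<epsilon> \<delta> \<sigma> w I0 f J)\<^sup>2) \<le> (\<Sum>J\<in>JJ. 5 * ((?x1 J)\<^sup>2 + (?x2 J)\<^sup>2 + (?x3 J)\<^sup>2 + (?x4 J)\<^sup>2 + (?x5 J)\<^sup>2))"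
    by (rule sum_mono)
  also have "\<dots> = 5 * ((\<Sum>J\<in>JJ. (?x1 J)\<^sup>2) + (\<Sum>J\<in>JJ. (?x2 J)\<^sup>2) + (\<Sum>J\<in>JJ. (?x3 J)\<^sup>2) + (\<Sum>J\<in>JJ. (?x4 J)\<^sup>2) + (\<Sum>J\<in>JJ. (?x5 J)\<^sup>2))"
    by (simp only: sum_distrib_left[symmetric] sum.distrib)
  also have "\<dots> \<le> 5 * (real (2 * r + 4) * (2 * H\<^sup>2 * ?n) + H\<^sup>2 * ?m + (real r * (2 ^ 15 * (sqrt (640 * C0 * H\<^sup>2) * nrm \<sigma> f)))\<^sup>2
      + ?N * H\<^sup>2 * ?m + ?N * H\<^sup>2 * ?m)"
    using near_bound[OF finJ JD, of "\<lambda>K J. level J + int r \<le> level K + 1"] para_bound[OF adm] stopping_bound[OF adm] error_bound[OF adm e(1)] error_bound[OF adm e(2)]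
    by (intro mult_left_mono add_mono) (simp_all add: mult_ac)
  also have "(real r * (2 ^ 15 * (sqrt (640 * C0 * H\<^sup>2) * nrm \<sigma> f)))\<^sup>2 = (real r * 2 ^ 15)\<^sup>2 * (640 * C0) * H\<^sup>2 * ?n"
    using C0 by (simp add: power_mult_distrib)
  also have "5 * (real (2 * r + 4) * (2 * H\<^sup>2 * ?n) + H\<^sup>2 * ?m + (real r * 2 ^ 15)\<^sup>2 * (640 * C0) * H\<^sup>2 * ?n
      + ?N * H\<^sup>2 * ?m + ?N * H\<^sup>2 * ?m) \<le> core_const r C0 * H\<^sup>2 * (?m + ?n)"
  proof -
    define A B E where "A = real (2 * r + 4) * 2" and "B = (real r * 2 ^ 15)\<^sup>2 * (640 * C0)" and "E = 2 * ?N"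
    have nn: "0 \<le> A" "0 \<le> B" "0 \<le> E" using C0 by (auto simp: A_def B_def E_def)
    define X Y where "X = H\<^sup>2 * ?m" and "Y = H\<^sup>2 * ?n"
    have XY: "0 \<le> X" "0 \<le> Y" by (auto simp: X_def Y_def measure_nonneg)
    have "5 * (A * Y + X + B * Y + E * X) \<le> 5 * (A + 1 + B + E) * (X + Y)"
      using mult_nonneg_nonneg[OF nn(1) XY(1)] mult_nonneg_nonneg[OF nn(2) XY(1)] mult_nonneg_nonneg[OF nn(3) XY(2)] XY
      by (simp add: algebra_simps)
    moreover have "5 * (A + 1 + B + E) = core_const r C0" by (simp add: core_const_def A_def B_def E_def)
    moreover have "5 * (real (2 * r + 4) * (2 * H\<^sup>2 * ?n) + H\<^sup>2 * ?m + (real r * 2 ^ 15)\<^sup>2 * (640 * C0) * H\<^sup>2 * ?n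
      + ?N * H\<^sup>2 * ?m + ?N * H\<^sup>2 * ?m) = 5 * (A * Y + X + B * Y + E * X)"
      unfolding A_def B_def E_def X_def Y_def by (simp only: mult.assoc mult_2 distrib_right add.assoc)
    ultimately show ?thesis by (simp add: X_def Y_def distrib_left mult.assoc)
  qed
  also have "\<dots> \<le> core_const r C0 * H\<^sup>2 * (sqrt ?m + nrm \<sigma> f)\<^sup>2"
  proof (rule mult_left_mono)
    show "?m + ?n \<le> (sqrt ?m + nrm \<sigma> f)\<^sup>2"
      using f_norm_nonneg by (simp add: power2_sum measure_nonneg)
    show "0 \<le> core_const r C0 * H\<^sup>2" using C0 by (auto simp: core_const_def)
  qed
  finally show ?thesis .
qed

end

text \<open>The best constants are infima and may be zero, whereas \<open>corona\<close> asks for a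
  positive admissible real. Estimates are therefore proved with every \<open>h\<close> above the
  constant and then passed to the limit.\<close>

lemma le_of_forall_gt_mult:
  fixes x c t :: real
  assumes "0 \<le> c" "\<And>s. t < s \<Longrightarrow> x \<le> c * s"
  shows "x \<le> c * t"
proof (rule field_le_epsilon)
  fix e :: real assume e: "0 < e"
  have "x \<le> c * (t + e / (c + 1))" using assms e by auto
  also have "\<dots> = c * t + e * (c / (c + 1))" by (simp add: distrib_left)
  also have "\<dots> \<le> c * t + e * 1" using assms(1) e by (intro add_left_mono mult_left_mono) auto
  finally show "x \<le> c * t + e" by simp
qed

lemma ennreal_sqrt_less:
  assumes "ennreal_sqrt x < ennreal h"
  shows "x < ennreal (h\<^sup>2)"
proof -
  have fin: "x \<noteq> \<infinity>" using assms by (auto simp: ennreal_sqrt_def)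
  then obtain u where u: "x = ennreal u" "0 \<le> u" by (cases x) auto
  have "ennreal (sqrt u) < ennreal h" using assms fin u by (simp add: ennreal_sqrt_def)
  then have "sqrt u < h" using u by (simp add: ennreal_less_iff)
  then have "(sqrt u)\<^sup>2 < h\<^sup>2" using u by (intro power_strict_mono) auto
  then show ?thesis using u by (simp add: ennreal_less_iff)
qed

context weight
begin

lemma poisson_lower:
  assumes "u < v"
  shows "ennreal (measure \<mu> {u..v} / (v - u)) \<le> poisson \<mu> {u..v}"
proof -
  have l: "len {u..v} = v - u" using assms by (simp add: len_def)
  have "ennreal (measure \<mu> {u..v} / (v - u)) = ennreal (1 / (v - u)) * emeasure \<mu> {u..v}"
    using emeasure_eq[of "{u..v}"] assms by (simp add: ennreal_mult'[symmetric] measure_nonneg)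
  also have "\<dots> = (\<integral>\<^sup>+x. ennreal (1 / (v - u)) * indicator {u..v} x \<partial>\<mu>)" by (simp add: nn_integral_cmult_indicator)
  also have "\<dots> \<le> poisson \<mu> {u..v}"
    unfolding poisson_def l
  proof (rule nn_integral_mono)
    fix x
    show "ennreal (1 / (v - u)) * indicator {u..v} x \<le> ennreal ((v - u) / ((v - u)\<^sup>2 + (infdist x {u..v})\<^sup>2))"
      using assms by (cases "x \<in> {u..v}") (auto simp: power2_eq_square intro!: ennreal_leI)
  qed
  finally show ?thesis .
qed

end

section \<open>From extended constants to real ones\<close>

context good_dyadic
begin

text \<open>Because \<open>h\<close> is strictly above \<open>H_const \<sigma> w\<close>, both
  infima have admissible members below \<open>h\<close> or its square.\<close>

lemma corona_exists:
  assumes wp: "weight_pair D \<sigma> w" and C0: "0 < C0" and eps: "0 < \<epsilon>" "\<epsilon> < \<delta>" and I0: "I0 \<in> D" and SS: "SS \<subseteq> D"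
    and f: "L2_zero I0 \<sigma> f" "good_function D \<theta> r \<sigma> f" "uniform_wrt D C0 \<sigma> w I0 SS f"
    and h: "0 < h" "H_const \<sigma> w < ennreal h"
  shows "corona D \<theta> r \<sigma> w h C0 \<epsilon> \<delta> I0 SS f"
proof -
  have W: "weight \<sigma>" "weight w" using wp by (auto simp: weight_pair_def weight_def)
  interpret sig: dyadic_weight D \<sigma> using grid W by (simp add: dyadic_weight_def dyadic_def)
  interpret wt: dyadic_weight D w using grid W by (simp add: dyadic_weight_def dyadic_def)
  show ?thesis
  proof
    have "testing_const \<sigma> w \<le> H_const \<sigma> w" by (simp add: H_const_def)
    then have "testing_const \<sigma> w < ennreal h" using h(2) by (rule le_less_trans)
    then obtain T where T: "T < ennreal h" "\<And>I \<epsilon> \<delta>. bounded_interval I \<Longrightarrow> 0 < \<epsilon> \<Longrightarrow> \<epsilon> < \<delta> \<Longrightarrow>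
        (\<integral>\<^sup>+x\<in>I. ennreal (\<bar>hilbert \<epsilon> \<delta> \<sigma> (indicator I) x\<bar>\<^sup>2) \<partial>w) \<le> T\<^sup>2 * emeasure \<sigma> I"
      unfolding testing_const_def Inf_less_iff by blast
    show "(\<integral>x. indicator B x * (sig.conv (hard \<epsilon> \<delta>) (indicator B) x)\<^sup>2 \<partial>w) \<le> h\<^sup>2 * measure \<sigma> B" if B: "B \<in> D" for B
    proof -
      have bi: "bounded_interval B"
      proof -
        have "is_interval {Inf B ..< Inf B + len B}" by simp
        moreover have "interior {Inf B ..< Inf B + len B} \<noteq> {}" using len_pos[OF B] by simp
        ultimately show ?thesis unfolding bounded_interval_def using sig.D_bounded[OF B] D_eq[OF B] by simp
      qed
      have bh: "sig.bker (hard \<epsilon> \<delta>)"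
      proof -
        have "\<bar>hard \<epsilon> \<delta> t\<bar> \<le> 1 / \<epsilon>" for t using eps by (auto simp: hard_def intro!: divide_left_mono)
        then show ?thesis by (auto simp: sig.bker_def)
      qed
      let ?g = "sig.conv (hard \<epsilon> \<delta>) (indicator B)"
      have bk: "wt.bker (\<lambda>x. (?g x)\<^sup>2)"
      proof -
        obtain C where C: "?g \<in> borel_measurable borel" "\<And>x. \<bar>?g x\<bar> \<le> C"
          using sig.conv_bker[OF sig.D_bsupp[OF B] bh] unfolding sig.bker_def by blast
        have "\<bar>(?g x)\<^sup>2\<bar> \<le> C\<^sup>2" for x using power_mono[OF C(2)[of x], of 2] by simp
        moreover have "(\<lambda>x. (?g x)\<^sup>2) \<in> borel_measurable borel" using C(1) by measurable
        ultimately show ?thesis unfolding wt.bker_def by blast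
      qed
      have i: "integrable w (\<lambda>x. indicator B x * (?g x)\<^sup>2)"
        by (rule wt.bsupp_integrable[OF wt.bsupp_mult_bker[OF wt.D_bsupp[OF B] bk]])
      have "ennreal (\<integral>x. indicator B x * (?g x)\<^sup>2 \<partial>w) = (\<integral>\<^sup>+x. ennreal (indicator B x * (?g x)\<^sup>2) \<partial>w)"
        using i by (intro nn_integral_eq_integral[symmetric]) auto
      also have "\<dots> = (\<integral>\<^sup>+x\<in>B. ennreal (\<bar>hilbert \<epsilon> \<delta> \<sigma> (indicator B) x\<bar>\<^sup>2) \<partial>w)"
        unfolding sig.hilbert_conv by (intro nn_integral_cong) (auto simp: indicator_def)
      also have "\<dots> \<le> T\<^sup>2 * emeasure \<sigma> B" by (rule T(2)[OF bi eps])
      also have "\<dots> \<le> (ennreal h)\<^sup>2 * emeasure \<sigma> B" using T(1) by (intro mult_right_mono power_mono) auto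
      also have "\<dots> = ennreal (h\<^sup>2 * measure \<sigma> B)"
        using h(1) sig.emeasure_eq[OF sig.D_bounded[OF B]] by (simp add: ennreal_power ennreal_mult' measure_nonneg)
      finally show ?thesis by (subst (asm) ennreal_le_iff) (auto simp: measure_nonneg)
    qed
    have "ennreal_sqrt (A2_const \<sigma> w) \<le> H_const \<sigma> w" by (simp add: H_const_def)
    then have "ennreal_sqrt (A2_const \<sigma> w) < ennreal h" using h(2) by (rule le_less_trans)
    then have "A2_const \<sigma> w < ennreal (h\<^sup>2)" by (rule ennreal_sqrt_less)
    then obtain A where A: "A < ennreal (h\<^sup>2)" "\<And>I. bounded_interval I \<Longrightarrow> poisson \<sigma> I * poisson w I \<le> A"
      unfolding A2_const_def Inf_less_iff by blast
    show "measure \<sigma> {u..v} * measure w {u..v} \<le> h\<^sup>2 * (v - u)\<^sup>2" if uv: "u < v" for u v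
    proof -
      have "bounded_interval {u..v}" unfolding bounded_interval_def using uv by simp
      then have "poisson \<sigma> {u..v} * poisson w {u..v} \<le> ennreal (h\<^sup>2)" using A by (meson less_imp_le order_trans)
      moreover have "ennreal (measure \<sigma> {u..v} / (v - u)) * ennreal (measure w {u..v} / (v - u)) \<le> poisson \<sigma> {u..v} * poisson w {u..v}"
        by (intro mult_mono sig.poisson_lower wt.poisson_lower uv) auto
      ultimately have "ennreal (measure \<sigma> {u..v} / (v - u)) * ennreal (measure w {u..v} / (v - u)) \<le> ennreal (h\<^sup>2)" by (rule order_trans[rotated])
      then have "measure \<sigma> {u..v} / (v - u) * (measure w {u..v} / (v - u)) \<le> h\<^sup>2"
        using uv by (subst (asm) ennreal_mult[symmetric]) (auto simp: measure_nonneg)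
      then show ?thesis using uv by (simp add: divide_le_eq power2_eq_square)
    qed
    show "(poisson (restrict_meas \<sigma> I0) R)\<^sup>2 * energy_sq w R * emeasure w R \<le> ennreal (10 * C0 * h\<^sup>2 * measure \<sigma> R)"
      if R: "R \<in> D" "R \<subset> I0" "\<not> (\<exists>S\<in>SS. R \<subseteq> S)" for R
    proof -
      \<comment> \<open>An \<open>R\<close> outside all members of \<open>SS\<close> cannot satisfy
        the stopping inequality: finitely many intervals lie between \<open>R\<close> and
        \<open>I0\<close>, so a maximal bad one containing \<open>R\<close> would be a stopping
        interval and lie in some \<open>S\<close>.\<close>
      define Bad where "Bad = {I\<in>D. I \<subset> I0 \<and> (poisson (restrict_meas \<sigma> I0) I)\<^sup>2 * energy_sq w I * emeasure w I
           > 10 * ennreal C0 * (H_const \<sigma> w)\<^sup>2 * emeasure \<sigma> I}"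
      have "R \<notin> Bad"
      proof
        assume RB: "R \<in> Bad"
        have "finite {I\<in>Bad. R \<subseteq> I}"
          using finite_between[OF R(1) I0] by (rule rev_finite_subset) (auto simp: Bad_def)
        moreover have "{I\<in>Bad. R \<subseteq> I} \<noteq> {}" using RB by blast
        ultimately obtain F where F: "F \<in> {I\<in>Bad. R \<subseteq> I}" "\<And>I. I \<in> {I\<in>Bad. R \<subseteq> I} \<Longrightarrow> F \<subseteq> I \<Longrightarrow> F = I"
          using finite_has_maximal[of "{I\<in>Bad. R \<subseteq> I}"] by auto
        have "\<forall>I'\<in>Bad. F \<subseteq> I' \<longrightarrow> I' = F"
        proof (intro ballI impI)
          fix I' assume I': "I' \<in> Bad" "F \<subseteq> I'"
          then have "I' \<in> {I\<in>Bad. R \<subseteq> I}" using F(1) by blast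
          then show "I' = F" using F(2)[of I'] I'(2) by simp
        qed
        then have "F \<in> energy_stopping D C0 \<sigma> w I0"
          using F(1) unfolding energy_stopping_def Let_def Bad_def[symmetric] by blast
        then obtain S where "S \<in> SS" "F \<subseteq> S" using f(3) unfolding uniform_wrt_def by blast
        then show False using F(1) R(3) by blast
      qed
      then have "(poisson (restrict_meas \<sigma> I0) R)\<^sup>2 * energy_sq w R * emeasure w R \<le> 10 * ennreal C0 * (H_const \<sigma> w)\<^sup>2 * emeasure \<sigma> R"
        using R by (simp add: Bad_def not_less)
      also have "\<dots> \<le> 10 * ennreal C0 * (ennreal h)\<^sup>2 * emeasure \<sigma> R"
        using h(2) by (intro mult_right_mono mult_left_mono power_mono) auto
      also have "\<dots> = ennreal (10 * C0 * h\<^sup>2 * measure \<sigma> R)"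
        using C0 h(1) sig.emeasure_eq[OF sig.D_bounded[OF R(1)]]
        by (simp add: ennreal_power ennreal_mult' measure_nonneg)
      finally show ?thesis .
    qed
    show "avg \<sigma> K (\<lambda>x. \<bar>f x\<bar>) \<le> 1" if "K \<in> D" "\<not> (\<exists>S\<in>SS. K \<subseteq> S)" for K
      using f(3) that unfolding uniform_wrt_def by blast
  qed (use h(1) C0 eps I0 SS f in auto)
qed

end

lemma weight_pair_sym: "weight_pair D \<sigma> w \<Longrightarrow> weight_pair D w \<sigma>"
  by (auto simp: weight_pair_def)

lemma nrm_nonneg: "0 \<le> nrm \<mu> f" and nrm_square: "(nrm \<mu> f)\<^sup>2 = ip \<mu> f f"
proof -
  have "0 \<le> ip \<mu> f f" unfolding ip_def by (intro integral_nonneg_AE) auto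
  then show "0 \<le> nrm \<mu> f" "(nrm \<mu> f)\<^sup>2 = ip \<mu> f f" by (auto simp: nrm_def)
qed

lemma core_const_pos: "0 < C0 \<Longrightarrow> 0 < core_const r C0"
proof -
  assume C0: "0 < C0"
  have "0 \<le> real (2 * r + 4) * 2" "0 \<le> (real r * 2 ^ 15)\<^sup>2 * (640 * C0)"
    "0 \<le> 2 * (36 * (6 * 2 ^ (2 * r + 8) * real (Suc (2 * r + 8))))" using C0 by auto
  then have "0 < real (2 * r + 4) * 2 + 1 + (real r * 2 ^ 15)\<^sup>2 * (640 * C0) + 2 * (36 * (6 * 2 ^ (2 * r + 8) * real (Suc (2 * r + 8))))"
    by linarith
  then show ?thesis unfolding core_const_def by simp
qed

section \<open>The finite form, its limit, and the bound for both\<close>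

context good_dyadic
begin

lemma main_estimate:
  assumes wp: "weight_pair D \<sigma> w" and C0: "0 < C0" and eps: "0 < \<epsilon>" "\<epsilon> < \<delta>" and I0: "I0 \<in> D" and SS: "SS \<subseteq> D"
    and f: "L2_zero I0 \<sigma> f" "good_function D \<theta> r \<sigma> f" "uniform_wrt D C0 \<sigma> w I0 SS f"
    and g: "L2_zero I0 w g" "good_function D \<theta> r w g" "weakly_adapted D r w SS g"
  defines "bound \<equiv> ennreal (sqrt (core_const r C0)) * H_const \<sigma> w * ennreal ((sqrt (measure \<sigma> I0) + nrm \<sigma> f) * nrm w g)"
  shows "finite (haar_support D w g) \<longrightarrow> ennreal \<bar>B_above_fin D \<theta> r \<epsilon> \<delta> \<sigma> w I0 f g\<bar> \<le> bound" (is ?fin)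
    and "H_const \<sigma> w < \<infinity> \<longrightarrow> ((\<lambda>F. B_above_fin D \<theta> r \<epsilon> \<delta> \<sigma> w I0 f (haar_trunc w F g))
        \<longlongrightarrow> B_above D \<theta> r \<epsilon> \<delta> \<sigma> w I0 f g) (finite_subsets_at_top D)" (is ?lim)
    and "ennreal \<bar>B_above D \<theta> r \<epsilon> \<delta> \<sigma> w I0 f g\<bar> \<le> bound" (is ?bd)
proof -
  have W: "weight \<sigma>" "weight w" using wp by (auto simp: weight_pair_def weight_def)
  interpret sig: dyadic_weight D \<sigma> using grid W by (simp add: dyadic_weight_def dyadic_def)
  interpret wt: dyadic_weight D w using grid W by (simp add: dyadic_weight_def dyadic_def)
  define N where "N = sqrt (measure \<sigma> I0) + nrm \<sigma> f"
  define G where "G = haar_support D w g"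
  define R where "R = row \<epsilon> \<delta> \<sigma> w I0 f"
  define b where "b = (\<lambda>J. ip w g (haar w J))"
  \<comment> \<open>The squared norm of the Haar function stays as a factor: truncation multiplies
    the coefficient by it, and it is zero where the Haar function is zero by default.\<close>
  define \<beta> where "\<beta> = (\<lambda>J. b J * ip w (haar w J) (haar w J) * R J)"
  let ?B = "B_above_fin D \<theta> r \<epsilon> \<delta> \<sigma> w I0 f"
  let ?Bt = "\<lambda>F. ?B (haar_trunc w F g)"
  have L2: "L2 \<sigma> f" "L2 w g" using f g by (auto simp: L2_zero_def)
  have N0: "0 \<le> N" using nrm_nonneg[of \<sigma> f] by (simp add: N_def measure_nonneg)
  have G: "J \<in> D \<and> good J \<and> (\<forall>S\<in>SS. \<not> deeply_inside r J S)" if "J \<in> G" for J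
    using that g good_D unfolding G_def good_function_def weakly_adapted_def by blast
  have b0: "b J = 0" if "J \<in> D" "J \<notin> G" for J using that by (auto simp: b_def G_def haar_support_def)
  have Bfin: "?B g = (\<Sum>J\<in>G. b J * R J)" if "finite G"
    unfolding b_def R_def using that G b0 good_D by (intro B_above_fin_eq W I0) (auto simp: b_def)
  have Bt: "?Bt F = (\<Sum>J\<in>F. \<beta> J)" if F: "finite F" "F \<subseteq> D" for F
  proof -
    have u: "haar_trunc w F g = (\<lambda>x. \<Sum>J\<in>F. b J * haar w J x)"
      by (simp add: fun_eq_iff haar_trunc_def haar_diff_def b_def)
    have c: "ip w (haar_trunc w F g) (haar w K) = (if K \<in> F then b K * ip w (haar w K) (haar w K) else 0)" if "K \<in> D" for K
      unfolding u by (rule wt.haar_coeff_sum[OF F that])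
    have "?Bt F = (\<Sum>J\<in>F \<inter> G. ip w (haar_trunc w F g) (haar w J) * row \<epsilon> \<delta> \<sigma> w I0 f J)"
    proof (rule B_above_fin_eq[OF W(1) I0])
      show "finite (F \<inter> G)" using F by simp
      show "good J" if "J \<in> F \<inter> G" for J using that G by blast
      show "ip w (haar_trunc w F g) (haar w J) = 0" if "good J" "J \<notin> F \<inter> G" for J
        using c[OF good_D[OF that(1)]] b0[OF good_D[OF that(1)]] that(2) by auto
    qed
    also have "\<dots> = (\<Sum>J\<in>F \<inter> G. \<beta> J)"
      using c F by (intro sum.cong refl) (auto simp: \<beta>_def R_def subset_iff)
    also have "\<dots> = (\<Sum>J\<in>F. \<beta> J)"
      using F b0 by (intro sum.mono_neutral_left) (auto simp: \<beta>_def)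
    finally show ?thesis .
  qed
  have evBt: "eventually (\<lambda>F. sum \<beta> F = ?Bt F) (finite_subsets_at_top D)"
    using Bt by (intro eventually_finite_subsets_at_top_weakI) simp
  have nt: "\<not> trivial_limit (finite_subsets_at_top D)" by simp
  have b2: "(\<Sum>J\<in>S. (b J)\<^sup>2) \<le> (nrm w g)\<^sup>2" if "finite S" "S \<subseteq> D" for S
    unfolding b_def nrm_square using that L2(2) by (rule wt.bessel)
  show ?fin ?lim ?bd
  proof -
    have "?fin \<and> ?lim \<and> ?bd"
    proof (cases "H_const \<sigma> w = \<infinity>")
      case True
      show ?thesis
      \<comment> \<open>With an infinite constant the bound is infinite unless the last factor
        vanishes; then the product is 0 in \<open>ennreal\<close>, and the form has to be shown to
        vanish.\<close>
      proof (cases "N * nrm w g = 0")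
        case False
        then have nz: "N \<noteq> 0" "nrm w g \<noteq> 0" and "0 < N * nrm w g"
          using N0 nrm_nonneg[of w g] by (auto simp add: order_less_le)
        then have "bound = \<infinity>"
          using core_const_pos[OF C0, of r] nz unfolding bound_def True N_def[symmetric]
          by (simp add: ennreal_mult_top ennreal_top_mult)
        then show ?thesis using True by simp
      next
        case zero: True
        have z: "b J * R J = 0" if J: "J \<in> D" for J
        proof (cases "nrm w g = 0")
          case True
          then show ?thesis using b2[of "{J}"] J by simp
        next
          case False
          then have "N = 0" using zero by simp
          then have "nrm \<sigma> f = 0"
            using nrm_nonneg[of \<sigma> f] real_sqrt_ge_zero[OF measure_nonneg, of \<sigma> I0] unfolding N_def by linarith
          then have "ip \<sigma> f f = 0" using nrm_square[of \<sigma> f] by simp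
          then have "ip \<sigma> f (haar \<sigma> I) = 0" if "I \<in> D" for I
            using sig.bessel[of "{I}" f] L2(1) that by simp
          then have "R J = 0"
            unfolding R_def row_def using parent(1) by (intro sum.neutral) (auto simp: scales_def)
          then show ?thesis by simp
        qed
        have zb: "\<beta> J = 0" if "J \<in> D" for J using z[OF that] by (auto simp: \<beta>_def)
        have zt: "?Bt F = 0" if "finite F" "F \<subseteq> D" for F
          unfolding Bt[OF that] using zb that(2) by (intro sum.neutral) auto
        have "((\<lambda>F. 0) \<longlongrightarrow> (0::real)) (finite_subsets_at_top D)" by simp
        then have "(?Bt \<longlongrightarrow> 0) (finite_subsets_at_top D)"
          by (rule Lim_transform_eventually) (use zt in \<open>intro eventually_finite_subsets_at_top_weakI, simp\<close>)
        then have "B_above D \<theta> r \<epsilon> \<delta> \<sigma> w I0 f g = 0" unfolding B_above_def by (rule tendsto_Lim[OF nt])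
        moreover have "?B g = 0" if "finite G"
          unfolding Bfin[OF that] using z G by (intro sum.neutral) auto
        ultimately show ?thesis using True by (simp add: G_def)
      qed
    next
      case False
      then obtain Hr where Hr: "H_const \<sigma> w = ennreal Hr" "0 \<le> Hr" by (cases "H_const \<sigma> w") auto
      define C where "C = sqrt (core_const r C0)"
      have C: "0 \<le> C" "C\<^sup>2 = core_const r C0" using core_const_pos[OF C0, of r] by (auto simp: C_def)
      have bound: "bound = ennreal (C * N * Hr * nrm w g)"
        unfolding bound_def Hr(1) C_def[symmetric] N_def[symmetric]
        using C(1) N0 Hr(2) nrm_nonneg[of w g] by (simp add: ennreal_mult'[symmetric] mult_ac)
      have R2: "sqrt (\<Sum>J\<in>S. (R J)\<^sup>2) \<le> (C * N) * Hr" if S: "finite S" "S \<subseteq> G" for S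
      proof (rule le_of_forall_gt_mult)
        show "0 \<le> C * N" using C N0 by simp
        fix h assume h: "Hr < h"
        have h0: "0 < h" "H_const \<sigma> w < ennreal h" using h Hr by (auto simp: ennreal_less_iff)
        interpret corona D \<theta> r \<sigma> w h C0 \<epsilon> \<delta> I0 SS f
          by (rule corona_exists[OF wp C0 eps I0 SS f h0])
        have "admissible S" using S G unfolding admissible_def by blast
        then have "(\<Sum>J\<in>S. (R J)\<^sup>2) \<le> core_const r C0 * h\<^sup>2 * N\<^sup>2"
          unfolding R_def N_def by (rule core_bound)
        also have "\<dots> = (C * N * h)\<^sup>2" unfolding C(2)[symmetric] by (simp add: power_mult_distrib mult_ac)
        finally have "sqrt (\<Sum>J\<in>S. (R J)\<^sup>2) \<le> sqrt ((C * N * h)\<^sup>2)" by (rule real_sqrt_le_mono)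
        also have "\<dots> = C * N * h" using C(1) N0 h0(1) by simp
        finally show "sqrt (\<Sum>J\<in>S. (R J)\<^sup>2) \<le> C * N * h" .
      qed
      define K where "K = C * N * Hr * nrm w g"
      have pairing_le: "(\<Sum>J\<in>S. \<bar>c J * R J\<bar>) \<le> K"
        if S: "finite S" "S \<subseteq> G" and c: "\<And>J. J \<in> S \<Longrightarrow> \<bar>c J\<bar> \<le> \<bar>b J\<bar>" for S c
      proof -
        have "(\<Sum>J\<in>S. \<bar>c J * R J\<bar>) = (\<Sum>J\<in>S. sqrt ((c J)\<^sup>2) * sqrt ((R J)\<^sup>2))" by (simp add: abs_mult)
        also have "\<dots> \<le> sqrt (\<Sum>J\<in>S. (c J)\<^sup>2) * sqrt (\<Sum>J\<in>S. (R J)\<^sup>2)" by (rule sum_sqrt_mult_le) auto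
        also have "\<dots> \<le> nrm w g * ((C * N) * Hr)"
        proof (rule mult_mono)
          have "(\<Sum>J\<in>S. (c J)\<^sup>2) \<le> (\<Sum>J\<in>S. (b J)\<^sup>2)" using c by (intro sum_mono) (simp add: abs_le_square_iff)
          also have "\<dots> \<le> (nrm w g)\<^sup>2" using S G by (intro b2) auto
          finally show "sqrt (\<Sum>J\<in>S. (c J)\<^sup>2) \<le> nrm w g" using nrm_nonneg[of w g] by (intro real_le_lsqrt) (auto intro: sum_nonneg)
        qed (use R2[OF S] nrm_nonneg[of w g] in \<open>auto intro: sum_nonneg\<close>)
        also have "\<dots> = K" by (simp add: K_def)
        finally show ?thesis .
      qed
      have "\<bar>?B g\<bar> \<le> K" if "finite G"
        unfolding Bfin[OF that] using pairing_le[of G b] that by (intro order_trans[OF sum_abs]) auto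
      then have 1: ?fin unfolding bound K_def[symmetric] G_def by (auto intro: ennreal_leI)
      have sb: "(\<Sum>J\<in>F. \<bar>\<beta> J\<bar>) \<le> K" if F: "finite F" "F \<subseteq> D" for F
      proof -
        have "(\<Sum>J\<in>F. \<bar>\<beta> J\<bar>) = (\<Sum>J\<in>F \<inter> G. \<bar>\<beta> J\<bar>)"
          using F b0 by (intro sum.mono_neutral_right) (auto simp: \<beta>_def)
        also have "\<dots> \<le> K"
          unfolding \<beta>_def
        proof (rule pairing_le)
          fix J assume "J \<in> F \<inter> G"
          then have "\<bar>ip w (haar w J) (haar w J)\<bar> \<le> 1"
            using wt.haar_norm[of J] nrm_square[of w "haar w J"] zero_le_power2[of "nrm w (haar w J)"] F by auto
          then have "\<bar>b J\<bar> * \<bar>ip w (haar w J) (haar w J)\<bar> \<le> \<bar>b J\<bar> * 1" by (intro mult_left_mono) auto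
          then show "\<bar>b J * ip w (haar w J) (haar w J)\<bar> \<le> \<bar>b J\<bar>" by (simp add: abs_mult)
        qed (use F in auto)
        finally show ?thesis .
      qed
      \<comment> \<open>A uniform bound on finite sums gives absolute summability, so the net of
        truncations converges and the \<open>Lim\<close> in \<open>B_above\<close> is a genuine
        limit.\<close>
      have "(\<lambda>J. \<bar>\<beta> J\<bar>) summable_on D"
        using sb by (intro nonneg_bdd_above_summable_on bdd_aboveI[of _ K]) auto
      then have "\<beta> summable_on D" using abs_summable_summable[of \<beta> D] by simp
      then have "(\<beta> has_sum infsum \<beta> D) D" by (rule has_sum_infsum)
      then have "(sum \<beta> \<longlongrightarrow> infsum \<beta> D) (finite_subsets_at_top D)" by (simp add: has_sum_def)
      then have lim: "(?Bt \<longlongrightarrow> infsum \<beta> D) (finite_subsets_at_top D)" by (rule Lim_transform_eventually[OF _ evBt])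
      then have Babove: "B_above D \<theta> r \<epsilon> \<delta> \<sigma> w I0 f g = infsum \<beta> D" unfolding B_above_def by (rule tendsto_Lim[OF nt])
      have "\<bar>infsum \<beta> D\<bar> \<le> K"
      proof (rule tendsto_upperbound[OF tendsto_rabs[OF lim] _ nt])
        have "\<bar>?Bt F\<bar> \<le> K" if "finite F" "F \<subseteq> D" for F
          unfolding Bt[OF that] using sb[OF that] sum_abs[of \<beta> F] by linarith
        then show "eventually (\<lambda>F. \<bar>?Bt F\<bar> \<le> K) (finite_subsets_at_top D)"
          by (intro eventually_finite_subsets_at_top_weakI) auto
      qed
      then have 3: ?bd unfolding Babove bound K_def[symmetric] by (rule ennreal_leI)
      show ?thesis using 1 3 lim Babove by simp
    qed
    then show ?fin ?lim ?bd by blast+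
  qed
qed

end

theorem theorem2p4:
  shows "\<exists>\<theta>0::real. 0 < \<theta>0 \<and> \<theta>0 \<le> 1 \<and>
    (\<forall>\<theta>. 0 < \<theta> \<and> \<theta> < \<theta>0 \<longrightarrow>
      (\<exists>r0::nat. \<forall>r\<ge>r0. \<forall>C0. energy_constant C0 \<longrightarrow>
        (\<exists>C::real. 0 < C \<and>
          (\<forall>D \<sigma> w \<epsilon> \<delta>. dyadic_grid D \<and> weight_pair D \<sigma> w \<and> 0 < \<epsilon> \<and> \<epsilon> < \<delta> \<longrightarrow>
            (\<forall>(\<mu>, \<nu>) \<in> {(\<sigma>, w), (w, \<sigma>)}. \<forall>I0\<in>D. \<forall>\<S> f g.
               \<S> \<subseteq> D \<and> disjoint \<S> \<and> (\<forall>S\<in>\<S>. S \<subseteq> I0) \<and>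
               L2_zero I0 \<mu> f \<and> good_function D \<theta> r \<mu> f \<and> uniform_wrt D C0 \<mu> \<nu> I0 \<S> f \<and>
               L2_zero I0 \<nu> g \<and> good_function D \<theta> r \<nu> g \<and> weakly_adapted D r \<nu> \<S> g \<longrightarrow>
               (let bound = ennreal C * H_const \<mu> \<nu> *
                      ennreal ((sqrt (measure \<mu> I0) + nrm \<mu> f) * nrm \<nu> g)
                in (finite (haar_support D \<nu> g) \<longrightarrow>
                      ennreal \<bar>B_above_fin D \<theta> r \<epsilon> \<delta> \<mu> \<nu> I0 f g\<bar> \<le> bound) \<and>
                   (H_const \<mu> \<nu> < \<infinity> \<longrightarrow>
                      ((\<lambda>F. B_above_fin D \<theta> r \<epsilon> \<delta> \<mu> \<nu> I0 f (haar_trunc \<nu> F g))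
                         \<longlongrightarrow> B_above D \<theta> r \<epsilon> \<delta> \<mu> \<nu> I0 f g) (finite_subsets_at_top D)) \<and>
                   ennreal \<bar>B_above D \<theta> r \<epsilon> \<delta> \<mu> \<nu> I0 f g\<bar> \<le> bound))))))"
\<comment> \<open>The threshold 1/2 is the one of \<open>good_dist\<close>. With it every
  \<open>r\<close> from 1 on is admissible, and the constant depends on \<open>r\<close> and
  \<open>C0\<close> alone.\<close>
proof (intro exI[of _ "1/2"] conjI allI impI)
  fix \<theta> :: real
  assume \<theta>: "0 < \<theta> \<and> \<theta> < 1/2"
  show "\<exists>r0::nat. \<forall>r\<ge>r0. \<forall>C0. energy_constant C0 \<longrightarrow>
        (\<exists>C::real. 0 < C \<and>
          (\<forall>D \<sigma> w \<epsilon> \<delta>. dyadic_grid D \<and> weight_pair D \<sigma> w \<and> 0 < \<epsilon> \<and> \<epsilon> < \<delta> \<longrightarrow>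
            (\<forall>(\<mu>, \<nu>) \<in> {(\<sigma>, w), (w, \<sigma>)}. \<forall>I0\<in>D. \<forall>\<S> f g.
               \<S> \<subseteq> D \<and> disjoint \<S> \<and> (\<forall>S\<in>\<S>. S \<subseteq> I0) \<and>
               L2_zero I0 \<mu> f \<and> good_function D \<theta> r \<mu> f \<and> uniform_wrt D C0 \<mu> \<nu> I0 \<S> f \<and>
               L2_zero I0 \<nu> g \<and> good_function D \<theta> r \<nu> g \<and> weakly_adapted D r \<nu> \<S> g \<longrightarrow>
               (let bound = ennreal C * H_const \<mu> \<nu> *
                      ennreal ((sqrt (measure \<mu> I0) + nrm \<mu> f) * nrm \<nu> g)
                in (finite (haar_support D \<nu> g) \<longrightarrow>
                      ennreal \<bar>B_above_fin D \<theta> r \<epsilon> \<delta> \<mu> \<nu> I0 f g\<bar> \<le> bound) \<and>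
                   (H_const \<mu> \<nu> < \<infinity> \<longrightarrow>
                      ((\<lambda>F. B_above_fin D \<theta> r \<epsilon> \<delta> \<mu> \<nu> I0 f (haar_trunc \<nu> F g))
                         \<longlongrightarrow> B_above D \<theta> r \<epsilon> \<delta> \<mu> \<nu> I0 f g) (finite_subsets_at_top D)) \<and>
                   ennreal \<bar>B_above D \<theta> r \<epsilon> \<delta> \<mu> \<nu> I0 f g\<bar> \<le> bound))))"
  proof (rule exI[of _ "1::nat"], intro allI impI)
    fix r :: nat and C0 :: real
    assume r: "1 \<le> r" and C0: "energy_constant C0"
    have C0': "0 < C0" using C0 by (simp add: energy_constant_def)
    show "\<exists>C::real. 0 < C \<and>
          (\<forall>D \<sigma> w \<epsilon> \<delta>. dyadic_grid D \<and> weight_pair D \<sigma> w \<and> 0 < \<epsilon> \<and> \<epsilon> < \<delta> \<longrightarrow>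
            (\<forall>(\<mu>, \<nu>) \<in> {(\<sigma>, w), (w, \<sigma>)}. \<forall>I0\<in>D. \<forall>\<S> f g.
               \<S> \<subseteq> D \<and> disjoint \<S> \<and> (\<forall>S\<in>\<S>. S \<subseteq> I0) \<and>
               L2_zero I0 \<mu> f \<and> good_function D \<theta> r \<mu> f \<and> uniform_wrt D C0 \<mu> \<nu> I0 \<S> f \<and>
               L2_zero I0 \<nu> g \<and> good_function D \<theta> r \<nu> g \<and> weakly_adapted D r \<nu> \<S> g \<longrightarrow>
               (let bound = ennreal C * H_const \<mu> \<nu> *
                      ennreal ((sqrt (measure \<mu> I0) + nrm \<mu> f) * nrm \<nu> g)
                in (finite (haar_support D \<nu> g) \<longrightarrow>
                      ennreal \<bar>B_above_fin D \<theta> r \<epsilon> \<delta> \<mu> \<nu> I0 f g\<bar> \<le> bound) \<and>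
                   (H_const \<mu> \<nu> < \<infinity> \<longrightarrow>
                      ((\<lambda>F. B_above_fin D \<theta> r \<epsilon> \<delta> \<mu> \<nu> I0 f (haar_trunc \<nu> F g))
                         \<longlongrightarrow> B_above D \<theta> r \<epsilon> \<delta> \<mu> \<nu> I0 f g) (finite_subsets_at_top D)) \<and>
                   ennreal \<bar>B_above D \<theta> r \<epsilon> \<delta> \<mu> \<nu> I0 f g\<bar> \<le> bound)))"
    proof (intro exI[of _ "sqrt (core_const r C0)"] conjI allI impI ballI, goal_cases)
      case 1
      then show ?case using core_const_pos[OF C0', of r] by simp
    next
      case (2 D \<sigma> w \<epsilon> \<delta> p)
      interpret good_dyadic D \<theta> r by unfold_locales (use 2 \<theta> r in auto)
      obtain \<mu> \<nu> where p: "p = (\<mu>, \<nu>)" by (cases p)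
      have wp: "weight_pair D \<mu> \<nu>" using 2 p weight_pair_sym by auto
      have eps: "0 < \<epsilon>" "\<epsilon> < \<delta>" using 2 by auto
      show ?case
        unfolding p prod.case Let_def
        by (intro ballI allI impI conjI; elim conjE)
          (rule main_estimate[OF wp C0' eps, rule_format]; assumption)+
    qed
  qed
qed auto

end
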